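(* The exact completion of the category $\mathbf{Stone}$ of Stone spaces (zero-dimensional compact Hausdorff spaces) and continuous maps is the category $\mathbf{KH}$ of compact Hausdorff spaces and continuous maps (up to equivalence). Therefore, $\mathbf{KH}$ is also the pretopos completion of $\mathbf{Stone}$.
   Context: Regular, coherent. A subobject of $X$ is an equivalence class of monomorphisms into $X$ (two being equivalent if each factors through the other); $\mathrm{Sub}(X)$ is the poset of subobjects, ordered by factorisation. All categories considered are assumed well-powered (each $\mathrm{Sub}(X)$ is a set). The image of $f\colon X\to Y$ is the smallest subobject of $Y$ through which $f$ factors. A regular category is a category with finite limits in which every morphism has an image and image factorisations are pullback-stable. A coherent category is a regular category in which every $\mathrm{Sub}(X)$ has finite joins and every pullback map $f^*\colon\mathrm{Sub}(Y)\to\mathrm{Sub}(X)$ preserves them. Exact, extensive, pretopos. A category is exact if it is regular and every internal equivalence relation is effective, i.e. coincides with the kernel pair of its coequaliser. A category $\mathbf{C}$ is extensive if it has finite coproducts and the canonical functor $(\mathbf{C}/X_1)\times(\mathbf{C}/X_2)\to\mathbf{C}/(X_1+X_2)$ is an equivalence for all $X_1,X_2$. A pretopos is an exact and extensive category (every pretopos is coherent). Functors. An exact functor between regular categories is one preserving finite limits and regular epimorphisms. A coherent functor between coherent categories is one preserving finite limits, regular epimorphisms and finite joins of subobjects. A pretopos morphism is a functor between pretoposes preserving finite limits, finite coproducts and coequalisers of internal equivalence relations. Completions. The exact completion of a regular category $\mathbf{C}$ is an exact category $\mathbf{C}_{ex/reg}$ together with a fully faithful exact functor $J\colon\mathbf{C}\to\mathbf{C}_{ex/reg}$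 such that, for every exact category $\mathbf{D}$, precomposition with $J$ is an equivalence from the category of exact functors $\mathbf{C}_{ex/reg}\to\mathbf{D}$ to the category of exact functors $\mathbf{C}\to\mathbf{D}$; it is unique up to equivalence. The pretopos completion of a coherent category $\mathbf{C}$ is a pretopos $\mathbf{P}$ together with a coherent functor $\mathbf{C}\to\mathbf{P}$ such that, for every pretopos $\mathbf{D}$, precomposition with it is an equivalence from the category of pretopos morphisms $\mathbf{P}\to\mathbf{D}$ to the category of coherent functors $\mathbf{C}\to\mathbf{D}$. *)

theory Defs
  imports "HOL-Analysis.Analysis"
begin

section \<open>Categories, functors, natural transformations\<close>

text \<open>
  Hom-sets are automatically sets and every category is automatically well-powered, because the
  arrows form a set over a type. The composite \<^term>\<open>Comp C g f\<close> (first \<open>f\<close>, then \<open>g\<close>) is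
  only meaningful if the codomain of \<open>f\<close> is the domain of \<open>g\<close>.
\<close>

record ('o, 'm) category =
  Obj :: "'o set"
  Arr :: "'m set"
  Dom :: "'m \<Rightarrow> 'o"
  Cod :: "'m \<Rightarrow> 'o"
  Ident :: "'o \<Rightarrow> 'm"
  Comp :: "'m \<Rightarrow> 'm \<Rightarrow> 'm"

definition in_hom :: "('o, 'm) category \<Rightarrow> 'm \<Rightarrow> 'o \<Rightarrow> 'o \<Rightarrow> bool" where
  "in_hom C f X Y \<longleftrightarrow> f \<in> Arr C \<and> Dom C f = X \<and> Cod C f = Y"

definition is_category :: "('o, 'm) category \<Rightarrow> bool" where
  "is_category C \<longleftrightarrow>
     (\<forall>f\<in>Arr C. Dom C f \<in> Obj C \<and> Cod C f \<in> Obj C) \<and>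
     (\<forall>X\<in>Obj C. in_hom C (Ident C X) X X) \<and>
     (\<forall>f\<in>Arr C. \<forall>g\<in>Arr C. Cod C f = Dom C g \<longrightarrow>
        in_hom C (Comp C g f) (Dom C f) (Cod C g)) \<and>
     (\<forall>f\<in>Arr C. Comp C f (Ident C (Dom C f)) = f \<and> Comp C (Ident C (Cod C f)) f = f) \<and>
     (\<forall>f\<in>Arr C. \<forall>g\<in>Arr C. \<forall>h\<in>Arr C. Cod C f = Dom C g \<and> Cod C g = Dom C h \<longrightarrow>
        Comp C h (Comp C g f) = Comp C (Comp C h g) f)"

definition is_iso :: "('o, 'm) category \<Rightarrow> 'm \<Rightarrow> bool" where
  "is_iso C f \<longleftrightarrow> f \<in> Arr C \<and>
     (\<exists>g. in_hom C g (Cod C f) (Dom C f) \<and>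
          Comp C g f = Ident C (Dom C f) \<and> Comp C f g = Ident C (Cod C f))"

text \<open>
  Functors are made extensional (arbitrary but fixed values outside the source category), so that
  functors that agree on the source category are equal.
\<close>

record ('o, 'm, 'p, 'n) cfunctor =
  FO :: "'o \<Rightarrow> 'p"
  FM :: "'m \<Rightarrow> 'n"

definition is_functor ::
  "('o, 'm) category \<Rightarrow> ('p, 'n) category \<Rightarrow> ('o, 'm, 'p, 'n) cfunctor \<Rightarrow> bool" where
  "is_functor C D F \<longleftrightarrow> is_category C \<and> is_category D \<and>
     FO F \<in> extensional (Obj C) \<and> FM F \<in> extensional (Arr C) \<and>
     (\<forall>X\<in>Obj C. FO F X \<in> Obj D) \<and>
     (\<forall>f\<in>Arr C. in_hom D (FM F f) (FO F (Dom C f)) (FO F (Cod C f))) \<and>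
     (\<forall>X\<in>Obj C. FM F (Ident C X) = Ident D (FO F X)) \<and>
     (\<forall>f\<in>Arr C. \<forall>g\<in>Arr C. Cod C f = Dom C g \<longrightarrow>
        FM F (Comp C g f) = Comp D (FM F g) (FM F f))"

definition inclusion_functor :: "('o, 'm) category \<Rightarrow> ('o, 'm, 'o, 'm) cfunctor" where
  "inclusion_functor C = \<lparr>FO = (\<lambda>X\<in>Obj C. X), FM = (\<lambda>f\<in>Arr C. f)\<rparr>"

abbreviation (input) id_functor :: "('o, 'm) category \<Rightarrow> ('o, 'm, 'o, 'm) cfunctor" where
  "id_functor C \<equiv> inclusion_functor C"

text \<open>The first argument of \<open>comp_functor\<close> is the source category of the composite.\<close>

definition comp_functor ::
  "('o, 'm) category \<Rightarrow> ('p, 'n, 'q, 'k) cfunctor \<Rightarrow> ('o, 'm, 'p, 'n) cfunctor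
     \<Rightarrow> ('o, 'm, 'q, 'k) cfunctor" where
  "comp_functor C G F =
     \<lparr>FO = compose (Obj C) (FO G) (FO F), FM = compose (Arr C) (FM G) (FM F)\<rparr>"

definition fully_faithful ::
  "('o, 'm) category \<Rightarrow> ('p, 'n) category \<Rightarrow> ('o, 'm, 'p, 'n) cfunctor \<Rightarrow> bool" where
  "fully_faithful C D F \<longleftrightarrow> is_functor C D F \<and>
     (\<forall>X\<in>Obj C. \<forall>Y\<in>Obj C.
        bij_betw (FM F) {f. in_hom C f X Y} {g. in_hom D g (FO F X) (FO F Y)})"

definition is_nat_trans ::
  "('o, 'm) category \<Rightarrow> ('p, 'n) category \<Rightarrow> ('o, 'm, 'p, 'n) cfunctor
     \<Rightarrow> ('o, 'm, 'p, 'n) cfunctor \<Rightarrow> ('o \<Rightarrow> 'n) \<Rightarrow> bool" where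
  "is_nat_trans C D F G \<alpha> \<longleftrightarrow> \<alpha> \<in> extensional (Obj C) \<and>
     (\<forall>X\<in>Obj C. in_hom D (\<alpha> X) (FO F X) (FO G X)) \<and>
     (\<forall>f\<in>Arr C. Comp D (\<alpha> (Cod C f)) (FM F f) = Comp D (FM G f) (\<alpha> (Dom C f)))"

definition naturally_isomorphic ::
  "('o, 'm) category \<Rightarrow> ('p, 'n) category \<Rightarrow> ('o, 'm, 'p, 'n) cfunctor
     \<Rightarrow> ('o, 'm, 'p, 'n) cfunctor \<Rightarrow> bool" where
  "naturally_isomorphic C D F G \<longleftrightarrow>
     (\<exists>\<alpha>. is_nat_trans C D F G \<alpha> \<and> (\<forall>X\<in>Obj C. is_iso D (\<alpha> X)))"

definition is_equivalence ::
  "('o, 'm) category \<Rightarrow> ('p, 'n) category \<Rightarrow> ('o, 'm, 'p, 'n) cfunctor \<Rightarrow> bool" where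
  "is_equivalence C D F \<longleftrightarrow> is_functor C D F \<and>
     (\<exists>G. is_functor D C G \<and>
          naturally_isomorphic C C (id_functor C) (comp_functor C G F) \<and>
          naturally_isomorphic D D (comp_functor D F G) (id_functor D))"

text \<open>
  The full subcategory, spanned by the functors satisfying \<open>P\<close>, of the category of functors from
  \<open>C\<close> to \<open>D\<close>. An arrow carries its source and target functors.
\<close>

type_synonym ('o, 'm, 'p, 'n) nat_arrow =
  "('o, 'm, 'p, 'n) cfunctor \<times> ('o \<Rightarrow> 'n) \<times> ('o, 'm, 'p, 'n) cfunctor"

definition functor_category ::
  "('o, 'm) category \<Rightarrow> ('p, 'n) category \<Rightarrow> (('o, 'm, 'p, 'n) cfunctor \<Rightarrow> bool)
     \<Rightarrow> (('o, 'm, 'p, 'n) cfunctor, ('o, 'm, 'p, 'n) nat_arrow) category" where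
  "functor_category C D P =
     \<lparr>Obj = {F. is_functor C D F \<and> P F},
      Arr = {(F, \<alpha>, G). is_functor C D F \<and> P F \<and> is_functor C D G \<and> P G \<and>
                         is_nat_trans C D F G \<alpha>},
      Dom = (\<lambda>(F, \<alpha>, G). F),
      Cod = (\<lambda>(F, \<alpha>, G). G),
      Ident = (\<lambda>F. (F, \<lambda>X\<in>Obj C. Ident D (FO F X), F)),
      Comp = (\<lambda>(G', \<beta>, H) (F, \<alpha>, G). (F, \<lambda>X\<in>Obj C. Comp D (\<beta> X) (\<alpha> X), H))\<rparr>"

text \<open>
  Precomposition with \<open>J: C \<rightarrow> E\<close>, as a functor defined on the category of functors from \<open>E\<close> to
  \<open>D\<close> satisfying \<open>P\<close>.
\<close>

definition precomposition ::
  "('o, 'm) category \<Rightarrow> ('p, 'n) category \<Rightarrow> ('d, 'e) category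
     \<Rightarrow> (('p, 'n, 'd, 'e) cfunctor \<Rightarrow> bool) \<Rightarrow> ('o, 'm, 'p, 'n) cfunctor
     \<Rightarrow> (('p, 'n, 'd, 'e) cfunctor, ('p, 'n, 'd, 'e) nat_arrow,
         ('o, 'm, 'd, 'e) cfunctor, ('o, 'm, 'd, 'e) nat_arrow) cfunctor" where
  "precomposition C E D P J =
     \<lparr>FO = (\<lambda>F\<in>Obj (functor_category E D P). comp_functor C F J),
      FM = (\<lambda>(F, \<alpha>, G)\<in>Arr (functor_category E D P).
              (comp_functor C F J, \<lambda>X\<in>Obj C. \<alpha> (FO J X), comp_functor C G J))\<rparr>"


section \<open>Limits and colimits\<close>

definition is_cone ::
  "('j, 'k) category \<Rightarrow> ('o, 'm) category \<Rightarrow> ('j, 'k, 'o, 'm) cfunctor \<Rightarrow> 'o \<Rightarrow> ('j \<Rightarrow> 'm) \<Rightarrow> bool"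
  where
  "is_cone J C G X p \<longleftrightarrow> X \<in> Obj C \<and>
     (\<forall>j\<in>Obj J. in_hom C (p j) X (FO G j)) \<and>
     (\<forall>a\<in>Arr J. Comp C (FM G a) (p (Dom J a)) = p (Cod J a))"

definition is_limit ::
  "('j, 'k) category \<Rightarrow> ('o, 'm) category \<Rightarrow> ('j, 'k, 'o, 'm) cfunctor \<Rightarrow> 'o \<Rightarrow> ('j \<Rightarrow> 'm) \<Rightarrow> bool"
  where
  "is_limit J C G X p \<longleftrightarrow> is_cone J C G X p \<and>
     (\<forall>Y q. is_cone J C G Y q \<longrightarrow>
        (\<exists>!u. in_hom C u Y X \<and> (\<forall>j\<in>Obj J. Comp C (p j) u = q j)))"

definition finite_category :: "('j, 'k) category \<Rightarrow> bool" where
  "finite_category J \<longleftrightarrow> is_category J \<and> finite (Obj J) \<and> finite (Arr J)"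

text \<open>Every finite category is isomorphic to one whose objects and arrows are natural numbers.\<close>

definition has_finite_limits :: "('o, 'm) category \<Rightarrow> bool" where
  "has_finite_limits C \<longleftrightarrow>
     (\<forall>(J :: (nat, nat) category) G. finite_category J \<and> is_functor J C G \<longrightarrow>
        (\<exists>X p. is_limit J C G X p))"

definition preserves_finite_limits ::
  "('o, 'm) category \<Rightarrow> ('p, 'n) category \<Rightarrow> ('o, 'm, 'p, 'n) cfunctor \<Rightarrow> bool" where
  "preserves_finite_limits C D F \<longleftrightarrow>
     (\<forall>(J :: (nat, nat) category) G X p. finite_category J \<and> is_functor J C G \<and>
        is_limit J C G X p \<longrightarrow>
        is_limit J D (comp_functor J F G) (FO F X) (\<lambda>j. FM F (p j)))"

text \<open>
  \<open>is_pullback C f g p q\<close>: the square \<open>f \<circ> p = g \<circ> q\<close> is a pullback, so \<open>p\<close> is the pullback of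
  \<open>g\<close> along \<open>f\<close>.
\<close>

definition is_pullback :: "('o, 'm) category \<Rightarrow> 'm \<Rightarrow> 'm \<Rightarrow> 'm \<Rightarrow> 'm \<Rightarrow> bool" where
  "is_pullback C f g p q \<longleftrightarrow>
     f \<in> Arr C \<and> g \<in> Arr C \<and> Cod C f = Cod C g \<and>
     p \<in> Arr C \<and> q \<in> Arr C \<and> Dom C p = Dom C q \<and> Cod C p = Dom C f \<and> Cod C q = Dom C g \<and>
     Comp C f p = Comp C g q \<and>
     (\<forall>a b. a \<in> Arr C \<and> b \<in> Arr C \<and> Dom C a = Dom C b \<and> Cod C a = Dom C f \<and>
        Cod C b = Dom C g \<and> Comp C f a = Comp C g b \<longrightarrow>
        (\<exists>!u. in_hom C u (Dom C a) (Dom C p) \<and> Comp C p u = a \<and> Comp C q u = b))"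

definition is_coequalizer :: "('o, 'm) category \<Rightarrow> 'm \<Rightarrow> 'm \<Rightarrow> 'm \<Rightarrow> bool" where
  "is_coequalizer C f g q \<longleftrightarrow>
     f \<in> Arr C \<and> g \<in> Arr C \<and> Dom C f = Dom C g \<and> Cod C f = Cod C g \<and>
     q \<in> Arr C \<and> Dom C q = Cod C f \<and> Comp C q f = Comp C q g \<and>
     (\<forall>a. a \<in> Arr C \<and> Dom C a = Cod C f \<and> Comp C a f = Comp C a g \<longrightarrow>
        (\<exists>!u. in_hom C u (Cod C q) (Cod C a) \<and> Comp C u q = a))"

definition is_regular_epi :: "('o, 'm) category \<Rightarrow> 'm \<Rightarrow> bool" where
  "is_regular_epi C q \<longleftrightarrow> (\<exists>f g. is_coequalizer C f g q)"

definition is_coproduct ::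
  "('o, 'm) category \<Rightarrow> 'i set \<Rightarrow> ('i \<Rightarrow> 'o) \<Rightarrow> 'o \<Rightarrow> ('i \<Rightarrow> 'm) \<Rightarrow> bool" where
  "is_coproduct C I A S \<iota> \<longleftrightarrow> S \<in> Obj C \<and>
     (\<forall>i\<in>I. in_hom C (\<iota> i) (A i) S) \<and>
     (\<forall>Y\<in>Obj C. \<forall>q. (\<forall>i\<in>I. in_hom C (q i) (A i) Y) \<longrightarrow>
        (\<exists>!u. in_hom C u S Y \<and> (\<forall>i\<in>I. Comp C u (\<iota> i) = q i)))"

definition has_finite_coproducts :: "('o, 'm) category \<Rightarrow> bool" where
  "has_finite_coproducts C \<longleftrightarrow>
     (\<forall>(I :: nat set) A. finite I \<and> (\<forall>i\<in>I. A i \<in> Obj C) \<longrightarrow> (\<exists>S \<iota>. is_coproduct C I A S \<iota>))"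

definition preserves_finite_coproducts ::
  "('o, 'm) category \<Rightarrow> ('p, 'n) category \<Rightarrow> ('o, 'm, 'p, 'n) cfunctor \<Rightarrow> bool" where
  "preserves_finite_coproducts C D F \<longleftrightarrow>
     (\<forall>(I :: nat set) A S \<iota>. finite I \<and> is_coproduct C I A S \<iota> \<longrightarrow>
        is_coproduct D I (\<lambda>i. FO F (A i)) (FO F S) (\<lambda>i. FM F (\<iota> i)))"


section \<open>Subobjects and images\<close>

definition is_mono :: "('o, 'm) category \<Rightarrow> 'm \<Rightarrow> bool" where
  "is_mono C m \<longleftrightarrow> m \<in> Arr C \<and>
     (\<forall>f\<in>Arr C. \<forall>g\<in>Arr C. Dom C f = Dom C g \<and> Cod C f = Dom C m \<and> Cod C g = Dom C m \<and>
        Comp C m f = Comp C m g \<longrightarrow> f = g)"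

definition factors_through :: "('o, 'm) category \<Rightarrow> 'm \<Rightarrow> 'm \<Rightarrow> bool" where
  "factors_through C f m \<longleftrightarrow> (\<exists>h. in_hom C h (Dom C f) (Dom C m) \<and> Comp C m h = f)"

definition monos_into :: "('o, 'm) category \<Rightarrow> 'o \<Rightarrow> 'm set" where
  "monos_into C X = {m. is_mono C m \<and> Cod C m = X}"

definition subobject_of :: "('o, 'm) category \<Rightarrow> 'm \<Rightarrow> 'm set" where
  "subobject_of C m =
     {n \<in> monos_into C (Cod C m). factors_through C m n \<and> factors_through C n m}"

definition Sub :: "('o, 'm) category \<Rightarrow> 'o \<Rightarrow> 'm set set" where
  "Sub C X = subobject_of C ` monos_into C X"

definition sub_le :: "('o, 'm) category \<Rightarrow> 'm set \<Rightarrow> 'm set \<Rightarrow> bool" where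
  "sub_le C S T \<longleftrightarrow> (\<exists>m\<in>S. \<exists>n\<in>T. factors_through C m n)"

definition is_join :: "('o, 'm) category \<Rightarrow> 'o \<Rightarrow> 'm set set \<Rightarrow> 'm set \<Rightarrow> bool" where
  "is_join C X \<S> V \<longleftrightarrow> \<S> \<subseteq> Sub C X \<and> V \<in> Sub C X \<and> (\<forall>S\<in>\<S>. sub_le C S V) \<and>
     (\<forall>T\<in>Sub C X. (\<forall>S\<in>\<S>. sub_le C S T) \<longrightarrow> sub_le C V T)"

text \<open>
  The pullbacks along \<open>f\<close> of the representatives of one subobject are all mutually equivalent and
  are closed under equivalence of monomorphisms, so they form a single subobject.
\<close>

definition sub_pullback :: "('o, 'm) category \<Rightarrow> 'm \<Rightarrow> 'm set \<Rightarrow> 'm set" where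
  "sub_pullback C f S = {p. \<exists>m\<in>S. \<exists>q. is_pullback C f m p q}"

text \<open>
  The subobject represented by the images under \<open>F\<close> of the representatives of \<open>S\<close> (for
  functors \<open>F\<close> that preserve monomorphisms).
\<close>

definition sub_map :: "('p, 'n) category \<Rightarrow> ('o, 'm, 'p, 'n) cfunctor \<Rightarrow> 'm set \<Rightarrow> 'n set" where
  "sub_map D F S = (\<Union>m\<in>S. subobject_of D (FM F m))"

definition is_image :: "('o, 'm) category \<Rightarrow> 'm \<Rightarrow> 'm set \<Rightarrow> bool" where
  "is_image C f S \<longleftrightarrow> f \<in> Arr C \<and> S \<in> Sub C (Cod C f) \<and> (\<exists>m\<in>S. factors_through C f m) \<and>
     (\<forall>T\<in>Sub C (Cod C f). (\<exists>n\<in>T. factors_through C f n) \<longrightarrow> sub_le C S T)"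


section \<open>Regular, coherent and exact categories\<close>

definition regular_category :: "('o, 'm) category \<Rightarrow> bool" where
  "regular_category C \<longleftrightarrow> is_category C \<and> has_finite_limits C \<and>
     (\<forall>f\<in>Arr C. \<exists>S. is_image C f S) \<and>
     (\<forall>f g p q S. is_pullback C g f p q \<and> is_image C f S \<longrightarrow> is_image C p (sub_pullback C g S))"

definition coherent_category :: "('o, 'm) category \<Rightarrow> bool" where
  "coherent_category C \<longleftrightarrow> regular_category C \<and>
     (\<forall>X\<in>Obj C. \<forall>\<S>. finite \<S> \<and> \<S> \<subseteq> Sub C X \<longrightarrow> (\<exists>V. is_join C X \<S> V)) \<and>
     (\<forall>f\<in>Arr C. \<forall>\<S> V. finite \<S> \<and> is_join C (Cod C f) \<S> V \<longrightarrow>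
        is_join C (Dom C f) (sub_pullback C f ` \<S>) (sub_pullback C f V))"

definition internal_equivalence_relation :: "('o, 'm) category \<Rightarrow> 'm \<Rightarrow> 'm \<Rightarrow> bool" where
  "internal_equivalence_relation C r s \<longleftrightarrow>
     r \<in> Arr C \<and> s \<in> Arr C \<and> Dom C r = Dom C s \<and> Cod C r = Cod C s \<and>
     \<comment> \<open>jointly monic\<close>
     (\<forall>f\<in>Arr C. \<forall>g\<in>Arr C. Dom C f = Dom C g \<and> Cod C f = Dom C r \<and> Cod C g = Dom C r \<and>
        Comp C r f = Comp C r g \<and> Comp C s f = Comp C s g \<longrightarrow> f = g) \<and>
     \<comment> \<open>reflexive\<close>
     (\<exists>d. in_hom C d (Cod C r) (Dom C r) \<and>
          Comp C r d = Ident C (Cod C r) \<and> Comp C s d = Ident C (Cod C r)) \<and>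
     \<comment> \<open>symmetric\<close>
     (\<exists>t. in_hom C t (Dom C r) (Dom C r) \<and> Comp C r t = s \<and> Comp C s t = r) \<and>
     \<comment> \<open>transitive\<close>
     (\<forall>p q. is_pullback C s r p q \<longrightarrow>
        (\<exists>t. in_hom C t (Dom C p) (Dom C r) \<and>
             Comp C r t = Comp C r p \<and> Comp C s t = Comp C s q))"

definition effective_relation :: "('o, 'm) category \<Rightarrow> 'm \<Rightarrow> 'm \<Rightarrow> bool" where
  "effective_relation C r s \<longleftrightarrow> (\<exists>q. is_coequalizer C r s q \<and> is_pullback C q q r s)"

definition exact_category :: "('o, 'm) category \<Rightarrow> bool" where
  "exact_category C \<longleftrightarrow> regular_category C \<and>
     (\<forall>r s. internal_equivalence_relation C r s \<longrightarrow> effective_relation C r s)"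


section \<open>Extensive categories and pretoposes\<close>

definition slice_category ::
  "('o, 'm) category \<Rightarrow> 'o \<Rightarrow> ('m, 'm \<times> 'm \<times> 'm) category" where
  "slice_category C X =
     \<lparr>Obj = {f\<in>Arr C. Cod C f = X},
      Arr = {(f, h, g). f \<in> Arr C \<and> Cod C f = X \<and> g \<in> Arr C \<and> Cod C g = X \<and>
                         in_hom C h (Dom C f) (Dom C g) \<and> Comp C g h = f},
      Dom = (\<lambda>(f, h, g). f),
      Cod = (\<lambda>(f, h, g). g),
      Ident = (\<lambda>f. (f, Ident C (Dom C f), f)),
      Comp = (\<lambda>(g', k, e) (f, h, g). (f, Comp C k h, e))\<rparr>"

definition product_category ::
  "('o, 'm) category \<Rightarrow> ('p, 'n) category \<Rightarrow> ('o \<times> 'p, 'm \<times> 'n) category" where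
  "product_category C D =
     \<lparr>Obj = Obj C \<times> Obj D,
      Arr = Arr C \<times> Arr D,
      Dom = (\<lambda>(f, g). (Dom C f, Dom D g)),
      Cod = (\<lambda>(f, g). (Cod C f, Cod D g)),
      Ident = (\<lambda>(X, Y). (Ident C X, Ident D Y)),
      Comp = (\<lambda>(f', g') (f, g). (Comp C f' f, Comp D g' g))\<rparr>"

text \<open>A chosen binary coproduct; its two injections are indexed by \<open>0\<close> and \<open>1\<close>.\<close>

definition chosen_sum :: "('o, 'm) category \<Rightarrow> 'o \<Rightarrow> 'o \<Rightarrow> 'o \<times> (nat \<Rightarrow> 'm)" where
  "chosen_sum C X Y =
     (SOME c. is_coproduct C {0, 1} (\<lambda>i. if i = 0 then X else Y) (fst c) (snd c))"

definition sum_obj :: "('o, 'm) category \<Rightarrow> 'o \<Rightarrow> 'o \<Rightarrow> 'o" where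
  "sum_obj C X Y = fst (chosen_sum C X Y)"

definition sum_inj :: "('o, 'm) category \<Rightarrow> 'o \<Rightarrow> 'o \<Rightarrow> nat \<Rightarrow> 'm" where
  "sum_inj C X Y = snd (chosen_sum C X Y)"

definition sum_map :: "('o, 'm) category \<Rightarrow> 'm \<Rightarrow> 'm \<Rightarrow> 'm" where
  "sum_map C f g =
     (THE u. in_hom C u (sum_obj C (Dom C f) (Dom C g)) (sum_obj C (Cod C f) (Cod C g)) \<and>
        Comp C u (sum_inj C (Dom C f) (Dom C g) 0) =
          Comp C (sum_inj C (Cod C f) (Cod C g) 0) f \<and>
        Comp C u (sum_inj C (Dom C f) (Dom C g) 1) =
          Comp C (sum_inj C (Cod C f) (Cod C g) 1) g)"

text \<open>The functor \<open>C/X \<times> C/Y \<rightarrow> C/(X + Y)\<close> that sends \<open>(A \<rightarrow> X, B \<rightarrow> Y)\<close> to \<open>A + B \<rightarrow> X + Y\<close>.\<close>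

definition slice_sum_functor ::
  "('o, 'm) category \<Rightarrow> 'o \<Rightarrow> 'o
     \<Rightarrow> ('m \<times> 'm, ('m \<times> 'm \<times> 'm) \<times> ('m \<times> 'm \<times> 'm), 'm, 'm \<times> 'm \<times> 'm) cfunctor" where
  "slice_sum_functor C X Y =
     (let P = product_category (slice_category C X) (slice_category C Y) in
     \<lparr>FO = (\<lambda>(f, g)\<in>Obj P. sum_map C f g),
      FM = (\<lambda>((f, h, f'), (g, k, g'))\<in>Arr P. (sum_map C f g, sum_map C h k, sum_map C f' g'))\<rparr>)"

definition extensive_category :: "('o, 'm) category \<Rightarrow> bool" where
  "extensive_category C \<longleftrightarrow> is_category C \<and> has_finite_coproducts C \<and>
     (\<forall>X\<in>Obj C. \<forall>Y\<in>Obj C.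
        is_equivalence (product_category (slice_category C X) (slice_category C Y))
          (slice_category C (sum_obj C X Y)) (slice_sum_functor C X Y))"

definition pretopos :: "('o, 'm) category \<Rightarrow> bool" where
  "pretopos C \<longleftrightarrow> exact_category C \<and> extensive_category C"


section \<open>Exact functors, coherent functors and pretopos morphisms\<close>

definition preserves_regular_epis ::
  "('o, 'm) category \<Rightarrow> ('p, 'n) category \<Rightarrow> ('o, 'm, 'p, 'n) cfunctor \<Rightarrow> bool" where
  "preserves_regular_epis C D F \<longleftrightarrow>
     (\<forall>q. is_regular_epi C q \<longrightarrow> is_regular_epi D (FM F q))"

definition preserves_finite_joins ::
  "('o, 'm) category \<Rightarrow> ('p, 'n) category \<Rightarrow> ('o, 'm, 'p, 'n) cfunctor \<Rightarrow> bool" where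
  "preserves_finite_joins C D F \<longleftrightarrow>
     (\<forall>X\<in>Obj C. \<forall>\<S> V. finite \<S> \<and> is_join C X \<S> V \<longrightarrow>
        is_join D (FO F X) (sub_map D F ` \<S>) (sub_map D F V))"

definition preserves_quotients ::
  "('o, 'm) category \<Rightarrow> ('p, 'n) category \<Rightarrow> ('o, 'm, 'p, 'n) cfunctor \<Rightarrow> bool" where
  "preserves_quotients C D F \<longleftrightarrow>
     (\<forall>r s q. internal_equivalence_relation C r s \<and> is_coequalizer C r s q \<longrightarrow>
        is_coequalizer D (FM F r) (FM F s) (FM F q))"

definition exact_functor ::
  "('o, 'm) category \<Rightarrow> ('p, 'n) category \<Rightarrow> ('o, 'm, 'p, 'n) cfunctor \<Rightarrow> bool" where
  "exact_functor C D F \<longleftrightarrow> is_functor C D F \<and>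
     preserves_finite_limits C D F \<and> preserves_regular_epis C D F"

definition coherent_functor ::
  "('o, 'm) category \<Rightarrow> ('p, 'n) category \<Rightarrow> ('o, 'm, 'p, 'n) cfunctor \<Rightarrow> bool" where
  "coherent_functor C D F \<longleftrightarrow> is_functor C D F \<and>
     preserves_finite_limits C D F \<and> preserves_regular_epis C D F \<and> preserves_finite_joins C D F"

definition pretopos_morphism ::
  "('o, 'm) category \<Rightarrow> ('p, 'n) category \<Rightarrow> ('o, 'm, 'p, 'n) cfunctor \<Rightarrow> bool" where
  "pretopos_morphism C D F \<longleftrightarrow> is_functor C D F \<and>
     preserves_finite_limits C D F \<and> preserves_finite_coproducts C D F \<and> preserves_quotients C D F"


section \<open>Completions\<close>

text \<open>
  HOL cannot quantify over types inside a formula. The test categories \<open>D\<close> in the universal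
  properties therefore have objects in the type \<open>'d\<close> and arrows in the type \<open>'e\<close> given by the last
  argument; leaving \<open>'d\<close> and \<open>'e\<close> as type variables in a theorem makes it range over all test
  categories.
\<close>

definition is_exact_completion ::
  "('o, 'm) category \<Rightarrow> ('p, 'n) category \<Rightarrow> ('o, 'm, 'p, 'n) cfunctor
     \<Rightarrow> ('d \<times> 'e) itself \<Rightarrow> bool" where
  "is_exact_completion C E J _ \<longleftrightarrow>
     regular_category C \<and> exact_category E \<and> fully_faithful C E J \<and> exact_functor C E J \<and>
     (\<forall>D :: ('d, 'e) category. exact_category D \<longrightarrow>
        is_equivalence (functor_category E D (exact_functor E D))
          (functor_category C D (exact_functor C D))
          (precomposition C E D (exact_functor E D) J))"

definition is_pretopos_completion ::
  "('o, 'm) category \<Rightarrow> ('p, 'n) category \<Rightarrow> ('o, 'm, 'p, 'n) cfunctor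
     \<Rightarrow> ('d \<times> 'e) itself \<Rightarrow> bool" where
  "is_pretopos_completion C P J _ \<longleftrightarrow>
     coherent_category C \<and> pretopos P \<and> coherent_functor C P J \<and>
     (\<forall>D :: ('d, 'e) category. pretopos D \<longrightarrow>
        is_equivalence (functor_category P D (pretopos_morphism P D))
          (functor_category C D (coherent_functor C D))
          (precomposition C P D (pretopos_morphism P D) J))"


section \<open>Universes\<close>

text \<open>
  HOL has no type of all sets, so ``all'' spaces have to be taken relative to a universe: a family
  \<open>U\<close> of small subsets of a type \<open>'a\<close>. The points of a space are elements of \<open>'a\<close>, and the space is
  small if it has a base of at most the size of some member of \<open>U\<close>. If \<open>U\<close> is
  closed under power sets, as the small sets of a Grothendieck universe or the sets of a model of
  ZFC are, then the small Hausdorff spaces are exactly the Hausdorff spaces with small carrier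
  (lemma \<open>small_space_iff\<close>). Closure under power sets is not required,
  since pure HOL does not prove that such a \<open>U\<close> containing an infinite set exists;
  without it, \<open>U\<close> may also be a bound on the weight of the spaces (lemma \<open>size_universe_bounded\<close>).
  The last condition makes \<open>'a\<close> large enough for every small Hausdorff space, on whatever type, to
  have a homeomorphic copy in \<open>'a\<close> (lemma \<open>small_space_copy\<close>).
\<close>

definition size_universe :: "'a set set \<Rightarrow> bool" where
  "size_universe U \<longleftrightarrow>
     (\<exists>A\<in>U. infinite A) \<and>
     (\<forall>A\<in>U. \<forall>B. B \<lesssim> A \<longrightarrow> B \<in> U) \<and>
     (\<forall>A\<in>U. Pow A \<lesssim> (UNIV :: 'a set))"

definition small_space :: "'a set set \<Rightarrow> 'b topology \<Rightarrow> bool" where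
  "small_space U X \<longleftrightarrow>
     (\<exists>\<B>. (\<exists>A\<in>U. \<B> \<lesssim> A) \<and> (\<forall>V\<in>\<B>. openin X V) \<and> neighbourhood_base_of (\<lambda>V. V \<in> \<B>) X)"

lemma Pow_lepoll_mono:
  assumes "A \<lesssim> B"
  shows "Pow A \<lesssim> Pow B"
proof -
  from assms obtain f where f: "inj_on f A" "f ` A \<subseteq> B" by (auto simp: lepoll_def)
  then have "inj_on ((`) f) (Pow A)" by (intro inj_on_image_Pow)
  moreover have "(`) f ` Pow A \<subseteq> Pow B" using f(2) by blast
  ultimately show ?thesis unfolding lepoll_def by blast
qed

lemma size_universe_bounded:
  assumes "infinite (UNIV :: 'i set)"
  shows "size_universe {A :: 'i set set. A \<lesssim> (UNIV :: 'i set)}"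
proof -
  have inf: "\<exists>A\<in>{A :: 'i set set. A \<lesssim> (UNIV :: 'i set)}. infinite A"
  proof
    have inj: "inj (\<lambda>x::'i. {x})" by (simp add: inj_on_def)
    show "range (\<lambda>x::'i. {x}) \<in> {A :: 'i set set. A \<lesssim> (UNIV :: 'i set)}"
      by (simp add: image_lepoll)
    show "infinite (range (\<lambda>x::'i. {x}))"
      using assms inj finite_imageD by blast
  qed
  have pow: "Pow A \<lesssim> (UNIV :: 'i set set)" if "A \<lesssim> (UNIV :: 'i set)" for A :: "'i set set"
  proof -
    from that obtain f :: "'i set \<Rightarrow> 'i" where f: "inj_on f A" by (auto simp: lepoll_def)
    then have "inj_on ((`) f) (Pow A)" by (rule inj_on_image_Pow)
    then show ?thesis by (auto simp: lepoll_def)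
  qed
  show ?thesis
    unfolding size_universe_def using inf pow lepoll_trans by blast
qed

lemma Hausdorff_lepoll_Pow_base:
  assumes "Hausdorff_space X" "neighbourhood_base_of (\<lambda>V. V \<in> \<B>) X"
    and "\<And>V. V \<in> \<B> \<Longrightarrow> openin X V"
  shows "topspace X \<lesssim> Pow \<B>"
proof -
  have "inj_on (\<lambda>x. {V\<in>\<B>. x \<in> V}) (topspace X)"
  proof (rule inj_onI, rule ccontr)
    fix x y assume x: "x \<in> topspace X" and y: "y \<in> topspace X"
      and eq: "{V\<in>\<B>. x \<in> V} = {V\<in>\<B>. y \<in> V}" and "x \<noteq> y"
    then obtain S T where "openin X S" "openin X T" "x \<in> S" "y \<in> T" "disjnt S T"
      using assms(1) unfolding Hausdorff_space_def by metis
    moreover obtain V where "V \<in> \<B>" "x \<in> V" "V \<subseteq> S"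
      using assms(2) \<open>openin X S\<close> \<open>x \<in> S\<close> unfolding neighbourhood_base_of by (meson subsetD)
    ultimately show False using eq unfolding disjnt_def by blast
  qed
  then show ?thesis by (auto simp: lepoll_def)
qed

lemma small_space_iff:
  fixes X :: "'a topology"
  assumes "size_universe U" and pow: "\<And>A. A \<in> U \<Longrightarrow> \<exists>B\<in>U. Pow A \<lesssim> B" and "Hausdorff_space X"
  shows "small_space U X \<longleftrightarrow> topspace X \<in> U"
proof
  assume "small_space U X"
  then obtain \<B> A where "A \<in> U" "\<B> \<lesssim> A" and B: "\<And>V. V \<in> \<B> \<Longrightarrow> openin X V"
    "neighbourhood_base_of (\<lambda>V. V \<in> \<B>) X" unfolding small_space_def by blast
  have "Pow \<B> \<lesssim> Pow A" using \<open>\<B> \<lesssim> A\<close> by (rule Pow_lepoll_mono)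
  with pow[OF \<open>A \<in> U\<close>] Hausdorff_lepoll_Pow_base[OF assms(3) B(2,1)]
  show "topspace X \<in> U" using assms(1) unfolding size_universe_def by (meson lepoll_trans)
next
  assume "topspace X \<in> U"
  moreover have "{V. openin X V} \<lesssim> Pow (topspace X)"
    by (rule subset_imp_lepoll) (auto dest: openin_subset)
  ultimately have "\<exists>A\<in>U. {V. openin X V} \<lesssim> A" using pow by (meson lepoll_trans)
  moreover have "neighbourhood_base_of (\<lambda>V. V \<in> {V. openin X V}) X"
    by (auto simp: open_neighbourhood_base_of)
  ultimately show "small_space U X" unfolding small_space_def by blast
qed

lemma small_space_copy:
  fixes U :: "'a set set" and X :: "'b topology"
  assumes "size_universe U" "Hausdorff_space X" "small_space U X"
  shows "\<exists>Y :: 'a topology. X homeomorphic_space Y \<and> small_space U Y"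
proof -
  obtain \<B> A where "A \<in> U" "\<B> \<lesssim> A" and B: "\<And>V. V \<in> \<B> \<Longrightarrow> openin X V"
    "neighbourhood_base_of (\<lambda>V. V \<in> \<B>) X" using assms(3) unfolding small_space_def by blast
  have "Pow \<B> \<lesssim> Pow A" using \<open>\<B> \<lesssim> A\<close> by (rule Pow_lepoll_mono)
  then have "topspace X \<lesssim> (UNIV :: 'a set)"
    using Hausdorff_lepoll_Pow_base[OF assms(2) B(2,1)] assms(1) \<open>A \<in> U\<close>
    unfolding size_universe_def by (meson lepoll_trans)
  then obtain f :: "'b \<Rightarrow> 'a" where f: "inj_on f (topspace X)" by (auto simp: lepoll_def)
  define g where "g = inv_into (topspace X) f"
  define Y where "Y = pullback_topology (f ` topspace X) g X"
  have gf: "g (f x) = x" if "x \<in> topspace X" for x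
    using f that by (simp add: g_def)
  have opn: "openin Y W \<longleftrightarrow> (\<exists>V. openin X V \<and> W = f ` V)" for W
  proof -
    have "g -` V \<inter> f ` topspace X = f ` V" if "openin X V" for V
    proof
      show "g -` V \<inter> f ` topspace X \<subseteq> f ` V" using gf by auto
      show "f ` V \<subseteq> g -` V \<inter> f ` topspace X" using openin_subset[OF that] gf by auto
    qed
    then show ?thesis unfolding Y_def openin_pullback_topology by (intro ex_cong) auto
  qed
  have top: "topspace Y = f ` topspace X"
    unfolding Y_def topspace_pullback_topology using gf by auto
  have "homeomorphic_map X Y f"
  proof (rule bijective_open_imp_homeomorphic_map)
    show "continuous_map X Y f"
      unfolding continuous_map
    proof (intro conjI allI impI)
      show "f ` topspace X \<subseteq> topspace Y" by (simp add: top)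
      fix W assume "openin Y W"
      then obtain V where V: "openin X V" "W = f ` V" by (auto simp: opn)
      have "{x \<in> topspace X. f x \<in> W} = V"
        using openin_subset[OF V(1)] f V(2) by (auto dest: inj_onD)
      then show "openin X {x \<in> topspace X. f x \<in> W}" using V by simp
    qed
    show "open_map X Y f" by (auto simp: open_map_def opn)
    show "f ` topspace X = topspace Y" by (simp add: top)
    show "inj_on f (topspace X)" by (rule f)
  qed
  then have "X homeomorphic_space Y" using homeomorphic_map_imp_homeomorphic_space by blast
  moreover have "small_space U Y"
    unfolding small_space_def
  proof (intro exI conjI)
    show "\<exists>A\<in>U. (`) f ` \<B> \<lesssim> A"
      using \<open>A \<in> U\<close> \<open>\<B> \<lesssim> A\<close> image_lepoll lepoll_trans by blast
    show "\<forall>V\<in>(`) f ` \<B>. openin Y V" using B(1) by (auto simp: opn)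
    show "neighbourhood_base_of (\<lambda>V. V \<in> (`) f ` \<B>) Y"
      unfolding neighbourhood_base_of
    proof (intro allI impI)
      fix W y assume "openin Y W \<and> y \<in> W"
      then obtain G x where G: "openin X G" "W = f ` G" "x \<in> G" "y = f x" by (auto simp: opn)
      then obtain V where V: "V \<in> \<B>" "x \<in> V" "V \<subseteq> G"
        using B(2) unfolding neighbourhood_base_of by (meson subsetD)
      then show "\<exists>V' N. openin Y V' \<and> N \<in> (`) f ` \<B> \<and> y \<in> V' \<and> V' \<subseteq> N \<and> N \<subseteq> W"
        using B(1) G by (intro exI[of _ "f ` V"]) (auto simp: opn)
    qed
  qed
  ultimately show ?thesis by blast
qed


section \<open>Stone spaces and compact Hausdorff spaces\<close>

text \<open>
  The full subcategory of topological spaces on the class \<open>\<X>\<close> of spaces. Maps are extensional, so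
  that equality of arrows is equality of maps on the points of the source.
\<close>

type_synonym 'a map_arrow = "'a topology \<times> ('a \<Rightarrow> 'a) \<times> 'a topology"

definition top_category :: "'a topology set \<Rightarrow> ('a topology, 'a map_arrow) category" where
  "top_category \<X> =
     \<lparr>Obj = \<X>,
      Arr = {(X, f, Y). X \<in> \<X> \<and> Y \<in> \<X> \<and> continuous_map X Y f \<and> f \<in> extensional (topspace X)},
      Dom = (\<lambda>(X, f, Y). X),
      Cod = (\<lambda>(X, f, Y). Y),
      Ident = (\<lambda>X. (X, \<lambda>x\<in>topspace X. x, X)),
      Comp = (\<lambda>(Y', g, Z) (X, f, Y). (X, compose (topspace X) g f, Z))\<rparr>"

definition zero_dimensional_space :: "'a topology \<Rightarrow> bool" where
  "zero_dimensional_space X \<longleftrightarrow> neighbourhood_base_of (\<lambda>V. openin X V \<and> closedin X V) X"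

definition KH :: "'a set set \<Rightarrow> ('a topology, 'a map_arrow) category" where
  "KH U = top_category {X. compact_space X \<and> Hausdorff_space X \<and> small_space U X}"

definition Stone :: "'a set set \<Rightarrow> ('a topology, 'a map_arrow) category" where
  "Stone U = top_category
     {X. zero_dimensional_space X \<and> compact_space X \<and> Hausdorff_space X \<and> small_space U X}"

end

theory Submission
  imports Defs
begin

text \<open>
  Every compact Hausdorff space \<open>X\<close> is covered by a Stone space \<open>T\<close>, and a pullback of Stone spaces over
  \<open>X\<close> is again a Stone space. So \<open>X\<close> is the coequalizer of the kernel pair of \<open>T \<rightarrow> X\<close>, a diagram in
  \<open>Stone\<close> which is an equivalence relation there. An exact functor on \<open>Stone\<close> to an exact category takes
  it to an effective equivalence relation, whose quotient is the value at \<open>X\<close> of the unique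
  exact extension to \<open>KH\<close>. Since \<open>KH\<close> is exact by forming quotient spaces, it is the exact completion.

  For a pretopos as target, the exact extension of a coherent functor preserves finite coproducts,
  because the coproduct of \<open>X\<close> and \<open>Y\<close> in \<open>KH\<close> is the disjoint join of \<open>X\<close> and \<open>Y\<close>;
  conversely a join of subobjects in \<open>Stone\<close> is an image of their coproduct in \<open>KH\<close>.
\<close>

section \<open>Categories and functors\<close>

text \<open>Size shapes the covers. The universe need not be closed under power sets, so the
  Stone-Cech compactification of the discrete set of points of X may be too large. Smallness is
  measured by weight instead: a base of X supplies the coordinates of a closed subspace of X times a
  power of the two-point space, and since the coordinates alone separate its points, two clopen sets
  per base set bound its weight. Although a cover T of X lies in Stone, X does not. The kernel pair
  of T -> X need not be a kernel pair in Stone, so a functor on Stone cannot be asked to preserve it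
  as one; only its being an equivalence relation survives, and exactness of the target restores the
  quotient. The functor need not be faithful either: an equation in the target is not reflected but
  turned into a lift through the image of a pullback formed in KH, where the equation holds. Such
  arguments run on generalized elements, lifted after restriction along a cover; the results descend
  because they are unique. For pretoposes the empty join counts too: its preservation makes the
  value at the empty space initial, and strictness of the initial object then yields
  disjointness.\<close>

abbreviation comp_in :: "'m \<Rightarrow> ('o, 'm) category \<Rightarrow> 'm \<Rightarrow> 'm"  ("(_ \<cdot>\<^sub>_/ _)" [56, 1000, 55] 55)
  where "g \<cdot>\<^sub>C f \<equiv> Comp C g f"

declare in_hom_def [simp]

lemma ex1_eq: "\<lbrakk>\<exists>!x. P x; P a; P b\<rbrakk> \<Longrightarrow> a = b"
  by blast

locale cat =
  fixes C :: "('o, 'm) category"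
  assumes cat: "is_category C"
begin

lemma Dom_Obj [simp]: "f \<in> Arr C \<Longrightarrow> Dom C f \<in> Obj C"
  and Cod_Obj [simp]: "f \<in> Arr C \<Longrightarrow> Cod C f \<in> Obj C"
  and Ident_Arr [simp]: "X \<in> Obj C \<Longrightarrow> Ident C X \<in> Arr C"
  and Ident_Dom [simp]: "X \<in> Obj C \<Longrightarrow> Dom C (Ident C X) = X"
  and Ident_Cod [simp]: "X \<in> Obj C \<Longrightarrow> Cod C (Ident C X) = X"
  using cat unfolding is_category_def by auto

lemma Comp_Arr [simp]: "\<lbrakk>f \<in> Arr C; g \<in> Arr C; Dom C g = Cod C f\<rbrakk> \<Longrightarrow> g \<cdot>\<^sub>C f \<in> Arr C"
  and Comp_Dom [simp]: "\<lbrakk>f \<in> Arr C; g \<in> Arr C; Dom C g = Cod C f\<rbrakk> \<Longrightarrow> Dom C (g \<cdot>\<^sub>C f) = Dom C f"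
  and Comp_Cod [simp]: "\<lbrakk>f \<in> Arr C; g \<in> Arr C; Dom C g = Cod C f\<rbrakk> \<Longrightarrow> Cod C (g \<cdot>\<^sub>C f) = Cod C g"
  using cat unfolding is_category_def by auto

lemma Comp_Ident_right [simp]: "\<lbrakk>f \<in> Arr C; Dom C f = X\<rbrakk> \<Longrightarrow> f \<cdot>\<^sub>C Ident C X = f"
  and Comp_Ident_left [simp]: "\<lbrakk>f \<in> Arr C; Cod C f = X\<rbrakk> \<Longrightarrow> Ident C X \<cdot>\<^sub>C f = f"
  using cat unfolding is_category_def by auto

lemma Comp_assoc [simp]:
  "\<lbrakk>f \<in> Arr C; g \<in> Arr C; h \<in> Arr C; Dom C g = Cod C f; Dom C h = Cod C g\<rbrakk>
    \<Longrightarrow> (h \<cdot>\<^sub>C g) \<cdot>\<^sub>C f = h \<cdot>\<^sub>C (g \<cdot>\<^sub>C f)"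
  using cat unfolding is_category_def by auto

text \<open>\<open>Comp_assoc\<close> brackets all composites to the right, where the left side of
  \<open>a \<cdot>\<^sub>C b = c\<close> no longer occurs as a subterm; in this form the equation
  still applies under a further arrow \<open>x\<close>.\<close>

lemma reassoc:
  "\<lbrakk>a \<cdot>\<^sub>C b = c; x \<in> Arr C; b \<in> Arr C; a \<in> Arr C; Dom C b = Cod C x; Dom C a = Cod C b\<rbrakk>
    \<Longrightarrow> a \<cdot>\<^sub>C (b \<cdot>\<^sub>C x) = c \<cdot>\<^sub>C x"
  using Comp_assoc by metis

lemma square_comp:
  assumes "f \<cdot>\<^sub>C p = g \<cdot>\<^sub>C q" "f \<in> Arr C" "p \<in> Arr C" "g \<in> Arr C" "q \<in> Arr C" "a \<in> Arr C"
    "Dom C f = Cod C p" "Dom C g = Cod C q" "Dom C p = Cod C a" "Dom C q = Cod C a"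
  shows "f \<cdot>\<^sub>C (p \<cdot>\<^sub>C a) = g \<cdot>\<^sub>C (q \<cdot>\<^sub>C a)"
  using assms Comp_assoc by metis

end

locale fctr =
  fixes C :: "('o, 'm) category" and D :: "('p, 'n) category" and F :: "('o, 'm, 'p, 'n) cfunctor"
  assumes fctr: "is_functor C D F"
begin

sublocale S: cat C using fctr by unfold_locales (simp add: is_functor_def)
sublocale T: cat D using fctr by unfold_locales (simp add: is_functor_def)

lemma FO_Obj [simp]: "X \<in> Obj C \<Longrightarrow> FO F X \<in> Obj D"
  and FM_Arr [simp]: "f \<in> Arr C \<Longrightarrow> FM F f \<in> Arr D"
  and FM_Dom [simp]: "f \<in> Arr C \<Longrightarrow> Dom D (FM F f) = FO F (Dom C f)"
  and FM_Cod [simp]: "f \<in> Arr C \<Longrightarrow> Cod D (FM F f) = FO F (Cod C f)"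
  and FM_Ident [simp]: "X \<in> Obj C \<Longrightarrow> FM F (Ident C X) = Ident D (FO F X)"
  and FM_Comp [simp]:
    "\<lbrakk>f \<in> Arr C; g \<in> Arr C; Dom C g = Cod C f\<rbrakk> \<Longrightarrow> FM F (g \<cdot>\<^sub>C f) = FM F g \<cdot>\<^sub>D FM F f"
  and FM_ext: "FM F \<in> extensional (Arr C)"
  using fctr unfolding is_functor_def by auto

lemma FM_eq: "\<lbrakk>g \<cdot>\<^sub>C f = h; f \<in> Arr C; g \<in> Arr C; Dom C g = Cod C f\<rbrakk> \<Longrightarrow> FM F g \<cdot>\<^sub>D FM F f = FM F h"
  by (simp flip: FM_Comp)

lemma FM_eq_assoc:
  "\<lbrakk>g \<cdot>\<^sub>C f = h; f \<in> Arr C; g \<in> Arr C; Dom C g = Cod C f; x \<in> Arr D; Cod D x = FO F (Dom C f)\<rbrakk>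
    \<Longrightarrow> FM F g \<cdot>\<^sub>D (FM F f \<cdot>\<^sub>D x) = FM F h \<cdot>\<^sub>D x"
  by (rule T.reassoc[OF FM_eq]) simp_all

lemma FM_square:
  "\<lbrakk>g \<cdot>\<^sub>C f = k \<cdot>\<^sub>C h; f \<in> Arr C; g \<in> Arr C; h \<in> Arr C; k \<in> Arr C; Dom C g = Cod C f; Dom C k = Cod C h\<rbrakk>
    \<Longrightarrow> FM F g \<cdot>\<^sub>D FM F f = FM F k \<cdot>\<^sub>D FM F h"
  by (simp flip: FM_Comp)

lemma FM_square_assoc:
  "\<lbrakk>g \<cdot>\<^sub>C f = k \<cdot>\<^sub>C h; f \<in> Arr C; g \<in> Arr C; h \<in> Arr C; k \<in> Arr C; Dom C g = Cod C f; Dom C k = Cod C h;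
     x \<in> Arr D; Cod D x = FO F (Dom C f); Dom C f = Dom C h\<rbrakk>
    \<Longrightarrow> FM F g \<cdot>\<^sub>D (FM F f \<cdot>\<^sub>D x) = FM F k \<cdot>\<^sub>D (FM F h \<cdot>\<^sub>D x)"
  by (rule T.square_comp[OF FM_square]) simp_all

end

lemma comp_functor_FO [simp]: "X \<in> Obj C \<Longrightarrow> FO (comp_functor C G F) X = FO G (FO F X)"
  and comp_functor_FM [simp]: "f \<in> Arr C \<Longrightarrow> FM (comp_functor C G F) f = FM G (FM F f)"
  by (simp_all add: comp_functor_def compose_eq)

lemma is_functor_comp:
  assumes "is_functor C D F" "is_functor D E G"
  shows "is_functor C E (comp_functor C G F)"
proof -
  interpret F: fctr C D F by unfold_locales fact
  interpret G: fctr D E G by unfold_locales fact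
  show ?thesis unfolding is_functor_def
    using F.S.cat G.T.cat by (auto simp: comp_functor_def compose_eq)
qed

lemma is_functor_inclusion:
  assumes "is_category C" "is_category E" "Obj C \<subseteq> Obj E" "Arr C \<subseteq> Arr E"
    "Dom C = Dom E" "Cod C = Cod E" "Ident C = Ident E" "Comp C = Comp E"
  shows "is_functor C E (inclusion_functor C)"
proof -
  interpret C: cat C by unfold_locales fact
  have "X \<in> Obj C \<Longrightarrow> Ident E X \<in> Arr C" for X using C.Ident_Arr assms by metis
  moreover have "Comp E g f \<in> Arr C" if "f \<in> Arr C" "g \<in> Arr C" "Cod E f = Dom E g" for f g
    using C.Comp_Arr[of f g] that assms by simp
  ultimately show ?thesis
    using assms C.Dom_Obj C.Cod_Obj unfolding is_functor_def inclusion_functor_def by auto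
qed

lemma inclusion_FO [simp]: "X \<in> Obj C \<Longrightarrow> FO (inclusion_functor C) X = X"
  and inclusion_FM [simp]: "f \<in> Arr C \<Longrightarrow> FM (inclusion_functor C) f = f"
  by (simp_all add: inclusion_functor_def)

section \<open>Finite limits from pullbacks and a terminal object\<close>

definition is_terminal :: "('o, 'm) category \<Rightarrow> 'o \<Rightarrow> bool" where
  "is_terminal C T \<longleftrightarrow> T \<in> Obj C \<and> (\<forall>X\<in>Obj C. \<exists>!u. in_hom C u X T)"

definition is_product :: "('o, 'm) category \<Rightarrow> 'o \<Rightarrow> 'o \<Rightarrow> 'm \<Rightarrow> 'm \<Rightarrow> bool" where
  "is_product C X Y p q \<longleftrightarrow> p \<in> Arr C \<and> q \<in> Arr C \<and> Dom C p = Dom C q \<and> Cod C p = X \<and> Cod C q = Y \<and>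
     (\<forall>a b. a \<in> Arr C \<and> b \<in> Arr C \<and> Dom C a = Dom C b \<and> Cod C a = X \<and> Cod C b = Y \<longrightarrow>
        (\<exists>!u. in_hom C u (Dom C a) (Dom C p) \<and> p \<cdot>\<^sub>C u = a \<and> q \<cdot>\<^sub>C u = b))"

definition is_equalizer :: "('o, 'm) category \<Rightarrow> 'm \<Rightarrow> 'm \<Rightarrow> 'm \<Rightarrow> bool" where
  "is_equalizer C f g e \<longleftrightarrow> f \<in> Arr C \<and> g \<in> Arr C \<and> e \<in> Arr C \<and> Dom C f = Dom C g \<and> Cod C f = Cod C g \<and>
     Cod C e = Dom C f \<and> f \<cdot>\<^sub>C e = g \<cdot>\<^sub>C e \<and>
     (\<forall>a. a \<in> Arr C \<and> Cod C a = Dom C f \<and> f \<cdot>\<^sub>C a = g \<cdot>\<^sub>C a \<longrightarrow>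
        (\<exists>!u. in_hom C u (Dom C a) (Dom C e) \<and> e \<cdot>\<^sub>C u = a))"

text \<open>A relation given by its two legs rather than by a monomorphism into a product, so that
  no product has to be chosen.\<close>

definition jointly_monic :: "('o, 'm) category \<Rightarrow> 'm \<Rightarrow> 'm \<Rightarrow> bool" where
  "jointly_monic C r s \<longleftrightarrow> r \<in> Arr C \<and> s \<in> Arr C \<and> Dom C r = Dom C s \<and>
     (\<forall>f\<in>Arr C. \<forall>g\<in>Arr C. Dom C f = Dom C g \<and> Cod C f = Dom C r \<and> Cod C g = Dom C r \<and>
        r \<cdot>\<^sub>C f = r \<cdot>\<^sub>C g \<and> s \<cdot>\<^sub>C f = s \<cdot>\<^sub>C g \<longrightarrow> f = g)"

definition has_pullbacks :: "('o, 'm) category \<Rightarrow> bool" where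
  "has_pullbacks C \<longleftrightarrow> (\<forall>f\<in>Arr C. \<forall>g\<in>Arr C. Cod C f = Cod C g \<longrightarrow> (\<exists>p q. is_pullback C f g p q))"

definition preserves_pullbacks ::
  "('o, 'm) category \<Rightarrow> ('p, 'n) category \<Rightarrow> ('o, 'm, 'p, 'n) cfunctor \<Rightarrow> bool" where
  "preserves_pullbacks C D F \<longleftrightarrow>
     (\<forall>f g p q. is_pullback C f g p q \<longrightarrow> is_pullback D (FM F f) (FM F g) (FM F p) (FM F q))"

definition preserves_terminal ::
  "('o, 'm) category \<Rightarrow> ('p, 'n) category \<Rightarrow> ('o, 'm, 'p, 'n) cfunctor \<Rightarrow> bool" where
  "preserves_terminal C D F \<longleftrightarrow> (\<forall>T. is_terminal C T \<longrightarrow> is_terminal D (FO F T))"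

lemma pullback_square:
  assumes "is_pullback C f g p q"
  shows "f \<in> Arr C" "g \<in> Arr C" "p \<in> Arr C" "q \<in> Arr C" "Cod C g = Cod C f" "Dom C q = Dom C p"
    "Cod C p = Dom C f" "Cod C q = Dom C g" "f \<cdot>\<^sub>C p = g \<cdot>\<^sub>C q"
  using assms unfolding is_pullback_def by auto

lemma pullback_ex1:
  assumes "is_pullback C f g p q" "a \<in> Arr C" "b \<in> Arr C" "Dom C a = Dom C b" "Cod C a = Dom C f"
    "Cod C b = Dom C g" "f \<cdot>\<^sub>C a = g \<cdot>\<^sub>C b"
  shows "\<exists>!u. in_hom C u (Dom C a) (Dom C p) \<and> p \<cdot>\<^sub>C u = a \<and> q \<cdot>\<^sub>C u = b"
  using assms unfolding is_pullback_def by blast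

lemma pullback_lift:
  assumes "is_pullback C f g p q" "a \<in> Arr C" "b \<in> Arr C" "Dom C a = Dom C b" "Cod C a = Dom C f"
    "Cod C b = Dom C g" "f \<cdot>\<^sub>C a = g \<cdot>\<^sub>C b"
  obtains u where "u \<in> Arr C" "Dom C u = Dom C a" "Cod C u = Dom C p" "p \<cdot>\<^sub>C u = a" "q \<cdot>\<^sub>C u = b"
proof -
  have "\<exists>u. in_hom C u (Dom C a) (Dom C p) \<and> p \<cdot>\<^sub>C u = a \<and> q \<cdot>\<^sub>C u = b"
    using pullback_ex1[OF assms] by blast
  then show ?thesis using that by auto
qed

lemma equalizer_square:
  assumes "is_equalizer C f g e"
  shows "f \<in> Arr C" "g \<in> Arr C" "e \<in> Arr C" "Dom C g = Dom C f" "Cod C g = Cod C f"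
    "Cod C e = Dom C f" "f \<cdot>\<^sub>C e = g \<cdot>\<^sub>C e"
  using assms unfolding is_equalizer_def by auto

lemma product_square:
  assumes "is_product C X Y p q"
  shows "p \<in> Arr C" "q \<in> Arr C" "Dom C q = Dom C p" "Cod C p = X" "Cod C q = Y"
  using assms unfolding is_product_def by auto

lemma jointly_monicD:
  assumes "jointly_monic C r s" "f \<in> Arr C" "g \<in> Arr C" "Dom C f = Dom C g" "Cod C f = Dom C r"
    "Cod C g = Dom C r" "r \<cdot>\<^sub>C f = r \<cdot>\<^sub>C g" "s \<cdot>\<^sub>C f = s \<cdot>\<^sub>C g"
  shows "f = g"
  using assms unfolding jointly_monic_def by blast

lemma is_monoD:
  assumes "is_mono C m" "f \<in> Arr C" "g \<in> Arr C" "Dom C f = Dom C g" "Cod C f = Dom C m"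
    "Cod C g = Dom C m" "m \<cdot>\<^sub>C f = m \<cdot>\<^sub>C g"
  shows "f = g"
  using assms unfolding is_mono_def by blast

lemma is_mono_Arr [dest]: "is_mono C m \<Longrightarrow> m \<in> Arr C"
  by (simp add: is_mono_def)

section \<open>Pullbacks, products and equalizers in a category\<close>

context cat
begin

lemma pullback_jointly_monic:
  assumes "is_pullback C f g p q"
  shows "jointly_monic C p q"
  unfolding jointly_monic_def
proof (intro conjI ballI impI)
  show "p \<in> Arr C" "q \<in> Arr C" "Dom C p = Dom C q" using pullback_square[OF assms] by auto
  fix h k assume hk: "h \<in> Arr C" "k \<in> Arr C"
    "Dom C h = Dom C k \<and> Cod C h = Dom C p \<and> Cod C k = Dom C p \<and> p \<cdot>\<^sub>C h = p \<cdot>\<^sub>C k \<and> q \<cdot>\<^sub>C h = q \<cdot>\<^sub>C k"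
  note sq = pullback_square[OF assms]
  have "f \<cdot>\<^sub>C (p \<cdot>\<^sub>C h) = g \<cdot>\<^sub>C (q \<cdot>\<^sub>C h)"
    by (rule square_comp[OF sq(9)]) (use hk sq in simp_all)
  then have "\<exists>!u. in_hom C u (Dom C (p \<cdot>\<^sub>C h)) (Dom C p) \<and> p \<cdot>\<^sub>C u = p \<cdot>\<^sub>C h \<and> q \<cdot>\<^sub>C u = q \<cdot>\<^sub>C h"
    by (intro pullback_ex1[OF assms]) (use hk sq in simp_all)
  then show "h = k" by (rule ex1_eq) (use hk sq in simp_all)
qed

text \<open>Uniqueness of the mediating arrow is joint monicity of the projections, which is often
  known beforehand, in particular for images of relations under functors; only existence is left to
  check.\<close>

lemma is_pullbackI:
  assumes "f \<in> Arr C" "g \<in> Arr C" "Cod C f = Cod C g" "jointly_monic C p q"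
    "Cod C p = Dom C f" "Cod C q = Dom C g" "f \<cdot>\<^sub>C p = g \<cdot>\<^sub>C q"
    "\<And>a b. \<lbrakk>a \<in> Arr C; b \<in> Arr C; Dom C a = Dom C b; Cod C a = Dom C f; Cod C b = Dom C g;
       f \<cdot>\<^sub>C a = g \<cdot>\<^sub>C b\<rbrakk> \<Longrightarrow> \<exists>u. in_hom C u (Dom C a) (Dom C p) \<and> p \<cdot>\<^sub>C u = a \<and> q \<cdot>\<^sub>C u = b"
  shows "is_pullback C f g p q"
  unfolding is_pullback_def
proof (intro conjI allI impI)
  show "p \<in> Arr C" "q \<in> Arr C" "Dom C p = Dom C q" using assms(4) by (auto simp: jointly_monic_def)
  fix a b assume ab: "a \<in> Arr C \<and> b \<in> Arr C \<and> Dom C a = Dom C b \<and> Cod C a = Dom C f \<and>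
    Cod C b = Dom C g \<and> f \<cdot>\<^sub>C a = g \<cdot>\<^sub>C b"
  show "\<exists>!u. in_hom C u (Dom C a) (Dom C p) \<and> p \<cdot>\<^sub>C u = a \<and> q \<cdot>\<^sub>C u = b"
  proof (rule ex_ex1I)
    show "\<exists>u. in_hom C u (Dom C a) (Dom C p) \<and> p \<cdot>\<^sub>C u = a \<and> q \<cdot>\<^sub>C u = b"
      using assms(8) ab by blast
    show "u = v" if "in_hom C u (Dom C a) (Dom C p) \<and> p \<cdot>\<^sub>C u = a \<and> q \<cdot>\<^sub>C u = b"
      "in_hom C v (Dom C a) (Dom C p) \<and> p \<cdot>\<^sub>C v = a \<and> q \<cdot>\<^sub>C v = b" for u v
      using jointly_monicD[OF assms(4), of u v] that by auto
  qed
qed (use assms in auto)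

lemma pullback_swap:
  assumes "is_pullback C f g p q" shows "is_pullback C g f q p"
proof (rule is_pullbackI)
  note sq = pullback_square[OF assms]
  show "jointly_monic C q p"
    using pullback_jointly_monic[OF assms] unfolding jointly_monic_def by auto
  show "\<exists>u. in_hom C u (Dom C a) (Dom C q) \<and> q \<cdot>\<^sub>C u = a \<and> p \<cdot>\<^sub>C u = b"
    if "a \<in> Arr C" "b \<in> Arr C" "Dom C a = Dom C b" "Cod C a = Dom C g" "Cod C b = Dom C f"
       "g \<cdot>\<^sub>C a = f \<cdot>\<^sub>C b" for a b
    using pullback_lift[OF assms, of b a] that sq by (metis in_hom_def)
qed (use pullback_square[OF assms] in auto)

lemma pullback_mono:
  assumes "is_pullback C f m p q" "is_mono C m"
  shows "is_mono C p"
  unfolding is_mono_def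
proof (intro conjI ballI impI)
  note sq = pullback_square[OF assms(1)]
  show "p \<in> Arr C" by (rule sq)
  fix h k assume hk: "h \<in> Arr C" "k \<in> Arr C"
    "Dom C h = Dom C k \<and> Cod C h = Dom C p \<and> Cod C k = Dom C p \<and> p \<cdot>\<^sub>C h = p \<cdot>\<^sub>C k"
  have "m \<cdot>\<^sub>C (q \<cdot>\<^sub>C h) = m \<cdot>\<^sub>C (q \<cdot>\<^sub>C k)"
    using square_comp[OF sq(9), of h] square_comp[OF sq(9), of k] hk sq by simp
  then have "q \<cdot>\<^sub>C h = q \<cdot>\<^sub>C k" using is_monoD[OF assms(2)] hk sq by simp
  then show "h = k" using jointly_monicD[OF pullback_jointly_monic[OF assms(1)]] hk by blast
qed

lemma terminal_unique:
  assumes "is_terminal C T" "u \<in> Arr C" "v \<in> Arr C" "Dom C u = Dom C v" "Cod C u = T" "Cod C v = T"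
  shows "u = v"
proof -
  have "\<exists>!w. in_hom C w (Dom C u) T" using assms unfolding is_terminal_def by simp
  then show ?thesis by (rule ex1_eq) (use assms in simp_all)
qed

lemma terminal_ex:
  assumes "is_terminal C T" "X \<in> Obj C"
  obtains t where "t \<in> Arr C" "Dom C t = X" "Cod C t = T"
  using assms unfolding is_terminal_def by auto

lemma product_of_pullback:
  assumes "is_terminal C T" "is_pullback C f g p q" "Cod C f = T"
  shows "is_product C (Dom C f) (Dom C g) p q"
proof -
  note sq = pullback_square[OF assms(2)]
  have "f \<cdot>\<^sub>C a = g \<cdot>\<^sub>C b" if "a \<in> Arr C" "b \<in> Arr C" "Dom C a = Dom C b" "Cod C a = Dom C f" "Cod C b = Dom C g" for a b
    using terminal_unique[OF assms(1)] that sq assms(3) by simp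
  then show ?thesis using assms(2) sq unfolding is_product_def is_pullback_def by auto
qed

lemma product_ex1:
  assumes "is_product C X Y p q" "a \<in> Arr C" "b \<in> Arr C" "Dom C a = Dom C b" "Cod C a = X" "Cod C b = Y"
  shows "\<exists>!u. in_hom C u (Dom C a) (Dom C p) \<and> p \<cdot>\<^sub>C u = a \<and> q \<cdot>\<^sub>C u = b"
  using assms unfolding is_product_def by blast

lemma product_lift:
  assumes "is_product C X Y p q" "a \<in> Arr C" "b \<in> Arr C" "Dom C a = Dom C b" "Cod C a = X" "Cod C b = Y"
  obtains u where "u \<in> Arr C" "Dom C u = Dom C a" "Cod C u = Dom C p" "p \<cdot>\<^sub>C u = a" "q \<cdot>\<^sub>C u = b"
proof -
  have "\<exists>u. in_hom C u (Dom C a) (Dom C p) \<and> p \<cdot>\<^sub>C u = a \<and> q \<cdot>\<^sub>C u = b"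
    using product_ex1[OF assms] by blast
  then show ?thesis using that by auto
qed

lemma product_unique:
  assumes "is_product C X Y p q" "u \<in> Arr C" "v \<in> Arr C" "Dom C u = Dom C v" "Cod C u = Dom C p" "Cod C v = Dom C p"
    "p \<cdot>\<^sub>C u = p \<cdot>\<^sub>C v" "q \<cdot>\<^sub>C u = q \<cdot>\<^sub>C v"
  shows "u = v"
proof -
  have "\<exists>!w. in_hom C w (Dom C (p \<cdot>\<^sub>C u)) (Dom C p) \<and> p \<cdot>\<^sub>C w = p \<cdot>\<^sub>C u \<and> q \<cdot>\<^sub>C w = q \<cdot>\<^sub>C u"
    by (intro product_ex1[OF assms(1)]) (use assms(2-) product_square[OF assms(1)] in simp_all)
  then show ?thesis by (rule ex1_eq) (use assms(2-) product_square[OF assms(1)] in simp_all)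
qed

lemma equalizer_ex1:
  assumes "is_equalizer C f g e" "a \<in> Arr C" "Cod C a = Dom C f" "f \<cdot>\<^sub>C a = g \<cdot>\<^sub>C a"
  shows "\<exists>!u. in_hom C u (Dom C a) (Dom C e) \<and> e \<cdot>\<^sub>C u = a"
  using assms unfolding is_equalizer_def by blast

lemma equalizer_lift:
  assumes "is_equalizer C f g e" "a \<in> Arr C" "Cod C a = Dom C f" "f \<cdot>\<^sub>C a = g \<cdot>\<^sub>C a"
  obtains u where "u \<in> Arr C" "Dom C u = Dom C a" "Cod C u = Dom C e" "e \<cdot>\<^sub>C u = a"
proof -
  have "\<exists>u. in_hom C u (Dom C a) (Dom C e) \<and> e \<cdot>\<^sub>C u = a"
    using equalizer_ex1[OF assms] by blast
  then show ?thesis using that by auto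
qed

lemma equalizer_mono:
  assumes "is_equalizer C f g e"
  shows "is_mono C e"
  unfolding is_mono_def
proof (intro conjI ballI impI)
  note eq = equalizer_square[OF assms]
  show "e \<in> Arr C" by (rule eq)
  fix h k assume hk: "h \<in> Arr C" "k \<in> Arr C"
    "Dom C h = Dom C k \<and> Cod C h = Dom C e \<and> Cod C k = Dom C e \<and> e \<cdot>\<^sub>C h = e \<cdot>\<^sub>C k"
  have "f \<cdot>\<^sub>C (e \<cdot>\<^sub>C h) = g \<cdot>\<^sub>C (e \<cdot>\<^sub>C h)"
    by (rule square_comp[OF eq(7)]) (use hk eq in simp_all)
  then have "\<exists>!u. in_hom C u (Dom C (e \<cdot>\<^sub>C h)) (Dom C e) \<and> e \<cdot>\<^sub>C u = e \<cdot>\<^sub>C h"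
    by (intro equalizer_ex1[OF assms]) (use hk eq in simp_all)
  then show "h = k" by (rule ex1_eq) (use hk \<open>e \<in> Arr C\<close> in simp_all)
qed

text \<open>The equalizer of \<open>f, g: A \<rightarrow> B\<close> is the intersection of their graphs \<open>m, n: A \<rightarrow> A \<times> B\<close>.\<close>

lemma equalizer_of_pullback:
  assumes fg: "f \<in> Arr C" "g \<in> Arr C" "Dom C f = Dom C g" "Cod C f = Cod C g"
    and pr: "is_product C (Dom C f) (Cod C f) p q"
    and m: "m \<in> Arr C" "Dom C m = Dom C f" "Cod C m = Dom C p" "p \<cdot>\<^sub>C m = Ident C (Dom C f)" "q \<cdot>\<^sub>C m = f"
    and n: "n \<in> Arr C" "Dom C n = Dom C f" "Cod C n = Dom C p" "p \<cdot>\<^sub>C n = Ident C (Dom C f)" "q \<cdot>\<^sub>C n = g"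
    and pb: "is_pullback C m n h k"
  shows "is_equalizer C f g h"
proof -
  note sq = pullback_square[OF pb]
  note pq = product_square[OF pr]
  have pm: "p \<cdot>\<^sub>C (m \<cdot>\<^sub>C a) = a" "q \<cdot>\<^sub>C (m \<cdot>\<^sub>C a) = f \<cdot>\<^sub>C a"
    "p \<cdot>\<^sub>C (n \<cdot>\<^sub>C a) = a" "q \<cdot>\<^sub>C (n \<cdot>\<^sub>C a) = g \<cdot>\<^sub>C a"
    if "a \<in> Arr C" "Cod C a = Dom C f" for a
    using that m n pq fg by (simp_all add: reassoc[OF m(4)] reassoc[OF m(5)] reassoc[OF n(4)] reassoc[OF n(5)])
  \<comment> \<open>Both graphs have the identity as first component, so the two projections of
    their intersection coincide.\<close>
  have "h = p \<cdot>\<^sub>C (m \<cdot>\<^sub>C h)" using pm(1)[of h] sq m by metis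
  also have "\<dots> = k" using pm(3)[of k] sq n by metis
  finally have hk: "h = k" .
  have eq: "f \<cdot>\<^sub>C h = g \<cdot>\<^sub>C h" using pm(2)[of h] pm(4)[of k] hk sq m by simp
  have "\<exists>!u. in_hom C u (Dom C a) (Dom C h) \<and> h \<cdot>\<^sub>C u = a"
    if a: "a \<in> Arr C" "Cod C a = Dom C f" "f \<cdot>\<^sub>C a = g \<cdot>\<^sub>C a" for a
  proof -
    have "m \<cdot>\<^sub>C a = n \<cdot>\<^sub>C a"
      by (rule product_unique[OF pr]) (use a m n pm in simp_all)
    then show ?thesis using pullback_ex1[OF pb, of a a] a hk m n by simp
  qed
  then show ?thesis using fg sq(3,7) m eq unfolding is_equalizer_def by simp
qed

lemma product_ex:
  assumes "is_terminal C T" "has_pullbacks C" "X \<in> Obj C" "Y \<in> Obj C"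
  obtains p q f g where "is_pullback C f g p q" "Cod C f = T" "Dom C f = X" "Dom C g = Y" "is_product C X Y p q"
proof -
  obtain f where f: "f \<in> Arr C" "Dom C f = X" "Cod C f = T" using terminal_ex[OF assms(1,3)] .
  obtain g where g: "g \<in> Arr C" "Dom C g = Y" "Cod C g = T" using terminal_ex[OF assms(1,4)] .
  from f g obtain p q where pb: "is_pullback C f g p q" using assms(2) unfolding has_pullbacks_def by metis
  show ?thesis by (rule that[OF pb]) (use f g product_of_pullback[OF assms(1) pb] in simp_all)
qed

end

section \<open>Functors that preserve pullbacks and the terminal object\<close>

locale lex = fctr +
  assumes pres_term: "preserves_terminal C D F" and pres_pb: "preserves_pullbacks C D F"
    and has_pb: "has_pullbacks C" and has_term: "\<exists>T. is_terminal C T"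
begin

lemma pullbackF: "is_pullback C f g p q \<Longrightarrow> is_pullback D (FM F f) (FM F g) (FM F p) (FM F q)"
  using pres_pb unfolding preserves_pullbacks_def by blast

lemma terminalF: "is_terminal C T \<Longrightarrow> is_terminal D (FO F T)"
  using pres_term unfolding preserves_terminal_def by blast

text \<open>Here and in \<open>equalizer_pres\<close> and \<open>finite_limit_ex\<close>, some limit
  is exhibited whose image is again a limit; arbitrary limits are reached from it by transport in
  \<open>preserves_finite_limits\<close>.\<close>

lemma product_pres:
  assumes "X \<in> Obj C" "Y \<in> Obj C"
  obtains p q where "is_product C X Y p q" "is_product D (FO F X) (FO F Y) (FM F p) (FM F q)"
proof -
  obtain T where T: "is_terminal C T" using has_term by blast
  obtain f g p q where *: "is_pullback C f g p q" "Cod C f = T" "Dom C f = X" "Dom C g = Y" "is_product C X Y p q"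
    using S.product_ex[OF T has_pb assms] .
  have "is_product D (Dom D (FM F f)) (Dom D (FM F g)) (FM F p) (FM F q)"
    by (rule T.product_of_pullback[OF terminalF[OF T] pullbackF[OF *(1)]])
       (use * pullback_square[OF *(1)] in simp)
  then show ?thesis using that * pullback_square[OF *(1)] by simp
qed

lemma equalizer_pres:
  assumes fg: "f \<in> Arr C" "g \<in> Arr C" "Dom C f = Dom C g" "Cod C f = Cod C g"
  obtains e where "is_equalizer C f g e" "is_equalizer D (FM F f) (FM F g) (FM F e)"
proof -
  obtain p q where pq: "is_product C (Dom C f) (Cod C f) p q"
    "is_product D (FO F (Dom C f)) (FO F (Cod C f)) (FM F p) (FM F q)"
    using product_pres[of "Dom C f" "Cod C f"] fg by auto
  note ar = product_square[OF pq(1)]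
  obtain m where m: "m \<in> Arr C" "Dom C m = Dom C f" "Cod C m = Dom C p" "p \<cdot>\<^sub>C m = Ident C (Dom C f)" "q \<cdot>\<^sub>C m = f"
    using S.product_lift[OF pq(1), of "Ident C (Dom C f)" f] fg by auto
  obtain n where n: "n \<in> Arr C" "Dom C n = Dom C f" "Cod C n = Dom C p" "p \<cdot>\<^sub>C n = Ident C (Dom C f)" "q \<cdot>\<^sub>C n = g"
    using S.product_lift[OF pq(1), of "Ident C (Dom C f)" g] fg by auto
  obtain h k where pb: "is_pullback C m n h k"
    using has_pb m n unfolding has_pullbacks_def by metis
  note sq = pullback_square[OF pb]
  have "is_equalizer C f g h" by (rule S.equalizer_of_pullback[OF fg pq(1) m n pb])
  moreover have "is_equalizer D (FM F f) (FM F g) (FM F h)"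
    by (rule T.equalizer_of_pullback[OF _ _ _ _ _ _ _ _ _ _ _ _ _ _ _ pullbackF[OF pb], of _ _ "FM F p" "FM F q"])
      (use fg pq(2) m n ar in \<open>simp_all flip: FM_Comp\<close>)
  ultimately show ?thesis by (rule that)
qed

text \<open>Joint monicity of \<open>r\<close> and \<open>s\<close> says that the two projections of
  the kernel pair of \<open>r\<close> agree on the equalizer of their composites with
  \<open>s\<close>. This is an equation between arrows out of a finite limit, so it survives
  \<open>F\<close>.\<close>

lemma jointly_monicF:
  assumes "jointly_monic C r s"
  shows "jointly_monic D (FM F r) (FM F s)"
proof -
  have ar: "r \<in> Arr C" "s \<in> Arr C" "Dom C r = Dom C s" using assms by (auto simp: jointly_monic_def)
  obtain a b where pb: "is_pullback C r r a b" using has_pb ar unfolding has_pullbacks_def by metis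
  note sq = pullback_square[OF pb]
  obtain e where e: "is_equalizer C (s \<cdot>\<^sub>C a) (s \<cdot>\<^sub>C b) e" "is_equalizer D (FM F (s \<cdot>\<^sub>C a)) (FM F (s \<cdot>\<^sub>C b)) (FM F e)"
    using equalizer_pres[of "s \<cdot>\<^sub>C a" "s \<cdot>\<^sub>C b"] ar sq by auto
  have ea: "e \<in> Arr C" "Cod C e = Dom C a" "s \<cdot>\<^sub>C (a \<cdot>\<^sub>C e) = s \<cdot>\<^sub>C (b \<cdot>\<^sub>C e)"
    using equalizer_square[OF e(1)] ar sq by auto
  have "a \<cdot>\<^sub>C e = b \<cdot>\<^sub>C e"
    by (rule jointly_monicD[OF assms]) (use ea ar sq S.reassoc[OF sq(9), of e] in simp_all)
  then have ab: "FM F a \<cdot>\<^sub>D FM F e = FM F b \<cdot>\<^sub>D FM F e" using ea sq by (simp flip: FM_Comp)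
  have "f = g" if fg: "f \<in> Arr D" "g \<in> Arr D" "Dom D f = Dom D g" "Cod D f = Dom D (FM F r)" "Cod D g = Dom D (FM F r)"
    "FM F r \<cdot>\<^sub>D f = FM F r \<cdot>\<^sub>D g" "FM F s \<cdot>\<^sub>D f = FM F s \<cdot>\<^sub>D g" for f g
  proof -
    obtain u where u: "u \<in> Arr D" "Dom D u = Dom D f" "Cod D u = Dom D (FM F a)" "FM F a \<cdot>\<^sub>D u = f" "FM F b \<cdot>\<^sub>D u = g"
      using pullback_lift[OF pullbackF[OF pb] fg(1-6)] .
    obtain v where v: "v \<in> Arr D" "Dom D v = Dom D u" "Cod D v = Dom D (FM F e)" "FM F e \<cdot>\<^sub>D v = u"
      using T.equalizer_lift[OF e(2), of u] u ar sq fg by auto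
    have "f = FM F a \<cdot>\<^sub>D (FM F e \<cdot>\<^sub>D v)" using u v by simp
    also have "\<dots> = FM F b \<cdot>\<^sub>D (FM F e \<cdot>\<^sub>D v)" using T.reassoc[OF ab, of v] v ea sq by simp
    finally show ?thesis using u v by simp
  qed
  then show ?thesis unfolding jointly_monic_def using ar by simp
qed

lemma monoF: "is_mono C m \<Longrightarrow> is_mono D (FM F m)"
  using jointly_monicF[of m m] unfolding jointly_monic_def is_mono_def by auto

end

text \<open>Limits of graphs with vertices in \<open>A\<close> and edges in \<open>B\<close>, so that a finite limit can be built by
  adding one vertex or one edge at a time.\<close>

definition graph_limit ::
  "('j, 'k) category \<Rightarrow> ('o, 'm) category \<Rightarrow> ('j, 'k, 'o, 'm) cfunctor \<Rightarrow> 'j set \<Rightarrow> 'k set \<Rightarrow> 'o \<Rightarrow> ('j \<Rightarrow> 'm) \<Rightarrow> bool"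
  where
  "graph_limit J C G A B X p \<longleftrightarrow> X \<in> Obj C \<and> (\<forall>j\<in>A. in_hom C (p j) X (FO G j)) \<and>
     (\<forall>a\<in>B. FM G a \<cdot>\<^sub>C p (Dom J a) = p (Cod J a)) \<and>
     (\<forall>Y q. Y \<in> Obj C \<and> (\<forall>j\<in>A. in_hom C (q j) Y (FO G j)) \<and> (\<forall>a\<in>B. FM G a \<cdot>\<^sub>C q (Dom J a) = q (Cod J a)) \<longrightarrow>
        (\<exists>!u. in_hom C u Y X \<and> (\<forall>j\<in>A. p j \<cdot>\<^sub>C u = q j)))"

lemma is_limit_graph_limit: "is_limit J C G X p \<longleftrightarrow> graph_limit J C G (Obj J) (Arr J) X p"
  by (simp add: is_limit_def is_cone_def graph_limit_def)

lemma graph_limit_cone: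
  assumes "graph_limit J C G A B X p"
  shows "X \<in> Obj C" "\<And>j. j \<in> A \<Longrightarrow> p j \<in> Arr C" "\<And>j. j \<in> A \<Longrightarrow> Dom C (p j) = X"
    "\<And>j. j \<in> A \<Longrightarrow> Cod C (p j) = FO G j" "\<And>a. a \<in> B \<Longrightarrow> FM G a \<cdot>\<^sub>C p (Dom J a) = p (Cod J a)"
  using assms unfolding graph_limit_def by auto

lemma graph_limit_ex1:
  assumes "graph_limit J C G A B X p" "Y \<in> Obj C" "\<And>j. j \<in> A \<Longrightarrow> in_hom C (q j) Y (FO G j)"
    "\<And>a. a \<in> B \<Longrightarrow> FM G a \<cdot>\<^sub>C q (Dom J a) = q (Cod J a)"
  shows "\<exists>!u. in_hom C u Y X \<and> (\<forall>j\<in>A. p j \<cdot>\<^sub>C u = q j)"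
  by (rule assms(1)[unfolded graph_limit_def, THEN conjunct2, THEN conjunct2, THEN conjunct2,
        THEN spec[of _ Y], THEN spec[of _ q], THEN mp]) (use assms in blast)

lemma graph_limit_lift:
  assumes "graph_limit J C G A B X p" "Y \<in> Obj C" "\<And>j. j \<in> A \<Longrightarrow> in_hom C (q j) Y (FO G j)"
    "\<And>a. a \<in> B \<Longrightarrow> FM G a \<cdot>\<^sub>C q (Dom J a) = q (Cod J a)"
  obtains u where "u \<in> Arr C" "Dom C u = Y" "Cod C u = X" "\<And>j. j \<in> A \<Longrightarrow> p j \<cdot>\<^sub>C u = q j"
proof -
  have "\<exists>u. in_hom C u Y X \<and> (\<forall>j\<in>A. p j \<cdot>\<^sub>C u = q j)"
    using graph_limit_ex1[OF assms] by blast
  then show ?thesis using that by auto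
qed

context cat
begin

lemma graph_limit_unique:
  assumes "graph_limit J C G A B X p" "u \<in> Arr C" "v \<in> Arr C" "Dom C u = Dom C v" "Cod C u = X" "Cod C v = X"
    "\<And>j. j \<in> A \<Longrightarrow> p j \<cdot>\<^sub>C u = p j \<cdot>\<^sub>C v" "\<And>a. a \<in> B \<Longrightarrow> Dom J a \<in> A" "\<And>a. a \<in> B \<Longrightarrow> Cod J a \<in> A"
    "\<And>a. a \<in> B \<Longrightarrow> FM G a \<in> Arr C" "\<And>a. a \<in> B \<Longrightarrow> Dom C (FM G a) = FO G (Dom J a)"
  shows "u = v"
proof -
  note lim = graph_limit_cone[OF assms(1)]
  have "\<exists>!w. in_hom C w (Dom C u) X \<and> (\<forall>j\<in>A. p j \<cdot>\<^sub>C w = p j \<cdot>\<^sub>C u)"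
  proof (rule graph_limit_ex1[OF assms(1)])
    show "Dom C u \<in> Obj C" using assms by simp
    show "in_hom C (p j \<cdot>\<^sub>C u) (Dom C u) (FO G j)" if "j \<in> A" for j
      using that assms(2,5) lim(2-4)[OF that] by simp
    show "FM G a \<cdot>\<^sub>C (p (Dom J a) \<cdot>\<^sub>C u) = p (Cod J a) \<cdot>\<^sub>C u" if "a \<in> B" for a
      by (rule reassoc[OF lim(5)[OF that]]) (use that assms(2,5,8-) lim in simp_all)
  qed
  then show ?thesis by (rule ex1_eq) (use assms(2-7) in simp_all)
qed

lemma graph_limit_empty: "is_terminal C T \<Longrightarrow> graph_limit J C G {} {} T p"
  unfolding graph_limit_def is_terminal_def by simp

text \<open>An isolated vertex multiplies the limit by the value there.\<close>

lemma graph_limit_insert_vertex: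
  assumes "graph_limit J C G A {} X p" "is_product C X (FO G k) r s"
    "\<And>j. j \<in> A \<Longrightarrow> p' j = p j \<cdot>\<^sub>C r" "p' k = s"
  shows "graph_limit J C G (insert k A) {} (Dom C r) p'"
  unfolding graph_limit_def
proof (intro conjI allI impI)
  note lim = graph_limit_cone[OF assms(1)] and pr = product_square[OF assms(2)]
  show "Dom C r \<in> Obj C" using pr by simp
  show "\<forall>j\<in>insert k A. in_hom C (p' j) (Dom C r) (FO G j)"
    using assms(3,4) lim pr by simp
  fix Y q assume "Y \<in> Obj C \<and> (\<forall>j\<in>insert k A. in_hom C (q j) Y (FO G j)) \<and> (\<forall>a\<in>{}. FM G a \<cdot>\<^sub>C q (Dom J a) = q (Cod J a))"
  then have Y: "Y \<in> Obj C" and q: "\<And>j. j \<in> insert k A \<Longrightarrow> in_hom C (q j) Y (FO G j)" by blast+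
  show "\<exists>!u. in_hom C u Y (Dom C r) \<and> (\<forall>j\<in>insert k A. p' j \<cdot>\<^sub>C u = q j)"
  proof (rule ex_ex1I)
    obtain u where u: "u \<in> Arr C" "Dom C u = Y" "Cod C u = X" "\<And>j. j \<in> A \<Longrightarrow> p j \<cdot>\<^sub>C u = q j"
      by (rule graph_limit_lift[OF assms(1) Y, of q]) (use q in auto)
    obtain v where v: "v \<in> Arr C" "Dom C v = Dom C u" "Cod C v = Dom C r" "r \<cdot>\<^sub>C v = u" "s \<cdot>\<^sub>C v = q k"
      by (rule product_lift[OF assms(2) u(1), of "q k"]) (use q[of k] u in auto)
    have "p' j \<cdot>\<^sub>C v = q j" if "j \<in> A" for j
      using that assms(3) lim(2-4)[OF that] pr u v by simp
    then have "in_hom C v Y (Dom C r) \<and> (\<forall>j\<in>insert k A. p' j \<cdot>\<^sub>C v = q j)"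
      using u v assms(4) by simp
    then show "\<exists>u. in_hom C u Y (Dom C r) \<and> (\<forall>j\<in>insert k A. p' j \<cdot>\<^sub>C u = q j)" by blast
    fix u v assume "in_hom C u Y (Dom C r) \<and> (\<forall>j\<in>insert k A. p' j \<cdot>\<^sub>C u = q j)"
      "in_hom C v Y (Dom C r) \<and> (\<forall>j\<in>insert k A. p' j \<cdot>\<^sub>C v = q j)"
    then have u: "u \<in> Arr C" "Dom C u = Y" "Cod C u = Dom C r" "s \<cdot>\<^sub>C u = q k"
      and v: "v \<in> Arr C" "Dom C v = Y" "Cod C v = Dom C r" "s \<cdot>\<^sub>C v = q k"
      and uv: "\<And>j. j \<in> A \<Longrightarrow> p' j \<cdot>\<^sub>C u = p' j \<cdot>\<^sub>C v" using assms(4) by auto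
    have "r \<cdot>\<^sub>C u = r \<cdot>\<^sub>C v"
      by (rule graph_limit_unique[OF assms(1)]) (use uv u v pr lim assms(3) in auto)
    then show "u = v" using product_unique[OF assms(2), of u v] u v by simp
  qed
qed simp

text \<open>A new edge imposes one equation, which cuts out an equalizer.\<close>

lemma graph_limit_insert_edge:
  assumes "graph_limit J C G A B X p" "is_equalizer C (FM G a \<cdot>\<^sub>C p (Dom J a)) (p (Cod J a)) e"
    "\<And>j. j \<in> A \<Longrightarrow> p' j = p j \<cdot>\<^sub>C e" and G: "is_functor J C G" and B: "insert a B \<subseteq> Arr J"
    and A: "\<And>b. b \<in> insert a B \<Longrightarrow> Dom J b \<in> A" "\<And>b. b \<in> insert a B \<Longrightarrow> Cod J b \<in> A"
  shows "graph_limit J C G A (insert a B) (Dom C e) p'"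
proof -
  interpret G: fctr J C G by unfold_locales fact
  note lim = graph_limit_cone[OF assms(1)] and eq = equalizer_square[OF assms(2)]
  have GA: "FM G b \<in> Arr C" "Dom C (FM G b) = FO G (Dom J b)" "Cod C (FM G b) = FO G (Cod J b)"
    if "b \<in> insert a B" for b using that B by auto
  have a: "Dom J a \<in> A" "Cod J a \<in> A" using A by auto
  have e: "e \<in> Arr C" "Cod C e = X" using eq lim a GA[of a] by auto
  show ?thesis unfolding graph_limit_def
  proof (intro conjI allI impI)
    show "Dom C e \<in> Obj C" using e by simp
    show "\<forall>j\<in>A. in_hom C (p' j) (Dom C e) (FO G j)" using assms(3) lim e by simp
    show "\<forall>b\<in>insert a B. FM G b \<cdot>\<^sub>C p' (Dom J b) = p' (Cod J b)"
    proof
      fix b assume b: "b \<in> insert a B"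
      have "FM G b \<cdot>\<^sub>C (p (Dom J b) \<cdot>\<^sub>C e) = p (Cod J b) \<cdot>\<^sub>C e"
      proof (cases "b = a")
        case True then show ?thesis using eq(7) lim a GA[of a] e by simp
      next
        case False
        then show ?thesis using b by (intro reassoc[OF lim(5)]) (use b A GA[OF b] lim e in auto)
      qed
      then show "FM G b \<cdot>\<^sub>C p' (Dom J b) = p' (Cod J b)" using A b assms(3) by simp
    qed
    fix Y q assume *: "Y \<in> Obj C \<and> (\<forall>j\<in>A. in_hom C (q j) Y (FO G j)) \<and>
      (\<forall>a\<in>insert a B. FM G a \<cdot>\<^sub>C q (Dom J a) = q (Cod J a))"
    then have Y: "Y \<in> Obj C" and q: "\<And>j. j \<in> A \<Longrightarrow> in_hom C (q j) Y (FO G j)"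
      and qa: "FM G a \<cdot>\<^sub>C q (Dom J a) = q (Cod J a)" and qB: "\<And>b. b \<in> B \<Longrightarrow> FM G b \<cdot>\<^sub>C q (Dom J b) = q (Cod J b)" by blast+
    show "\<exists>!u. in_hom C u Y (Dom C e) \<and> (\<forall>j\<in>A. p' j \<cdot>\<^sub>C u = q j)"
    proof (rule ex_ex1I)
      obtain u where u: "u \<in> Arr C" "Dom C u = Y" "Cod C u = X" "\<And>j. j \<in> A \<Longrightarrow> p j \<cdot>\<^sub>C u = q j"
        using graph_limit_lift[OF assms(1) Y, of q] q qB by blast
      have "(FM G a \<cdot>\<^sub>C p (Dom J a)) \<cdot>\<^sub>C u = p (Cod J a) \<cdot>\<^sub>C u"
        using u a lim GA[of a] qa by simp
      then obtain v where v: "v \<in> Arr C" "Dom C v = Dom C u" "Cod C v = Dom C e" "e \<cdot>\<^sub>C v = u"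
        using equalizer_lift[OF assms(2), of u] u lim a GA[of a] by auto
      then have "in_hom C v Y (Dom C e) \<and> (\<forall>j\<in>A. p' j \<cdot>\<^sub>C v = q j)"
        using u assms(3) lim e by simp
      then show "\<exists>u. in_hom C u Y (Dom C e) \<and> (\<forall>j\<in>A. p' j \<cdot>\<^sub>C u = q j)" by blast
      fix u v assume "in_hom C u Y (Dom C e) \<and> (\<forall>j\<in>A. p' j \<cdot>\<^sub>C u = q j)"
        "in_hom C v Y (Dom C e) \<and> (\<forall>j\<in>A. p' j \<cdot>\<^sub>C v = q j)"
      then have u: "u \<in> Arr C" "Dom C u = Y" "Cod C u = Dom C e"
        and v: "v \<in> Arr C" "Dom C v = Y" "Cod C v = Dom C e"
        and uv: "\<And>j. j \<in> A \<Longrightarrow> p' j \<cdot>\<^sub>C u = p' j \<cdot>\<^sub>C v" by auto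
      have "e \<cdot>\<^sub>C u = e \<cdot>\<^sub>C v"
        by (rule graph_limit_unique[OF assms(1)]) (use uv u v e lim assms(3) A GA in auto)
      then show "u = v" using is_monoD[OF equalizer_mono[OF assms(2)], of u v] u v by simp
    qed
  qed
qed

lemma limit_transport:
  assumes "is_limit J C G X p" "is_functor J C G" "in_hom C i Y X" "in_hom C k X Y"
    "i \<cdot>\<^sub>C k = Ident C X" "k \<cdot>\<^sub>C i = Ident C Y" "\<And>j. j \<in> Obj J \<Longrightarrow> q j = p j \<cdot>\<^sub>C i"
  shows "is_limit J C G Y q"
proof -
  interpret G: fctr J C G by unfold_locales fact
  note lim0 = assms(1)[unfolded is_limit_graph_limit]
  note lim = graph_limit_cone[OF lim0]
  have ik: "i \<in> Arr C" "Dom C i = Y" "Cod C i = X" "k \<in> Arr C" "Dom C k = X" "Cod C k = Y"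
    using assms by auto
  show ?thesis unfolding is_limit_graph_limit graph_limit_def
  proof (intro conjI allI impI)
    show "Y \<in> Obj C" using ik Dom_Obj by metis
    show "\<forall>j\<in>Obj J. in_hom C (q j) Y (FO G j)" using assms(7) lim ik by simp
    show "\<forall>a\<in>Arr J. FM G a \<cdot>\<^sub>C q (Dom J a) = q (Cod J a)"
      using assms(7) lim ik by (auto intro!: reassoc)
    fix Z r assume "Z \<in> Obj C \<and> (\<forall>j\<in>Obj J. in_hom C (r j) Z (FO G j)) \<and> (\<forall>a\<in>Arr J. FM G a \<cdot>\<^sub>C r (Dom J a) = r (Cod J a))"
    then have Z: "Z \<in> Obj C" and r: "\<And>j. j \<in> Obj J \<Longrightarrow> in_hom C (r j) Z (FO G j)"
      and rB: "\<And>b. b \<in> Arr J \<Longrightarrow> FM G b \<cdot>\<^sub>C r (Dom J b) = r (Cod J b)" by blast+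
    show "\<exists>!u. in_hom C u Z Y \<and> (\<forall>j\<in>Obj J. q j \<cdot>\<^sub>C u = r j)"
    proof (rule ex_ex1I)
      obtain u where u: "u \<in> Arr C" "Dom C u = Z" "Cod C u = X" "\<And>j. j \<in> Obj J \<Longrightarrow> p j \<cdot>\<^sub>C u = r j"
        using graph_limit_lift[OF lim0 Z, of r] r rB by blast
      have "q j \<cdot>\<^sub>C (k \<cdot>\<^sub>C u) = r j" if "j \<in> Obj J" for j
        using that assms(7) u lim ik reassoc[OF assms(5) u(1)] by simp
      then have "in_hom C (k \<cdot>\<^sub>C u) Z Y \<and> (\<forall>j\<in>Obj J. q j \<cdot>\<^sub>C (k \<cdot>\<^sub>C u) = r j)" using u ik by simp
      then show "\<exists>u. in_hom C u Z Y \<and> (\<forall>j\<in>Obj J. q j \<cdot>\<^sub>C u = r j)" by blast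
      fix u v assume "in_hom C u Z Y \<and> (\<forall>j\<in>Obj J. q j \<cdot>\<^sub>C u = r j)" "in_hom C v Z Y \<and> (\<forall>j\<in>Obj J. q j \<cdot>\<^sub>C v = r j)"
      then have u: "u \<in> Arr C" "Dom C u = Z" "Cod C u = Y"
        and v: "v \<in> Arr C" "Dom C v = Z" "Cod C v = Y"
        and uv: "\<And>j. j \<in> Obj J \<Longrightarrow> q j \<cdot>\<^sub>C u = q j \<cdot>\<^sub>C v" by auto
      have "i \<cdot>\<^sub>C u = i \<cdot>\<^sub>C v"
        by (rule graph_limit_unique[OF lim0]) (use uv u v lim ik assms(7) in auto)
      then have "k \<cdot>\<^sub>C (i \<cdot>\<^sub>C u) = k \<cdot>\<^sub>C (i \<cdot>\<^sub>C v)" by simp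
      then show "u = v" using reassoc[OF assms(6), of u] reassoc[OF assms(6), of v] u v ik by simp
    qed
  qed
qed

end

context lex
begin

text \<open>All vertices are added before any edge, so that both ends of an edge are present when
  its equation is imposed. The limit in \<open>C\<close> and its image in \<open>D\<close> grow in
  parallel, by the same preserved product or equalizer.\<close>

lemma finite_limit_ex:
  assumes "finite_category J" "is_functor J C G"
  shows "\<exists>X p. is_limit J C G X p \<and> is_limit J D (comp_functor J F G) (FO F X) (\<lambda>j. FM F (p j))"
proof -
  interpret G: fctr J C G by unfold_locales fact
  interpret FG: fctr J D "comp_functor J F G" using is_functor_comp[OF assms(2) fctr] by unfold_locales
  define P where "P A B \<longleftrightarrow> (\<exists>X p. graph_limit J C G A B X p \<and>
    graph_limit J D (comp_functor J F G) A B (FO F X) (\<lambda>j. FM F (p j)))" for A B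
  have fin: "finite (Obj J)" "finite (Arr J)" using assms(1) by (auto simp: finite_category_def)
  have vert: "P A {}" if "A \<subseteq> Obj J" for A
    using finite_subset[OF that fin(1)] that
  proof (induction A rule: finite_induct)
    case empty
    obtain T where "is_terminal C T" using has_term by blast
    then show ?case unfolding P_def using S.graph_limit_empty T.graph_limit_empty terminalF by blast
  next
    case (insert k A)
    then obtain X p where X: "graph_limit J C G A {} X p"
      "graph_limit J D (comp_functor J F G) A {} (FO F X) (\<lambda>j. FM F (p j))" unfolding P_def by auto
    note lim = graph_limit_cone[OF X(1)]
    have k: "k \<in> Obj J" using insert by simp
    obtain r s where rs: "is_product C X (FO G k) r s" "is_product D (FO F X) (FO F (FO G k)) (FM F r) (FM F s)"
      using product_pres[OF lim(1), of "FO G k"] k by auto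
    note pr = product_square[OF rs(1)]
    let ?p = "\<lambda>j. if j = k then s else p j \<cdot>\<^sub>C r"
    have "graph_limit J C G (insert k A) {} (Dom C r) ?p"
      by (rule S.graph_limit_insert_vertex[OF X(1) rs(1)]) (use insert in auto)
    moreover have "graph_limit J D (comp_functor J F G) (insert k A) {} (Dom D (FM F r)) (\<lambda>j. FM F (?p j))"
      by (rule T.graph_limit_insert_vertex[OF X(2), where r="FM F r" and s="FM F s"])
        (use rs(2) k insert lim pr in auto)
    ultimately show ?case unfolding P_def using pr by auto
  qed
  have "P (Obj J) B" if "B \<subseteq> Arr J" for B
    using finite_subset[OF that fin(2)] that
  proof (induction B rule: finite_induct)
    case empty show ?case by (rule vert) simp
  next
    case (insert a B)
    then obtain X p where X: "graph_limit J C G (Obj J) B X p"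
      "graph_limit J D (comp_functor J F G) (Obj J) B (FO F X) (\<lambda>j. FM F (p j))" unfolding P_def by auto
    note lim = graph_limit_cone[OF X(1)]
    have a: "a \<in> Arr J" using insert by simp
    obtain e where e: "is_equalizer C (FM G a \<cdot>\<^sub>C p (Dom J a)) (p (Cod J a)) e"
      "is_equalizer D (FM F (FM G a \<cdot>\<^sub>C p (Dom J a))) (FM F (p (Cod J a))) (FM F e)"
      using equalizer_pres[of "FM G a \<cdot>\<^sub>C p (Dom J a)" "p (Cod J a)"] lim a by auto
    note eq = equalizer_square[OF e(1)]
    have ar: "e \<in> Arr C" "Cod C e = X" using eq lim a by auto
    have "graph_limit J C G (Obj J) (insert a B) (Dom C e) (\<lambda>j. p j \<cdot>\<^sub>C e)"
      by (rule S.graph_limit_insert_edge[OF X(1) e(1) _ assms(2)]) (use insert in auto)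
    moreover have "graph_limit J D (comp_functor J F G) (Obj J) (insert a B) (Dom D (FM F e)) (\<lambda>j. FM F (p j \<cdot>\<^sub>C e))"
      by (rule T.graph_limit_insert_edge[OF X(2), where e="FM F e"]) (use e(2) a insert lim ar FG.fctr in auto)
    ultimately show ?case unfolding P_def using ar by auto
  qed
  from this[of "Arr J"] show ?thesis unfolding P_def is_limit_graph_limit by simp
qed

text \<open>The given limit is isomorphic to the one constructed in \<open>finite_limit_ex\<close>;
  the image of this isomorphism transports the limit property in \<open>D\<close>.\<close>

lemma preserves_finite_limits: "preserves_finite_limits C D F"
  unfolding preserves_finite_limits_def
proof (intro allI impI)
  fix J :: "(nat, nat) category" and G X p
  assume *: "finite_category J \<and> is_functor J C G \<and> is_limit J C G X p"
  then have J: "finite_category J" and G: "is_functor J C G" and X: "is_limit J C G X p" by auto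
  interpret G: fctr J C G by unfold_locales fact
  obtain X' p' where X': "is_limit J C G X' p'"
    "is_limit J D (comp_functor J F G) (FO F X') (\<lambda>j. FM F (p' j))" using finite_limit_ex[OF J G] by blast
  note l = X[unfolded is_limit_graph_limit] and l' = X'(1)[unfolded is_limit_graph_limit]
  note lim = graph_limit_cone[OF l] and lim' = graph_limit_cone[OF l']
  obtain i where i: "i \<in> Arr C" "Dom C i = X" "Cod C i = X'" "\<And>j. j \<in> Obj J \<Longrightarrow> p' j \<cdot>\<^sub>C i = p j"
    by (rule graph_limit_lift[OF l' lim(1), of p]) (use lim in auto)
  obtain k where k: "k \<in> Arr C" "Dom C k = X'" "Cod C k = X" "\<And>j. j \<in> Obj J \<Longrightarrow> p j \<cdot>\<^sub>C k = p' j"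
    by (rule graph_limit_lift[OF l lim'(1), of p']) (use lim' in auto)
  have ik: "i \<cdot>\<^sub>C k = Ident C X'"
    by (rule S.graph_limit_unique[OF l'])
      (use i k lim' S.reassoc[OF i(4)] in auto)
  have ki: "k \<cdot>\<^sub>C i = Ident C X"
    by (rule S.graph_limit_unique[OF l])
      (use i k lim S.reassoc[OF k(4)] in auto)
  show "is_limit J D (comp_functor J F G) (FO F X) (\<lambda>j. FM F (p j))"
    by (rule T.limit_transport[OF X'(2) is_functor_comp[OF G fctr], where i="FM F i" and k="FM F k"])
      (use i k lim lim' FM_eq[OF ik] FM_eq[OF ki] FM_eq[OF i(4)] in auto)
qed

end

lemma is_functor_id: "is_category C \<Longrightarrow> is_functor C C (id_functor C)"
  by (rule is_functor_inclusion) auto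

text \<open>The identity functor preserves pullbacks and the terminal object, so
  \<open>finite_limit_ex\<close> applies to it and yields existence.\<close>

lemma has_finite_limitsI:
  assumes "is_category C" "is_terminal C T" "has_pullbacks C"
  shows "has_finite_limits C"
proof -
  interpret lex C C "id_functor C"
  proof (unfold_locales)
    show "is_functor C C (id_functor C)" using is_functor_id assms by blast
    show "preserves_terminal C C (id_functor C)"
      unfolding preserves_terminal_def by (auto simp: is_terminal_def)
    show "preserves_pullbacks C C (id_functor C)" unfolding preserves_pullbacks_def
    proof (intro allI impI)
      fix f g p q assume pb: "is_pullback C f g p q"
      show "is_pullback C (FM (id_functor C) f) (FM (id_functor C) g) (FM (id_functor C) p) (FM (id_functor C) q)"
        using pb pullback_square(1-4)[OF pb] by simp
    qed
  qed (use assms in auto)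
  show ?thesis unfolding has_finite_limits_def using finite_limit_ex by blast
qed

section \<open>The empty diagram and the cospan as finite categories\<close>

definition empty_category :: "(nat, nat) category" where
  "empty_category = \<lparr>Obj = {}, Arr = {}, Dom = id, Cod = id, Ident = id, Comp = \<lambda>_ _. 0\<rparr>"

text \<open>The shape 0 -> 2 <- 1: the arrows 0, 1, 2 are the identities, 3 goes from 0 to 2 and 4
  from 1 to 2. The arrows 3 and 4 end at 2, where only the identity can follow, so the composite is
  then \<open>f\<close>.\<close>

definition cospan_category :: "(nat, nat) category" where
  "cospan_category = \<lparr>Obj = {0, 1, 2}, Arr = {0, 1, 2, 3, 4}, Dom = \<lambda>a. if a = 3 then 0 else if a = 4 then 1 else a,
     Cod = \<lambda>a. if a = 3 \<or> a = 4 then 2 else a, Ident = id, Comp = \<lambda>g f. if f < 3 then g else f\<rparr>"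

lemma finite_category_empty: "finite_category empty_category"
  by (simp add: finite_category_def empty_category_def is_category_def)

lemma finite_category_cospan: "finite_category cospan_category"
  by (simp add: finite_category_def cospan_category_def is_category_def)

lemma empty_limit: "is_limit empty_category C G X p \<longleftrightarrow> is_terminal C X"
  by (auto simp: is_limit_def is_cone_def empty_category_def is_terminal_def)

text \<open>A function that is \<open>undefined\<close> everywhere is the only extensional one on
  the empty set.\<close>

definition empty_functor :: "(nat, nat, 'o, 'm) cfunctor" where
  "empty_functor = \<lparr>FO = \<lambda>_. undefined, FM = \<lambda>_. undefined\<rparr>"

lemma is_functor_empty: "is_category C \<Longrightarrow> is_functor empty_category C empty_functor"
  using finite_category_empty by (simp add: is_functor_def empty_functor_def empty_category_def finite_category_def)

definition cospan_functor :: "('o, 'm) category \<Rightarrow> 'm \<Rightarrow> 'm \<Rightarrow> (nat, nat, 'o, 'm) cfunctor" where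
  "cospan_functor C f g = \<lparr>FO = \<lambda>i\<in>{0, 1, 2}. if i = 0 then Dom C f else if i = 1 then Dom C g else Cod C f,
     FM = \<lambda>a\<in>{0, 1, 2, 3, 4}. if a = 3 then f else if a = 4 then g
            else Ident C (if a = 0 then Dom C f else if a = 1 then Dom C g else Cod C f)\<rparr>"

lemma (in cat) is_functor_cospan:
  assumes "f \<in> Arr C" "g \<in> Arr C" "Cod C f = Cod C g"
  shows "is_functor cospan_category C (cospan_functor C f g)"
  using finite_category_cospan assms cat
  by (simp add: is_functor_def cospan_functor_def cospan_category_def finite_category_def)

lemma (in cat) cospan_limit_pullback:
  assumes "is_functor cospan_category C G" "FM G 3 = f" "FM G 4 = g" "is_limit cospan_category C G X p"
  shows "is_pullback C f g (p 0) (p 1)" "Dom C (p 0) = X"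
proof -
  interpret G: fctr cospan_category C G by unfold_locales fact
  have s: "0 \<in> Obj cospan_category" "1 \<in> Obj cospan_category" "2 \<in> Obj cospan_category"
    "3 \<in> Arr cospan_category" "4 \<in> Arr cospan_category"
    "Dom cospan_category 3 = 0" "Dom cospan_category 4 = 1" "Cod cospan_category 3 = 2" "Cod cospan_category 4 = 2"
    by (auto simp: cospan_category_def)
  note l = assms(4)[unfolded is_limit_graph_limit]
  note lim = graph_limit_cone[OF l]
  have G: "f \<in> Arr C" "g \<in> Arr C" "Dom C f = FO G 0" "Dom C g = FO G 1" "Cod C f = FO G 2" "Cod C g = FO G 2"
    using s G.FM_Arr[of 3] G.FM_Arr[of 4] G.FM_Dom[of 3] G.FM_Dom[of 4] G.FM_Cod[of 3] G.FM_Cod[of 4] assms(2,3) by auto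
  have p: "p 0 \<in> Arr C" "p 1 \<in> Arr C" "Dom C (p 0) = X" "Dom C (p 1) = X" "Cod C (p 0) = FO G 0" "Cod C (p 1) = FO G 1"
    "f \<cdot>\<^sub>C p 0 = p 2" "g \<cdot>\<^sub>C p 1 = p 2" "p 2 \<in> Arr C" "Cod C (p 2) = FO G 2"
    using lim s lim(5)[of 3] lim(5)[of 4] assms(2,3) by auto
  have ob: "Obj cospan_category = {0, 1, 2}" by (simp add: cospan_category_def)
  have GFM: "FM G a \<in> Arr C" "Dom C (FM G a) = FO G (Dom cospan_category a)"
    if "a \<in> Arr cospan_category" for a using that by simp_all
  show "Dom C (p 0) = X" by (rule p)
  show "is_pullback C f g (p 0) (p 1)"
  proof (rule is_pullbackI)
    show "jointly_monic C (p 0) (p 1)" unfolding jointly_monic_def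
    proof (intro conjI ballI impI)
      fix h k assume hk: "h \<in> Arr C" "k \<in> Arr C"
        and *: "Dom C h = Dom C k \<and> Cod C h = Dom C (p 0) \<and> Cod C k = Dom C (p 0) \<and> p 0 \<cdot>\<^sub>C h = p 0 \<cdot>\<^sub>C k \<and> p 1 \<cdot>\<^sub>C h = p 1 \<cdot>\<^sub>C k"
      have "p 2 \<cdot>\<^sub>C h = f \<cdot>\<^sub>C (p 0 \<cdot>\<^sub>C h)" "p 2 \<cdot>\<^sub>C k = f \<cdot>\<^sub>C (p 0 \<cdot>\<^sub>C k)"
        using reassoc[OF p(7) hk(1)] reassoc[OF p(7) hk(2)] hk * p G by auto
      then have "p 2 \<cdot>\<^sub>C h = p 2 \<cdot>\<^sub>C k" using * by simp
      then have "p j \<cdot>\<^sub>C h = p j \<cdot>\<^sub>C k" if "j \<in> Obj cospan_category" for j using that ob * by auto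
      then show "h = k"
        by (rule graph_limit_unique[OF l hk(1,2), rotated 3]) (use * p GFM in auto)
    qed (use p in auto)
    fix a b assume ab: "a \<in> Arr C" "b \<in> Arr C" "Dom C a = Dom C b" "Cod C a = Dom C f" "Cod C b = Dom C g" "f \<cdot>\<^sub>C a = g \<cdot>\<^sub>C b"
    define q where "q j = (if j = 0 then a else if j = 1 then b else f \<cdot>\<^sub>C a)" for j :: nat
    have D: "Dom C (FM G 0) = FO G 0" "Dom C (FM G 1) = FO G 1" by (auto simp: cospan_category_def)
    have I: "FM G 0 = Ident C (FO G 0)" "FM G 1 = Ident C (FO G 1)" "FM G 2 = Ident C (FO G 2)"
      using G.FM_Ident[of 0] G.FM_Ident[of 1] G.FM_Ident[of 2] by (auto simp: cospan_category_def)
    obtain u where "u \<in> Arr C" "Dom C u = Dom C a" "Cod C u = X" "\<And>j. j \<in> Obj cospan_category \<Longrightarrow> p j \<cdot>\<^sub>C u = q j"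
    proof (rule graph_limit_lift[OF l, of "Dom C a" q])
      show "in_hom C (q j) (Dom C a) (FO G j)" if "j \<in> Obj cospan_category" for j
        using that ab G unfolding ob q_def by auto
      show "FM G c \<cdot>\<^sub>C q (Dom cospan_category c) = q (Cod cospan_category c)" if "c \<in> Arr cospan_category" for c
        using that ab G I assms(2,3) unfolding q_def by (auto simp: cospan_category_def)
    qed (use ab in auto)
    then show "\<exists>u. in_hom C u (Dom C a) (Dom C (p 0)) \<and> p 0 \<cdot>\<^sub>C u = a \<and> p 1 \<cdot>\<^sub>C u = b"
      using s p unfolding q_def by (intro exI[of _ u]) auto
  qed (use G p in auto)
qed

lemma (in cat) pullback_cospan_limit:
  assumes pb: "is_pullback C f g p q"
  shows "is_limit cospan_category C (cospan_functor C f g) (Dom C p) (\<lambda>i. if i = 0 then p else if i = 1 then q else f \<cdot>\<^sub>C p)"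
  unfolding is_limit_def is_cone_def
proof (intro conjI allI impI)
  note sq = pullback_square[OF pb]
  have ob: "Obj cospan_category = {0, 1, 2}" by (simp add: cospan_category_def)
  show "Dom C p \<in> Obj C" using sq by simp
  show "\<forall>j\<in>Obj cospan_category. in_hom C (if j = 0 then p else if j = 1 then q else f \<cdot>\<^sub>C p) (Dom C p) (FO (cospan_functor C f g) j)"
    using sq by (simp add: cospan_functor_def ob)
  show "\<forall>a\<in>Arr cospan_category. FM (cospan_functor C f g) a \<cdot>\<^sub>C (if Dom cospan_category a = 0 then p else if Dom cospan_category a = 1 then q else f \<cdot>\<^sub>C p) =
      (if Cod cospan_category a = 0 then p else if Cod cospan_category a = 1 then q else f \<cdot>\<^sub>C p)"
    using sq by (simp add: cospan_functor_def cospan_category_def)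
  fix Y r assume "Y \<in> Obj C \<and> (\<forall>j\<in>Obj cospan_category. in_hom C (r j) Y (FO (cospan_functor C f g) j)) \<and>
    (\<forall>a\<in>Arr cospan_category. FM (cospan_functor C f g) a \<cdot>\<^sub>C r (Dom cospan_category a) = r (Cod cospan_category a))"
  then have r: "in_hom C (r 0) Y (Dom C f)" "in_hom C (r 1) Y (Dom C g)" "f \<cdot>\<^sub>C r 0 = r 2" "g \<cdot>\<^sub>C r 1 = r 2"
    by (auto simp: cospan_functor_def cospan_category_def)
  have "(in_hom C u Y (Dom C p) \<and> (\<forall>j\<in>Obj cospan_category. (if j = 0 then p else if j = 1 then q else f \<cdot>\<^sub>C p) \<cdot>\<^sub>C u = r j)) \<longleftrightarrow>
    in_hom C u (Dom C (r 0)) (Dom C p) \<and> p \<cdot>\<^sub>C u = r 0 \<and> q \<cdot>\<^sub>C u = r 1" for u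
    using r sq unfolding ob by auto
  then show "\<exists>!u. in_hom C u Y (Dom C p) \<and> (\<forall>j\<in>Obj cospan_category. (if j = 0 then p else if j = 1 then q else f \<cdot>\<^sub>C p) \<cdot>\<^sub>C u = r j)"
    using pullback_ex1[OF pb, of "r 0" "r 1"] r by simp
qed

lemma has_finite_limitsD:
  assumes "is_category C" "has_finite_limits C"
  shows "\<exists>T. is_terminal C T" "has_pullbacks C"
proof -
  interpret cat C by unfold_locales fact
  show "\<exists>T. is_terminal C T"
    using assms(2) finite_category_empty is_functor_empty[OF assms(1)] empty_limit unfolding has_finite_limits_def by metis
  show "has_pullbacks C" unfolding has_pullbacks_def
  proof (intro ballI impI)
    fix f g assume fg: "f \<in> Arr C" "g \<in> Arr C" "Cod C f = Cod C g"
    then obtain X p where "is_limit cospan_category C (cospan_functor C f g) X p"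
      using assms(2) finite_category_cospan is_functor_cospan[OF fg] unfolding has_finite_limits_def by blast
    then have "is_pullback C f g (p 0) (p 1)"
      by (rule cospan_limit_pullback(1)[OF is_functor_cospan[OF fg], rotated 2]) (simp_all add: cospan_functor_def)
    then show "\<exists>p q. is_pullback C f g p q" by blast
  qed
qed

text \<open>The empty diagram and the cospan are two particular finite diagrams, so preservation of
  all finite limits specializes to the two conditions of \<open>lex\<close>.\<close>

lemma lexI:
  assumes "is_functor C D F" "has_finite_limits C" "preserves_finite_limits C D F"
  shows "lex C D F"
proof -
  interpret fctr C D F by unfold_locales fact
  have "preserves_terminal C D F" unfolding preserves_terminal_def
  proof (intro allI impI)
    fix T assume "is_terminal C T"
    then have "is_limit empty_category C empty_functor T (\<lambda>_. undefined)" by (simp add: empty_limit)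
    then have "is_limit empty_category D (comp_functor empty_category F empty_functor) (FO F T) (\<lambda>j. FM F ((\<lambda>_. undefined) j))"
      using assms(3) finite_category_empty is_functor_empty[OF S.cat] unfolding preserves_finite_limits_def by blast
    then show "is_terminal D (FO F T)" by (simp add: empty_limit)
  qed
  moreover have "preserves_pullbacks C D F" unfolding preserves_pullbacks_def
  proof (intro allI impI)
    fix f g p q assume pb: "is_pullback C f g p q"
    note sq = pullback_square[OF pb]
    have G: "is_functor cospan_category C (cospan_functor C f g)" by (rule S.is_functor_cospan) (use sq in auto)
    let ?G = "comp_functor cospan_category F (cospan_functor C f g)"
    let ?p = "\<lambda>i::nat. if i = 0 then p else if i = 1 then q else f \<cdot>\<^sub>C p"
    have *: "is_limit cospan_category D ?G (FO F (Dom C p)) (\<lambda>j. FM F (?p j))"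
      using assms(3) finite_category_cospan G S.pullback_cospan_limit[OF pb] unfolding preserves_finite_limits_def by blast
    have m: "3 \<in> Arr cospan_category" "4 \<in> Arr cospan_category" by (auto simp: cospan_category_def)
    have "is_pullback D (FM F f) (FM F g) (FM F (?p 0)) (FM F (?p 1))"
      by (rule T.cospan_limit_pullback(1)[OF is_functor_comp[OF G fctr] _ _ *])
        (use m in \<open>simp_all add: cospan_functor_def\<close>)
    then show "is_pullback D (FM F f) (FM F g) (FM F p) (FM F q)" by simp
  qed
  ultimately show ?thesis using has_finite_limitsD[OF S.cat assms(2)] by unfold_locales auto
qed

section \<open>Covers in regular categories\<close>

text \<open>An extremal epimorphism without the demand to be epic, which follows once equalizers
  exist (\<open>cover_epi\<close>). In a regular category these are the regular epimorphisms
  (\<open>regular_epi_iff_cover\<close>), but cancellation and composition are easier to prove in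
  this form.\<close>

definition is_cover :: "('o, 'm) category \<Rightarrow> 'm \<Rightarrow> bool" where
  "is_cover C f \<longleftrightarrow> f \<in> Arr C \<and>
     (\<forall>m h. is_mono C m \<and> Cod C m = Cod C f \<and> in_hom C h (Dom C f) (Dom C m) \<and> m \<cdot>\<^sub>C h = f \<longrightarrow> is_iso C m)"

lemma is_cover_Arr: "is_cover C f \<Longrightarrow> f \<in> Arr C"
  by (simp add: is_cover_def)

lemma is_coverD:
  "\<lbrakk>is_cover C f; is_mono C m; Cod C m = Cod C f; h \<in> Arr C; Dom C h = Dom C f; Cod C h = Dom C m; m \<cdot>\<^sub>C h = f\<rbrakk>
    \<Longrightarrow> is_iso C m"
  unfolding is_cover_def by auto

lemma is_coverI:
  "\<lbrakk>f \<in> Arr C; \<And>m h. \<lbrakk>is_mono C m; Cod C m = Cod C f; h \<in> Arr C; Dom C h = Dom C f; Cod C h = Dom C m; m \<cdot>\<^sub>C h = f\<rbrakk>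
      \<Longrightarrow> is_iso C m\<rbrakk> \<Longrightarrow> is_cover C f"
  unfolding is_cover_def by auto

lemma is_monoI:
  "\<lbrakk>m \<in> Arr C; \<And>f g. \<lbrakk>f \<in> Arr C; g \<in> Arr C; Dom C f = Dom C g; Cod C f = Dom C m; Cod C g = Dom C m; m \<cdot>\<^sub>C f = m \<cdot>\<^sub>C g\<rbrakk>
      \<Longrightarrow> f = g\<rbrakk> \<Longrightarrow> is_mono C m"
  unfolding is_mono_def by blast

lemma is_isoE:
  assumes "is_iso C f"
  obtains g where "f \<in> Arr C" "g \<in> Arr C" "Dom C g = Cod C f" "Cod C g = Dom C f"
    "g \<cdot>\<^sub>C f = Ident C (Dom C f)" "f \<cdot>\<^sub>C g = Ident C (Cod C f)"
  using assms unfolding is_iso_def by auto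

lemma is_isoI:
  "\<lbrakk>f \<in> Arr C; g \<in> Arr C; Dom C g = Cod C f; Cod C g = Dom C f; g \<cdot>\<^sub>C f = Ident C (Dom C f);
     f \<cdot>\<^sub>C g = Ident C (Cod C f)\<rbrakk> \<Longrightarrow> is_iso C f"
  unfolding is_iso_def by auto

lemma coequalizer_square:
  assumes "is_coequalizer C f g q"
  shows "f \<in> Arr C" "g \<in> Arr C" "q \<in> Arr C" "Dom C g = Dom C f" "Cod C g = Cod C f" "Dom C q = Cod C f"
    "q \<cdot>\<^sub>C f = q \<cdot>\<^sub>C g"
  using assms unfolding is_coequalizer_def by auto

lemma coequalizer_ex1:
  assumes "is_coequalizer C f g q" "a \<in> Arr C" "Dom C a = Cod C f" "a \<cdot>\<^sub>C f = a \<cdot>\<^sub>C g"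
  shows "\<exists>!u. in_hom C u (Cod C q) (Cod C a) \<and> u \<cdot>\<^sub>C q = a"
  using assms unfolding is_coequalizer_def by blast

lemma coequalizer_lift:
  assumes "is_coequalizer C f g q" "a \<in> Arr C" "Dom C a = Cod C f" "a \<cdot>\<^sub>C f = a \<cdot>\<^sub>C g"
  obtains u where "u \<in> Arr C" "Dom C u = Cod C q" "Cod C u = Cod C a" "u \<cdot>\<^sub>C q = a"
proof -
  have "\<exists>u. in_hom C u (Cod C q) (Cod C a) \<and> u \<cdot>\<^sub>C q = a" using coequalizer_ex1[OF assms] by blast
  then show ?thesis using that by auto
qed

section \<open>Isomorphisms, covers and subobjects\<close>

context cat
begin

lemma is_iso_Ident: "X \<in> Obj C \<Longrightarrow> is_iso C (Ident C X)"
  by (rule is_isoI[where g="Ident C X"]) auto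

lemma is_iso_mono:
  assumes "is_iso C f" shows "is_mono C f"
proof -
  obtain g where g: "f \<in> Arr C" "g \<in> Arr C" "Dom C g = Cod C f" "Cod C g = Dom C f" "g \<cdot>\<^sub>C f = Ident C (Dom C f)"
    by (rule is_isoE[OF assms])
  have "h = k" if hk: "h \<in> Arr C" "k \<in> Arr C" "Dom C h = Dom C k" "Cod C h = Dom C f" "Cod C k = Dom C f" "f \<cdot>\<^sub>C h = f \<cdot>\<^sub>C k" for h k
  proof -
    have "h = g \<cdot>\<^sub>C (f \<cdot>\<^sub>C h)" using reassoc[OF g(5), of h] g hk by simp
    also have "\<dots> = k" using reassoc[OF g(5), of k] g hk by simp
    finally show ?thesis .
  qed
  then show ?thesis using g(1) unfolding is_mono_def by blast
qed

lemma split_mono_iso: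
  assumes "is_mono C m" "s \<in> Arr C" "Dom C s = Cod C m" "Cod C s = Dom C m" "m \<cdot>\<^sub>C s = Ident C (Cod C m)"
  shows "is_iso C m"
proof (rule is_isoI[where g=s])
  have m: "m \<in> Arr C" using assms(1) by auto
  show "s \<cdot>\<^sub>C m = Ident C (Dom C m)"
    by (rule is_monoD[OF assms(1)]) (use assms m reassoc[OF assms(5), of m] in simp_all)
qed (use assms in auto)

lemma mono_comp:
  assumes "is_mono C m" "is_mono C n" "Cod C n = Dom C m"
  shows "is_mono C (m \<cdot>\<^sub>C n)"
proof -
  have mn: "m \<in> Arr C" "n \<in> Arr C" using assms by auto
  have "h = k" if hk: "h \<in> Arr C" "k \<in> Arr C" "Dom C h = Dom C k" "Cod C h = Dom C n" "Cod C k = Dom C n"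
    "m \<cdot>\<^sub>C (n \<cdot>\<^sub>C h) = m \<cdot>\<^sub>C (n \<cdot>\<^sub>C k)" for h k
    by (rule is_monoD[OF assms(2)], (rule hk)+, rule is_monoD[OF assms(1)]) (use hk assms(3) mn in simp_all)
  then show ?thesis using mn assms(3) by (intro is_monoI) auto
qed

lemma jointly_monic_mono:
  assumes "is_mono C m" "q \<in> Arr C" "Dom C q = Dom C m"
  shows "jointly_monic C m q"
  using assms unfolding is_mono_def jointly_monic_def by auto

lemma iso_cover:
  assumes "is_iso C f" shows "is_cover C f"
proof -
  obtain g where g: "f \<in> Arr C" "g \<in> Arr C" "Dom C g = Cod C f" "Cod C g = Dom C f" "f \<cdot>\<^sub>C g = Ident C (Cod C f)"
    by (rule is_isoE[OF assms])
  have "is_iso C m" if m: "is_mono C m" "Cod C m = Cod C f" "h \<in> Arr C" "Dom C h = Dom C f" "Cod C h = Dom C m" "m \<cdot>\<^sub>C h = f" for m h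
    by (rule split_mono_iso[OF m(1), where s="h \<cdot>\<^sub>C g"]) (use m g is_mono_Arr[OF m(1)] reassoc[OF m(6), of g] in simp_all)
  then show ?thesis using g(1) by (intro is_coverI) auto
qed

lemma cover_mono_iso: "\<lbrakk>is_cover C f; is_mono C f\<rbrakk> \<Longrightarrow> is_iso C f"
  by (rule is_coverD[where h="Ident C (Dom C f)"]) (auto dest: is_mono_Arr)

lemma cover_cancel:
  assumes "is_cover C (g \<cdot>\<^sub>C f)" "f \<in> Arr C" "g \<in> Arr C" "Dom C g = Cod C f"
  shows "is_cover C g"
proof -
  have "is_iso C m" if m: "is_mono C m" "Cod C m = Cod C g" "h \<in> Arr C" "Dom C h = Dom C g" "Cod C h = Dom C m" "m \<cdot>\<^sub>C h = g" for m h
    by (rule is_coverD[OF assms(1) m(1), where h="h \<cdot>\<^sub>C f"]) (use m assms is_mono_Arr[OF m(1)] reassoc[OF m(6), of f] in simp_all)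
  then show ?thesis using assms by (intro is_coverI) auto
qed

text \<open>If \<open>q\<close> factors as \<open>h\<close> followed by a monomorphism
  \<open>m\<close>, then \<open>h\<close> coequalizes the same pair; the arrow that the coequalizer
  gives for \<open>h\<close> is a section of \<open>m\<close>.\<close>

lemma regular_epi_cover:
  assumes "is_regular_epi C q" shows "is_cover C q"
proof -
  obtain f g where co: "is_coequalizer C f g q" using assms unfolding is_regular_epi_def by blast
  note sq = coequalizer_square[OF co]
  have "is_iso C m" if m: "is_mono C m" "Cod C m = Cod C q" "h \<in> Arr C" "Dom C h = Dom C q" "Cod C h = Dom C m" "m \<cdot>\<^sub>C h = q" for m h
  proof -
    have m1: "m \<in> Arr C" using m by auto
    have "h \<cdot>\<^sub>C f = h \<cdot>\<^sub>C g"
    proof (rule is_monoD[OF m(1)])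
      have "m \<cdot>\<^sub>C (h \<cdot>\<^sub>C f) = q \<cdot>\<^sub>C f" "m \<cdot>\<^sub>C (h \<cdot>\<^sub>C g) = q \<cdot>\<^sub>C g"
        using reassoc[OF m(6), of f] reassoc[OF m(6), of g] m m1 sq by auto
      then show "m \<cdot>\<^sub>C (h \<cdot>\<^sub>C f) = m \<cdot>\<^sub>C (h \<cdot>\<^sub>C g)" using sq by simp
    qed (use m sq in auto)
    then obtain u where u: "u \<in> Arr C" "Dom C u = Cod C q" "Cod C u = Cod C h" "u \<cdot>\<^sub>C q = h"
      using coequalizer_lift[OF co, of h] m sq by auto
    have "\<exists>!w. in_hom C w (Cod C q) (Cod C q) \<and> w \<cdot>\<^sub>C q = q" by (rule coequalizer_ex1[OF co]) (use sq in auto)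
    then have "m \<cdot>\<^sub>C u = Ident C (Cod C q)"
      by (rule ex1_eq) (use u m m1 sq in auto)
    then show ?thesis using split_mono_iso[OF m(1) u(1)] u m by simp
  qed
  then show ?thesis using sq by (intro is_coverI) auto
qed

lemma subobject_self: "is_mono C m \<Longrightarrow> m \<in> subobject_of C m"
  unfolding subobject_of_def monos_into_def factors_through_def
  by (auto intro!: exI[of _ "Ident C (Dom C m)"])

lemma factors_through_trans:
  assumes "factors_through C f m" "factors_through C m n" "m \<in> Arr C" "n \<in> Arr C"
  shows "factors_through C f n"
proof -
  obtain h k where "in_hom C h (Dom C f) (Dom C m)" "m \<cdot>\<^sub>C h = f" "in_hom C k (Dom C m) (Dom C n)" "n \<cdot>\<^sub>C k = m"
    using assms unfolding factors_through_def by auto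
  then show ?thesis unfolding factors_through_def
    using assms(3,4) reassoc[of n k m h] by (intro exI[of _ "k \<cdot>\<^sub>C h"]) auto
qed

lemma mem_Sub:
  assumes "S \<in> Sub C X" "m \<in> S"
  shows "is_mono C m" "Cod C m = X" "S = subobject_of C m"
proof -
  obtain n where n: "is_mono C n" "Cod C n = X" "S = subobject_of C n"
    using assms unfolding Sub_def monos_into_def by auto
  then have m: "is_mono C m" "Cod C m = X" "factors_through C n m" "factors_through C m n"
    using assms(2) unfolding subobject_of_def monos_into_def by auto
  then show "is_mono C m" "Cod C m = X" by auto
  have mn: "m \<in> Arr C" "n \<in> Arr C" using m n by auto
  show "S = subobject_of C m"
    unfolding n(3) subobject_of_def monos_into_def using m n
    by (auto dest: is_mono_Arr intro: factors_through_trans[OF _ _ mn(1)] factors_through_trans[OF _ _ mn(2)]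
        factors_through_trans[OF m(3) _ mn(1)] factors_through_trans[OF m(4) _ mn(2)])
qed

lemma subobject_of_Sub: "is_mono C m \<Longrightarrow> subobject_of C m \<in> Sub C (Cod C m)"
  unfolding Sub_def monos_into_def by auto

lemma Sub_rep:
  assumes "S \<in> Sub C X"
  obtains m where "m \<in> S" "is_mono C m" "Cod C m = X" "S = subobject_of C m"
  using assms subobject_self unfolding Sub_def monos_into_def by auto

lemma sub_le_iff:
  assumes "is_mono C m" "is_mono C n"
  shows "sub_le C (subobject_of C m) (subobject_of C n) \<longleftrightarrow> factors_through C m n"
proof
  assume "sub_le C (subobject_of C m) (subobject_of C n)"
  then obtain m' n' where *: "m' \<in> subobject_of C m" "n' \<in> subobject_of C n" "factors_through C m' n'"
    unfolding sub_le_def by blast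
  then have **: "is_mono C m'" "is_mono C n'" "factors_through C m m'" "factors_through C n' n"
    unfolding subobject_of_def monos_into_def by auto
  show "factors_through C m n"
    using factors_through_trans[OF **(3) factors_through_trans[OF *(3) **(4)]] ** assms by auto
qed (use assms subobject_self in \<open>auto simp: sub_le_def\<close>)

lemma factors_through_mem_iff:
  assumes "is_mono C n" "n' \<in> subobject_of C n"
  shows "factors_through C f n' \<longleftrightarrow> factors_through C f n"
proof -
  have *: "is_mono C n'" "factors_through C n n'" "factors_through C n' n"
    using assms unfolding subobject_of_def monos_into_def by auto
  show ?thesis using factors_through_trans[of f n' n] factors_through_trans[of f n n'] * assms by auto
qed

lemma is_image_iff:
  assumes "is_mono C m" "Cod C m = Cod C f" "f \<in> Arr C"
  shows "is_image C f (subobject_of C m) \<longleftrightarrow> factors_through C f m \<and>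
    (\<forall>n. is_mono C n \<and> Cod C n = Cod C f \<and> factors_through C f n \<longrightarrow> factors_through C m n)"
proof -
  have 1: "(\<exists>n\<in>subobject_of C m. factors_through C f n) \<longleftrightarrow> factors_through C f m" if "is_mono C m" for m
    using factors_through_mem_iff[OF that] subobject_self[OF that] by blast
  have "(\<forall>T\<in>Sub C (Cod C f). (\<exists>n\<in>T. factors_through C f n) \<longrightarrow> sub_le C (subobject_of C m) T) \<longleftrightarrow>
     (\<forall>n. is_mono C n \<and> Cod C n = Cod C f \<and> factors_through C f n \<longrightarrow> factors_through C m n)"
    using 1 sub_le_iff[OF assms(1)] unfolding Sub_def monos_into_def by auto
  then show ?thesis using 1[OF assms(1)] subobject_of_Sub[OF assms(1)] assms(2,3) unfolding is_image_def by simp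
qed

end

section \<open>Covers in a category with finite limits\<close>

locale flim = cat +
  assumes has_term: "\<exists>T. is_terminal C T" and has_pb: "has_pullbacks C"
begin

text \<open>Products and equalizers in \<open>C\<close> itself come from the constructions in
  \<open>lex\<close>, applied to the identity functor.\<close>

sublocale Id: lex C C "id_functor C"
proof (unfold_locales)
  show "is_functor C C (id_functor C)" by (rule is_functor_id[OF cat])
  show "preserves_terminal C C (id_functor C)"
    unfolding preserves_terminal_def by (auto simp: is_terminal_def)
  show "preserves_pullbacks C C (id_functor C)" unfolding preserves_pullbacks_def
  proof (intro allI impI)
    fix f g p q assume pb: "is_pullback C f g p q"
    show "is_pullback C (FM (id_functor C) f) (FM (id_functor C) g) (FM (id_functor C) p) (FM (id_functor C) q)"
      using pb pullback_square(1-4)[OF pb] by simp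
  qed
qed (use has_term has_pb in auto)

lemma pullback_ex:
  assumes "f \<in> Arr C" "g \<in> Arr C" "Cod C f = Cod C g"
  obtains p q where "is_pullback C f g p q"
  using assms has_pb unfolding has_pullbacks_def by blast

text \<open>The equalizer of \<open>g\<close> and \<open>h\<close> is a monomorphism through which
  \<open>f\<close> factors, hence an isomorphism.\<close>

lemma cover_epi:
  assumes "is_cover C f" "g \<in> Arr C" "h \<in> Arr C" "Dom C g = Cod C f" "Dom C h = Cod C f" "Cod C g = Cod C h" "g \<cdot>\<^sub>C f = h \<cdot>\<^sub>C f"
  shows "g = h"
proof -
  have f: "f \<in> Arr C" using assms(1) by (rule is_cover_Arr)
  obtain e where e: "is_equalizer C g h e" by (rule Id.equalizer_pres[of g h]) (use assms in auto)
  note eq = equalizer_square[OF e]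
  obtain u where u: "u \<in> Arr C" "Dom C u = Dom C f" "Cod C u = Dom C e" "e \<cdot>\<^sub>C u = f"
    by (rule equalizer_lift[OF e f]) (use assms in auto)
  have "is_iso C e" by (rule is_coverD[OF assms(1) equalizer_mono[OF e], of u]) (use u eq assms in auto)
  then obtain k where k: "k \<in> Arr C" "Dom C k = Cod C e" "Cod C k = Dom C e" "e \<cdot>\<^sub>C k = Ident C (Cod C e)"
    by (rule is_isoE)
  have "g \<cdot>\<^sub>C (e \<cdot>\<^sub>C k) = h \<cdot>\<^sub>C (e \<cdot>\<^sub>C k)" by (rule square_comp[OF eq(7)]) (use eq k in auto)
  moreover have "g \<cdot>\<^sub>C (e \<cdot>\<^sub>C k) = g" "h \<cdot>\<^sub>C (e \<cdot>\<^sub>C k) = h" using k eq by simp_all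
  ultimately show ?thesis by (simp only:)
qed

end

section \<open>Image factorization and descent along covers\<close>

locale regcat = cat +
  assumes regular: "regular_category C"
begin

sublocale flim
  using regular has_finite_limitsD[OF cat] by unfold_locales (auto simp: regular_category_def)

text \<open>If the first factor passes through a monomorphism \<open>n\<close>, then
  \<open>f\<close> factors through \<open>m \<cdot>\<^sub>C n\<close>; minimality of the image makes
  \<open>m\<close> factor through it as well, which splits \<open>n\<close>.\<close>

lemma image_factorization:
  assumes f: "f \<in> Arr C"
  obtains m e where "is_mono C m" "is_cover C e" "Cod C m = Cod C f" "Dom C e = Dom C f" "Cod C e = Dom C m" "m \<cdot>\<^sub>C e = f"
proof -
  obtain S where S: "is_image C f S" using regular f unfolding regular_category_def by blast
  then obtain m where m: "is_mono C m" "Cod C m = Cod C f" "S = subobject_of C m"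
    unfolding is_image_def Sub_def monos_into_def by auto
  note im = S[unfolded m(3) is_image_iff[OF m(1,2) f]]
  have m1: "m \<in> Arr C" using m by auto
  obtain e where e: "e \<in> Arr C" "Dom C e = Dom C f" "Cod C e = Dom C m" "m \<cdot>\<^sub>C e = f"
    using im unfolding factors_through_def by auto
  have "is_iso C n" if n: "is_mono C n" "Cod C n = Cod C e" "k \<in> Arr C" "Dom C k = Dom C e" "Cod C k = Dom C n" "n \<cdot>\<^sub>C k = e" for n k
  proof -
    have n1: "n \<in> Arr C" using n by auto
    have "is_mono C (m \<cdot>\<^sub>C n)" by (rule mono_comp) (use m n e in auto)
    moreover have "factors_through C f (m \<cdot>\<^sub>C n)"
      unfolding factors_through_def using n n1 e m1 by (intro exI[of _ k]) auto
    ultimately have "factors_through C m (m \<cdot>\<^sub>C n)" using im m1 n1 n e m by simp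
    then obtain h where "in_hom C h (Dom C m) (Dom C (m \<cdot>\<^sub>C n))" "(m \<cdot>\<^sub>C n) \<cdot>\<^sub>C h = m"
      unfolding factors_through_def by blast
    then have h: "h \<in> Arr C" "Dom C h = Dom C m" "Cod C h = Dom C n" "m \<cdot>\<^sub>C (n \<cdot>\<^sub>C h) = m"
      using m1 n1 n(2) e(3) by simp_all
    have "n \<cdot>\<^sub>C h = Ident C (Dom C m)"
      by (rule is_monoD[OF m(1)]) (use h m1 n1 n e in auto)
    then show ?thesis using split_mono_iso[OF n(1) h(1)] h n e by simp
  qed
  then have "is_cover C e" using e by (intro is_coverI) auto
  then show ?thesis using that m e by blast
qed

text \<open>A cover is an arrow whose image is the top subobject, so pullback stability of images
  carries over to covers.\<close>

lemma cover_pullback: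
  assumes pb: "is_pullback C g f p q" and f: "is_cover C f"
  shows "is_cover C p"
proof -
  note sq = pullback_square[OF pb]
  let ?i = "Ident C (Cod C f)" and ?j = "Ident C (Dom C g)"
  have X: "Cod C f \<in> Obj C" "Dom C g \<in> Obj C" using sq by auto
  have i: "is_mono C ?i" using is_iso_mono[OF is_iso_Ident] sq by simp
  have "is_image C f (subobject_of C ?i)"
  proof (subst is_image_iff[OF i _ sq(2)], simp add: X, intro conjI allI impI)
    show "factors_through C f ?i" unfolding factors_through_def using sq by (intro exI[of _ f]) auto
    fix n assume n: "is_mono C n \<and> Cod C n = Cod C f \<and> factors_through C f n"
    then obtain h where "in_hom C h (Dom C f) (Dom C n)" "n \<cdot>\<^sub>C h = f" unfolding factors_through_def by blast
    then have "is_iso C n" using is_coverD[OF f, of n h] n by simp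
    then obtain k where "k \<in> Arr C" "Dom C k = Cod C n" "Cod C k = Dom C n" "n \<cdot>\<^sub>C k = Ident C (Cod C n)"
      by (rule is_isoE)
    then show "factors_through C ?i n" unfolding factors_through_def using n X by (intro exI[of _ k]) auto
  qed
  then have im: "is_image C p (sub_pullback C g (subobject_of C ?i))"
    using regular pb unfolding regular_category_def by blast
  \<comment> \<open>The top subobject pulls back to the top subobject.\<close>
  have "is_pullback C g ?i ?j g"
  proof (rule is_pullbackI)
    show "jointly_monic C ?j g" by (rule jointly_monic_mono[OF is_iso_mono[OF is_iso_Ident]]) (use sq in auto)
    show "\<exists>u. in_hom C u (Dom C a) (Dom C ?j) \<and> ?j \<cdot>\<^sub>C u = a \<and> g \<cdot>\<^sub>C u = b"
      if "a \<in> Arr C" "b \<in> Arr C" "Dom C a = Dom C b" "Cod C a = Dom C g" "Cod C b = Dom C ?i" "g \<cdot>\<^sub>C a = ?i \<cdot>\<^sub>C b" for a b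
      using that sq X by (intro exI[of _ a]) auto
  qed (use sq in auto)
  then have j: "?j \<in> sub_pullback C g (subobject_of C ?i)"
    unfolding sub_pullback_def using subobject_self[OF i] by blast
  have jm: "is_mono C ?j" using is_iso_mono[OF is_iso_Ident] sq by simp
  have S: "sub_pullback C g (subobject_of C ?i) = subobject_of C ?j"
    using im j mem_Sub(3) unfolding is_image_def by blast
  have im': "factors_through C ?j n" if "is_mono C n" "Cod C n = Cod C p" "factors_through C p n" for n
    using im[unfolded S] is_image_iff[OF jm _ sq(3)] that sq X by simp
  have "is_iso C m" if m: "is_mono C m" "Cod C m = Cod C p" "h \<in> Arr C" "Dom C h = Dom C p" "Cod C h = Dom C m" "m \<cdot>\<^sub>C h = p" for m h
  proof -
    have "factors_through C p m" unfolding factors_through_def using m by auto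
    then have "factors_through C ?j m" using im' m by blast
    then obtain s where s: "s \<in> Arr C" "Dom C s = Dom C g" "Cod C s = Dom C m" "m \<cdot>\<^sub>C s = ?j"
      unfolding factors_through_def using X by auto
    show ?thesis by (rule split_mono_iso[OF m(1) s(1)]) (use s m sq in auto)
  qed
  then show ?thesis using sq by (intro is_coverI) auto
qed

text \<open>If the composite factors through \<open>m\<close>, then \<open>f\<close> factors through
  the pullback of \<open>m\<close> along \<open>g\<close>. This pullback is therefore an
  isomorphism, and \<open>g\<close> itself factors through \<open>m\<close>.\<close>

lemma cover_comp:
  assumes "is_cover C f" "is_cover C g" "Dom C g = Cod C f"
  shows "is_cover C (g \<cdot>\<^sub>C f)"
proof -
  have fg: "f \<in> Arr C" "g \<in> Arr C" using is_cover_Arr[OF assms(1)] is_cover_Arr[OF assms(2)] by auto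
  have "is_iso C m" if m: "is_mono C m" "Cod C m = Cod C (g \<cdot>\<^sub>C f)" "h \<in> Arr C" "Dom C h = Dom C (g \<cdot>\<^sub>C f)" "Cod C h = Dom C m" "m \<cdot>\<^sub>C h = g \<cdot>\<^sub>C f" for m h
  proof -
    have m1: "m \<in> Arr C" using m by auto
    obtain p q where pb: "is_pullback C g m p q" by (rule pullback_ex[of g m]) (use fg m m1 assms in auto)
    note sq = pullback_square[OF pb]
    obtain u where u: "u \<in> Arr C" "Dom C u = Dom C f" "Cod C u = Dom C p" "p \<cdot>\<^sub>C u = f"
      by (rule pullback_lift[OF pb, of f h]) (use fg m assms in auto)
    have "is_iso C p" by (rule is_coverD[OF assms(1) pullback_mono[OF pb m(1)], of u]) (use u sq assms in auto)
    then obtain k where k: "k \<in> Arr C" "Dom C k = Cod C p" "Cod C k = Dom C p" "p \<cdot>\<^sub>C k = Ident C (Cod C p)"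
      by (rule is_isoE)
    have "m \<cdot>\<^sub>C (q \<cdot>\<^sub>C k) = g \<cdot>\<^sub>C (p \<cdot>\<^sub>C k)" by (rule square_comp[OF sq(9)[symmetric]]) (use sq k in auto)
    then have "m \<cdot>\<^sub>C (q \<cdot>\<^sub>C k) = g" using k sq by simp
    then show ?thesis by (intro is_coverD[OF assms(2) m(1)]) (use k sq m fg assms in auto)
  qed
  then show ?thesis using fg assms by (intro is_coverI) auto
qed

text \<open>Local existence: a generalized element of the codomain of \<open>e\<close> has a
  preimage after restriction along a cover. Together with \<open>cover_jointly_monic_lift\<close>
  this replaces the choice of elements in later arguments.\<close>

lemma cover_lift:
  assumes "is_cover C e" "u \<in> Arr C" "Cod C u = Cod C e"
  obtains y v where "is_cover C y" "y \<in> Arr C" "v \<in> Arr C" "Cod C y = Dom C u" "Cod C v = Dom C e" "Dom C v = Dom C y" "e \<cdot>\<^sub>C v = u \<cdot>\<^sub>C y"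
proof -
  obtain p q where pb: "is_pullback C u e p q" by (rule pullback_ex[of u e]) (use assms is_cover_Arr[OF assms(1)] in auto)
  note sq = pullback_square[OF pb]
  show ?thesis by (rule that[of p q]) (use cover_pullback[OF pb assms(1)] sq in auto)
qed

text \<open>The graph of a map \<open>c\<close> coequalizing the kernel pair of \<open>f\<close> has an image that projects
  isomorphically to the codomain of \<open>f\<close>.\<close>

lemma cover_coequalizer:
  assumes f: "is_cover C f" and pb: "is_pullback C f f r s"
  shows "is_coequalizer C r s f"
proof -
  have f1: "f \<in> Arr C" using f by (rule is_cover_Arr)
  note sq = pullback_square[OF pb]
  have ex: "\<exists>u. in_hom C u (Cod C f) (Cod C c) \<and> u \<cdot>\<^sub>C f = c"
    if c: "c \<in> Arr C" "Dom C c = Dom C f" "c \<cdot>\<^sub>C r = c \<cdot>\<^sub>C s" for c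
  proof -
    obtain p q where pq: "is_product C (Cod C f) (Cod C c) p q"
      by (rule Id.product_pres[of "Cod C f" "Cod C c"]) (use f1 c in auto)
    note pr = product_square[OF pq]
    obtain h where h: "h \<in> Arr C" "Dom C h = Dom C f" "Cod C h = Dom C p" "p \<cdot>\<^sub>C h = f" "q \<cdot>\<^sub>C h = c"
      by (rule product_lift[OF pq f1 c(1)]) (use c in auto)
    obtain m e where me: "is_mono C m" "is_cover C e" "Cod C m = Cod C h" "Dom C e = Dom C h" "Cod C e = Dom C m" "m \<cdot>\<^sub>C e = h"
      by (rule image_factorization[OF h(1)])
    have ar: "m \<in> Arr C" "e \<in> Arr C" using me is_cover_Arr[OF me(2)] by auto
    define d d' where "d = p \<cdot>\<^sub>C m" and "d' = q \<cdot>\<^sub>C m"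
    have d: "d \<in> Arr C" "d' \<in> Arr C" "Dom C d = Dom C m" "Dom C d' = Dom C m" "Cod C d = Cod C f" "Cod C d' = Cod C c"
      "d \<cdot>\<^sub>C e = f" "d' \<cdot>\<^sub>C e = c"
      unfolding d_def d'_def using ar me h pr by auto
    have jm: "x = y" if "x \<in> Arr C" "y \<in> Arr C" "Dom C x = Dom C y" "Cod C x = Dom C m" "Cod C y = Dom C m"
      "d \<cdot>\<^sub>C x = d \<cdot>\<^sub>C y" "d' \<cdot>\<^sub>C x = d' \<cdot>\<^sub>C y" for x y
    proof (rule is_monoD[OF me(1)])
      show "m \<cdot>\<^sub>C x = m \<cdot>\<^sub>C y" by (rule product_unique[OF pq]) (use that ar me pr h in \<open>auto simp: d_def d'_def\<close>)
    qed (use that in auto)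
    \<comment> \<open>\<open>d\<close> and \<open>d'\<close> are the projections of the image of the
      graph of \<open>c\<close>. Elements of the image that agree under \<open>d\<close> lift
      locally to elements with the same value under \<open>f\<close>; these form an element of the
      kernel pair, so \<open>c\<close>, and with it \<open>d'\<close>, cannot tell them
      apart.\<close>
    have "is_mono C d" unfolding is_mono_def
    proof (intro conjI ballI impI)
      fix x y assume xy: "x \<in> Arr C" "y \<in> Arr C" "Dom C x = Dom C y \<and> Cod C x = Dom C d \<and> Cod C y = Dom C d \<and> d \<cdot>\<^sub>C x = d \<cdot>\<^sub>C y"
      obtain x1 a where x1: "is_cover C x1" "x1 \<in> Arr C" "a \<in> Arr C" "Cod C x1 = Dom C x" "Cod C a = Dom C e" "Dom C a = Dom C x1" "e \<cdot>\<^sub>C a = x \<cdot>\<^sub>C x1"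
        by (rule cover_lift[OF me(2) xy(1)]) (use xy d me in auto)
      obtain y1 b where y1: "is_cover C y1" "y1 \<in> Arr C" "b \<in> Arr C" "Cod C y1 = Dom C (y \<cdot>\<^sub>C x1)" "Cod C b = Dom C e" "Dom C b = Dom C y1" "e \<cdot>\<^sub>C b = (y \<cdot>\<^sub>C x1) \<cdot>\<^sub>C y1"
        by (rule cover_lift[OF me(2), of "y \<cdot>\<^sub>C x1"]) (use xy d me x1 in auto)
      have Y: "Cod C y1 = Dom C x1" "e \<cdot>\<^sub>C b = y \<cdot>\<^sub>C (x1 \<cdot>\<^sub>C y1)" using y1 xy x1 by auto
      have ea: "e \<cdot>\<^sub>C (a \<cdot>\<^sub>C y1) = x \<cdot>\<^sub>C (x1 \<cdot>\<^sub>C y1)" by (rule square_comp[OF x1(7)]) (use x1 y1 Y xy d me ar in auto)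
      have xd: "d \<cdot>\<^sub>C (x \<cdot>\<^sub>C (x1 \<cdot>\<^sub>C y1)) = d \<cdot>\<^sub>C (y \<cdot>\<^sub>C (x1 \<cdot>\<^sub>C y1))"
        by (rule square_comp) (use xy d x1 y1 Y in auto)
      have ar2: "a \<cdot>\<^sub>C y1 \<in> Arr C" "Cod C (a \<cdot>\<^sub>C y1) = Dom C e" "Dom C (a \<cdot>\<^sub>C y1) = Dom C y1" using x1 y1 Y by auto
      have ec: "d \<cdot>\<^sub>C (e \<cdot>\<^sub>C z) = f \<cdot>\<^sub>C z" "d' \<cdot>\<^sub>C (e \<cdot>\<^sub>C z) = c \<cdot>\<^sub>C z" if "z \<in> Arr C" "Cod C z = Dom C e" for z
        using reassoc[OF d(7) that(1)] reassoc[OF d(8) that(1)] that ar d me by auto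
      have "f \<cdot>\<^sub>C (a \<cdot>\<^sub>C y1) = f \<cdot>\<^sub>C b" using ec(1)[OF ar2(1,2)] ec(1)[OF y1(3,5)] ea Y xd by simp
      then obtain w where w: "w \<in> Arr C" "Dom C w = Dom C (a \<cdot>\<^sub>C y1)" "Cod C w = Dom C r" "r \<cdot>\<^sub>C w = a \<cdot>\<^sub>C y1" "s \<cdot>\<^sub>C w = b"
        by (rule pullback_lift[OF pb ar2(1) y1(3), rotated 3]) (use ar2 y1 me h in auto)
      have "c \<cdot>\<^sub>C (r \<cdot>\<^sub>C w) = c \<cdot>\<^sub>C (s \<cdot>\<^sub>C w)" by (rule square_comp[OF c(3)]) (use c sq w in auto)
      then have cab: "c \<cdot>\<^sub>C (a \<cdot>\<^sub>C y1) = c \<cdot>\<^sub>C b" using w by simp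
      have "d' \<cdot>\<^sub>C (x \<cdot>\<^sub>C (x1 \<cdot>\<^sub>C y1)) = d' \<cdot>\<^sub>C (y \<cdot>\<^sub>C (x1 \<cdot>\<^sub>C y1))"
        using ec(2)[OF ar2(1,2)] ec(2)[OF y1(3,5)] ea Y cab by simp
      then have "(d' \<cdot>\<^sub>C x) \<cdot>\<^sub>C (x1 \<cdot>\<^sub>C y1) = (d' \<cdot>\<^sub>C y) \<cdot>\<^sub>C (x1 \<cdot>\<^sub>C y1)" using xy d x1 y1 Y by simp
      then have "d' \<cdot>\<^sub>C x = d' \<cdot>\<^sub>C y"
        by - (rule cover_epi[OF cover_comp[OF y1(1) x1(1)]], use xy d x1 y1 Y in auto)
      then show "x = y" using jm xy d by simp
    qed (rule d)
    moreover have "is_cover C d" using cover_cancel[of d e] f d ar me by simp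
    \<comment> \<open>The image is now the graph of an arrow defined on the whole codomain of
      \<open>f\<close>: the inverse of \<open>d\<close> followed by \<open>d'\<close>.\<close>
    ultimately have "is_iso C d" by (intro cover_mono_iso)
    then obtain k where k: "k \<in> Arr C" "Dom C k = Cod C d" "Cod C k = Dom C d" "k \<cdot>\<^sub>C d = Ident C (Dom C d)"
      by (rule is_isoE)
    have "k \<cdot>\<^sub>C f = e" using reassoc[OF k(4), of e] ar me k d by simp
    then have "(d' \<cdot>\<^sub>C k) \<cdot>\<^sub>C f = c" using k d f1 by simp
    then show ?thesis using k d by (intro exI[of _ "d' \<cdot>\<^sub>C k"]) auto
  qed
  show ?thesis unfolding is_coequalizer_def
  proof (intro conjI allI impI)
    fix c assume c: "c \<in> Arr C \<and> Dom C c = Cod C r \<and> c \<cdot>\<^sub>C r = c \<cdot>\<^sub>C s"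
    show "\<exists>!u. in_hom C u (Cod C f) (Cod C c) \<and> u \<cdot>\<^sub>C f = c"
    proof (rule ex_ex1I)
      show "\<exists>u. in_hom C u (Cod C f) (Cod C c) \<and> u \<cdot>\<^sub>C f = c" using ex c sq by simp
      show "u = v" if "in_hom C u (Cod C f) (Cod C c) \<and> u \<cdot>\<^sub>C f = c" "in_hom C v (Cod C f) (Cod C c) \<and> v \<cdot>\<^sub>C f = c" for u v
        by (rule cover_epi[OF f]) (use that in auto)
    qed
  qed (use sq in auto)
qed

lemma regular_epi_iff_cover: "is_regular_epi C f \<longleftrightarrow> is_cover C f"
proof
  assume f: "is_cover C f"
  obtain r s where "is_pullback C f f r s" by (rule pullback_ex[of f f]) (use is_cover_Arr[OF f] in auto)
  then show "is_regular_epi C f" using cover_coequalizer[OF f] unfolding is_regular_epi_def by blast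
qed (rule regular_epi_cover)

text \<open>Local solutions descend when they are unique: joint monicity makes \<open>z\<close>
  agree on the kernel pair of \<open>y\<close>, whose coequalizer is \<open>y\<close>.\<close>

lemma cover_jointly_monic_lift:
  assumes y: "is_cover C y" and jm: "jointly_monic C p q"
    and ar: "z \<in> Arr C" "u \<in> Arr C" "v \<in> Arr C" "Dom C z = Dom C y" "Cod C z = Dom C p"
      "Dom C u = Cod C y" "Dom C v = Cod C y" "Cod C u = Cod C p" "Cod C v = Cod C q"
    and eq: "p \<cdot>\<^sub>C z = u \<cdot>\<^sub>C y" "q \<cdot>\<^sub>C z = v \<cdot>\<^sub>C y"
  obtains w where "w \<in> Arr C" "Dom C w = Cod C y" "Cod C w = Dom C p" "p \<cdot>\<^sub>C w = u" "q \<cdot>\<^sub>C w = v" "w \<cdot>\<^sub>C y = z"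
proof -
  have y1: "y \<in> Arr C" using y by (rule is_cover_Arr)
  have pq: "p \<in> Arr C" "q \<in> Arr C" "Dom C q = Dom C p" using jm by (auto simp: jointly_monic_def)
  obtain r s where pb: "is_pullback C y y r s" by (rule pullback_ex[of y y]) (use y1 in auto)
  note sq = pullback_square[OF pb]
  have "p \<cdot>\<^sub>C (z \<cdot>\<^sub>C t) = u \<cdot>\<^sub>C (y \<cdot>\<^sub>C t)" "q \<cdot>\<^sub>C (z \<cdot>\<^sub>C t) = v \<cdot>\<^sub>C (y \<cdot>\<^sub>C t)" if "t \<in> Arr C" "Cod C t = Dom C y" for t
    by ((rule square_comp[OF eq(1)], use that y1 pq ar in auto)[], rule square_comp[OF eq(2)], use that y1 pq ar in auto)
  then have "z \<cdot>\<^sub>C r = z \<cdot>\<^sub>C s"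
    by - (rule jointly_monicD[OF jm], use sq ar pq in auto)
  then obtain w where w: "w \<in> Arr C" "Dom C w = Cod C y" "Cod C w = Cod C z" "w \<cdot>\<^sub>C y = z"
    using coequalizer_lift[OF cover_coequalizer[OF y pb] ar(1)] ar sq by auto
  have "p \<cdot>\<^sub>C w = u" by (rule cover_epi[OF y]) (use w pq ar eq y1 in auto)
  moreover have "q \<cdot>\<^sub>C w = v" by (rule cover_epi[OF y]) (use w pq ar eq y1 in auto)
  ultimately show ?thesis using that w ar by simp
qed

end

section \<open>Equivalences of categories\<close>

lemma fully_faithful_full:
  assumes "fully_faithful C D F" "X \<in> Obj C" "Y \<in> Obj C" "in_hom D g (FO F X) (FO F Y)"
  obtains f where "f \<in> Arr C" "Dom C f = X" "Cod C f = Y" "FM F f = g"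
proof -
  have "bij_betw (FM F) {f. in_hom C f X Y} {g. in_hom D g (FO F X) (FO F Y)}"
    using assms unfolding fully_faithful_def by blast
  then have "g \<in> FM F ` {f. in_hom C f X Y}" using assms(4) unfolding bij_betw_def by blast
  then show ?thesis using that by auto
qed

lemma fully_faithful_faithful:
  assumes "fully_faithful C D F" "f \<in> Arr C" "g \<in> Arr C" "Dom C f = Dom C g" "Cod C f = Cod C g" "FM F f = FM F g"
  shows "f = g"
proof -
  have "is_category C" using assms(1) unfolding fully_faithful_def is_functor_def by blast
  then interpret cat C by unfold_locales
  have "inj_on (FM F) {h. in_hom C h (Dom C f) (Cod C f)}"
    using assms unfolding fully_faithful_def bij_betw_def by auto
  then show ?thesis using assms unfolding inj_on_def by auto
qed

lemma fully_faithfulI: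
  assumes "is_functor C D F"
    "\<And>f g. \<lbrakk>f \<in> Arr C; g \<in> Arr C; Dom C f = Dom C g; Cod C f = Cod C g; FM F f = FM F g\<rbrakk> \<Longrightarrow> f = g"
    "\<And>X Y g. \<lbrakk>X \<in> Obj C; Y \<in> Obj C; in_hom D g (FO F X) (FO F Y)\<rbrakk> \<Longrightarrow> \<exists>f. in_hom C f X Y \<and> FM F f = g"
  shows "fully_faithful C D F"
proof -
  interpret fctr C D F by unfold_locales fact
  have "bij_betw (FM F) {f. in_hom C f X Y} {g. in_hom D g (FO F X) (FO F Y)}" if "X \<in> Obj C" "Y \<in> Obj C" for X Y
    unfolding bij_betw_def
  proof
    show "inj_on (FM F) {f. in_hom C f X Y}" using assms(2) by (auto intro!: inj_onI)
    show "FM F ` {f. in_hom C f X Y} = {g. in_hom D g (FO F X) (FO F Y)}"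
      using assms(3)[OF that] by (auto simp: image_iff)
  qed
  then show ?thesis unfolding fully_faithful_def using assms(1) by blast
qed

text \<open>On arrows the inverse is the preimage of the conjugate by the chosen isomorphisms.
  Faithfulness turns functoriality and naturality into equations in \<open>D\<close>, where the
  isomorphisms cancel.\<close>

lemma equivalenceI:
  assumes ff: "fully_faithful C D F"
    and es: "\<And>Y. Y \<in> Obj D \<Longrightarrow> \<exists>X\<in>Obj C. \<exists>i. in_hom D i (FO F X) Y \<and> is_iso D i"
  shows "is_equivalence C D F"
proof -
  have F: "is_functor C D F" using ff unfolding fully_faithful_def by blast
  interpret fctr C D F by unfold_locales fact
  have "\<forall>Y\<in>Obj D. \<exists>X i k. X \<in> Obj C \<and> in_hom D i (FO F X) Y \<and> in_hom D k Y (FO F X) \<and> k \<cdot>\<^sub>D i = Ident D (FO F X) \<and> i \<cdot>\<^sub>D k = Ident D Y"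
  proof
    fix Y assume "Y \<in> Obj D"
    then obtain X i where Xi: "X \<in> Obj C" "in_hom D i (FO F X) Y" "is_iso D i" using es by blast
    obtain k where "k \<in> Arr D" "Dom D k = Cod D i" "Cod D k = Dom D i" "k \<cdot>\<^sub>D i = Ident D (Dom D i)" "i \<cdot>\<^sub>D k = Ident D (Cod D i)"
      by (rule is_isoE[OF Xi(3)])
    then show "\<exists>X i k. X \<in> Obj C \<and> in_hom D i (FO F X) Y \<and> in_hom D k Y (FO F X) \<and> k \<cdot>\<^sub>D i = Ident D (FO F X) \<and> i \<cdot>\<^sub>D k = Ident D Y"
      using Xi by (intro exI[of _ X] exI[of _ i] exI[of _ k]) auto
  qed
  then obtain g i k where gik: "\<And>Y. Y \<in> Obj D \<Longrightarrow> g Y \<in> Obj C \<and> in_hom D (i Y) (FO F (g Y)) Y \<and> in_hom D (k Y) Y (FO F (g Y)) \<and>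
     k Y \<cdot>\<^sub>D i Y = Ident D (FO F (g Y)) \<and> i Y \<cdot>\<^sub>D k Y = Ident D Y" by metis
  have g: "g Y \<in> Obj C" "i Y \<in> Arr D" "k Y \<in> Arr D" "Dom D (i Y) = FO F (g Y)" "Cod D (i Y) = Y" "Dom D (k Y) = Y"
    "Cod D (k Y) = FO F (g Y)" "k Y \<cdot>\<^sub>D i Y = Ident D (FO F (g Y))" "i Y \<cdot>\<^sub>D k Y = Ident D Y" if "Y \<in> Obj D" for Y
    using gik[OF that] by auto
  define pre where "pre X Y h = (SOME f. in_hom C f X Y \<and> FM F f = h)" for X Y h
  have pre: "pre X Y h \<in> Arr C" "Dom C (pre X Y h) = X" "Cod C (pre X Y h) = Y" "FM F (pre X Y h) = h"
    if "X \<in> Obj C" "Y \<in> Obj C" "h \<in> Arr D" "Dom D h = FO F X" "Cod D h = FO F Y" for X Y h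
  proof -
    have "\<exists>f. in_hom C f X Y \<and> FM F f = h" by (rule fully_faithful_full[OF ff that(1,2), of h]) (use that in auto)
    then have "in_hom C (pre X Y h) X Y \<and> FM F (pre X Y h) = h" unfolding pre_def by (rule someI_ex)
    then show "pre X Y h \<in> Arr C" "Dom C (pre X Y h) = X" "Cod C (pre X Y h) = Y" "FM F (pre X Y h) = h" by auto
  qed
  define G where "G = \<lparr>FO = (\<lambda>Y\<in>Obj D. g Y), FM = (\<lambda>f\<in>Arr D. pre (g (Dom D f)) (g (Cod D f)) (k (Cod D f) \<cdot>\<^sub>D (f \<cdot>\<^sub>D i (Dom D f))))\<rparr>"
  have GO: "FO G Y = g Y" if "Y \<in> Obj D" for Y using that by (simp add: G_def)
  have GM: "FM G f \<in> Arr C" "Dom C (FM G f) = g (Dom D f)" "Cod C (FM G f) = g (Cod D f)"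
    "FM F (FM G f) = k (Cod D f) \<cdot>\<^sub>D (f \<cdot>\<^sub>D i (Dom D f))" if "f \<in> Arr D" for f
    using that pre[of "g (Dom D f)" "g (Cod D f)" "k (Cod D f) \<cdot>\<^sub>D (f \<cdot>\<^sub>D i (Dom D f))"]
    by (auto simp: G_def g)
  have GF: "is_functor D C G" unfolding is_functor_def
  proof (intro conjI ballI impI)
    show "FO G \<in> extensional (Obj D)" "FM G \<in> extensional (Arr D)" by (auto simp: G_def)
    show "FO G Y \<in> Obj C" if "Y \<in> Obj D" for Y using that g by (simp add: GO)
    show "in_hom C (FM G f) (FO G (Dom D f)) (FO G (Cod D f))" if "f \<in> Arr D" for f
      using that GM by (simp add: GO)
    show "FM G (Ident D Y) = Ident C (FO G Y)" if "Y \<in> Obj D" for Y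
      by (rule fully_faithful_faithful[OF ff]) (use that GM[of "Ident D Y"] g[OF that] in \<open>auto simp: GO\<close>)
    show "FM G (f' \<cdot>\<^sub>D f) = FM G f' \<cdot>\<^sub>C FM G f" if "f \<in> Arr D" "f' \<in> Arr D" "Cod D f = Dom D f'" for f f'
    proof (rule fully_faithful_faithful[OF ff])
      have ij: "i (Dom D f') \<cdot>\<^sub>D (k (Dom D f') \<cdot>\<^sub>D z) = z" if "z \<in> Arr D" "Cod D z = Dom D f'" for z
        using T.reassoc[OF g(9)[of "Dom D f'"] that(1)] that \<open>f' \<in> Arr D\<close> by (simp add: g)
      show "FM F (FM G (f' \<cdot>\<^sub>D f)) = FM F (FM G f' \<cdot>\<^sub>C FM G f)"
        using that GM[of f] GM[of f'] GM[of "f' \<cdot>\<^sub>D f"] ij[of "f \<cdot>\<^sub>D i (Dom D f)"] by (simp add: g)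
    qed (use that GM[of f] GM[of f'] GM[of "f' \<cdot>\<^sub>D f"] in auto)
  qed (use S.cat T.cat in auto)
  have "is_nat_trans C C (id_functor C) (comp_functor C G F) (\<lambda>X\<in>Obj C. pre X (g (FO F X)) (k (FO F X)))"
    unfolding is_nat_trans_def
  proof (intro conjI ballI)
    fix X assume X: "X \<in> Obj C"
    show "in_hom C ((\<lambda>X\<in>Obj C. pre X (g (FO F X)) (k (FO F X))) X) (FO (id_functor C) X) (FO (comp_functor C G F) X)"
      using X pre[of X "g (FO F X)" "k (FO F X)"] by (simp add: g GO)
  next
    fix f assume f: "f \<in> Arr C"
    define X Y where "X = Dom C f" and "Y = Cod C f"
    have XY: "X \<in> Obj C" "Y \<in> Obj C" "Dom C f = X" "Cod C f = Y" using f by (auto simp: X_def Y_def)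
    have p: "pre X (g (FO F X)) (k (FO F X)) \<in> Arr C" "Dom C (pre X (g (FO F X)) (k (FO F X))) = X"
      "Cod C (pre X (g (FO F X)) (k (FO F X))) = g (FO F X)" "FM F (pre X (g (FO F X)) (k (FO F X))) = k (FO F X)"
      if "X \<in> Obj C" for X
      using pre[of X "g (FO F X)" "k (FO F X)"] that by (auto simp: g)
    have ij: "i (FO F X) \<cdot>\<^sub>D k (FO F X) = Ident D (FO F X)" using XY by (simp add: g)
    have "pre Y (g (FO F Y)) (k (FO F Y)) \<cdot>\<^sub>C f = FM G (FM F f) \<cdot>\<^sub>C pre X (g (FO F X)) (k (FO F X))"
      by (rule fully_faithful_faithful[OF ff]) (use f XY p GM[of "FM F f"] ij in \<open>auto simp: g\<close>)
    then show "(\<lambda>X\<in>Obj C. pre X (g (FO F X)) (k (FO F X))) (Cod C f) \<cdot>\<^sub>C FM (id_functor C) f =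
        FM (comp_functor C G F) f \<cdot>\<^sub>C (\<lambda>X\<in>Obj C. pre X (g (FO F X)) (k (FO F X))) (Dom C f)"
      using f XY by simp
  qed simp
  moreover have "is_iso C ((\<lambda>X\<in>Obj C. pre X (g (FO F X)) (k (FO F X))) X)" if X: "X \<in> Obj C" for X
  proof -
    have p: "pre X (g (FO F X)) (k (FO F X)) \<in> Arr C" "Dom C (pre X (g (FO F X)) (k (FO F X))) = X"
      "Cod C (pre X (g (FO F X)) (k (FO F X))) = g (FO F X)" "FM F (pre X (g (FO F X)) (k (FO F X))) = k (FO F X)"
      using pre[of X "g (FO F X)" "k (FO F X)"] that by (auto simp: g)
    have q: "pre (g (FO F X)) X (i (FO F X)) \<in> Arr C" "Dom C (pre (g (FO F X)) X (i (FO F X))) = g (FO F X)"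
      "Cod C (pre (g (FO F X)) X (i (FO F X))) = X" "FM F (pre (g (FO F X)) X (i (FO F X))) = i (FO F X)"
      using pre[of "g (FO F X)" X "i (FO F X)"] that by (auto simp: g)
    have "is_iso C (pre X (g (FO F X)) (k (FO F X)))"
    proof (rule is_isoI[where g="pre (g (FO F X)) X (i (FO F X))"])
      show "pre (g (FO F X)) X (i (FO F X)) \<cdot>\<^sub>C pre X (g (FO F X)) (k (FO F X)) = Ident C (Dom C (pre X (g (FO F X)) (k (FO F X))))"
        by (rule fully_faithful_faithful[OF ff]) (use p q X in \<open>auto simp: g\<close>)
      show "pre X (g (FO F X)) (k (FO F X)) \<cdot>\<^sub>C pre (g (FO F X)) X (i (FO F X)) = Ident C (Cod C (pre X (g (FO F X)) (k (FO F X))))"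
        by (rule fully_faithful_faithful[OF ff]) (use p q X in \<open>auto simp: g\<close>)
    qed (use p q in auto)
    then show ?thesis using X by simp
  qed
  ultimately have 1: "naturally_isomorphic C C (id_functor C) (comp_functor C G F)"
    unfolding naturally_isomorphic_def by blast
  have "is_nat_trans D D (comp_functor D F G) (id_functor D) (\<lambda>Y\<in>Obj D. i Y)"
    unfolding is_nat_trans_def
  proof (intro conjI ballI)
    fix f assume f: "f \<in> Arr D"
    have "i (Cod D f) \<cdot>\<^sub>D (k (Cod D f) \<cdot>\<^sub>D (f \<cdot>\<^sub>D i (Dom D f))) = f \<cdot>\<^sub>D i (Dom D f)"
      using T.reassoc[OF g(9)[of "Cod D f"], of "f \<cdot>\<^sub>D i (Dom D f)"] f by (simp add: g)
    then show "(\<lambda>Y\<in>Obj D. i Y) (Cod D f) \<cdot>\<^sub>D FM (comp_functor D F G) f = FM (id_functor D) f \<cdot>\<^sub>D (\<lambda>Y\<in>Obj D. i Y) (Dom D f)"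
      using f GM[OF f] by simp
  qed (auto simp: g GO)
  moreover have "is_iso D ((\<lambda>Y\<in>Obj D. i Y) Y)" if "Y \<in> Obj D" for Y
    using is_isoI[of "i Y" D "k Y"] g[OF that] that by simp
  ultimately have "naturally_isomorphic D D (comp_functor D F G) (id_functor D)"
    unfolding naturally_isomorphic_def by blast
  with 1 show ?thesis unfolding is_equivalence_def using F GF by blast
qed

lemma equivalence_ess_surj:
  assumes "is_equivalence C D F" "Y \<in> Obj D"
  obtains X i where "X \<in> Obj C" "in_hom D i (FO F X) Y" "is_iso D i"
proof -
  obtain G where G: "is_functor D C G" "naturally_isomorphic D D (comp_functor D F G) (id_functor D)"
    using assms unfolding is_equivalence_def by blast
  interpret G: fctr D C G by unfold_locales fact
  obtain \<alpha> where "is_nat_trans D D (comp_functor D F G) (id_functor D) \<alpha>" "is_iso D (\<alpha> Y)"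
    using G(2) assms(2) unfolding naturally_isomorphic_def by blast
  then show ?thesis using that[of "FO G Y" "\<alpha> Y"] assms(2) unfolding is_nat_trans_def by auto
qed

text \<open>The preimage of \<open>h\<close> is \<open>FM G h\<close> conjugated by the unit
  \<open>\<beta>\<close>. By naturality its image agrees with \<open>h\<close> after applying
  \<open>G\<close>, and \<open>G\<close> is faithful because the counit \<open>\<alpha>\<close>
  consists of isomorphisms.\<close>

lemma equivalence_full:
  assumes "is_equivalence C D F" "X \<in> Obj C" "Y \<in> Obj C" "h \<in> Arr D" "Dom D h = FO F X" "Cod D h = FO F Y"
  obtains f where "f \<in> Arr C" "Dom C f = X" "Cod C f = Y" "FM F f = h"
proof -
  obtain G where G: "is_functor C D F" "is_functor D C G" "naturally_isomorphic D D (comp_functor D F G) (id_functor D)"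
    "naturally_isomorphic C C (id_functor C) (comp_functor C G F)"
    using assms unfolding is_equivalence_def by blast
  interpret F: fctr C D F by unfold_locales fact
  interpret G: fctr D C G by unfold_locales fact
  obtain \<alpha> where \<alpha>: "is_nat_trans D D (comp_functor D F G) (id_functor D) \<alpha>" "\<And>Y. Y \<in> Obj D \<Longrightarrow> is_iso D (\<alpha> Y)"
    using G(3) unfolding naturally_isomorphic_def by blast
  obtain \<beta> where \<beta>: "is_nat_trans C C (id_functor C) (comp_functor C G F) \<beta>" "\<And>X. X \<in> Obj C \<Longrightarrow> is_iso C (\<beta> X)"
    using G(4) unfolding naturally_isomorphic_def by blast
  have a: "\<alpha> Y \<in> Arr D" "Dom D (\<alpha> Y) = FO F (FO G Y)" "Cod D (\<alpha> Y) = Y" if "Y \<in> Obj D" for Y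
    using \<alpha>(1) that unfolding is_nat_trans_def by auto
  have an: "\<alpha> (Cod D f) \<cdot>\<^sub>D FM F (FM G f) = f \<cdot>\<^sub>D \<alpha> (Dom D f)" if "f \<in> Arr D" for f
    using \<alpha>(1) that unfolding is_nat_trans_def by auto
  have b: "\<beta> X \<in> Arr C" "Dom C (\<beta> X) = X" "Cod C (\<beta> X) = FO G (FO F X)" if "X \<in> Obj C" for X
    using \<beta>(1) that unfolding is_nat_trans_def by auto
  have bn: "\<beta> (Cod C f) \<cdot>\<^sub>C f = FM G (FM F f) \<cdot>\<^sub>C \<beta> (Dom C f)" if "f \<in> Arr C" for f
    using \<beta>(1) that unfolding is_nat_trans_def by auto
  have faithful: "f = f'" if f: "f \<in> Arr D" "f' \<in> Arr D" "Dom D f = Dom D f'" "Cod D f = Cod D f'" "FM G f = FM G f'" for f f'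
  proof -
    have Y: "Dom D f \<in> Obj D" using f by simp
    obtain k where k: "k \<in> Arr D" "Dom D k = Cod D (\<alpha> (Dom D f))" "Cod D k = Dom D (\<alpha> (Dom D f))" "\<alpha> (Dom D f) \<cdot>\<^sub>D k = Ident D (Cod D (\<alpha> (Dom D f)))"
      by (rule is_isoE[OF \<alpha>(2)[OF Y]])
    have "f \<cdot>\<^sub>D \<alpha> (Dom D f) = f' \<cdot>\<^sub>D \<alpha> (Dom D f)" using an[OF f(1)] an[OF f(2)] f(3-5) by metis
    then have "f \<cdot>\<^sub>D (\<alpha> (Dom D f) \<cdot>\<^sub>D k) = f' \<cdot>\<^sub>D (\<alpha> (Dom D f) \<cdot>\<^sub>D k)"
      by (rule F.T.square_comp) (use f k a[OF Y] in auto)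
    moreover have "f \<cdot>\<^sub>D (\<alpha> (Dom D f) \<cdot>\<^sub>D k) = f" "f' \<cdot>\<^sub>D (\<alpha> (Dom D f) \<cdot>\<^sub>D k) = f'" using k a[OF Y] f by simp_all
    ultimately show ?thesis by (simp only:)
  qed
  obtain k where k: "k \<in> Arr C" "Dom C k = Cod C (\<beta> Y)" "Cod C k = Dom C (\<beta> Y)" "k \<cdot>\<^sub>C \<beta> Y = Ident C (Dom C (\<beta> Y))" "\<beta> Y \<cdot>\<^sub>C k = Ident C (Cod C (\<beta> Y))"
    by (rule is_isoE[OF \<beta>(2)[OF assms(3)]])
  obtain l where l: "l \<in> Arr C" "Dom C l = Cod C (\<beta> X)" "Cod C l = Dom C (\<beta> X)" "\<beta> X \<cdot>\<^sub>C l = Ident C (Cod C (\<beta> X))"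
    by (rule is_isoE[OF \<beta>(2)[OF assms(2)]])
  define f where "f = k \<cdot>\<^sub>C (FM G h \<cdot>\<^sub>C \<beta> X)"
  note bX = b[OF assms(2)] and bY = b[OF assms(3)]
  have f: "f \<in> Arr C" "Dom C f = X" "Cod C f = Y" using k bX bY assms by (auto simp: f_def)
  have "\<beta> Y \<cdot>\<^sub>C f = FM G h \<cdot>\<^sub>C \<beta> X"
    using F.S.reassoc[OF k(5), of "FM G h \<cdot>\<^sub>C \<beta> X"] k bX bY assms unfolding f_def by simp
  then have "FM G (FM F f) \<cdot>\<^sub>C \<beta> X = FM G h \<cdot>\<^sub>C \<beta> X" using bn[OF f(1)] f by simp
  then have "FM G (FM F f) \<cdot>\<^sub>C (\<beta> X \<cdot>\<^sub>C l) = FM G h \<cdot>\<^sub>C (\<beta> X \<cdot>\<^sub>C l)"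
    by (rule F.S.square_comp) (use f l bX assms in auto)
  then have "FM G (FM F f) = FM G h" using l bX assms f by simp
  then have "FM F f = h" by - (rule faithful, use f assms in auto)
  then show ?thesis using that f by blast
qed

section \<open>Categories of functors\<close>

lemma nat_transD:
  assumes "is_nat_trans C D F G \<alpha>"
  shows "\<And>X. X \<in> Obj C \<Longrightarrow> \<alpha> X \<in> Arr D" "\<And>X. X \<in> Obj C \<Longrightarrow> Dom D (\<alpha> X) = FO F X" "\<And>X. X \<in> Obj C \<Longrightarrow> Cod D (\<alpha> X) = FO G X"
    "\<And>f. f \<in> Arr C \<Longrightarrow> \<alpha> (Cod C f) \<cdot>\<^sub>D FM F f = FM G f \<cdot>\<^sub>D \<alpha> (Dom C f)" "\<alpha> \<in> extensional (Obj C)"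
  using assms unfolding is_nat_trans_def by auto

lemma nat_trans_inverse:
  assumes "is_functor C D F" "is_functor C D G" "is_nat_trans C D F G \<alpha>" "\<And>X. X \<in> Obj C \<Longrightarrow> is_iso D (\<alpha> X)"
  obtains \<beta> where "is_nat_trans C D G F \<beta>"
    "\<And>X. X \<in> Obj C \<Longrightarrow> \<beta> X \<cdot>\<^sub>D \<alpha> X = Ident D (FO F X)" "\<And>X. X \<in> Obj C \<Longrightarrow> \<alpha> X \<cdot>\<^sub>D \<beta> X = Ident D (FO G X)"
proof -
  interpret F: fctr C D F by unfold_locales fact
  interpret G: fctr C D G by unfold_locales fact
  note a = nat_transD[OF assms(3)]
  have "\<forall>X\<in>Obj C. \<exists>k. k \<in> Arr D \<and> Dom D k = FO G X \<and> Cod D k = FO F X \<and> k \<cdot>\<^sub>D \<alpha> X = Ident D (FO F X) \<and> \<alpha> X \<cdot>\<^sub>D k = Ident D (FO G X)"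
  proof
    fix X assume X: "X \<in> Obj C"
    then obtain k where "k \<in> Arr D" "Dom D k = Cod D (\<alpha> X)" "Cod D k = Dom D (\<alpha> X)" "k \<cdot>\<^sub>D \<alpha> X = Ident D (Dom D (\<alpha> X))" "\<alpha> X \<cdot>\<^sub>D k = Ident D (Cod D (\<alpha> X))"
      using is_isoE[OF assms(4)] by blast
    then show "\<exists>k. k \<in> Arr D \<and> Dom D k = FO G X \<and> Cod D k = FO F X \<and> k \<cdot>\<^sub>D \<alpha> X = Ident D (FO F X) \<and> \<alpha> X \<cdot>\<^sub>D k = Ident D (FO G X)"
      using a(2,3)[OF X] by auto
  qed
  then obtain b where b: "\<And>X. X \<in> Obj C \<Longrightarrow> b X \<in> Arr D" "\<And>X. X \<in> Obj C \<Longrightarrow> Dom D (b X) = FO G X" "\<And>X. X \<in> Obj C \<Longrightarrow> Cod D (b X) = FO F X"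
    "\<And>X. X \<in> Obj C \<Longrightarrow> b X \<cdot>\<^sub>D \<alpha> X = Ident D (FO F X)" "\<And>X. X \<in> Obj C \<Longrightarrow> \<alpha> X \<cdot>\<^sub>D b X = Ident D (FO G X)"
    by metis
  have "b (Cod C f) \<cdot>\<^sub>D FM G f = FM F f \<cdot>\<^sub>D b (Dom C f)" if f: "f \<in> Arr C" for f
  proof -
    have X: "Dom C f \<in> Obj C" "Cod C f \<in> Obj C" using f by auto
    have "b (Cod C f) \<cdot>\<^sub>D (FM G f \<cdot>\<^sub>D (\<alpha> (Dom C f) \<cdot>\<^sub>D b (Dom C f))) = b (Cod C f) \<cdot>\<^sub>D (\<alpha> (Cod C f) \<cdot>\<^sub>D (FM F f \<cdot>\<^sub>D b (Dom C f)))"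
      using F.T.square_comp[OF a(4)[OF f], of "b (Dom C f)"] f X a b by simp
    then show ?thesis using F.T.reassoc[OF b(4)[OF X(2)], of "FM F f \<cdot>\<^sub>D b (Dom C f)"] f X a b by simp
  qed
  then have "is_nat_trans C D G F (restrict b (Obj C))" unfolding is_nat_trans_def using b F.S.Dom_Obj F.S.Cod_Obj by auto
  then show ?thesis using that[of "restrict b (Obj C)"] b by simp
qed

lemma functor_category_Obj [simp]: "F \<in> Obj (functor_category C D P) \<longleftrightarrow> is_functor C D F \<and> P F"
  by (simp add: functor_category_def)

lemma functor_category_Arr [simp]:
  "(F, \<alpha>, G) \<in> Arr (functor_category C D P) \<longleftrightarrow>
     is_functor C D F \<and> P F \<and> is_functor C D G \<and> P G \<and> is_nat_trans C D F G \<alpha>"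
  by (simp add: functor_category_def)

lemma functor_category_ops [simp]:
  "Dom (functor_category C D P) (F, \<alpha>, G) = F" "Cod (functor_category C D P) (F, \<alpha>, G) = G"
  "Ident (functor_category C D P) F = (F, \<lambda>X\<in>Obj C. Ident D (FO F X), F)"
  "Comp (functor_category C D P) (G', \<beta>, H) (F, \<alpha>, G) = (F, \<lambda>X\<in>Obj C. \<beta> X \<cdot>\<^sub>D \<alpha> X, H)"
  by (simp_all add: functor_category_def)

lemma nat_trans_comp:
  assumes "is_functor C D F" "is_functor C D G" "is_functor C D H" "is_nat_trans C D F G \<alpha>" "is_nat_trans C D G H \<beta>"
  shows "is_nat_trans C D F H (\<lambda>X\<in>Obj C. \<beta> X \<cdot>\<^sub>D \<alpha> X)"
proof -
  interpret F: fctr C D F by unfold_locales fact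
  interpret G: fctr C D G by unfold_locales fact
  interpret H: fctr C D H by unfold_locales fact
  note a = nat_transD[OF assms(4)] and b = nat_transD[OF assms(5)]
  have "(\<beta> (Cod C f) \<cdot>\<^sub>D \<alpha> (Cod C f)) \<cdot>\<^sub>D FM F f = FM H f \<cdot>\<^sub>D (\<beta> (Dom C f) \<cdot>\<^sub>D \<alpha> (Dom C f))" if "f \<in> Arr C" for f
    using F.T.square_comp[OF b(4)[OF that], of "\<alpha> (Dom C f)"] a b that by simp
  then show ?thesis unfolding is_nat_trans_def using a b F.S.Dom_Obj F.S.Cod_Obj by auto
qed

lemma nat_trans_Ident:
  assumes "is_functor C D F" shows "is_nat_trans C D F F (\<lambda>X\<in>Obj C. Ident D (FO F X))"
proof -
  interpret F: fctr C D F by unfold_locales fact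
  show ?thesis unfolding is_nat_trans_def by auto
qed

lemma functor_category_is_category:
  assumes "is_category C" "is_category D"
  shows "is_category (functor_category C D P)"
proof -
  interpret D: cat D by unfold_locales fact
  note nt = nat_transD
  let ?E = "functor_category C D P"
  show ?thesis unfolding is_category_def
  proof (intro conjI ballI impI)
    fix X assume "X \<in> Obj ?E" then show "in_hom ?E (Ident ?E X) X X"
      using nat_trans_Ident[of C D X] by simp
  next
    fix f assume "f \<in> Arr ?E"
    then obtain F \<alpha> G where f: "f = (F, \<alpha>, G)" "is_functor C D F" "P F" "is_functor C D G" "P G" "is_nat_trans C D F G \<alpha>"
      by (cases f) auto
    then show "Dom ?E f \<in> Obj ?E" "Cod ?E f \<in> Obj ?E" by auto
    note a = nt[OF f(6)]
    show "Comp ?E f (Ident ?E (Dom ?E f)) = f" "Comp ?E (Ident ?E (Cod ?E f)) f = f"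
      unfolding f(1) using a by (auto intro!: extensionalityI[of _ "Obj C"])
    fix g assume "g \<in> Arr ?E"
    then obtain G' \<beta> H where g: "g = (G', \<beta>, H)" "is_functor C D G'" "P G'" "is_functor C D H" "P H" "is_nat_trans C D G' H \<beta>"
      by (cases g) auto
    note b = nt[OF g(6)]
    show "in_hom ?E (Comp ?E g f) (Dom ?E f) (Cod ?E g)" if "Cod ?E f = Dom ?E g"
      using that f g nat_trans_comp[OF f(2,4) g(4) f(6)] by auto
    fix h assume "h \<in> Arr ?E"
    then obtain H' \<gamma> K where h: "h = (H', \<gamma>, K)" "is_functor C D H'" "P H'" "is_functor C D K" "P K" "is_nat_trans C D H' K \<gamma>"
      by (cases h) auto
    note c = nt[OF h(6)]
    show "Comp ?E h (Comp ?E g f) = Comp ?E (Comp ?E h g) f" if "Cod ?E f = Dom ?E g \<and> Cod ?E g = Dom ?E h"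
      using that a b c unfolding f(1) g(1) h(1) by (auto intro!: restrict_ext)
  qed
qed

lemma precomposition_FO [simp]:
  "\<lbrakk>is_functor E D F; P F\<rbrakk> \<Longrightarrow> FO (precomposition C E D P J) F = comp_functor C F J"
  by (simp add: precomposition_def)

lemma precomposition_FM [simp]:
  "\<lbrakk>is_functor E D F; P F; is_functor E D G; P G; is_nat_trans E D F G \<alpha>\<rbrakk> \<Longrightarrow>
   FM (precomposition C E D P J) (F, \<alpha>, G) = (comp_functor C F J, \<lambda>X\<in>Obj C. \<alpha> (FO J X), comp_functor C G J)"
  by (simp add: precomposition_def)

lemma nat_trans_precomp:
  assumes "is_functor C E J" "is_nat_trans E D F G \<alpha>"
  shows "is_nat_trans C D (comp_functor C F J) (comp_functor C G J) (\<lambda>X\<in>Obj C. \<alpha> (FO J X))"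
proof -
  interpret J: fctr C E J by unfold_locales fact
  note a = nat_transD[OF assms(2)]
  have "\<alpha> (FO J (Cod C f)) \<cdot>\<^sub>D FM F (FM J f) = FM G (FM J f) \<cdot>\<^sub>D \<alpha> (FO J (Dom C f))" if "f \<in> Arr C" for f
    using a(4)[of "FM J f"] that by simp
  then show ?thesis unfolding is_nat_trans_def using a by auto
qed

text \<open>Precomposition with \<open>J\<close> is an equivalence if natural transformations extend uniquely along
  \<open>J\<close> and every functor satisfying \<open>Q\<close> has an extension satisfying \<open>P\<close>, up to isomorphism.\<close>

lemma precomposition_equivalence:
  assumes J: "is_functor C E J" and D: "is_category D"
    and PQ: "\<And>F. \<lbrakk>is_functor E D F; P F\<rbrakk> \<Longrightarrow> Q (comp_functor C F J)"
    and unique: "\<And>F G \<alpha> \<beta>. \<lbrakk>is_functor E D F; P F; is_functor E D G; P G; is_nat_trans E D F G \<alpha>; is_nat_trans E D F G \<beta>;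
       \<And>X. X \<in> Obj C \<Longrightarrow> \<alpha> (FO J X) = \<beta> (FO J X)\<rbrakk> \<Longrightarrow> \<alpha> = \<beta>"
    and extend: "\<And>F G \<beta>. \<lbrakk>is_functor E D F; P F; is_functor E D G; P G;
       is_nat_trans C D (comp_functor C F J) (comp_functor C G J) \<beta>\<rbrakk>
       \<Longrightarrow> \<exists>\<alpha>. is_nat_trans E D F G \<alpha> \<and> (\<forall>X\<in>Obj C. \<alpha> (FO J X) = \<beta> X)"
    and extension: "\<And>F. \<lbrakk>is_functor C D F; Q F\<rbrakk>
       \<Longrightarrow> \<exists>G. is_functor E D G \<and> P G \<and> naturally_isomorphic C D (comp_functor C G J) F"
  shows "is_equivalence (functor_category E D P) (functor_category C D Q) (precomposition C E D P J)"
proof (rule equivalenceI)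
  interpret J: fctr C E J by unfold_locales fact
  let ?J = "precomposition C E D P J" and ?E = "functor_category E D P" and ?C = "functor_category C D Q"
  have c: "is_category ?E" "is_category ?C"
    using functor_category_is_category J.T.cat J.S.cat D by blast+
  show "fully_faithful ?E ?C ?J"
  proof (rule fully_faithfulI)
    show "is_functor ?E ?C ?J" unfolding is_functor_def
    proof (intro conjI ballI impI c)
      show "FO ?J \<in> extensional (Obj ?E)" "FM ?J \<in> extensional (Arr ?E)"
        by (auto simp: precomposition_def)
      fix F assume F: "F \<in> Obj ?E"
      then show "FO ?J F \<in> Obj ?C" using is_functor_comp[OF J, of D F] PQ by simp
      interpret F: fctr E D F using F by unfold_locales simp
      show "FM ?J (Ident ?E F) = Ident ?C (FO ?J F)"
        using F nat_trans_Ident[of E D F] by (auto intro!: restrict_ext)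
    next
      fix f assume "f \<in> Arr ?E"
      then obtain F \<alpha> G where f: "f = (F, \<alpha>, G)" "is_functor E D F" "P F" "is_functor E D G" "P G" "is_nat_trans E D F G \<alpha>"
        by (cases f) auto
      show "in_hom ?C (FM ?J f) (FO ?J (Dom ?E f)) (FO ?J (Cod ?E f))"
        using f nat_trans_precomp[OF J f(6)] is_functor_comp[OF J f(2)] is_functor_comp[OF J f(4)] PQ by simp
      fix g assume "g \<in> Arr ?E" "Cod ?E f = Dom ?E g"
      then obtain \<beta> H where g: "g = (G, \<beta>, H)" "is_functor E D H" "P H" "is_nat_trans E D G H \<beta>"
        using f by (cases g) auto
      show "FM ?J (Comp ?E g f) = Comp ?C (FM ?J g) (FM ?J f)"
        using f g nat_trans_comp[OF f(2,4) g(2) f(6) g(4)] by (auto intro!: restrict_ext)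
    qed
    fix f g assume fg: "f \<in> Arr ?E" "g \<in> Arr ?E" "Dom ?E f = Dom ?E g" "Cod ?E f = Cod ?E g" "FM ?J f = FM ?J g"
    obtain F \<alpha> G where f: "f = (F, \<alpha>, G)" "is_functor E D F" "P F" "is_functor E D G" "P G" "is_nat_trans E D F G \<alpha>"
      using fg(1) by (cases f) auto
    obtain \<beta> where g: "g = (F, \<beta>, G)" "is_nat_trans E D F G \<beta>"
      using fg(2-4) f by (cases g) auto
    have "(\<lambda>X\<in>Obj C. \<alpha> (FO J X)) = (\<lambda>X\<in>Obj C. \<beta> (FO J X))" using fg(5) f g by simp
    then have "\<alpha> (FO J X) = \<beta> (FO J X)" if "X \<in> Obj C" for X using that by (metis restrict_apply')
    then have "\<alpha> = \<beta>" using unique[OF f(2-6) g(2)] by blast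
    then show "f = g" using f g by simp
  next
    fix F G g assume F: "F \<in> Obj ?E" and G: "G \<in> Obj ?E" and g: "in_hom ?C g (FO ?J F) (FO ?J G)"
    then obtain \<beta> where b: "g = (comp_functor C F J, \<beta>, comp_functor C G J)"
      "is_nat_trans C D (comp_functor C F J) (comp_functor C G J) \<beta>" by (cases g) auto
    obtain \<alpha> where a: "is_nat_trans E D F G \<alpha>" "\<forall>X\<in>Obj C. \<alpha> (FO J X) = \<beta> X"
      using extend[OF _ _ _ _ b(2)] F G by auto
    have "(\<lambda>X\<in>Obj C. \<alpha> (FO J X)) = \<beta>"
      using a(2) nat_transD(5)[OF b(2)] by (auto intro!: extensionalityI[of _ "Obj C"])
    then show "\<exists>f. in_hom ?E f F G \<and> FM ?J f = g" using F G a(1) b(1) by (intro exI[of _ "(F, \<alpha>, G)"]) auto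
  qed
  fix F assume "F \<in> Obj ?C"
  then have F: "is_functor C D F" "Q F" by auto
  then obtain G \<alpha> where G: "is_functor E D G" "P G" and a: "is_nat_trans C D (comp_functor C G J) F \<alpha>"
    "\<And>X. X \<in> Obj C \<Longrightarrow> is_iso D (\<alpha> X)" using extension[OF F] unfolding naturally_isomorphic_def by blast
  have GJ: "is_functor C D (comp_functor C G J)" by (rule is_functor_comp[OF J G(1)])
  obtain \<beta> where b: "is_nat_trans C D F (comp_functor C G J) \<beta>"
    "\<And>X. X \<in> Obj C \<Longrightarrow> \<beta> X \<cdot>\<^sub>D \<alpha> X = Ident D (FO (comp_functor C G J) X)" "\<And>X. X \<in> Obj C \<Longrightarrow> \<alpha> X \<cdot>\<^sub>D \<beta> X = Ident D (FO F X)"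
    using nat_trans_inverse[OF GJ F(1) a(1,2)] by blast
  have "is_iso ?C (comp_functor C G J, \<alpha>, F)"
    by (rule is_isoI[where g="(F, \<beta>, comp_functor C G J)"])
       (use GJ PQ[OF G] F a b in \<open>auto intro!: restrict_ext\<close>)
  then show "\<exists>X\<in>Obj ?E. \<exists>i. in_hom ?C i (FO ?J X) F \<and> is_iso ?C i"
    using G GJ PQ[OF G] F a(1) by (intro bexI[of _ G] exI[of _ "(comp_functor C G J, \<alpha>, F)"]) auto
qed

section \<open>Extension along a full subcategory of covering objects\<close>

text \<open>The situation of Stone spaces among compact Hausdorff spaces. In
  \<open>pullback_closed\<close> the common codomain of \<open>a\<close> and \<open>b\<close> is any
  object of \<open>E\<close>, so the kernel pair of a cover from \<open>C\<close> has its vertex in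
  \<open>C\<close>. \<open>cover_sub\<close> is a condition because the monomorphisms that test a
  cover range over different objects in \<open>C\<close> and in \<open>E\<close>. The operations
  coincide literally, so that \<open>simp\<close> moves everything to \<open>E\<close>.\<close>

locale covering_subcategory = E: regcat E + C: regcat C
  for E C :: "('o, 'm) category" +
  assumes Obj_sub: "Obj C \<subseteq> Obj E"
    and Arr_full [simp]: "f \<in> Arr C \<longleftrightarrow> f \<in> Arr E \<and> Dom E f \<in> Obj C \<and> Cod E f \<in> Obj C"
    and ops [simp]: "Dom C = Dom E" "Cod C = Cod E" "Ident C = Ident E" "Comp C = Comp E"
    and pullback_closed: "\<lbrakk>is_pullback E a b p q; Dom E a \<in> Obj C; Dom E b \<in> Obj C\<rbrakk> \<Longrightarrow> Dom E p \<in> Obj C"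
    and terminal_closed: "\<exists>T\<in>Obj C. is_terminal E T"
    and covering: "X \<in> Obj E \<Longrightarrow> \<exists>c. is_cover E c \<and> Cod E c = X \<and> Dom E c \<in> Obj C"
    and cover_sub: "\<lbrakk>f \<in> Arr E; Dom E f \<in> Obj C; Cod E f \<in> Obj C\<rbrakk> \<Longrightarrow> is_cover C f \<longleftrightarrow> is_cover E f"
begin

lemma Obj_CE [simp]: "X \<in> Obj C \<Longrightarrow> X \<in> Obj E"
  using Obj_sub by blast

lemma jointly_monic_sub:
  assumes "jointly_monic E p q" "Dom E p \<in> Obj C" "Cod E p \<in> Obj C" "Cod E q \<in> Obj C"
  shows "jointly_monic C p q"
  using assms unfolding jointly_monic_def by auto

lemma pullback_sub:
  assumes pb: "is_pullback E f g p q" and "Dom E f \<in> Obj C" "Dom E g \<in> Obj C" "Cod E f \<in> Obj C"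
  shows "is_pullback C f g p q"
proof (rule C.is_pullbackI)
  note sq = pullback_square[OF pb]
  have P: "Dom E p \<in> Obj C" by (rule pullback_closed[OF pb assms(2,3)])
  show "jointly_monic C p q"
    by (rule jointly_monic_sub[OF E.pullback_jointly_monic[OF pb]]) (use sq assms P in auto)
  show "\<exists>u. in_hom C u (Dom C a) (Dom C p) \<and> p \<cdot>\<^sub>C u = a \<and> q \<cdot>\<^sub>C u = b"
    if ab: "a \<in> Arr C" "b \<in> Arr C" "Dom C a = Dom C b" "Cod C a = Dom C f" "Cod C b = Dom C g" "f \<cdot>\<^sub>C a = g \<cdot>\<^sub>C b" for a b
  proof -
    obtain u where "u \<in> Arr E" "Dom E u = Dom E a" "Cod E u = Dom E p" "p \<cdot>\<^sub>E u = a" "q \<cdot>\<^sub>E u = b"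
      by (rule pullback_lift[OF pb, of a b]) (use ab in simp_all)
    then show ?thesis using P ab by (intro exI[of _ u]) simp
  qed
qed (use pullback_square[OF pb] assms in simp_all)

lemma terminal_sub:
  assumes "is_terminal E T" "T \<in> Obj C" shows "is_terminal C T"
proof -
  have "in_hom C u X T \<longleftrightarrow> in_hom E u X T" if "X \<in> Obj C" for u X using that assms(2) by auto
  then show ?thesis using assms unfolding is_terminal_def by simp
qed

lemma covering_obtain:
  assumes "X \<in> Obj E"
  obtains c where "is_cover E c" "c \<in> Arr E" "Cod E c = X" "Dom E c \<in> Obj C"
proof -
  obtain c where "is_cover E c" "Cod E c = X" "Dom E c \<in> Obj C" using covering[OF assms] by blast
  then show ?thesis using that[of c] is_cover_Arr[of E c] by simp
qed

end

locale exact_restriction = covering_subcategory E C + D: regcat D + F: lex C D F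
  for E C :: "('o, 'm) category" and D :: "('d, 'e) category" and F :: "('o, 'm, 'd, 'e) cfunctor" +
  assumes D_exact: "exact_category D"
    and F_covers: "is_cover C f \<Longrightarrow> is_cover D (FM F f)"
begin

lemma FE_Ident [simp]: "X \<in> Obj C \<Longrightarrow> FM F (Ident E X) = Ident D (FO F X)"
  using F.FM_Ident by auto

lemma FE_eq: "\<lbrakk>g \<cdot>\<^sub>E f = h; f \<in> Arr E; g \<in> Arr E; Dom E g = Cod E f; Dom E f \<in> Obj C; Cod E f \<in> Obj C; Cod E g \<in> Obj C\<rbrakk>
    \<Longrightarrow> FM F g \<cdot>\<^sub>D FM F f = FM F h"
  using F.FM_eq[of g f h] by simp

lemma FE_eq_assoc:
  "\<lbrakk>g \<cdot>\<^sub>E f = h; f \<in> Arr E; g \<in> Arr E; Dom E g = Cod E f; Dom E f \<in> Obj C; Cod E f \<in> Obj C; Cod E g \<in> Obj C;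
     x \<in> Arr D; Cod D x = FO F (Dom E f)\<rbrakk>
    \<Longrightarrow> FM F g \<cdot>\<^sub>D (FM F f \<cdot>\<^sub>D x) = FM F h \<cdot>\<^sub>D x"
  using F.FM_eq_assoc[of g f h x] by simp

lemma FE_pullback:
  assumes "is_pullback E f g p q" "Dom E f \<in> Obj C" "Dom E g \<in> Obj C" "Cod E f \<in> Obj C"
  shows "is_pullback D (FM F f) (FM F g) (FM F p) (FM F q)"
  by (rule F.pullbackF[OF pullback_sub[OF assms]])

lemma FE_jointly_monic:
  assumes "jointly_monic E p q" "Dom E p \<in> Obj C" "Cod E p \<in> Obj C" "Cod E q \<in> Obj C"
  shows "jointly_monic D (FM F p) (FM F q)"
  by (rule F.jointly_monicF[OF jointly_monic_sub[OF assms]])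

lemma FE_cover:
  assumes "is_cover E f" "Dom E f \<in> Obj C" "Cod E f \<in> Obj C"
  shows "is_cover D (FM F f)"
  using F_covers cover_sub[of f] assms is_cover_Arr[OF assms(1)] by blast

text \<open>The codomain of \<open>c\<close> need not lie in \<open>C\<close>, so \<open>F\<close>
  cannot be applied to the pullback square. What \<open>F\<close> does carry over is joint monicity,
  the reflexivity and symmetry arrows, and the composition of related pairs.\<close>

lemma kernel_pair_equivalence_relation:
  assumes pb: "is_pullback E c c r s" and c: "Dom E c \<in> Obj C"
  shows "internal_equivalence_relation D (FM F r) (FM F s)"
proof -
  note sq = pullback_square[OF pb]
  have R: "Dom E r \<in> Obj C" using pullback_closed[OF pb c c] .
  have jm: "jointly_monic D (FM F r) (FM F s)"
    by (rule FE_jointly_monic[OF E.pullback_jointly_monic[OF pb]]) (use sq c R in auto)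
  have S: "Dom E c \<in> Obj E" using sq by simp
  obtain d where d: "d \<in> Arr E" "Dom E d = Dom E c" "Cod E d = Dom E r" "r \<cdot>\<^sub>E d = Ident E (Dom E c)" "s \<cdot>\<^sub>E d = Ident E (Dom E c)"
    by (rule pullback_lift[OF pb, of "Ident E (Dom E c)" "Ident E (Dom E c)"]) (use sq S in auto)
  obtain t where t: "t \<in> Arr E" "Dom E t = Dom E r" "Cod E t = Dom E r" "r \<cdot>\<^sub>E t = s" "s \<cdot>\<^sub>E t = r"
    by (rule pullback_lift[OF pb, of s r]) (use sq in auto)
  have trans: "\<exists>w. in_hom D w (Dom D p) (Dom D (FM F r)) \<and> FM F r \<cdot>\<^sub>D w = FM F r \<cdot>\<^sub>D p \<and> FM F s \<cdot>\<^sub>D w = FM F s \<cdot>\<^sub>D q"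
    if pq: "is_pullback D (FM F s) (FM F r) p q" for p q
  proof -
    \<comment> \<open>The composition arrow is built in \<open>E\<close> on the pullback of
      \<open>s\<close> and \<open>r\<close> there; the pullback given in \<open>D\<close> maps to
      the image of that one.\<close>
    obtain p0 q0 where pb0: "is_pullback E s r p0 q0" by (rule E.pullback_ex[of s r]) (use sq in auto)
    note sq0 = pullback_square[OF pb0] and sqD = pullback_square[OF pq]
    have P: "Dom E p0 \<in> Obj C" by (rule pullback_closed[OF pb0]) (use sq R in auto)
    have "c \<cdot>\<^sub>E (r \<cdot>\<^sub>E p0) = c \<cdot>\<^sub>E (s \<cdot>\<^sub>E p0)" by (rule E.square_comp[OF sq(9)]) (use sq sq0 in auto)
    moreover have "c \<cdot>\<^sub>E (r \<cdot>\<^sub>E q0) = c \<cdot>\<^sub>E (s \<cdot>\<^sub>E q0)" by (rule E.square_comp[OF sq(9)]) (use sq sq0 in auto)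
    ultimately have "c \<cdot>\<^sub>E (r \<cdot>\<^sub>E p0) = c \<cdot>\<^sub>E (s \<cdot>\<^sub>E q0)" using sq0(9) by simp
    then obtain w0 where w0: "w0 \<in> Arr E" "Dom E w0 = Dom E p0" "Cod E w0 = Dom E r" "r \<cdot>\<^sub>E w0 = r \<cdot>\<^sub>E p0" "s \<cdot>\<^sub>E w0 = s \<cdot>\<^sub>E q0"
      using pullback_lift[OF pb, of "r \<cdot>\<^sub>E p0" "s \<cdot>\<^sub>E q0"] sq sq0 by auto
    obtain u where u: "u \<in> Arr D" "Dom D u = Dom D p" "Cod D u = Dom D (FM F p0)" "FM F p0 \<cdot>\<^sub>D u = p" "FM F q0 \<cdot>\<^sub>D u = q"
      by (rule pullback_lift[OF FE_pullback[OF pb0] sqD(3,4)]) (use sq sq0 sqD R c in auto)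
    have "FM F r \<cdot>\<^sub>D (FM F w0 \<cdot>\<^sub>D u) = FM F r \<cdot>\<^sub>D p"
      using FE_eq_assoc[OF w0(4), of u] FE_eq_assoc[of r p0 "r \<cdot>\<^sub>E p0" u] w0 u sq sq0 R P c by simp
    moreover have "FM F s \<cdot>\<^sub>D (FM F w0 \<cdot>\<^sub>D u) = FM F s \<cdot>\<^sub>D q"
      using FE_eq_assoc[OF w0(5), of u] FE_eq_assoc[of s q0 "s \<cdot>\<^sub>E q0" u] w0 u sq sq0 R P c by simp
    ultimately show ?thesis using w0 u sq sq0 R P c by (intro exI[of _ "FM F w0 \<cdot>\<^sub>D u"]) auto
  qed
  show ?thesis unfolding internal_equivalence_relation_def
  proof (intro conjI)
    show "\<exists>d. in_hom D d (Cod D (FM F r)) (Dom D (FM F r)) \<and> FM F r \<cdot>\<^sub>D d = Ident D (Cod D (FM F r)) \<and> FM F s \<cdot>\<^sub>D d = Ident D (Cod D (FM F r))"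
      using d FE_eq[OF d(4)] FE_eq[OF d(5)] sq R c by (intro exI[of _ "FM F d"]) simp
    show "\<exists>t. in_hom D t (Dom D (FM F r)) (Dom D (FM F r)) \<and> FM F r \<cdot>\<^sub>D t = FM F s \<and> FM F s \<cdot>\<^sub>D t = FM F r"
      using t FE_eq[OF t(4)] FE_eq[OF t(5)] sq R c by (intro exI[of _ "FM F t"]) simp
  qed (use jm trans sq R c in \<open>auto simp: jointly_monic_def\<close>)
qed

text \<open>\<open>Z\<close> is the value at \<open>X\<close> of the extension of \<open>F\<close>: the colimit of \<open>F\<close> over the category of arrows
  \<open>a: T \<rightarrow> X\<close> with \<open>T\<close> in \<open>C\<close>, with coprojections \<open>l a\<close>.\<close>

definition is_value :: "'o \<Rightarrow> 'd \<Rightarrow> ('m \<Rightarrow> 'e) \<Rightarrow> bool" where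
  "is_value X Z l \<longleftrightarrow> Z \<in> Obj D \<and>
     (\<forall>a. a \<in> Arr E \<and> Dom E a \<in> Obj C \<and> Cod E a = X \<longrightarrow> in_hom D (l a) (FO F (Dom E a)) Z) \<and>
     (\<forall>a t. a \<in> Arr E \<and> t \<in> Arr E \<and> Dom E a \<in> Obj C \<and> Cod E a = X \<and> Dom E t \<in> Obj C \<and> Cod E t = Dom E a \<longrightarrow>
        l (a \<cdot>\<^sub>E t) = l a \<cdot>\<^sub>D FM F t) \<and>
     (\<forall>a. is_cover E a \<and> Dom E a \<in> Obj C \<and> Cod E a = X \<longrightarrow> is_cover D (l a)) \<and>
     (\<forall>a b p q. is_pullback E a b p q \<and> Dom E a \<in> Obj C \<and> Dom E b \<in> Obj C \<and> Cod E a = X \<longrightarrow>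
        is_pullback D (l a) (l b) (FM F p) (FM F q))"

text \<open>\<open>Z\<close> is the quotient of the value of \<open>F\<close> at a covering object
  by the image of the kernel pair of the cover \<open>c\<close>. The coprojection at
  \<open>a\<close> arises by descent along the pullback of \<open>c\<close> along \<open>a\<close>.
  It satisfies \<open>l a \<cdot>\<^sub>D FM F t = e \<cdot>\<^sub>D FM F t'\<close> whenever
  \<open>a \<cdot>\<^sub>E t = c \<cdot>\<^sub>E t'\<close>, and the remaining clauses are derived
  from this equation.\<close>

lemma value_ex:
  assumes X: "X \<in> Obj E"
  shows "\<exists>Z l. is_value X Z l"
proof -
  obtain c where c: "is_cover E c" "c \<in> Arr E" "Cod E c = X" "Dom E c \<in> Obj C" by (rule covering_obtain[OF X])
  obtain r s where rs: "is_pullback E c c r s" by (rule E.pullback_ex[of c c]) (use c in auto)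
  note sq = pullback_square[OF rs]
  have R: "Dom E r \<in> Obj C" using pullback_closed[OF rs c(4) c(4)] .
  have "effective_relation D (FM F r) (FM F s)"
    using D_exact kernel_pair_equivalence_relation[OF rs c(4)] unfolding exact_category_def by blast
  then obtain e where e: "is_coequalizer D (FM F r) (FM F s) e" "is_pullback D e e (FM F r) (FM F s)"
    unfolding effective_relation_def by blast
  have ec: "is_cover D e" using D.regular_epi_cover e(1) unfolding is_regular_epi_def by blast
  have ea: "e \<in> Arr D" "Dom D e = FO F (Dom E c)" using coequalizer_square[OF e(1)] sq R c by auto
  define Z where "Z = Cod D e"
  have pbE: "\<exists>p p'. is_pullback E a c p p'" if "a \<in> Arr E" "Cod E a = X" for a
    using E.pullback_ex[of a c] that c by metis
  have "\<forall>a. a \<in> Arr E \<and> Dom E a \<in> Obj C \<and> Cod E a = X \<longrightarrow> (\<exists>l. l \<in> Arr D \<and> Dom D l = FO F (Dom E a) \<and> Cod D l = Z \<and>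
    (\<forall>t t'. t \<in> Arr E \<and> t' \<in> Arr E \<and> Dom E t \<in> Obj C \<and> Dom E t' = Dom E t \<and> Cod E t = Dom E a \<and> Cod E t' = Dom E c \<and> a \<cdot>\<^sub>E t = c \<cdot>\<^sub>E t' \<longrightarrow>
       l \<cdot>\<^sub>D FM F t = e \<cdot>\<^sub>D FM F t'))"
  proof (intro allI impI, elim conjE)
    fix a assume a: "a \<in> Arr E" "Dom E a \<in> Obj C" "Cod E a = X"
    obtain p p' where pb: "is_pullback E a c p p'" using pbE a by blast
    note sp = pullback_square[OF pb]
    have P: "Dom E p \<in> Obj C" by (rule pullback_closed[OF pb a(2) c(4)])
    have Fp: "is_cover D (FM F p)" by (rule FE_cover[OF E.cover_pullback[OF pb c(1)]]) (use P sp a in auto)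
    obtain k1 k2 where kp: "is_pullback E p p k1 k2" by (rule E.pullback_ex[of p p]) (use sp in auto)
    note sk = pullback_square[OF kp]
    have K: "Dom E k1 \<in> Obj C" by (rule pullback_closed[OF kp P P])
    have Fk: "is_pullback D (FM F p) (FM F p) (FM F k1) (FM F k2)" by (rule FE_pullback[OF kp P P]) (use sp a in auto)
    have "c \<cdot>\<^sub>E (p' \<cdot>\<^sub>E k1) = a \<cdot>\<^sub>E (p \<cdot>\<^sub>E k1)" by (rule E.square_comp[OF sp(9)[symmetric]]) (use sp sk in auto)
    moreover have "c \<cdot>\<^sub>E (p' \<cdot>\<^sub>E k2) = a \<cdot>\<^sub>E (p \<cdot>\<^sub>E k2)" by (rule E.square_comp[OF sp(9)[symmetric]]) (use sp sk in auto)
    ultimately have "c \<cdot>\<^sub>E (p' \<cdot>\<^sub>E k1) = c \<cdot>\<^sub>E (p' \<cdot>\<^sub>E k2)" using sk(9) by simp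
    \<comment> \<open>The two composites with \<open>p'\<close> have the same image under
      \<open>c\<close>, hence are related by the kernel pair, whose image \<open>e\<close>
      coequalizes.\<close>
    then obtain w where w: "w \<in> Arr E" "Dom E w = Dom E k1" "Cod E w = Dom E r" "r \<cdot>\<^sub>E w = p' \<cdot>\<^sub>E k1" "s \<cdot>\<^sub>E w = p' \<cdot>\<^sub>E k2"
      using pullback_lift[OF rs, of "p' \<cdot>\<^sub>E k1" "p' \<cdot>\<^sub>E k2"] sp sk by auto
    have "e \<cdot>\<^sub>D (FM F r \<cdot>\<^sub>D FM F w) = e \<cdot>\<^sub>D (FM F s \<cdot>\<^sub>D FM F w)"
      by (rule D.square_comp[OF coequalizer_square(7)[OF e(1)]]) (use ea w R K sq c sk in auto)
    then have "(e \<cdot>\<^sub>D FM F p') \<cdot>\<^sub>D FM F k1 = (e \<cdot>\<^sub>D FM F p') \<cdot>\<^sub>D FM F k2"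
      using FE_eq[OF w(4)] FE_eq[OF w(5)] FE_eq[of p' k1 "p' \<cdot>\<^sub>E k1"] FE_eq[of p' k2 "p' \<cdot>\<^sub>E k2"] w R K sq c sk sp P ea
      by simp
    then obtain l where l: "l \<in> Arr D" "Dom D l = FO F (Dom E a)" "Cod D l = Z" "l \<cdot>\<^sub>D FM F p = e \<cdot>\<^sub>D FM F p'"
      using coequalizer_lift[OF D.cover_coequalizer[OF Fp Fk], of "e \<cdot>\<^sub>D FM F p'"] sp sk P K a c ea Z_def by auto
    have "l \<cdot>\<^sub>D FM F t = e \<cdot>\<^sub>D FM F t'"
      if t: "t \<in> Arr E" "t' \<in> Arr E" "Dom E t \<in> Obj C" "Dom E t' = Dom E t" "Cod E t = Dom E a" "Cod E t' = Dom E c" "a \<cdot>\<^sub>E t = c \<cdot>\<^sub>E t'" for t t'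
    proof -
      obtain v where v: "v \<in> Arr E" "Dom E v = Dom E t" "Cod E v = Dom E p" "p \<cdot>\<^sub>E v = t" "p' \<cdot>\<^sub>E v = t'"
        by (rule pullback_lift[OF pb t(1,2)]) (use t in auto)
      have "l \<cdot>\<^sub>D (FM F p \<cdot>\<^sub>D FM F v) = e \<cdot>\<^sub>D (FM F p' \<cdot>\<^sub>D FM F v)"
        by (rule D.square_comp[OF l(4)]) (use l v sp P t a c ea in auto)
      then show ?thesis using FE_eq[OF v(4)] FE_eq[OF v(5)] v sp P t a c by simp
    qed
    then show "\<exists>l. l \<in> Arr D \<and> Dom D l = FO F (Dom E a) \<and> Cod D l = Z \<and>
       (\<forall>t t'. t \<in> Arr E \<and> t' \<in> Arr E \<and> Dom E t \<in> Obj C \<and> Dom E t' = Dom E t \<and> Cod E t = Dom E a \<and> Cod E t' = Dom E c \<and> a \<cdot>\<^sub>E t = c \<cdot>\<^sub>E t' \<longrightarrow>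
         l \<cdot>\<^sub>D FM F t = e \<cdot>\<^sub>D FM F t')" using l(1-3) by (intro exI[of _ l]) blast
  qed
  then obtain l where l0: "\<forall>a. a \<in> Arr E \<and> Dom E a \<in> Obj C \<and> Cod E a = X \<longrightarrow> (l a \<in> Arr D \<and> Dom D (l a) = FO F (Dom E a) \<and> Cod D (l a) = Z \<and>
    (\<forall>t t'. t \<in> Arr E \<and> t' \<in> Arr E \<and> Dom E t \<in> Obj C \<and> Dom E t' = Dom E t \<and> Cod E t = Dom E a \<and> Cod E t' = Dom E c \<and> a \<cdot>\<^sub>E t = c \<cdot>\<^sub>E t' \<longrightarrow>
       l a \<cdot>\<^sub>D FM F t = e \<cdot>\<^sub>D FM F t'))" by metis
  have l: "l a \<in> Arr D" "Dom D (l a) = FO F (Dom E a)" "Cod D (l a) = Z"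
    if "a \<in> Arr E" "Dom E a \<in> Obj C" "Cod E a = X" for a
    using l0 that by blast+
  have lt: "l a \<cdot>\<^sub>D FM F t = e \<cdot>\<^sub>D FM F t'"
    if "a \<in> Arr E" "Dom E a \<in> Obj C" "Cod E a = X" "t \<in> Arr E" "t' \<in> Arr E" "Dom E t \<in> Obj C" "Dom E t' = Dom E t"
      "Cod E t = Dom E a" "Cod E t' = Dom E c" "a \<cdot>\<^sub>E t = c \<cdot>\<^sub>E t'" for a t t'
    using l0 that by blast
  have nat: "l (a \<cdot>\<^sub>E t) = l a \<cdot>\<^sub>D FM F t"
    if a: "a \<in> Arr E" "Dom E a \<in> Obj C" "Cod E a = X" and t: "t \<in> Arr E" "Dom E t \<in> Obj C" "Cod E t = Dom E a" for a t
  proof -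
    obtain p p' where pb: "is_pullback E (a \<cdot>\<^sub>E t) c p p'" using pbE[of "a \<cdot>\<^sub>E t"] a t by auto
    note sp = pullback_square[OF pb]
    have P: "Dom E p \<in> Obj C" by (rule pullback_closed[OF pb]) (use a t c in auto)
    have pt: "Cod E p = Dom E t" using sp a t by simp
    have Fp: "is_cover D (FM F p)" by (rule FE_cover[OF E.cover_pullback[OF pb c(1)]]) (use P pt t in auto)
    have "l (a \<cdot>\<^sub>E t) \<cdot>\<^sub>D FM F p = e \<cdot>\<^sub>D FM F p'" by (rule lt) (use a t sp P in auto)
    moreover have "l a \<cdot>\<^sub>D FM F (t \<cdot>\<^sub>E p) = e \<cdot>\<^sub>D FM F p'" by (rule lt) (use a t sp P pt in auto)
    ultimately have "l (a \<cdot>\<^sub>E t) \<cdot>\<^sub>D FM F p = (l a \<cdot>\<^sub>D FM F t) \<cdot>\<^sub>D FM F p"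
      using FE_eq[of t p "t \<cdot>\<^sub>E p"] l[OF a] a t P pt sp by simp
    then show ?thesis by - (rule D.cover_epi[OF Fp], use a t l[of a] l[of "a \<cdot>\<^sub>E t"] sp P pt in auto)
  qed
  have cov: "is_cover D (l a)" if a: "is_cover E a" "Dom E a \<in> Obj C" "Cod E a = X" for a
  proof -
    have a1: "a \<in> Arr E" by (rule is_cover_Arr[OF a(1)])
    obtain p p' where pb: "is_pullback E a c p p'" using pbE a1 a by blast
    note sp = pullback_square[OF pb]
    have P: "Dom E p \<in> Obj C" by (rule pullback_closed[OF pb a(2) c(4)])
    have "is_cover D (FM F p')"
      by (rule FE_cover[OF E.cover_pullback[OF E.pullback_swap[OF pb] a(1)]]) (use P sp c in auto)
    then have "is_cover D (e \<cdot>\<^sub>D FM F p')" by (rule D.cover_comp) (use ec ea sp P c in auto)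
    moreover have "l a \<cdot>\<^sub>D FM F p = e \<cdot>\<^sub>D FM F p'" by (rule lt) (use a a1 sp P in auto)
    ultimately show ?thesis using D.cover_cancel[of "l a" "FM F p"] l[OF a1 a(2,3)] sp P a by simp
  qed
  have pull: "is_pullback D (l a) (l b) (FM F p) (FM F q)"
    if pb: "is_pullback E a b p q" and A: "Dom E a \<in> Obj C" "Dom E b \<in> Obj C" "Cod E a = X" for a b p q
  proof -
    note sq2 = pullback_square[OF pb]
    have W: "Dom E p \<in> Obj C" by (rule pullback_closed[OF pb A(1,2)])
    have a: "a \<in> Arr E" "Dom E a \<in> Obj C" "Cod E a = X" and b: "b \<in> Arr E" "Dom E b \<in> Obj C" "Cod E b = X"
      using sq2 A by auto
    show ?thesis
    proof (rule D.is_pullbackI)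
      show "jointly_monic D (FM F p) (FM F q)"
        by (rule FE_jointly_monic[OF E.pullback_jointly_monic[OF pb]]) (use sq2 W a b in auto)
      show "l a \<cdot>\<^sub>D FM F p = l b \<cdot>\<^sub>D FM F q"
        using nat[OF a, of p] nat[OF b, of q] sq2 W by simp
      \<comment> \<open>\<open>u\<close> and \<open>v\<close> are lifted locally to the pullbacks of
        the cover \<open>c\<close> along \<open>a\<close> and along \<open>b\<close>; the lifts then
        agree under \<open>e\<close>.\<close>
      fix u v assume uv: "u \<in> Arr D" "v \<in> Arr D" "Dom D u = Dom D v" "Cod D u = Dom D (l a)" "Cod D v = Dom D (l b)" "l a \<cdot>\<^sub>D u = l b \<cdot>\<^sub>D v"
      obtain pa pa' where pba: "is_pullback E a c pa pa'" using pbE a by blast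
      obtain pb pb' where pbb: "is_pullback E b c pb pb'" using pbE b by blast
      note spa = pullback_square[OF pba] and spb = pullback_square[OF pbb]
      have Pa: "Dom E pa \<in> Obj C" by (rule pullback_closed[OF pba a(2) c(4)])
      have Pb: "Dom E pb \<in> Obj C" by (rule pullback_closed[OF pbb b(2) c(4)])
      have Fpa: "is_cover D (FM F pa)" by (rule FE_cover[OF E.cover_pullback[OF pba c(1)]]) (use Pa spa a in auto)
      have Fpb: "is_cover D (FM F pb)" by (rule FE_cover[OF E.cover_pullback[OF pbb c(1)]]) (use Pb spb b in auto)
      obtain y1 u1 where y1: "is_cover D y1" "y1 \<in> Arr D" "u1 \<in> Arr D" "Cod D y1 = Dom D u" "Cod D u1 = Dom D (FM F pa)"
        "Dom D u1 = Dom D y1" "FM F pa \<cdot>\<^sub>D u1 = u \<cdot>\<^sub>D y1"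
        by (rule D.cover_lift[OF Fpa uv(1)]) (use uv l[OF a] spa Pa a in auto)
      obtain y2 v2 where y2: "is_cover D y2" "y2 \<in> Arr D" "v2 \<in> Arr D" "Cod D y2 = Dom D (v \<cdot>\<^sub>D y1)" "Cod D v2 = Dom D (FM F pb)"
        "Dom D v2 = Dom D y2" "FM F pb \<cdot>\<^sub>D v2 = (v \<cdot>\<^sub>D y1) \<cdot>\<^sub>D y2"
        by (rule D.cover_lift[OF Fpb, of "v \<cdot>\<^sub>D y1"]) (use uv y1 l[OF b] spb Pb b in auto)
      have y2c: "Cod D y2 = Dom D y1" "FM F pb \<cdot>\<^sub>D v2 = v \<cdot>\<^sub>D (y1 \<cdot>\<^sub>D y2)" using y2 y1 uv by auto
      have u1y: "u1 \<cdot>\<^sub>D y2 \<in> Arr D" "Cod D (u1 \<cdot>\<^sub>D y2) = FO F (Dom E pa)" "Dom D (u1 \<cdot>\<^sub>D y2) = Dom D y2"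
        using y1(3,5,6) y2(2) y2c(1) spa(3,7) Pa a(2) by simp_all
      have ty: "v2 \<in> Arr D" "Cod D v2 = FO F (Dom E pb)" "Dom D v2 = Dom D y2" "y2 \<in> Arr D"
        using y2(2,3,5,6) spb(3,7) Pb b(2) by simp_all
      have uy: "FM F pa \<cdot>\<^sub>D (u1 \<cdot>\<^sub>D y2) = u \<cdot>\<^sub>D (y1 \<cdot>\<^sub>D y2)"
        by (rule D.square_comp[OF y1(7)]) (use uv y1 y2 y2c spa Pa a in auto)
      have "e \<cdot>\<^sub>D (FM F pa' \<cdot>\<^sub>D (u1 \<cdot>\<^sub>D y2)) = l a \<cdot>\<^sub>D (FM F pa \<cdot>\<^sub>D (u1 \<cdot>\<^sub>D y2))"
        by (rule D.square_comp[OF lt[symmetric]]) (use uv y1 y2 y2c spa Pa a c ea l[OF a] in auto)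
      also have "\<dots> = l b \<cdot>\<^sub>D (FM F pb \<cdot>\<^sub>D v2)"
        unfolding uy y2c(2) by (rule D.square_comp[OF uv(6)]) (use uv y1 y2 y2c l[OF a] l[OF b] in auto)
      also have "\<dots> = e \<cdot>\<^sub>D (FM F pb' \<cdot>\<^sub>D v2)"
        by (rule D.square_comp[OF lt]) (use uv y1 y2 y2c spb Pb b c ea l[OF b] in auto)
      finally have ee: "e \<cdot>\<^sub>D (FM F pa' \<cdot>\<^sub>D (u1 \<cdot>\<^sub>D y2)) = e \<cdot>\<^sub>D (FM F pb' \<cdot>\<^sub>D v2)" .
      \<comment> \<open>The relation is effective: \<open>e\<close> has the images of
        \<open>r\<close> and \<open>s\<close> as kernel pair, so the agreement is witnessed by an
        element of the relation.\<close>
      obtain w where w: "w \<in> Arr D" "Dom D w = Dom D y2" "Cod D w = Dom D (FM F r)" "FM F r \<cdot>\<^sub>D w = FM F pa' \<cdot>\<^sub>D (u1 \<cdot>\<^sub>D y2)" "FM F s \<cdot>\<^sub>D w = FM F pb' \<cdot>\<^sub>D v2"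
        by (rule pullback_lift[OF e(2) _ _ _ _ _ ee]) (use u1y ty spa(4,6,8) spb(4,6,8) Pa Pb c(4) ea in simp_all)
      \<comment> \<open>\<open>F\<close> need not be faithful, so the chain from \<open>a\<close> to
        \<open>b\<close> through the relation is realized in \<open>E\<close>: two pullbacks gather
        the lift of \<open>u\<close>, the related pair and the lift of \<open>v\<close> in one
        object of \<open>C\<close>, over which \<open>a\<close> and \<open>b\<close> agree.\<close>
      obtain m1 m2 where mm: "is_pullback E pa' r m1 m2" by (rule E.pullback_ex[of pa' r]) (use spa sq in auto)
      note sm = pullback_square[OF mm]
      have M: "Dom E m1 \<in> Obj C" by (rule pullback_closed[OF mm]) (use Pa R spa in auto)
      obtain w1 where w1: "w1 \<in> Arr D" "Dom D w1 = Dom D y2" "Cod D w1 = Dom D (FM F m1)" "FM F m1 \<cdot>\<^sub>D w1 = u1 \<cdot>\<^sub>D y2" "FM F m2 \<cdot>\<^sub>D w1 = w"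
        by (rule pullback_lift[OF FE_pullback[OF mm] u1y(1) w(1)])
          (use ty u1y(2,3) w(1-3) w(4)[symmetric] spa(4,6,8) Pa R c(4) sq(3,7) in simp_all)
      obtain n1 n2 where nn: "is_pullback E (s \<cdot>\<^sub>E m2) pb' n1 n2" by (rule E.pullback_ex[of "s \<cdot>\<^sub>E m2" pb']) (use spb sq sm in auto)
      note sn = pullback_square[OF nn]
      have N: "Dom E n1 \<in> Obj C" by (rule pullback_closed[OF nn]) (use Pb M sm sq spb in auto)
      have sw: "FM F (s \<cdot>\<^sub>E m2) \<cdot>\<^sub>D w1 = FM F pb' \<cdot>\<^sub>D v2"
        using FE_eq_assoc[of s m2 "s \<cdot>\<^sub>E m2" w1] w(5) w1(1-3,5) spa(6) Pa sq(4,6,8) sm(3,4,6-8) M R c(4) by simp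
      obtain w2 where w2: "w2 \<in> Arr D" "Dom D w2 = Dom D y2" "Cod D w2 = Dom D (FM F n1)" "FM F n1 \<cdot>\<^sub>D w2 = w1" "FM F n2 \<cdot>\<^sub>D w2 = v2"
        by (rule pullback_lift[OF FE_pullback[OF nn] w1(1) y2(3) _ _ _ sw])
          (use ty w1(1-3) spa(6) Pa spb(4,6,8) Pb M R c(4) sq(3,4,6,7,8) sm(3,4,6-8) in simp_all)
      have "Dom E (s \<cdot>\<^sub>E m2) = Dom E m2"
        by (rule E.Comp_Dom[OF sm(4) sq(4)]) (simp only: sm(8) sq(6))
      then have nm: "Cod E n1 = Dom E m1" "Cod E n2 = Dom E pb" "Dom E n2 = Dom E n1" "Cod E m1 = Dom E pa"
        by (simp_all only: sn(6-8) sm(6,7) spa(6) spb(6))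
      have "a \<cdot>\<^sub>E (pa \<cdot>\<^sub>E (m1 \<cdot>\<^sub>E n1)) = c \<cdot>\<^sub>E (pa' \<cdot>\<^sub>E (m1 \<cdot>\<^sub>E n1))"
        by (rule E.square_comp[OF spa(9)]) (use spa sm sn nm in auto)
      also have "pa' \<cdot>\<^sub>E (m1 \<cdot>\<^sub>E n1) = r \<cdot>\<^sub>E (m2 \<cdot>\<^sub>E n1)" by (rule E.square_comp[OF sm(9)]) (use spa sm sn nm sq in auto)
      also have "c \<cdot>\<^sub>E (r \<cdot>\<^sub>E (m2 \<cdot>\<^sub>E n1)) = c \<cdot>\<^sub>E (s \<cdot>\<^sub>E (m2 \<cdot>\<^sub>E n1))" by (rule E.square_comp[OF sq(9)]) (use sq sm sn nm in auto)
      also have "s \<cdot>\<^sub>E (m2 \<cdot>\<^sub>E n1) = pb' \<cdot>\<^sub>E n2" using sn(9) sq sm nm sn by simp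
      also have "c \<cdot>\<^sub>E (pb' \<cdot>\<^sub>E n2) = b \<cdot>\<^sub>E (pb \<cdot>\<^sub>E n2)" by (rule E.square_comp[OF spb(9)[symmetric]]) (use spb sn nm in auto)
      finally obtain t where t: "t \<in> Arr E" "Dom E t = Dom E n1" "Cod E t = Dom E p" "p \<cdot>\<^sub>E t = pa \<cdot>\<^sub>E (m1 \<cdot>\<^sub>E n1)" "q \<cdot>\<^sub>E t = pb \<cdot>\<^sub>E n2"
        using pullback_lift[OF pb, of "pa \<cdot>\<^sub>E (m1 \<cdot>\<^sub>E n1)" "pb \<cdot>\<^sub>E n2"] spa spb sm sn nm by auto
      have w2c: "Cod D w2 = FO F (Dom E n1)" using w2 sn N nm M by auto
      have "FM F p \<cdot>\<^sub>D (FM F t \<cdot>\<^sub>D w2) = FM F (pa \<cdot>\<^sub>E (m1 \<cdot>\<^sub>E n1)) \<cdot>\<^sub>D w2"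
        by (rule FE_eq_assoc[OF t(4)]) (use t sq2 W N a w2 w2c in auto)
      also have "\<dots> = FM F pa \<cdot>\<^sub>D (FM F (m1 \<cdot>\<^sub>E n1) \<cdot>\<^sub>D w2)"
        by (rule FE_eq_assoc[symmetric]) (use spa sm sn nm Pa N a w2 w2c in auto)
      also have "FM F (m1 \<cdot>\<^sub>E n1) \<cdot>\<^sub>D w2 = FM F m1 \<cdot>\<^sub>D (FM F n1 \<cdot>\<^sub>D w2)"
        by (rule FE_eq_assoc[symmetric]) (use spa sm sn nm Pa N M a w2 w2c in auto)
      finally have z1: "FM F p \<cdot>\<^sub>D (FM F t \<cdot>\<^sub>D w2) = u \<cdot>\<^sub>D (y1 \<cdot>\<^sub>D y2)" using w2 w1 uy by simp
      have "FM F q \<cdot>\<^sub>D (FM F t \<cdot>\<^sub>D w2) = FM F (pb \<cdot>\<^sub>E n2) \<cdot>\<^sub>D w2"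
        by (rule FE_eq_assoc[OF t(5)]) (use t sq2 W N b w2 w2c in auto)
      also have "\<dots> = FM F pb \<cdot>\<^sub>D (FM F n2 \<cdot>\<^sub>D w2)"
        by (rule FE_eq_assoc[symmetric]) (use spb sn nm Pb N b w2 w2c in auto)
      finally have z2: "FM F q \<cdot>\<^sub>D (FM F t \<cdot>\<^sub>D w2) = v \<cdot>\<^sub>D (y1 \<cdot>\<^sub>D y2)" using w2 y2c by simp
      \<comment> \<open>The solution found over the cover descends by joint monicity.\<close>
      obtain z where "z \<in> Arr D" "Dom D z = Cod D (y1 \<cdot>\<^sub>D y2)" "Cod D z = Dom D (FM F p)" "FM F p \<cdot>\<^sub>D z = u" "FM F q \<cdot>\<^sub>D z = v"
        by (rule D.cover_jointly_monic_lift[OF D.cover_comp[OF y2(1) y1(1)] FE_jointly_monic[OF E.pullback_jointly_monic[OF pb]] _ _ _ _ _ _ _ _ _ z1 z2])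
          (use sq2 W a b t N w2 w2c y1 y2 y2c uv l[OF a] l[OF b] in auto)
      then show "\<exists>z. in_hom D z (Dom D u) (Dom D (FM F p)) \<and> FM F p \<cdot>\<^sub>D z = u \<and> FM F q \<cdot>\<^sub>D z = v"
        using y1 y2 y2c by (intro exI[of _ z]) auto
    qed (use l[OF a] l[OF b] sq2 W a b in auto)
  qed
  have "is_value X Z l" unfolding is_value_def
    using l nat cov pull ea Z_def by simp
  then show ?thesis by blast
qed

end

section \<open>The extension is an exact functor\<close>

context exact_restriction
begin

definition val :: "'o \<Rightarrow> 'd" where
  "val X = (SOME Z. \<exists>l. is_value X Z l)"

text \<open>The family is chosen once for each codomain, so that all legs into the same object are
  coprojections of one value.\<close>

definition leg :: "'m \<Rightarrow> 'e" where
  "leg a = (SOME l. is_value (Cod E a) (val (Cod E a)) l) a"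

lemma is_value_val: "X \<in> Obj E \<Longrightarrow> is_value X (val X) (SOME l. is_value X (val X) l)"
  unfolding val_def using someI_ex[OF value_ex] by (rule someI_ex)

lemma val_Obj [simp]: "X \<in> Obj E \<Longrightarrow> val X \<in> Obj D"
  using is_value_val unfolding is_value_def by blast

lemma leg_in_hom: "\<lbrakk>a \<in> Arr E; Dom E a \<in> Obj C\<rbrakk> \<Longrightarrow> in_hom D (leg a) (FO F (Dom E a)) (val (Cod E a))"
  using is_value_val[of "Cod E a"] unfolding is_value_def leg_def by simp

lemma leg_Arr [simp]: "\<lbrakk>a \<in> Arr E; Dom E a \<in> Obj C\<rbrakk> \<Longrightarrow> leg a \<in> Arr D"
  and leg_Dom [simp]: "\<lbrakk>a \<in> Arr E; Dom E a \<in> Obj C\<rbrakk> \<Longrightarrow> Dom D (leg a) = FO F (Dom E a)"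
  and leg_Cod [simp]: "\<lbrakk>a \<in> Arr E; Dom E a \<in> Obj C\<rbrakk> \<Longrightarrow> Cod D (leg a) = val (Cod E a)"
  using leg_in_hom by auto

lemma leg_comp:
  assumes "a \<in> Arr E" "t \<in> Arr E" "Dom E a \<in> Obj C" "Dom E t \<in> Obj C" "Cod E t = Dom E a"
  shows "leg (a \<cdot>\<^sub>E t) = leg a \<cdot>\<^sub>D FM F t"
proof -
  have "is_value (Cod E a) (val (Cod E a)) (SOME l. is_value (Cod E a) (val (Cod E a)) l)"
    using is_value_val assms by simp
  then show ?thesis using assms unfolding is_value_def leg_def by auto
qed

lemma leg_eq_assoc:
  assumes "a \<cdot>\<^sub>E t = b" "a \<in> Arr E" "t \<in> Arr E" "Dom E a \<in> Obj C" "Dom E t \<in> Obj C" "Cod E t = Dom E a"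
    "x \<in> Arr D" "Cod D x = FO F (Dom E t)"
  shows "leg a \<cdot>\<^sub>D (FM F t \<cdot>\<^sub>D x) = leg b \<cdot>\<^sub>D x"
  by (rule D.reassoc[OF leg_comp[symmetric, of a t, unfolded assms(1)]]) (use assms in auto)

lemma leg_cover: "\<lbrakk>is_cover E a; Dom E a \<in> Obj C\<rbrakk> \<Longrightarrow> is_cover D (leg a)"
  using is_value_val[of "Cod E a"] is_cover_Arr[of E a] unfolding is_value_def leg_def by simp

lemma leg_pullback:
  assumes pb: "is_pullback E a b p q" and "Dom E a \<in> Obj C" "Dom E b \<in> Obj C"
  shows "is_pullback D (leg a) (leg b) (FM F p) (FM F q)"
proof -
  note sq = pullback_square[OF pb]
  have "is_value (Cod E a) (val (Cod E a)) (SOME l. is_value (Cod E a) (val (Cod E a)) l)"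
    using is_value_val sq by simp
  then show ?thesis using assms sq unfolding is_value_def leg_def by auto
qed

text \<open>Already the leg of a single cover from \<open>C\<close> is a cover, hence epic.\<close>

lemma leg_jointly_epic:
  assumes X: "X \<in> Obj E" and gh: "g \<in> Arr D" "h \<in> Arr D" "Dom D g = val X" "Dom D h = val X" "Cod D g = Cod D h"
    and eq: "\<And>a. \<lbrakk>a \<in> Arr E; Dom E a \<in> Obj C; Cod E a = X\<rbrakk> \<Longrightarrow> g \<cdot>\<^sub>D leg a = h \<cdot>\<^sub>D leg a"
  shows "g = h"
proof -
  obtain c where c: "is_cover E c" "c \<in> Arr E" "Cod E c = X" "Dom E c \<in> Obj C" by (rule covering_obtain[OF X])
  show ?thesis by (rule D.cover_epi[OF leg_cover[OF c(1,4)]]) (use c gh eq in auto)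
qed

text \<open>Brings an equation between legs back to \<open>E\<close>: an element on which the legs
  of \<open>a\<close> and \<open>b\<close> agree comes from an object of \<open>C\<close> on which
  \<open>a\<close> and \<open>b\<close> themselves agree. The element lifts to the pullback of
  \<open>a\<close> and \<open>b\<close> with \<open>z\<close> as both components, and then to the
  equalizer of the two projections.\<close>

lemma leg_equalizer:
  assumes ab: "a \<in> Arr E" "b \<in> Arr E" "Dom E b = Dom E a" "Cod E b = Cod E a" "Dom E a \<in> Obj C"
    and z: "z \<in> Arr D" "Cod D z = FO F (Dom E a)" "leg a \<cdot>\<^sub>D z = leg b \<cdot>\<^sub>D z"
  obtains e z' where "e \<in> Arr E" "Dom E e \<in> Obj C" "Cod E e = Dom E a" "a \<cdot>\<^sub>E e = b \<cdot>\<^sub>E e"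
    "z' \<in> Arr D" "Dom D z' = Dom D z" "Cod D z' = FO F (Dom E e)" "FM F e \<cdot>\<^sub>D z' = z"
proof -
  obtain m1 m2 where pb: "is_pullback E a b m1 m2" by (rule E.pullback_ex[of a b]) (use ab in auto)
  note sq = pullback_square[OF pb]
  have M: "Dom E m1 \<in> Obj C" by (rule pullback_closed[OF pb]) (use ab in auto)
  obtain w where w: "w \<in> Arr D" "Dom D w = Dom D z" "Cod D w = Dom D (FM F m1)" "FM F m1 \<cdot>\<^sub>D w = z" "FM F m2 \<cdot>\<^sub>D w = z"
    by (rule pullback_lift[OF leg_pullback[OF pb] z(1) z(1)]) (use ab z in auto)
  have m: "m1 \<in> Arr C" "m2 \<in> Arr C" "Dom C m1 = Dom C m2" "Cod C m1 = Cod C m2" using sq M ab by auto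
  obtain e where e: "is_equalizer C m1 m2 e" "is_equalizer D (FM F m1) (FM F m2) (FM F e)"
    by (rule F.equalizer_pres[OF m])
  note eq = equalizer_square[OF e(1)]
  have ea: "e \<in> Arr E" "Dom E e \<in> Obj C" "Cod E e = Dom E m1" "m1 \<cdot>\<^sub>E e = m2 \<cdot>\<^sub>E e" using eq by auto
  obtain z' where z': "z' \<in> Arr D" "Dom D z' = Dom D w" "Cod D z' = Dom D (FM F e)" "FM F e \<cdot>\<^sub>D z' = w"
    by (rule D.equalizer_lift[OF e(2) w(1)]) (use w in auto)
  have z'c: "Cod D z' = FO F (Dom E e)" using z' ea M by auto
  have "a \<cdot>\<^sub>E (m1 \<cdot>\<^sub>E e) = b \<cdot>\<^sub>E (m2 \<cdot>\<^sub>E e)" by (rule E.square_comp[OF sq(9)]) (use sq ea in auto)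
  then have "a \<cdot>\<^sub>E (m1 \<cdot>\<^sub>E e) = b \<cdot>\<^sub>E (m1 \<cdot>\<^sub>E e)" using ea(4) by simp
  moreover have "FM F (m1 \<cdot>\<^sub>E e) \<cdot>\<^sub>D z' = z"
    using FE_eq_assoc[of m1 e "m1 \<cdot>\<^sub>E e" z'] sq(3,7) M ab(5) ea(1-3) z'(1,4) z'c w(4) by simp
  ultimately show ?thesis using that[of "m1 \<cdot>\<^sub>E e" z'] sq(3,7) ea(1-3) z'(1,2) z'c w(2) by simp
qed

text \<open>Two applications of \<open>cover_lift\<close> in succession, so that both lifts live
  over the same cover.\<close>

lemma leg_lifts:
  assumes u: "u \<in> Arr D" "Cod D u = val (Cod E c)" and v: "v \<in> Arr D" "Cod D v = val (Cod E d)" "Dom D v = Dom D u"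
    and c: "is_cover E c" "Dom E c \<in> Obj C" and d: "is_cover E d" "Dom E d \<in> Obj C"
  obtains y u' v' where "is_cover D y" "y \<in> Arr D" "Cod D y = Dom D u"
    "u' \<in> Arr D" "Dom D u' = Dom D y" "Cod D u' = FO F (Dom E c)" "leg c \<cdot>\<^sub>D u' = u \<cdot>\<^sub>D y"
    "v' \<in> Arr D" "Dom D v' = Dom D y" "Cod D v' = FO F (Dom E d)" "leg d \<cdot>\<^sub>D v' = v \<cdot>\<^sub>D y"
proof -
  have cd: "c \<in> Arr E" "d \<in> Arr E" using is_cover_Arr[OF c(1)] is_cover_Arr[OF d(1)] by auto
  obtain y1 u1 where y1: "is_cover D y1" "y1 \<in> Arr D" "u1 \<in> Arr D" "Cod D y1 = Dom D u" "Cod D u1 = Dom D (leg c)"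
    "Dom D u1 = Dom D y1" "leg c \<cdot>\<^sub>D u1 = u \<cdot>\<^sub>D y1"
    by (rule D.cover_lift[OF leg_cover[OF c] u(1)]) (use u cd c in auto)
  obtain y2 v2 where y2: "is_cover D y2" "y2 \<in> Arr D" "v2 \<in> Arr D" "Cod D y2 = Dom D (v \<cdot>\<^sub>D y1)" "Cod D v2 = Dom D (leg d)"
    "Dom D v2 = Dom D y2" "leg d \<cdot>\<^sub>D v2 = (v \<cdot>\<^sub>D y1) \<cdot>\<^sub>D y2"
    by (rule D.cover_lift[OF leg_cover[OF d], of "v \<cdot>\<^sub>D y1"]) (use v y1 cd d in auto)
  have y2c: "Cod D y2 = Dom D y1" using y2 y1 v by auto
  have 1: "is_cover D (y1 \<cdot>\<^sub>D y2)" by (rule D.cover_comp[OF y2(1) y1(1)]) (use y2c in auto)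
  have 2: "leg c \<cdot>\<^sub>D (u1 \<cdot>\<^sub>D y2) = u \<cdot>\<^sub>D (y1 \<cdot>\<^sub>D y2)" by (rule D.square_comp[OF y1(7)]) (use y1 y2 y2c u cd c in auto)
  have 3: "leg d \<cdot>\<^sub>D v2 = v \<cdot>\<^sub>D (y1 \<cdot>\<^sub>D y2)" using y2(7) y1(2,4) y2(2) y2c v by simp
  show ?thesis by (rule that[of "y1 \<cdot>\<^sub>D y2" "u1 \<cdot>\<^sub>D y2" v2, OF 1 _ _ _ _ _ 2 _ _ _ 3]) (use y1 y2 y2c u cd c d in auto)
qed

definition ext_map :: "'m \<Rightarrow> 'e" where
  "ext_map f = (SOME g. in_hom D g (val (Dom E f)) (val (Cod E f)) \<and>
     (\<forall>a. a \<in> Arr E \<and> Dom E a \<in> Obj C \<and> Cod E a = Dom E f \<longrightarrow> g \<cdot>\<^sub>D leg a = leg (f \<cdot>\<^sub>E a)))"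

text \<open>Descent along the leg of a cover: the leg of \<open>f \<cdot>\<^sub>E c\<close>
  coequalizes the image of the kernel pair of \<open>c\<close>. For an arbitrary \<open>a\<close>
  the equation is checked after restriction to the pullback of \<open>c\<close> along
  \<open>a\<close>.\<close>

lemma ext_map_ex:
  assumes f: "f \<in> Arr E"
  shows "\<exists>g. in_hom D g (val (Dom E f)) (val (Cod E f)) \<and>
     (\<forall>a. a \<in> Arr E \<and> Dom E a \<in> Obj C \<and> Cod E a = Dom E f \<longrightarrow> g \<cdot>\<^sub>D leg a = leg (f \<cdot>\<^sub>E a))"
proof -
  obtain c where c: "is_cover E c" "c \<in> Arr E" "Cod E c = Dom E f" "Dom E c \<in> Obj C" by (rule covering_obtain[of "Dom E f"]) (use f in auto)
  obtain r s where rs: "is_pullback E c c r s" by (rule E.pullback_ex[of c c]) (use c in auto)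
  note sq = pullback_square[OF rs]
  have R: "Dom E r \<in> Obj C" using pullback_closed[OF rs c(4) c(4)] .
  have co: "is_coequalizer D (FM F r) (FM F s) (leg c)"
    by (rule D.cover_coequalizer[OF leg_cover[OF c(1,4)] leg_pullback[OF rs c(4) c(4)]])
  have "leg (f \<cdot>\<^sub>E c) \<cdot>\<^sub>D FM F r = leg ((f \<cdot>\<^sub>E c) \<cdot>\<^sub>E r)" by (rule leg_comp[symmetric]) (use f c sq R in auto)
  also have "(f \<cdot>\<^sub>E c) \<cdot>\<^sub>E r = (f \<cdot>\<^sub>E c) \<cdot>\<^sub>E s" using f c sq by simp
  also have "leg \<dots> = leg (f \<cdot>\<^sub>E c) \<cdot>\<^sub>D FM F s" by (rule leg_comp) (use f c sq R in auto)
  finally obtain g where g: "g \<in> Arr D" "Dom D g = val (Dom E f)" "Cod D g = val (Cod E f)" "g \<cdot>\<^sub>D leg c = leg (f \<cdot>\<^sub>E c)"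
    using coequalizer_lift[OF co, of "leg (f \<cdot>\<^sub>E c)"] f c sq R by auto
  have "g \<cdot>\<^sub>D leg a = leg (f \<cdot>\<^sub>E a)" if a: "a \<in> Arr E" "Dom E a \<in> Obj C" "Cod E a = Dom E f" for a
  proof -
    obtain p p' where pb: "is_pullback E a c p p'" by (rule E.pullback_ex[of a c]) (use a c in auto)
    note sp = pullback_square[OF pb]
    have P: "Dom E p \<in> Obj C" by (rule pullback_closed[OF pb a(2) c(4)])
    have Fp: "is_cover D (FM F p)" by (rule FE_cover[OF E.cover_pullback[OF pb c(1)]]) (use P sp a in auto)
    have "leg a \<cdot>\<^sub>D FM F p = leg c \<cdot>\<^sub>D FM F p'"
      using leg_comp[of a p] leg_comp[of c p'] sp P a(2) c(4) by simp
    then have "g \<cdot>\<^sub>D (leg a \<cdot>\<^sub>D FM F p) = g \<cdot>\<^sub>D (leg c \<cdot>\<^sub>D FM F p')" by simp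
    also have "\<dots> = leg (f \<cdot>\<^sub>E c) \<cdot>\<^sub>D FM F p'"
      by (rule D.reassoc[OF g(4)]) (use g sp(4,6,8) P c in auto)
    also have "\<dots> = leg ((f \<cdot>\<^sub>E c) \<cdot>\<^sub>E p')" by (rule leg_comp[symmetric]) (use f sp(4,6,8) P c in auto)
    also have "(f \<cdot>\<^sub>E c) \<cdot>\<^sub>E p' = (f \<cdot>\<^sub>E a) \<cdot>\<^sub>E p" using f a(1,3) c(2,3) sp(3,4,6-9) by simp
    also have "leg \<dots> = leg (f \<cdot>\<^sub>E a) \<cdot>\<^sub>D FM F p" by (rule leg_comp) (use f a sp(3,7) P in auto)
    finally have *: "g \<cdot>\<^sub>D (leg a \<cdot>\<^sub>D FM F p) = leg (f \<cdot>\<^sub>E a) \<cdot>\<^sub>D FM F p" .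
    show ?thesis
      by (rule D.cover_epi[OF Fp]) (use * f g(1-3) a sp(3,7) P in simp_all)
  qed
  then show ?thesis using g by (intro exI[of _ g]) auto
qed

lemma ext_map_Arr [simp]: "f \<in> Arr E \<Longrightarrow> ext_map f \<in> Arr D"
  and ext_map_Dom [simp]: "f \<in> Arr E \<Longrightarrow> Dom D (ext_map f) = val (Dom E f)"
  and ext_map_Cod [simp]: "f \<in> Arr E \<Longrightarrow> Cod D (ext_map f) = val (Cod E f)"
  and ext_map_leg: "\<lbrakk>f \<in> Arr E; a \<in> Arr E; Dom E a \<in> Obj C; Cod E a = Dom E f\<rbrakk> \<Longrightarrow> ext_map f \<cdot>\<^sub>D leg a = leg (f \<cdot>\<^sub>E a)"
  using someI_ex[OF ext_map_ex, of f] unfolding ext_map_def[symmetric] by auto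

lemma ext_map_leg_assoc:
  "\<lbrakk>f \<cdot>\<^sub>E a = b; f \<in> Arr E; a \<in> Arr E; Dom E a \<in> Obj C; Cod E a = Dom E f; x \<in> Arr D; Cod D x = FO F (Dom E a)\<rbrakk>
    \<Longrightarrow> ext_map f \<cdot>\<^sub>D (leg a \<cdot>\<^sub>D x) = leg b \<cdot>\<^sub>D x"
  using D.reassoc[OF ext_map_leg, of f a x] by simp

definition extension :: "('o, 'm, 'd, 'e) cfunctor" where
  "extension = \<lparr>FO = \<lambda>X\<in>Obj E. val X, FM = \<lambda>f\<in>Arr E. ext_map f\<rparr>"

lemma extension_FO [simp]: "X \<in> Obj E \<Longrightarrow> FO extension X = val X"
  and extension_FM [simp]: "f \<in> Arr E \<Longrightarrow> FM extension f = ext_map f"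
  by (simp_all add: extension_def)

lemma extension_functor: "is_functor E D extension"
  unfolding is_functor_def
proof (intro conjI ballI impI)
  show "FO extension \<in> extensional (Obj E)" "FM extension \<in> extensional (Arr E)"
    by (auto simp: extension_def)
  show "FM extension (Ident E X) = Ident D (FO extension X)" if X: "X \<in> Obj E" for X
    by (rule leg_jointly_epic[OF X]) (use X in \<open>auto simp: ext_map_leg\<close>)
  show "FM extension (g \<cdot>\<^sub>E f) = FM extension g \<cdot>\<^sub>D FM extension f"
    if fg: "f \<in> Arr E" "g \<in> Arr E" "Cod E f = Dom E g" for f g
  proof (rule leg_jointly_epic[of "Dom E f"])
    fix a assume "a \<in> Arr E" "Dom E a \<in> Obj C" "Cod E a = Dom E f"
    then show "FM extension (g \<cdot>\<^sub>E f) \<cdot>\<^sub>D leg a = (FM extension g \<cdot>\<^sub>D FM extension f) \<cdot>\<^sub>D leg a"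
      using fg by (simp add: ext_map_leg)
  qed (use fg in auto)
qed (use E.cat D.cat in auto)

sublocale X: fctr E D extension by unfold_locales (rule extension_functor)

lemma extension_terminal: "preserves_terminal E D extension"
  unfolding preserves_terminal_def
proof (intro allI impI)
  fix T assume T: "is_terminal E T"
  then have T1: "T \<in> Obj E" by (simp add: is_terminal_def)
  obtain T0 where T0: "T0 \<in> Obj C" "is_terminal E T0" using terminal_closed by blast
  have FT: "is_terminal D (FO F T0)" by (rule F.terminalF[OF terminal_sub[OF T0(2,1)]])
  obtain t where t: "t \<in> Arr E" "Dom E t = T0" "Cod E t = T" by (rule E.terminal_ex[OF T, of T0]) (use T0 in auto)
  have ex: "\<exists>!u. in_hom D u Y (val T)" if Y: "Y \<in> Obj D" for Y
  proof (rule ex_ex1I)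
    obtain y where "y \<in> Arr D" "Dom D y = Y" "Cod D y = FO F T0" by (rule D.terminal_ex[OF FT Y])
    then show "\<exists>u. in_hom D u Y (val T)" using t T0 by (intro exI[of _ "leg t \<cdot>\<^sub>D y"]) auto
    fix u v assume uv: "in_hom D u Y (val T)" "in_hom D v Y (val T)"
    obtain c where c: "is_cover E c" "c \<in> Arr E" "Cod E c = T" "Dom E c \<in> Obj C" by (rule covering_obtain[OF T1])
    obtain y u' v' where y: "is_cover D y" "y \<in> Arr D" "Cod D y = Dom D u"
      "u' \<in> Arr D" "Dom D u' = Dom D y" "Cod D u' = FO F (Dom E c)" "leg c \<cdot>\<^sub>D u' = u \<cdot>\<^sub>D y"
      "v' \<in> Arr D" "Dom D v' = Dom D y" "Cod D v' = FO F (Dom E c)" "leg c \<cdot>\<^sub>D v' = v \<cdot>\<^sub>D y"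
      by (rule leg_lifts[of u c v c]) (use uv c in auto)
    obtain s where s: "s \<in> Arr E" "Dom E s = Dom E c" "Cod E s = T0" by (rule E.terminal_ex[OF T0(2), of "Dom E c"]) (use c in auto)
    \<comment> \<open>The leg of \<open>c\<close> passes through the terminal object
      \<open>FO F T0\<close>, where both lifts become equal.\<close>
    have ts: "t \<cdot>\<^sub>E s = c" by (rule E.terminal_unique[OF T]) (use t s c in auto)
    have "FM F s \<cdot>\<^sub>D u' = FM F s \<cdot>\<^sub>D v'" by (rule D.terminal_unique[OF FT]) (use y s c T0 in auto)
    then have "leg c \<cdot>\<^sub>D u' = leg c \<cdot>\<^sub>D v'"
      using leg_eq_assoc[OF ts, of u'] leg_eq_assoc[OF ts, of v'] t s c T0 y by simp
    then have "u \<cdot>\<^sub>D y = v \<cdot>\<^sub>D y" using y by simp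
    then show "u = v" by - (rule D.cover_epi[OF y(1)], use uv y in auto)
  qed
  show "is_terminal D (FO extension T)" unfolding is_terminal_def using ex T1 by simp
qed

text \<open>Elements of the values are represented locally by elements of \<open>F\<close> at
  covering objects. Equalities between legs are converted by \<open>leg_pullback\<close> and
  \<open>leg_equalizer\<close> into arrows and equations of \<open>E\<close>, where the given
  pullback applies; the outcome descends along the cover.\<close>

lemma extension_pullbacks: "preserves_pullbacks E D extension"
  unfolding preserves_pullbacks_def
proof (intro allI impI)
  fix f g p q assume pb: "is_pullback E f g p q"
  note sq = pullback_square[OF pb]
  have X: "Dom E f \<in> Obj E" "Dom E g \<in> Obj E" "Dom E p \<in> Obj E" using sq by auto
  show "is_pullback D (FM extension f) (FM extension g) (FM extension p) (FM extension q)"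
  proof (rule D.is_pullbackI)
    show "FM extension f \<cdot>\<^sub>D FM extension p = FM extension g \<cdot>\<^sub>D FM extension q"
      by (rule X.FM_square[OF sq(9)]) (use sq in auto)
    show "jointly_monic D (FM extension p) (FM extension q)"
      unfolding jointly_monic_def
    proof (intro conjI ballI impI)
      fix u v assume u: "u \<in> Arr D" and v: "v \<in> Arr D" and "Dom D u = Dom D v \<and> Cod D u = Dom D (FM extension p) \<and>
        Cod D v = Dom D (FM extension p) \<and> FM extension p \<cdot>\<^sub>D u = FM extension p \<cdot>\<^sub>D v \<and> FM extension q \<cdot>\<^sub>D u = FM extension q \<cdot>\<^sub>D v"
      then have uv: "Dom D v = Dom D u" "Cod D u = val (Dom E p)" "Cod D v = val (Dom E p)"
        "ext_map p \<cdot>\<^sub>D u = ext_map p \<cdot>\<^sub>D v" "ext_map q \<cdot>\<^sub>D u = ext_map q \<cdot>\<^sub>D v" using sq by auto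
      obtain c where c: "is_cover E c" "c \<in> Arr E" "Cod E c = Dom E p" "Dom E c \<in> Obj C" by (rule covering_obtain[OF X(3)])
      obtain y u' v' where y: "is_cover D y" "y \<in> Arr D" "Cod D y = Dom D u"
        "u' \<in> Arr D" "Dom D u' = Dom D y" "Cod D u' = FO F (Dom E c)" "leg c \<cdot>\<^sub>D u' = u \<cdot>\<^sub>D y"
        "v' \<in> Arr D" "Dom D v' = Dom D y" "Cod D v' = FO F (Dom E c)" "leg c \<cdot>\<^sub>D v' = v \<cdot>\<^sub>D y"
        by (rule leg_lifts[of u c v c]) (use u v uv c in auto)
      have pq: "leg (p \<cdot>\<^sub>E c) \<cdot>\<^sub>D u' = leg (p \<cdot>\<^sub>E c) \<cdot>\<^sub>D v'" "leg (q \<cdot>\<^sub>E c) \<cdot>\<^sub>D u' = leg (q \<cdot>\<^sub>E c) \<cdot>\<^sub>D v'"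
      proof -
        have e: "ext_map h \<cdot>\<^sub>D (u \<cdot>\<^sub>D y) = ext_map h \<cdot>\<^sub>D (v \<cdot>\<^sub>D y)" if "h = p \<or> h = q" for h
          using that D.square_comp[OF uv(4), of y] D.square_comp[OF uv(5), of y] u v uv(1-3) y(2,3) sq(3,4,6) by auto
        show "leg (p \<cdot>\<^sub>E c) \<cdot>\<^sub>D u' = leg (p \<cdot>\<^sub>E c) \<cdot>\<^sub>D v'"
          using e[of p] ext_map_leg_assoc[of p c "p \<cdot>\<^sub>E c" u'] ext_map_leg_assoc[of p c "p \<cdot>\<^sub>E c" v'] sq(3) c(2-4) y by simp
        show "leg (q \<cdot>\<^sub>E c) \<cdot>\<^sub>D u' = leg (q \<cdot>\<^sub>E c) \<cdot>\<^sub>D v'"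
          using e[of q] ext_map_leg_assoc[of q c "q \<cdot>\<^sub>E c" u'] ext_map_leg_assoc[of q c "q \<cdot>\<^sub>E c" v'] sq(4,6) c(2-4) y by simp
      qed
      have pc: "p \<cdot>\<^sub>E c \<in> Arr E" "Dom E (p \<cdot>\<^sub>E c) = Dom E c" "q \<cdot>\<^sub>E c \<in> Arr E" "Dom E (q \<cdot>\<^sub>E c) = Dom E c" using sq(3,4,6) c by auto
      \<comment> \<open>\<open>u'\<close> and \<open>v'\<close> agree under the leg of
        \<open>p \<cdot>\<^sub>E c\<close>, so they are the components of an element
        \<open>w\<close> at the kernel pair of that arrow. After restriction to where the composites
        with \<open>q\<close> agree too, joint monicity of \<open>p\<close> and \<open>q\<close>
        identifies the components under \<open>c\<close>.\<close>
      obtain k1 k2 where kp: "is_pullback E (p \<cdot>\<^sub>E c) (p \<cdot>\<^sub>E c) k1 k2" by (rule E.pullback_ex[of "p \<cdot>\<^sub>E c" "p \<cdot>\<^sub>E c"]) (use pc in auto)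
      note sk = pullback_square[OF kp, unfolded pc(2)]
      have K: "Dom E k1 \<in> Obj C" by (rule pullback_closed[OF kp]) (use pc c in auto)
      obtain w where w: "w \<in> Arr D" "Dom D w = Dom D u'" "Cod D w = Dom D (FM F k1)" "FM F k1 \<cdot>\<^sub>D w = u'" "FM F k2 \<cdot>\<^sub>D w = v'"
        by (rule pullback_lift[OF leg_pullback[OF kp] y(4,8) _ _ _ pq(1)]) (use pc c y in auto)
      have wc: "Cod D w = FO F (Dom E k1)" using w sk K c by auto
      have qk: "leg (q \<cdot>\<^sub>E c) \<cdot>\<^sub>D (FM F k1 \<cdot>\<^sub>D w) = leg ((q \<cdot>\<^sub>E c) \<cdot>\<^sub>E k1) \<cdot>\<^sub>D w" "leg (q \<cdot>\<^sub>E c) \<cdot>\<^sub>D (FM F k2 \<cdot>\<^sub>D w) = leg ((q \<cdot>\<^sub>E c) \<cdot>\<^sub>E k2) \<cdot>\<^sub>D w"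
        by (rule leg_eq_assoc[OF refl]; use pc sk(3,4,6-8) K c(4) w(1) wc in simp)+
      have "leg ((q \<cdot>\<^sub>E c) \<cdot>\<^sub>E k1) \<cdot>\<^sub>D w = leg ((q \<cdot>\<^sub>E c) \<cdot>\<^sub>E k2) \<cdot>\<^sub>D w" using qk w(4,5) pq(2) by simp
      then obtain e z where e: "e \<in> Arr E" "Dom E e \<in> Obj C" "Cod E e = Dom E ((q \<cdot>\<^sub>E c) \<cdot>\<^sub>E k1)" "((q \<cdot>\<^sub>E c) \<cdot>\<^sub>E k1) \<cdot>\<^sub>E e = ((q \<cdot>\<^sub>E c) \<cdot>\<^sub>E k2) \<cdot>\<^sub>E e"
        "z \<in> Arr D" "Dom D z = Dom D w" "Cod D z = FO F (Dom E e)" "FM F e \<cdot>\<^sub>D z = w"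
        by - (rule leg_equalizer[of "(q \<cdot>\<^sub>E c) \<cdot>\<^sub>E k1" "(q \<cdot>\<^sub>E c) \<cdot>\<^sub>E k2" w], use pc sk(3,4,6-8) K w(1) wc in simp_all)
      have ek: "Cod E e = Dom E k1" using e(3) pc sk(3,7) by simp
      have ce: "c \<cdot>\<^sub>E (k1 \<cdot>\<^sub>E e) = c \<cdot>\<^sub>E (k2 \<cdot>\<^sub>E e)"
      proof (rule jointly_monicD[OF E.pullback_jointly_monic[OF pb]])
        have "(p \<cdot>\<^sub>E c) \<cdot>\<^sub>E (k1 \<cdot>\<^sub>E e) = (p \<cdot>\<^sub>E c) \<cdot>\<^sub>E (k2 \<cdot>\<^sub>E e)"
          by (rule E.square_comp[OF sk(9)]) (use pc sk(3,4,6-8) e(1) ek in simp_all)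
        then show "p \<cdot>\<^sub>E (c \<cdot>\<^sub>E (k1 \<cdot>\<^sub>E e)) = p \<cdot>\<^sub>E (c \<cdot>\<^sub>E (k2 \<cdot>\<^sub>E e))" using sq(3) c(2,3) sk(3,4,6-8) e(1) ek by simp
        show "q \<cdot>\<^sub>E (c \<cdot>\<^sub>E (k1 \<cdot>\<^sub>E e)) = q \<cdot>\<^sub>E (c \<cdot>\<^sub>E (k2 \<cdot>\<^sub>E e))" using e(4) sq(4,6) c(2,3) sk(3,4,6-8) e(1) ek by simp
      qed (use c(2,3) sk(3,4,6-8) e(1) ek in simp_all)
      have "u' = FM F (k1 \<cdot>\<^sub>E e) \<cdot>\<^sub>D z" "v' = FM F (k2 \<cdot>\<^sub>E e) \<cdot>\<^sub>D z"
        using FE_eq_assoc[of k1 e "k1 \<cdot>\<^sub>E e" z] FE_eq_assoc[of k2 e "k2 \<cdot>\<^sub>E e" z] w(4,5) e(1,2,5,7,8) ek sk(3,4,6-8) K c(4) by simp_all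
      moreover have "leg c \<cdot>\<^sub>D (FM F (k1 \<cdot>\<^sub>E e) \<cdot>\<^sub>D z) = leg (c \<cdot>\<^sub>E (k1 \<cdot>\<^sub>E e)) \<cdot>\<^sub>D z" "leg c \<cdot>\<^sub>D (FM F (k2 \<cdot>\<^sub>E e) \<cdot>\<^sub>D z) = leg (c \<cdot>\<^sub>E (k2 \<cdot>\<^sub>E e)) \<cdot>\<^sub>D z"
        by (rule leg_eq_assoc[OF refl]; use e(1,2,5,7) ek sk(3,4,6-8) K c(2,4) in simp)+
      ultimately have "u \<cdot>\<^sub>D y = v \<cdot>\<^sub>D y" using y(7,11) ce by simp
      then show "u = v" by - (rule D.cover_epi[OF y(1)], use u v uv(1-3) y(2,3) in simp_all)
    qed (use sq in auto)
    fix u v assume u: "u \<in> Arr D" and v: "v \<in> Arr D" and uv0: "Dom D u = Dom D v" "Cod D u = Dom D (FM extension f)" "Cod D v = Dom D (FM extension g)"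
      "FM extension f \<cdot>\<^sub>D u = FM extension g \<cdot>\<^sub>D v"
    then have uv: "Dom D v = Dom D u" "Cod D u = val (Dom E f)" "Cod D v = val (Dom E g)" "ext_map f \<cdot>\<^sub>D u = ext_map g \<cdot>\<^sub>D v" using sq by auto
    obtain c where c: "is_cover E c" "c \<in> Arr E" "Cod E c = Dom E f" "Dom E c \<in> Obj C" by (rule covering_obtain[OF X(1)])
    obtain d where d: "is_cover E d" "d \<in> Arr E" "Cod E d = Dom E g" "Dom E d \<in> Obj C" by (rule covering_obtain[OF X(2)])
    obtain y u' v' where y: "is_cover D y" "y \<in> Arr D" "Cod D y = Dom D u"
      "u' \<in> Arr D" "Dom D u' = Dom D y" "Cod D u' = FO F (Dom E c)" "leg c \<cdot>\<^sub>D u' = u \<cdot>\<^sub>D y"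
      "v' \<in> Arr D" "Dom D v' = Dom D y" "Cod D v' = FO F (Dom E d)" "leg d \<cdot>\<^sub>D v' = v \<cdot>\<^sub>D y"
      by (rule leg_lifts[of u c v d]) (use u v uv c d in auto)
    have fc: "f \<cdot>\<^sub>E c \<in> Arr E" "Dom E (f \<cdot>\<^sub>E c) = Dom E c" "g \<cdot>\<^sub>E d \<in> Arr E" "Dom E (g \<cdot>\<^sub>E d) = Dom E d" using sq(1,2) c d by auto
    have "ext_map f \<cdot>\<^sub>D (u \<cdot>\<^sub>D y) = ext_map g \<cdot>\<^sub>D (v \<cdot>\<^sub>D y)"
      by (rule D.square_comp[OF uv(4)]) (use u v uv(1-3) y(2,3) sq(1,2,5) in simp_all)
    then have "leg (f \<cdot>\<^sub>E c) \<cdot>\<^sub>D u' = leg (g \<cdot>\<^sub>E d) \<cdot>\<^sub>D v'"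
      using ext_map_leg_assoc[of f c "f \<cdot>\<^sub>E c" u'] ext_map_leg_assoc[of g d "g \<cdot>\<^sub>E d" v'] sq(1,2) c(2-4) d(2-4) y by simp
    \<comment> \<open>The agreeing legs give an element of \<open>F\<close> at the pullback of
      \<open>f \<cdot>\<^sub>E c\<close> and \<open>g \<cdot>\<^sub>E d\<close>. This object maps to
      the pullback of \<open>f\<close> and \<open>g\<close> in \<open>E\<close>, and the leg of that
      map yields the local solution.\<close>
    moreover obtain m1 m2 where mp: "is_pullback E (f \<cdot>\<^sub>E c) (g \<cdot>\<^sub>E d) m1 m2"
      by (rule E.pullback_ex[of "f \<cdot>\<^sub>E c" "g \<cdot>\<^sub>E d"]) (use fc sq(1,2,5) c d in auto)
    note sm = pullback_square[OF mp, unfolded fc(2,4)]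
    have M: "Dom E m1 \<in> Obj C" by (rule pullback_closed[OF mp]) (use fc c d in auto)
    ultimately obtain w where w: "w \<in> Arr D" "Dom D w = Dom D u'" "Cod D w = Dom D (FM F m1)" "FM F m1 \<cdot>\<^sub>D w = u'" "FM F m2 \<cdot>\<^sub>D w = v'"
      by - (rule pullback_lift[OF leg_pullback[OF mp] y(4,8)], use fc c(4) d(4) y in auto)
    have wc: "Cod D w = FO F (Dom E m1)" using w(3) sm(3,7) M c(4) by simp
    have "f \<cdot>\<^sub>E (c \<cdot>\<^sub>E m1) = g \<cdot>\<^sub>E (d \<cdot>\<^sub>E m2)" using sm(3,4,6-9) sq(1,2) c(2,3) d(2,3) by simp
    then obtain t where t: "t \<in> Arr E" "Dom E t = Dom E m1" "Cod E t = Dom E p" "p \<cdot>\<^sub>E t = c \<cdot>\<^sub>E m1" "q \<cdot>\<^sub>E t = d \<cdot>\<^sub>E m2"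
      using pullback_lift[OF pb, of "c \<cdot>\<^sub>E m1" "d \<cdot>\<^sub>E m2"] sm(3,4,6-8) c(2,3) d(2,3) by auto
    have tc: "leg t \<cdot>\<^sub>D w \<in> Arr D" "Dom D (leg t \<cdot>\<^sub>D w) = Dom D y" "Cod D (leg t \<cdot>\<^sub>D w) = val (Dom E p)"
      using t(1-3) M w(1,2) wc y(5) by simp_all
    have 1: "ext_map p \<cdot>\<^sub>D (leg t \<cdot>\<^sub>D w) = u \<cdot>\<^sub>D y"
      using ext_map_leg_assoc[OF t(4), of w] leg_eq_assoc[of c m1 "c \<cdot>\<^sub>E m1" w] t(1-3) sq(3) M w(1,4) wc sm(3,7) c(2,4) y(7) by simp
    have 2: "ext_map q \<cdot>\<^sub>D (leg t \<cdot>\<^sub>D w) = v \<cdot>\<^sub>D y"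
      using ext_map_leg_assoc[OF t(5), of w] leg_eq_assoc[of d m2 "d \<cdot>\<^sub>E m2" w] t(1-3) sq(4,6) M w(1,5) wc sm(4,6,8) d(2,4) y(11) by simp
    have jm: "jointly_monic D (ext_map p) (ext_map q)" using \<open>jointly_monic D (FM extension p) (FM extension q)\<close> sq by simp
    obtain z where "z \<in> Arr D" "Dom D z = Cod D y" "Cod D z = Dom D (ext_map p)" "ext_map p \<cdot>\<^sub>D z = u" "ext_map q \<cdot>\<^sub>D z = v"
      by (rule D.cover_jointly_monic_lift[OF y(1) jm tc(1) u v _ _ _ _ _ _ 1 2]) (use tc uv(1-3) y(3) sq in auto)
    then show "\<exists>z. in_hom D z (Dom D u) (Dom D (FM extension p)) \<and> FM extension p \<cdot>\<^sub>D z = u \<and> FM extension q \<cdot>\<^sub>D z = v"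
      using y(3) sq by (intro exI[of _ z]) auto
  qed (use sq in auto)
qed

text \<open>The leg of a cover of the domain, followed by the image of \<open>f\<close>, is the leg
  of a composite cover; \<open>cover_cancel\<close> removes the first factor.\<close>

lemma extension_cover:
  assumes f: "is_cover E f" shows "is_cover D (ext_map f)"
proof -
  have f1: "f \<in> Arr E" by (rule is_cover_Arr[OF f])
  obtain c where c: "is_cover E c" "c \<in> Arr E" "Cod E c = Dom E f" "Dom E c \<in> Obj C" by (rule covering_obtain[of "Dom E f"]) (use f1 in auto)
  have "is_cover D (leg (f \<cdot>\<^sub>E c))" by (rule leg_cover[OF E.cover_comp[OF c(1) f]]) (use c f1 in auto)
  then have "is_cover D (ext_map f \<cdot>\<^sub>D leg c)" using ext_map_leg f1 c by simp
  then show ?thesis by (rule D.cover_cancel) (use f1 c in auto)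
qed

sublocale X: lex E D extension
  by unfold_locales (use extension_terminal extension_pullbacks E.has_pb E.has_term in auto)

lemma extension_exact: "exact_functor E D extension"
proof -
  have "preserves_regular_epis E D extension" unfolding preserves_regular_epis_def
    using E.regular_epi_iff_cover D.regular_epi_iff_cover extension_cover is_cover_Arr[of E] extension_FM by metis
  then show ?thesis unfolding exact_functor_def using extension_functor X.preserves_finite_limits by blast
qed

text \<open>The identity is its own pullback along itself, so by \<open>leg_pullback\<close> its leg
  has a trivial kernel pair and is monic; it is also a cover.\<close>

lemma leg_Ident_iso:
  assumes X: "X \<in> Obj C" shows "is_iso D (leg (Ident E X))"
proof -
  have X1: "X \<in> Obj E" using X by simp
  have "is_pullback E (Ident E X) (Ident E X) (Ident E X) (Ident E X)"
  proof (rule E.is_pullbackI)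
    show "jointly_monic E (Ident E X) (Ident E X)"
      by (rule E.jointly_monic_mono[OF E.is_iso_mono[OF E.is_iso_Ident[OF X1]]]) (use X1 in auto)
  qed (use X1 in auto)
  then have pb: "is_pullback D (leg (Ident E X)) (leg (Ident E X)) (FM F (Ident E X)) (FM F (Ident E X))"
    by (rule leg_pullback) (use X in auto)
  have "is_mono D (leg (Ident E X))"
  proof (rule is_monoI)
    fix u v assume uv: "u \<in> Arr D" "v \<in> Arr D" "Dom D u = Dom D v" "Cod D u = Dom D (leg (Ident E X))" "Cod D v = Dom D (leg (Ident E X))"
      "leg (Ident E X) \<cdot>\<^sub>D u = leg (Ident E X) \<cdot>\<^sub>D v"
    obtain w where "w \<in> Arr D" "Cod D w = Dom D (FM F (Ident E X))" "FM F (Ident E X) \<cdot>\<^sub>D w = u" "FM F (Ident E X) \<cdot>\<^sub>D w = v"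
      by (rule pullback_lift[OF pb uv])
    then show "u = v" by simp
  qed (use X in auto)
  moreover have "is_cover D (leg (Ident E X))" by (rule leg_cover[OF E.iso_cover[OF E.is_iso_Ident[OF X1]]]) (use X in auto)
  ultimately show ?thesis by (rule D.cover_mono_iso[rotated])
qed

text \<open>The legs of the identities form a natural isomorphism in the opposite direction, which
  is then inverted.\<close>

lemma extension_restrict: "naturally_isomorphic C D (comp_functor C extension (inclusion_functor C)) F"
proof -
  have J: "is_functor C E (inclusion_functor C)"
    by (rule is_functor_inclusion) (use E.cat C.cat Obj_sub in auto)
  have nat: "is_nat_trans C D F (comp_functor C extension (inclusion_functor C)) (\<lambda>X\<in>Obj C. leg (Ident E X))"
    unfolding is_nat_trans_def
  proof (intro conjI ballI)
    fix f assume f: "f \<in> Arr C"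
    then show "(\<lambda>X\<in>Obj C. leg (Ident E X)) (Cod C f) \<cdot>\<^sub>D FM F f =
        FM (comp_functor C extension (inclusion_functor C)) f \<cdot>\<^sub>D (\<lambda>X\<in>Obj C. leg (Ident E X)) (Dom C f)"
      using leg_comp[of "Ident E (Cod E f)" f] ext_map_leg[of f "Ident E (Dom E f)"] by simp
  qed auto
  have iso: "is_iso D ((\<lambda>X\<in>Obj C. leg (Ident E X)) X)" if "X \<in> Obj C" for X
    using leg_Ident_iso that by simp
  obtain \<beta> where b: "is_nat_trans C D (comp_functor C extension (inclusion_functor C)) F \<beta>"
    "\<And>X. X \<in> Obj C \<Longrightarrow> \<beta> X \<cdot>\<^sub>D (\<lambda>X\<in>Obj C. leg (Ident E X)) X = Ident D (FO F X)"
    "\<And>X. X \<in> Obj C \<Longrightarrow> (\<lambda>X\<in>Obj C. leg (Ident E X)) X \<cdot>\<^sub>D \<beta> X = Ident D (FO (comp_functor C extension (inclusion_functor C)) X)"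
    using nat_trans_inverse[OF F.fctr is_functor_comp[OF J extension_functor] nat iso] by blast
  have "is_iso D (\<beta> X)" if X: "X \<in> Obj C" for X
    using b(2,3)[OF X] nat_transD(1-3)[OF b(1) X] X
    by (intro is_isoI[where g="leg (Ident E X)"]) auto
  then show ?thesis unfolding naturally_isomorphic_def using b(1) by blast
qed

end

section \<open>Natural transformations are determined on the covering objects\<close>

context covering_subcategory
begin

lemma inclusion_functor: "is_functor C E (inclusion_functor C)"
  by (rule is_functor_inclusion) (use E.cat C.cat Obj_sub in auto)

text \<open>\<open>F\<close> preserves covers, so naturality along a cover from \<open>C\<close>
  fixes the component at any object.\<close>

lemma restriction_unique:
  assumes D: "regcat D" and F: "exact_functor E D F" and G: "is_functor E D G"
    and \<alpha>: "is_nat_trans E D F G \<alpha>" and \<beta>: "is_nat_trans E D F G \<beta>" and eq: "\<And>X. X \<in> Obj C \<Longrightarrow> \<alpha> X = \<beta> X"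
  shows "\<alpha> = \<beta>"
proof (rule extensionalityI[of _ "Obj E"])
  interpret D: regcat D by fact
  interpret F: fctr E D F using F by unfold_locales (simp add: exact_functor_def)
  interpret G: fctr E D G by unfold_locales fact
  note a = nat_transD[OF \<alpha>] and b = nat_transD[OF \<beta>]
  fix X assume X: "X \<in> Obj E"
  obtain c where c: "is_cover E c" "c \<in> Arr E" "Cod E c = X" "Dom E c \<in> Obj C" by (rule covering_obtain[OF X])
  have "is_cover D (FM F c)"
    using F c(1) E.regular_epi_iff_cover D.regular_epi_iff_cover unfolding exact_functor_def preserves_regular_epis_def by blast
  then show "\<alpha> X = \<beta> X"
    by (rule D.cover_epi) (use a(1-3)[OF X] b(1-3)[OF X] a(4)[OF c(2)] b(4)[OF c(2)] c eq[OF c(4)] in auto)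
qed (use nat_transD(5)[OF \<alpha>] nat_transD(5)[OF \<beta>] in auto)

text \<open>The component at \<open>X\<close> comes from descent along the image under
  \<open>F\<close> of a cover \<open>c\<close> from \<open>C\<close>, which is the coequalizer of
  the image of the kernel pair. Its defining equation is established for every \<open>t\<close> from
  \<open>C\<close>, not only for \<open>c\<close>; this makes the components natural.\<close>

lemma restriction_extend:
  assumes D: "regcat D" and F: "exact_functor E D F" and G: "is_functor E D G"
    and \<beta>: "is_nat_trans C D (comp_functor C F (inclusion_functor C)) (comp_functor C G (inclusion_functor C)) \<beta>"
  obtains \<alpha> where "is_nat_trans E D F G \<alpha>" "\<And>X. X \<in> Obj C \<Longrightarrow> \<alpha> X = \<beta> X"
proof -
  interpret D: regcat D by fact
  interpret F: lex E D F
    using F E.regular by (intro lexI) (auto simp: exact_functor_def regular_category_def)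
  interpret G: fctr E D G by unfold_locales fact
  have b: "\<beta> X \<in> Arr D" "Dom D (\<beta> X) = FO F X" "Cod D (\<beta> X) = FO G X" if "X \<in> Obj C" for X
    using nat_transD(1-3)[OF \<beta> that] that by auto
  have bn: "\<beta> (Cod E f) \<cdot>\<^sub>D FM F f = FM G f \<cdot>\<^sub>D \<beta> (Dom E f)" if "f \<in> Arr E" "Dom E f \<in> Obj C" "Cod E f \<in> Obj C" for f
    using nat_transD(4)[OF \<beta>, of f] that by simp
  have Fcov: "is_cover D (FM F c)" if "is_cover E c" for c
    using F that E.regular_epi_iff_cover D.regular_epi_iff_cover unfolding exact_functor_def preserves_regular_epis_def by blast
  have "\<forall>X\<in>Obj E. \<exists>x. in_hom D x (FO F X) (FO G X) \<and>
    (\<forall>t. t \<in> Arr E \<and> Dom E t \<in> Obj C \<and> Cod E t = X \<longrightarrow> x \<cdot>\<^sub>D FM F t = FM G t \<cdot>\<^sub>D \<beta> (Dom E t))"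
  proof
    fix X assume X: "X \<in> Obj E"
    obtain c where c: "is_cover E c" "c \<in> Arr E" "Cod E c = X" "Dom E c \<in> Obj C" by (rule covering_obtain[OF X])
    obtain r s where rs: "is_pullback E c c r s" by (rule E.pullback_ex[of c c]) (use c in auto)
    note sq = pullback_square[OF rs]
    have R: "Dom E r \<in> Obj C" using pullback_closed[OF rs c(4) c(4)] .
    have co: "is_coequalizer D (FM F r) (FM F s) (FM F c)"
      by (rule D.cover_coequalizer[OF Fcov[OF c(1)] F.pullbackF[OF rs]])
    have "FM G c \<cdot>\<^sub>D (FM G r \<cdot>\<^sub>D \<beta> (Dom E r)) = FM G c \<cdot>\<^sub>D (FM G s \<cdot>\<^sub>D \<beta> (Dom E r))"
      by (rule G.FM_square_assoc[OF sq(9)]) (use sq(3,4,6-8) b R c in simp_all)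
    then have "(FM G c \<cdot>\<^sub>D \<beta> (Dom E c)) \<cdot>\<^sub>D FM F r = (FM G c \<cdot>\<^sub>D \<beta> (Dom E c)) \<cdot>\<^sub>D FM F s"
      using bn[of r] bn[of s] sq(3,4,6-8) b R c by simp
    then obtain x where x: "x \<in> Arr D" "Dom D x = FO F X" "Cod D x = FO G X" "x \<cdot>\<^sub>D FM F c = FM G c \<cdot>\<^sub>D \<beta> (Dom E c)"
      using coequalizer_lift[OF co, of "FM G c \<cdot>\<^sub>D \<beta> (Dom E c)"] sq(3,7) b R c by auto
    have "x \<cdot>\<^sub>D FM F t = FM G t \<cdot>\<^sub>D \<beta> (Dom E t)" if t: "t \<in> Arr E" "Dom E t \<in> Obj C" "Cod E t = X" for t
    proof -
      obtain p p' where pb: "is_pullback E t c p p'" by (rule E.pullback_ex[of t c]) (use t c in auto)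
      note sp = pullback_square[OF pb]
      have P: "Dom E p \<in> Obj C" by (rule pullback_closed[OF pb t(2) c(4)])
      have "x \<cdot>\<^sub>D (FM F t \<cdot>\<^sub>D FM F p) = x \<cdot>\<^sub>D (FM F c \<cdot>\<^sub>D FM F p')"
        using F.FM_square[OF sp(9)] sp(3,4,6-8) t c by simp
      also have "\<dots> = FM G c \<cdot>\<^sub>D (\<beta> (Dom E c) \<cdot>\<^sub>D FM F p')"
        by (rule D.square_comp[OF x(4)]) (use x sp(4,6,8) t c b in simp_all)
      also have "\<dots> = FM G c \<cdot>\<^sub>D (FM G p' \<cdot>\<^sub>D \<beta> (Dom E p))"
        using bn[of p'] sp(4,6,8) P c by simp
      also have "\<dots> = FM G t \<cdot>\<^sub>D (FM G p \<cdot>\<^sub>D \<beta> (Dom E p))"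
        by (rule G.FM_square_assoc[OF sp(9)[symmetric]]) (use sp(3,4,6-8) P c t b in simp_all)
      also have "\<dots> = FM G t \<cdot>\<^sub>D (\<beta> (Dom E t) \<cdot>\<^sub>D FM F p)"
        using bn[of p] sp(3,7) P t by simp
      finally have *: "x \<cdot>\<^sub>D (FM F t \<cdot>\<^sub>D FM F p) = FM G t \<cdot>\<^sub>D (\<beta> (Dom E t) \<cdot>\<^sub>D FM F p)" .
      show ?thesis
        by (rule D.cover_epi[OF Fcov[OF E.cover_pullback[OF pb c(1)]]]) (use * sp(3,7) P t b x in simp_all)
    qed
    then show "\<exists>x. in_hom D x (FO F X) (FO G X) \<and>
      (\<forall>t. t \<in> Arr E \<and> Dom E t \<in> Obj C \<and> Cod E t = X \<longrightarrow> x \<cdot>\<^sub>D FM F t = FM G t \<cdot>\<^sub>D \<beta> (Dom E t))"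
      using x by (intro exI[of _ x]) auto
  qed
  then obtain a where a: "\<And>X. X \<in> Obj E \<Longrightarrow> a X \<in> Arr D" "\<And>X. X \<in> Obj E \<Longrightarrow> Dom D (a X) = FO F X" "\<And>X. X \<in> Obj E \<Longrightarrow> Cod D (a X) = FO G X"
    and at: "\<And>X t. \<lbrakk>X \<in> Obj E; t \<in> Arr E; Dom E t \<in> Obj C; Cod E t = X\<rbrakk> \<Longrightarrow> a X \<cdot>\<^sub>D FM F t = FM G t \<cdot>\<^sub>D \<beta> (Dom E t)"
    unfolding in_hom_def by metis
  have "a (Cod E f) \<cdot>\<^sub>D FM F f = FM G f \<cdot>\<^sub>D a (Dom E f)" if f: "f \<in> Arr E" for f
  proof -
    obtain c where c: "is_cover E c" "c \<in> Arr E" "Cod E c = Dom E f" "Dom E c \<in> Obj C" by (rule covering_obtain[of "Dom E f"]) (use f in auto)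
    have "a (Cod E f) \<cdot>\<^sub>D (FM F f \<cdot>\<^sub>D FM F c) = FM G f \<cdot>\<^sub>D (a (Dom E f) \<cdot>\<^sub>D FM F c)"
      using at[of "Cod E f" "f \<cdot>\<^sub>E c"] at[of "Dom E f" c] f c b by simp
    then show ?thesis
      by - (rule D.cover_epi[OF Fcov[OF c(1)]], use f c a in simp_all)
  qed
  then have nt: "is_nat_trans E D F G (restrict a (Obj E))" unfolding is_nat_trans_def using a by simp
  have "restrict a (Obj E) X = \<beta> X" if X: "X \<in> Obj C" for X
    using at[of X "Ident E X"] X a[of X] b[OF X] by simp
  with nt show ?thesis by (rule that)
qed

end

section \<open>Finite coproducts and extensive categories\<close>

definition is_initial :: "('o, 'm) category \<Rightarrow> 'o \<Rightarrow> bool" where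
  "is_initial C X \<longleftrightarrow> X \<in> Obj C \<and> (\<forall>Y\<in>Obj C. \<exists>!u. in_hom C u X Y)"

lemma is_coproduct_empty: "is_coproduct C {} A X \<iota> \<longleftrightarrow> is_initial C X"
  by (simp add: is_coproduct_def is_initial_def)

lemma coproduct_cocone:
  assumes "is_coproduct C I A S \<iota>"
  shows "S \<in> Obj C" "\<And>i. i \<in> I \<Longrightarrow> \<iota> i \<in> Arr C" "\<And>i. i \<in> I \<Longrightarrow> Dom C (\<iota> i) = A i" "\<And>i. i \<in> I \<Longrightarrow> Cod C (\<iota> i) = S"
  using assms unfolding is_coproduct_def by auto

lemma coproduct_lift:
  assumes "is_coproduct C I A S \<iota>" "Y \<in> Obj C" "\<And>i. i \<in> I \<Longrightarrow> in_hom C (q i) (A i) Y"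
  obtains u where "u \<in> Arr C" "Dom C u = S" "Cod C u = Y" "\<And>i. i \<in> I \<Longrightarrow> u \<cdot>\<^sub>C \<iota> i = q i"
proof -
  have "\<exists>!u. in_hom C u S Y \<and> (\<forall>i\<in>I. u \<cdot>\<^sub>C \<iota> i = q i)"
    using assms unfolding is_coproduct_def by blast
  then obtain u where "in_hom C u S Y" "\<forall>i\<in>I. u \<cdot>\<^sub>C \<iota> i = q i" by blast
  then show ?thesis using that[of u] by simp
qed

lemma coproduct_ex1:
  assumes "is_coproduct C I A S \<iota>" "Y \<in> Obj C" "\<forall>i\<in>I. in_hom C (q i) (A i) Y"
  shows "\<exists>!u. in_hom C u S Y \<and> (\<forall>i\<in>I. u \<cdot>\<^sub>C \<iota> i = q i)"
  by (rule assms(1)[unfolded is_coproduct_def, THEN conjunct2, THEN conjunct2, THEN bspec[OF _ assms(2)],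
        THEN spec[of _ q], THEN mp, OF assms(3)])

context cat
begin

lemma coproduct_unique:
  assumes "is_coproduct C I A S \<iota>" "u \<in> Arr C" "v \<in> Arr C" "Dom C u = S" "Dom C v = S" "Cod C u = Cod C v"
    "\<And>i. i \<in> I \<Longrightarrow> u \<cdot>\<^sub>C \<iota> i = v \<cdot>\<^sub>C \<iota> i"
  shows "u = v"
proof -
  note co = coproduct_cocone[OF assms(1)]
  have "Cod C u \<in> Obj C" "\<forall>i\<in>I. in_hom C (u \<cdot>\<^sub>C \<iota> i) (A i) (Cod C u)" using assms(2,4) co by auto
  then have "\<exists>!w. in_hom C w S (Cod C u) \<and> (\<forall>i\<in>I. w \<cdot>\<^sub>C \<iota> i = u \<cdot>\<^sub>C \<iota> i)"
    by (rule coproduct_ex1[OF assms(1)])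
  then show ?thesis by (rule ex1_eq) (use assms(2-7) in simp_all)
qed

lemma coproduct_transport:
  assumes co: "is_coproduct C I A S \<iota>" and h: "is_iso C h" "Dom C h = S"
    and \<kappa>: "\<And>i. i \<in> I \<Longrightarrow> \<kappa> i = h \<cdot>\<^sub>C \<iota> i"
  shows "is_coproduct C I A (Cod C h) \<kappa>"
proof -
  note c = coproduct_cocone[OF co]
  obtain k where k: "h \<in> Arr C" "k \<in> Arr C" "Dom C k = Cod C h" "Cod C k = Dom C h"
    "k \<cdot>\<^sub>C h = Ident C (Dom C h)" "h \<cdot>\<^sub>C k = Ident C (Cod C h)" by (rule is_isoE[OF h(1)])
  have "\<exists>!u. in_hom C u (Cod C h) Y \<and> (\<forall>i\<in>I. u \<cdot>\<^sub>C \<kappa> i = q i)"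
    if Y: "Y \<in> Obj C" and q: "\<forall>i\<in>I. in_hom C (q i) (A i) Y" for Y q
  proof (rule ex_ex1I)
    obtain u where u: "u \<in> Arr C" "Dom C u = S" "Cod C u = Y" "\<And>i. i \<in> I \<Longrightarrow> u \<cdot>\<^sub>C \<iota> i = q i"
      by (rule coproduct_lift[OF co Y, of q]) (use q in auto)
    have "(u \<cdot>\<^sub>C k) \<cdot>\<^sub>C \<kappa> i = q i" if "i \<in> I" for i
      using that \<kappa> u k h(2) c(2-4)[OF that] reassoc[OF k(5), of "\<iota> i"] by simp
    then have "in_hom C (u \<cdot>\<^sub>C k) (Cod C h) Y \<and> (\<forall>i\<in>I. (u \<cdot>\<^sub>C k) \<cdot>\<^sub>C \<kappa> i = q i)" using u k h(2) by simp
    then show "\<exists>u. in_hom C u (Cod C h) Y \<and> (\<forall>i\<in>I. u \<cdot>\<^sub>C \<kappa> i = q i)" by blast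
    fix u v assume uv: "in_hom C u (Cod C h) Y \<and> (\<forall>i\<in>I. u \<cdot>\<^sub>C \<kappa> i = q i)" "in_hom C v (Cod C h) Y \<and> (\<forall>i\<in>I. v \<cdot>\<^sub>C \<kappa> i = q i)"
    have "u \<cdot>\<^sub>C h = v \<cdot>\<^sub>C h"
    proof (rule coproduct_unique[OF co])
      show "(u \<cdot>\<^sub>C h) \<cdot>\<^sub>C \<iota> i = (v \<cdot>\<^sub>C h) \<cdot>\<^sub>C \<iota> i" if i: "i \<in> I" for i
      proof -
        have "(w \<cdot>\<^sub>C h) \<cdot>\<^sub>C \<iota> i = w \<cdot>\<^sub>C \<kappa> i" if "w \<in> Arr C" "Dom C w = Cod C h" for w
          using that \<kappa>[OF i] c(2-4)[OF i] k(1) h(2) by simp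
        moreover have "u \<cdot>\<^sub>C \<kappa> i = v \<cdot>\<^sub>C \<kappa> i" using uv i by simp
        ultimately show ?thesis using uv by simp
      qed
    qed (use uv k h in auto)
    then have "u \<cdot>\<^sub>C (h \<cdot>\<^sub>C k) = v \<cdot>\<^sub>C (h \<cdot>\<^sub>C k)" by (rule square_comp) (use uv k in auto)
    moreover have "u \<cdot>\<^sub>C (h \<cdot>\<^sub>C k) = u" "v \<cdot>\<^sub>C (h \<cdot>\<^sub>C k) = v" using uv k by simp_all
    ultimately show "u = v" by (simp only:)
  qed
  then show ?thesis unfolding is_coproduct_def using c k h \<kappa> by simp
qed

lemma initial_unique:
  assumes "is_initial C X" "u \<in> Arr C" "v \<in> Arr C" "Dom C u = X" "Dom C v = X" "Cod C u = Cod C v"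
  shows "u = v"
proof -
  have "\<exists>!w. in_hom C w X (Cod C u)" using assms unfolding is_initial_def by simp
  then show ?thesis by (rule ex1_eq) (use assms in simp_all)
qed

lemma initial_ex:
  assumes "is_initial C X" "Y \<in> Obj C"
  obtains u where "u \<in> Arr C" "Dom C u = X" "Cod C u = Y"
  using assms unfolding is_initial_def by auto

end

lemma slice_category_simps [simp]:
  "f \<in> Obj (slice_category C X) \<longleftrightarrow> f \<in> Arr C \<and> Cod C f = X"
  "(f, h, g) \<in> Arr (slice_category C X) \<longleftrightarrow> f \<in> Arr C \<and> Cod C f = X \<and> g \<in> Arr C \<and> Cod C g = X \<and>
     in_hom C h (Dom C f) (Dom C g) \<and> g \<cdot>\<^sub>C h = f"
  "Dom (slice_category C X) (f, h, g) = f" "Cod (slice_category C X) (f, h, g) = g"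
  "Ident (slice_category C X) f = (f, Ident C (Dom C f), f)"
  "Comp (slice_category C X) (g', k, e) (f, h, g) = (f, k \<cdot>\<^sub>C h, e)"
  by (simp_all add: slice_category_def)

lemma slice_category_ArrE:
  assumes "x \<in> Arr (slice_category C X)"
  obtains f h g where "x = (f, h, g)" "f \<in> Arr C" "Cod C f = X" "g \<in> Arr C" "Cod C g = X"
    "h \<in> Arr C" "Dom C h = Dom C f" "Cod C h = Dom C g" "g \<cdot>\<^sub>C h = f"
  using assms by (cases x) simp

lemma (in cat) slice_category_is_category: "is_category (slice_category C X)"
  unfolding is_category_def
proof (intro conjI ballI impI)
  let ?S = "slice_category C X"
  fix x assume "x \<in> Arr ?S"
  then obtain f h g where x: "x = (f, h, g)" "f \<in> Arr C" "Cod C f = X" "g \<in> Arr C" "Cod C g = X"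
    "h \<in> Arr C" "Dom C h = Dom C f" "Cod C h = Dom C g" "g \<cdot>\<^sub>C h = f" by (rule slice_category_ArrE)
  show "Dom ?S x \<in> Obj ?S" "Cod ?S x \<in> Obj ?S" using x(1-5) by simp_all
  show "Comp ?S x (Ident ?S (Dom ?S x)) = x" "Comp ?S (Ident ?S (Cod ?S x)) x = x" using x(1,6-8) by simp_all
  fix y assume "y \<in> Arr ?S"
  then obtain f' h' g' where y: "y = (f', h', g')" "f' \<in> Arr C" "Cod C f' = X" "g' \<in> Arr C" "Cod C g' = X"
    "h' \<in> Arr C" "Dom C h' = Dom C f'" "Cod C h' = Dom C g'" "g' \<cdot>\<^sub>C h' = f'" by (rule slice_category_ArrE)
  show "in_hom ?S (Comp ?S y x) (Dom ?S x) (Cod ?S y)" if "Cod ?S x = Dom ?S y"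
  proof -
    have "g = f'" using that x(1) y(1) by simp
    then have "g' \<cdot>\<^sub>C (h' \<cdot>\<^sub>C h) = f" using reassoc[OF y(9), of h] x y by simp
    then show ?thesis using x y \<open>g = f'\<close> by simp
  qed
  fix z assume "z \<in> Arr ?S"
  then obtain f2 h2 g2 where z: "z = (f2, h2, g2)" "f2 \<in> Arr C" "Cod C f2 = X" "g2 \<in> Arr C" "Cod C g2 = X"
    "h2 \<in> Arr C" "Dom C h2 = Dom C f2" "Cod C h2 = Dom C g2" "g2 \<cdot>\<^sub>C h2 = f2" by (rule slice_category_ArrE)
  show "Comp ?S z (Comp ?S y x) = Comp ?S (Comp ?S z y) x" if "Cod ?S x = Dom ?S y \<and> Cod ?S y = Dom ?S z"
    using that x(1,6-8) y(1,6-8) z(1,6-8) by simp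
qed auto

lemma product_category_simps [simp]:
  "Obj (product_category C D) = Obj C \<times> Obj D" "Arr (product_category C D) = Arr C \<times> Arr D"
  "Dom (product_category C D) (f, g) = (Dom C f, Dom D g)" "Cod (product_category C D) (f, g) = (Cod C f, Cod D g)"
  "Ident (product_category C D) (X, Y) = (Ident C X, Ident D Y)"
  "Comp (product_category C D) (f', g') (f, g) = (f' \<cdot>\<^sub>C f, g' \<cdot>\<^sub>D g)"
  by (simp_all add: product_category_def)

lemma product_category_is_category: "\<lbrakk>is_category C; is_category D\<rbrakk> \<Longrightarrow> is_category (product_category C D)"
  unfolding is_category_def by (auto split: prod.splits)

section \<open>Chosen binary sums and the slice functor\<close>

locale sumcat = cat +
  assumes has_sums: "has_finite_coproducts C"
begin

lemma coproduct_ex: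
  assumes "finite I" "\<And>i. i \<in> I \<Longrightarrow> A i \<in> Obj C"
  obtains S \<iota> where "is_coproduct C (I :: nat set) A S \<iota>"
  using has_sums assms unfolding has_finite_coproducts_def by blast

lemma sum_coproduct:
  assumes "X \<in> Obj C" "Y \<in> Obj C"
  shows "is_coproduct C {0, 1} (\<lambda>i. if i = 0 then X else Y) (sum_obj C X Y) (sum_inj C X Y)"
proof -
  obtain S \<iota> where "is_coproduct C {0, 1} (\<lambda>i::nat. if i = 0 then X else Y) S \<iota>"
    by (rule coproduct_ex[of "{0, 1}" "\<lambda>i. if i = 0 then X else Y"]) (use assms in auto)
  then have "\<exists>c. is_coproduct C {0, 1} (\<lambda>i::nat. if i = 0 then X else Y) (fst c) (snd c)"
    by (intro exI[of _ "(S, \<iota>)"]) simp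
  then show ?thesis unfolding sum_obj_def sum_inj_def chosen_sum_def by (rule someI_ex)
qed

lemma sum_obj_Obj [simp]: "\<lbrakk>X \<in> Obj C; Y \<in> Obj C\<rbrakk> \<Longrightarrow> sum_obj C X Y \<in> Obj C"
  using coproduct_cocone(1)[OF sum_coproduct] by blast

lemma sum_inj_simps [simp]:
  assumes "X \<in> Obj C" "Y \<in> Obj C"
  shows "sum_inj C X Y 0 \<in> Arr C" "sum_inj C X Y (Suc 0) \<in> Arr C" "Dom C (sum_inj C X Y 0) = X" "Dom C (sum_inj C X Y (Suc 0)) = Y"
    "Cod C (sum_inj C X Y 0) = sum_obj C X Y" "Cod C (sum_inj C X Y (Suc 0)) = sum_obj C X Y"
  using coproduct_cocone(2-4)[OF sum_coproduct[OF assms], of 0] coproduct_cocone(2-4)[OF sum_coproduct[OF assms], of 1] by auto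

lemma sum_lift:
  assumes "f \<in> Arr C" "g \<in> Arr C" "Cod C f = Cod C g"
  obtains u where "u \<in> Arr C" "Dom C u = sum_obj C (Dom C f) (Dom C g)" "Cod C u = Cod C f"
    "u \<cdot>\<^sub>C sum_inj C (Dom C f) (Dom C g) 0 = f" "u \<cdot>\<^sub>C sum_inj C (Dom C f) (Dom C g) (Suc 0) = g"
proof -
  obtain u where u: "u \<in> Arr C" "Dom C u = sum_obj C (Dom C f) (Dom C g)" "Cod C u = Cod C f"
    "\<And>i. i \<in> {0, 1} \<Longrightarrow> u \<cdot>\<^sub>C sum_inj C (Dom C f) (Dom C g) i = (if i = 0 then f else g)"
    by (rule coproduct_lift[OF sum_coproduct[of "Dom C f" "Dom C g"], of "Cod C f" "\<lambda>i. if i = 0 then f else g"])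
      (use assms in auto)
  show ?thesis using that[of u] u(1-3) u(4)[of 0] u(4)[of 1] by simp
qed

lemma sum_unique:
  assumes "X \<in> Obj C" "Y \<in> Obj C" "u \<in> Arr C" "v \<in> Arr C" "Dom C u = sum_obj C X Y" "Dom C v = sum_obj C X Y" "Cod C u = Cod C v"
    "u \<cdot>\<^sub>C sum_inj C X Y 0 = v \<cdot>\<^sub>C sum_inj C X Y 0" "u \<cdot>\<^sub>C sum_inj C X Y (Suc 0) = v \<cdot>\<^sub>C sum_inj C X Y (Suc 0)"
  shows "u = v"
  by (rule coproduct_unique[OF sum_coproduct[OF assms(1,2)] assms(3-7)]) (use assms(8,9) in auto)

lemma sum_map_spec:
  assumes f: "f \<in> Arr C" and g: "g \<in> Arr C"
  shows "in_hom C (sum_map C f g) (sum_obj C (Dom C f) (Dom C g)) (sum_obj C (Cod C f) (Cod C g)) \<and>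
        sum_map C f g \<cdot>\<^sub>C sum_inj C (Dom C f) (Dom C g) 0 = sum_inj C (Cod C f) (Cod C g) 0 \<cdot>\<^sub>C f \<and>
        sum_map C f g \<cdot>\<^sub>C sum_inj C (Dom C f) (Dom C g) 1 = sum_inj C (Cod C f) (Cod C g) 1 \<cdot>\<^sub>C g"
  unfolding sum_map_def
proof (rule theI', rule ex_ex1I)
  obtain u where "u \<in> Arr C" "Dom C u = sum_obj C (Dom C f) (Dom C g)" "Cod C u = sum_obj C (Cod C f) (Cod C g)"
    "u \<cdot>\<^sub>C sum_inj C (Dom C f) (Dom C g) 0 = sum_inj C (Cod C f) (Cod C g) 0 \<cdot>\<^sub>C f"
    "u \<cdot>\<^sub>C sum_inj C (Dom C f) (Dom C g) (Suc 0) = sum_inj C (Cod C f) (Cod C g) (Suc 0) \<cdot>\<^sub>C g"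
    using sum_lift[of "sum_inj C (Cod C f) (Cod C g) 0 \<cdot>\<^sub>C f" "sum_inj C (Cod C f) (Cod C g) (Suc 0) \<cdot>\<^sub>C g"] f g by auto
  then show "\<exists>u. in_hom C u (sum_obj C (Dom C f) (Dom C g)) (sum_obj C (Cod C f) (Cod C g)) \<and>
        u \<cdot>\<^sub>C sum_inj C (Dom C f) (Dom C g) 0 = sum_inj C (Cod C f) (Cod C g) 0 \<cdot>\<^sub>C f \<and>
        u \<cdot>\<^sub>C sum_inj C (Dom C f) (Dom C g) 1 = sum_inj C (Cod C f) (Cod C g) 1 \<cdot>\<^sub>C g"
    by (intro exI[of _ u]) simp
qed (use f g in \<open>auto intro: sum_unique[of "Dom C f" "Dom C g"]\<close>)

lemma sum_map_simps [simp]: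
  assumes "f \<in> Arr C" "g \<in> Arr C"
  shows "sum_map C f g \<in> Arr C" "Dom C (sum_map C f g) = sum_obj C (Dom C f) (Dom C g)"
    "Cod C (sum_map C f g) = sum_obj C (Cod C f) (Cod C g)"
  using sum_map_spec[OF assms] by auto

lemma sum_map_inj:
  assumes "f \<in> Arr C" "g \<in> Arr C" "Dom C f = A" "Dom C g = B" "Cod C f = X" "Cod C g = Y"
  shows "sum_map C f g \<cdot>\<^sub>C sum_inj C A B 0 = sum_inj C X Y 0 \<cdot>\<^sub>C f"
    "sum_map C f g \<cdot>\<^sub>C sum_inj C A B (Suc 0) = sum_inj C X Y (Suc 0) \<cdot>\<^sub>C g"
  using sum_map_spec[OF assms(1,2)] assms(3-6) by auto

lemma sum_map_comp:
  assumes "f \<in> Arr C" "g \<in> Arr C" "f' \<in> Arr C" "g' \<in> Arr C" "Cod C f = Dom C f'" "Cod C g = Dom C g'"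
  shows "sum_map C (f' \<cdot>\<^sub>C f) (g' \<cdot>\<^sub>C g) = sum_map C f' g' \<cdot>\<^sub>C sum_map C f g"
proof (rule sum_unique[of "Dom C f" "Dom C g"])
  let ?s = "sum_inj C (Dom C f) (Dom C g)"
  have "sum_map C f' g' \<cdot>\<^sub>C (sum_map C f g \<cdot>\<^sub>C ?s 0) = sum_map C f' g' \<cdot>\<^sub>C (sum_inj C (Dom C f') (Dom C g') 0 \<cdot>\<^sub>C f)"
    "sum_map C f' g' \<cdot>\<^sub>C (sum_map C f g \<cdot>\<^sub>C ?s (Suc 0)) = sum_map C f' g' \<cdot>\<^sub>C (sum_inj C (Dom C f') (Dom C g') (Suc 0) \<cdot>\<^sub>C g)"
    using assms by (simp_all add: sum_map_inj)
  moreover have "sum_map C f' g' \<cdot>\<^sub>C (sum_inj C (Dom C f') (Dom C g') 0 \<cdot>\<^sub>C f) = sum_inj C (Cod C f') (Cod C g') 0 \<cdot>\<^sub>C (f' \<cdot>\<^sub>C f)"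
    "sum_map C f' g' \<cdot>\<^sub>C (sum_inj C (Dom C f') (Dom C g') (Suc 0) \<cdot>\<^sub>C g) = sum_inj C (Cod C f') (Cod C g') (Suc 0) \<cdot>\<^sub>C (g' \<cdot>\<^sub>C g)"
    by (rule square_comp; use assms in \<open>simp add: sum_map_inj\<close>)+
  ultimately show "sum_map C (f' \<cdot>\<^sub>C f) (g' \<cdot>\<^sub>C g) \<cdot>\<^sub>C ?s 0 = (sum_map C f' g' \<cdot>\<^sub>C sum_map C f g) \<cdot>\<^sub>C ?s 0"
    "sum_map C (f' \<cdot>\<^sub>C f) (g' \<cdot>\<^sub>C g) \<cdot>\<^sub>C ?s (Suc 0) = (sum_map C f' g' \<cdot>\<^sub>C sum_map C f g) \<cdot>\<^sub>C ?s (Suc 0)"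
    using assms by (simp_all add: sum_map_inj)
qed (use assms in simp_all)

lemma sum_map_Ident:
  assumes "X \<in> Obj C" "Y \<in> Obj C"
  shows "sum_map C (Ident C X) (Ident C Y) = Ident C (sum_obj C X Y)"
  by (rule sum_unique[of X Y]) (use assms in \<open>simp_all add: sum_map_inj\<close>)

abbreviation slice_pair :: "'a \<Rightarrow> 'a \<Rightarrow> ('b \<times> 'b, ('b \<times> 'b \<times> 'b) \<times> ('b \<times> 'b \<times> 'b)) category" where
  "slice_pair X Y \<equiv> product_category (slice_category C X) (slice_category C Y)"

lemma slice_pair_is_category: "is_category (slice_pair X Y)"
  by (intro product_category_is_category slice_category_is_category)

lemma slice_sum_FO [simp]:
  "\<lbrakk>f \<in> Arr C; Cod C f = X; g \<in> Arr C; Cod C g = Y\<rbrakk> \<Longrightarrow> FO (slice_sum_functor C X Y) (f, g) = sum_map C f g"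
  by (simp add: slice_sum_functor_def Let_def)

lemma slice_sum_FM [simp]:
  "\<lbrakk>(f, h, f') \<in> Arr (slice_category C X); (g, k, g') \<in> Arr (slice_category C Y)\<rbrakk> \<Longrightarrow>
    FM (slice_sum_functor C X Y) ((f, h, f'), (g, k, g')) = (sum_map C f g, sum_map C h k, sum_map C f' g')"
  by (simp add: slice_sum_functor_def Let_def)

lemma slice_sum_is_functor:
  assumes XY: "X \<in> Obj C" "Y \<in> Obj C"
  shows "is_functor (slice_pair X Y) (slice_category C (sum_obj C X Y)) (slice_sum_functor C X Y)"
  unfolding is_functor_def
proof (intro conjI ballI impI)
  let ?F = "slice_sum_functor C X Y" and ?P = "slice_pair X Y" and ?S = "slice_category C (sum_obj C X Y)"
  show "is_category ?P" by (rule slice_pair_is_category)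
  show "is_category ?S" by (rule slice_category_is_category)
  show "FO ?F \<in> extensional (Obj ?P)" "FM ?F \<in> extensional (Arr ?P)"
    by (auto simp: slice_sum_functor_def Let_def)
  fix p assume p: "p \<in> Obj ?P"
  then obtain f g where fg: "p = (f, g)" "f \<in> Arr C" "Cod C f = X" "g \<in> Arr C" "Cod C g = Y" by (cases p) auto
  then show "FO ?F p \<in> Obj ?S" by simp
  show "FM ?F (Ident ?P p) = Ident ?S (FO ?F p)" using fg by (simp add: sum_map_Ident)
next
  let ?F = "slice_sum_functor C X Y" and ?P = "slice_pair X Y" and ?S = "slice_category C (sum_obj C X Y)"
  fix a assume "a \<in> Arr ?P"
  then obtain x y where xy: "a = (x, y)" "x \<in> Arr (slice_category C X)" "y \<in> Arr (slice_category C Y)"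
    by (cases a) simp
  obtain f h f' g k g' where "x = (f, h, f')" "y = (g, k, g')" by (cases x; cases y)
  with xy have a: "a = ((f, h, f'), (g, k, g'))" and af: "(f, h, f') \<in> Arr (slice_category C X)"
    and ag: "(g, k, g') \<in> Arr (slice_category C Y)" by simp_all
  have eq: "f' \<cdot>\<^sub>C h = f" "g' \<cdot>\<^sub>C k = g" using af ag by auto
  show "in_hom ?S (FM ?F a) (FO ?F (Dom ?P a)) (FO ?F (Cod ?P a))"
    using af ag sum_map_comp[of h k f' g'] unfolding a by (simp add: eq)
  fix b assume "b \<in> Arr ?P" and ab: "Cod ?P a = Dom ?P b"
  then obtain x' y' where xy': "b = (x', y')" "x' \<in> Arr (slice_category C X)" "y' \<in> Arr (slice_category C Y)"
    by (cases b) simp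
  obtain f1 h2 f2 g1 k2 g2 where xy2: "x' = (f1, h2, f2)" "y' = (g1, k2, g2)" by (cases x'; cases y')
  have "f1 = f'" "g1 = g'" using ab a xy'(1) xy2 by simp_all
  with xy' xy2 have b: "b = ((f', h2, f2), (g', k2, g2))" and bf: "(f', h2, f2) \<in> Arr (slice_category C X)"
    and bg: "(g', k2, g2) \<in> Arr (slice_category C Y)" by simp_all
  have cf: "(f, h2 \<cdot>\<^sub>C h, f2) \<in> Arr (slice_category C X)" "(g, k2 \<cdot>\<^sub>C k, g2) \<in> Arr (slice_category C Y)"
    using af bf ag bg reassoc[of f2 h2 f' h] reassoc[of g2 k2 g' k] by auto
  show "FM ?F (Comp ?P b a) = Comp ?S (FM ?F b) (FM ?F a)"
    using slice_sum_FM[OF af ag] slice_sum_FM[OF bf bg] slice_sum_FM[OF cf] sum_map_comp[of h k h2 k2] af ag bf bg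
    unfolding a b by simp
qed

text \<open>\<open>mono\<close> makes the slice functor faithful. \<open>disj\<close> makes it full:
  an arrow over the sum restricts to each summand because the summand is a pullback.
  \<open>univ\<close> makes it essentially surjective: an arrow into the sum is the sum of its
  pullbacks along the injections.\<close>

lemma extensiveI:
  assumes pb: "has_pullbacks C"
    and mono: "\<And>A B. \<lbrakk>A \<in> Obj C; B \<in> Obj C\<rbrakk> \<Longrightarrow> is_mono C (sum_inj C A B 0)"
      "\<And>A B. \<lbrakk>A \<in> Obj C; B \<in> Obj C\<rbrakk> \<Longrightarrow> is_mono C (sum_inj C A B (Suc 0))"
    and disj: "\<And>f g. \<lbrakk>f \<in> Arr C; g \<in> Arr C\<rbrakk> \<Longrightarrow>
      is_pullback C (sum_map C f g) (sum_inj C (Cod C f) (Cod C g) 0) (sum_inj C (Dom C f) (Dom C g) 0) f \<and>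
      is_pullback C (sum_map C f g) (sum_inj C (Cod C f) (Cod C g) (Suc 0)) (sum_inj C (Dom C f) (Dom C g) (Suc 0)) g"
    and univ: "\<And>X Y h a p b q. \<lbrakk>X \<in> Obj C; Y \<in> Obj C; is_pullback C h (sum_inj C X Y 0) a p; is_pullback C h (sum_inj C X Y (Suc 0)) b q\<rbrakk> \<Longrightarrow>
      is_coproduct C {0, 1} (\<lambda>i. if i = 0 then Dom C a else Dom C b) (Dom C h) (\<lambda>i::nat. if i = 0 then a else b)"
  shows "extensive_category C"
proof -
  have "is_equivalence (slice_pair X Y) (slice_category C (sum_obj C X Y)) (slice_sum_functor C X Y)"
    if XY: "X \<in> Obj C" "Y \<in> Obj C" for X Y
  proof (rule equivalenceI)
    let ?F = "slice_sum_functor C X Y" and ?P = "slice_pair X Y" and ?S = "slice_category C (sum_obj C X Y)"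
    show "fully_faithful ?P ?S ?F"
    proof (rule fully_faithfulI)
      show "is_functor ?P ?S ?F" by (rule slice_sum_is_functor[OF XY])
      fix a b assume aP: "a \<in> Arr ?P" "b \<in> Arr ?P" and ab: "Dom ?P a = Dom ?P b" "Cod ?P a = Cod ?P b" "FM ?F a = FM ?F b"
      obtain x y x' y' where xy: "a = (x, y)" "b = (x', y')" by (cases a; cases b)
      obtain f h f' g k g' where xy1: "x = (f, h, f')" "y = (g, k, g')" by (cases x; cases y)
      obtain f1 h2 f1' g1 k2 g1' where xy2: "x' = (f1, h2, f1')" "y' = (g1, k2, g1')" by (cases x'; cases y')
      have "f1 = f" "f1' = f'" "g1 = g" "g1' = g'" using ab(1,2) xy xy1 xy2 by simp_all
      with xy xy1 xy2 have a: "a = ((f, h, f'), (g, k, g'))" "b = ((f, h2, f'), (g, k2, g'))" by simp_all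
      have ar: "(f, h, f') \<in> Arr (slice_category C X)" "(g, k, g') \<in> Arr (slice_category C Y)"
          "(f, h2, f') \<in> Arr (slice_category C X)" "(g, k2, g') \<in> Arr (slice_category C Y)"
        using aP unfolding a product_category_simps by simp_all
      have D: "h \<in> Arr C" "Dom C h = Dom C f" "Cod C h = Dom C f'" "k \<in> Arr C" "Dom C k = Dom C g" "Cod C k = Dom C g'"
        "h2 \<in> Arr C" "Dom C h2 = Dom C f" "Cod C h2 = Dom C f'" "k2 \<in> Arr C" "Dom C k2 = Dom C g" "Cod C k2 = Dom C g'"
        "Dom C f' \<in> Obj C" "Dom C g' \<in> Obj C"
        using ar by simp_all
      have s: "sum_map C h k = sum_map C h2 k2"
        using ab(3) slice_sum_FM[OF ar(1,2)] slice_sum_FM[OF ar(3,4)] a by simp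
      have "sum_inj C (Dom C f') (Dom C g') 0 \<cdot>\<^sub>C h = sum_inj C (Dom C f') (Dom C g') 0 \<cdot>\<^sub>C h2"
        "sum_inj C (Dom C f') (Dom C g') (Suc 0) \<cdot>\<^sub>C k = sum_inj C (Dom C f') (Dom C g') (Suc 0) \<cdot>\<^sub>C k2"
        using sum_map_inj[OF D(1,4,2,5,3,6)] sum_map_inj[OF D(7,10,8,11,9,12)] s by simp_all
      then have "h = h2" "k = k2"
        using is_monoD[OF mono(1)[OF D(13,14)] D(1,7)] is_monoD[OF mono(2)[OF D(13,14)] D(4,10)] D by simp_all
      then show "a = b" using a by simp
    next
      fix p q s assume p: "p \<in> Obj ?P" and q: "q \<in> Obj ?P" and s: "in_hom ?S s (FO ?F p) (FO ?F q)"
      obtain f g where fg: "p = (f, g)" "f \<in> Arr C" "Cod C f = X" "g \<in> Arr C" "Cod C g = Y" using p by (cases p) auto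
      obtain f' g' where fg': "q = (f', g')" "f' \<in> Arr C" "Cod C f' = X" "g' \<in> Arr C" "Cod C g' = Y" using q by (cases q) auto
      obtain t where t: "s = (sum_map C f g, t, sum_map C f' g')" "t \<in> Arr C" "Dom C t = sum_obj C (Dom C f) (Dom C g)"
        "Cod C t = sum_obj C (Dom C f') (Dom C g')" "sum_map C f' g' \<cdot>\<^sub>C t = sum_map C f g"
        using s fg fg' by (cases s) auto
      have A: "Dom C f \<in> Obj C" "Dom C g \<in> Obj C" "Dom C f' \<in> Obj C" "Dom C g' \<in> Obj C" using fg fg' by auto
      note pbs = disj[OF fg'(2,4), unfolded fg'(3,5)]
      have "sum_map C f' g' \<cdot>\<^sub>C (t \<cdot>\<^sub>C sum_inj C (Dom C f) (Dom C g) 0) = sum_inj C X Y 0 \<cdot>\<^sub>C f"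
        "sum_map C f' g' \<cdot>\<^sub>C (t \<cdot>\<^sub>C sum_inj C (Dom C f) (Dom C g) (Suc 0)) = sum_inj C X Y (Suc 0) \<cdot>\<^sub>C g"
        using reassoc[OF t(5), of "sum_inj C (Dom C f) (Dom C g) 0"] reassoc[OF t(5), of "sum_inj C (Dom C f) (Dom C g) (Suc 0)"]
          t A fg fg' sum_map_inj[OF fg(2,4) refl refl fg(3,5)] by simp_all
      note e = this
      obtain h where h: "h \<in> Arr C" "Dom C h = Dom C f" "Cod C h = Dom C f'" "sum_inj C (Dom C f') (Dom C g') 0 \<cdot>\<^sub>C h = t \<cdot>\<^sub>C sum_inj C (Dom C f) (Dom C g) 0" "f' \<cdot>\<^sub>C h = f"
        by (rule pullback_lift[OF conjunct1[OF pbs] _ fg(2) _ _ _ e(1)]) (use t A fg fg' XY in simp_all)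
      obtain k where k: "k \<in> Arr C" "Dom C k = Dom C g" "Cod C k = Dom C g'" "sum_inj C (Dom C f') (Dom C g') (Suc 0) \<cdot>\<^sub>C k = t \<cdot>\<^sub>C sum_inj C (Dom C f) (Dom C g) (Suc 0)" "g' \<cdot>\<^sub>C k = g"
        by (rule pullback_lift[OF conjunct2[OF pbs] _ fg(4) _ _ _ e(2)]) (use t A fg fg' XY in simp_all)
      have "sum_map C h k = t"
        by (rule sum_unique[OF A(1,2)]) (use h k t A sum_map_inj[OF h(1) k(1) h(2) k(2) h(3) k(3)] in simp_all)
      then show "\<exists>a. in_hom ?P a p q \<and> FM ?F a = s"
        using fg fg' h k t by (intro exI[of _ "((f, h, f'), (g, k, g'))"]) simp
    qed
    fix h assume "h \<in> Obj ?S"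
    then have h: "h \<in> Arr C" "Cod C h = sum_obj C X Y" by auto
    obtain a p where ap: "is_pullback C h (sum_inj C X Y 0) a p"
      using pb h XY unfolding has_pullbacks_def by (metis sum_inj_simps(1,5))
    obtain b q where bq: "is_pullback C h (sum_inj C X Y (Suc 0)) b q"
      using pb h XY unfolding has_pullbacks_def by (metis sum_inj_simps(2,6))
    note sa = pullback_square[OF ap] and sb = pullback_square[OF bq]
    have pq: "p \<in> Arr C" "q \<in> Arr C" "Cod C p = X" "Cod C q = Y" "Dom C p = Dom C a" "Dom C q = Dom C b" using sa sb XY by auto
    have AB: "Dom C a \<in> Obj C" "Dom C b \<in> Obj C" using sa sb by auto
    note co = univ[OF XY ap bq]
    obtain i where i: "i \<in> Arr C" "Dom C i = sum_obj C (Dom C a) (Dom C b)" "Cod C i = Dom C h"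
      "i \<cdot>\<^sub>C sum_inj C (Dom C a) (Dom C b) 0 = a" "i \<cdot>\<^sub>C sum_inj C (Dom C a) (Dom C b) (Suc 0) = b"
      using sum_lift[of a b] sa sb by auto
    obtain k where k0: "k \<in> Arr C" "Dom C k = Dom C h" "Cod C k = sum_obj C (Dom C a) (Dom C b)"
      "\<And>n. n \<in> {0, 1} \<Longrightarrow> k \<cdot>\<^sub>C (if n = 0 then a else b) = sum_inj C (Dom C a) (Dom C b) n"
      by (rule coproduct_lift[OF co, of "sum_obj C (Dom C a) (Dom C b)" "sum_inj C (Dom C a) (Dom C b)"]) (use AB in auto)
    have k: "k \<cdot>\<^sub>C a = sum_inj C (Dom C a) (Dom C b) 0" "k \<cdot>\<^sub>C b = sum_inj C (Dom C a) (Dom C b) (Suc 0)" using k0(4)[of 0] k0(4)[of 1] by auto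
    have ki: "k \<cdot>\<^sub>C i = Ident C (sum_obj C (Dom C a) (Dom C b))"
      by (rule sum_unique[OF AB]) (use i k0(1-3) k AB in simp_all)
    have ik: "i \<cdot>\<^sub>C k = Ident C (Dom C h)"
      by (rule coproduct_unique[OF co]) (use i k0(1-3) k AB sa sb h in auto)
    have hi: "h \<cdot>\<^sub>C i = sum_map C p q"
      by (rule sum_unique[OF AB]) (use i pq AB h sa(3,7,9) sb(3,7,9) XY sum_map_inj[OF pq(1,2,5,6,3,4)] in simp_all)
    have hk: "sum_map C p q \<cdot>\<^sub>C k = h" using reassoc[OF hi, of k] i k0(1-3) h ik by simp
    have iso: "is_iso ?S (sum_map C p q, i, h)"
      by (rule is_isoI[where g="(h, k, sum_map C p q)"]) (use hi hk i k0(1-3) h pq XY ki ik in simp_all)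
    show "\<exists>x\<in>Obj ?P. \<exists>i. in_hom ?S i (FO ?F x) h \<and> is_iso ?S i"
      by (intro bexI[of _ "(p, q)"] exI[of _ "(sum_map C p q, i, h)"]) (use iso hi i h pq XY in simp_all)
  qed
  then show ?thesis unfolding extensive_category_def using cat has_sums by blast
qed

end

section \<open>Strict initial objects and universal sums in extensive categories\<close>

locale extcat = cat +
  assumes extensive: "extensive_category C"
begin

sublocale sumcat using extensive by unfold_locales (simp add: extensive_category_def)

text \<open>By essential surjectivity \<open>g\<close> is isomorphic to a sum of two arrows;
  \<open>j0\<close> and \<open>j1\<close> are the injections carried over by the
  isomorphism.\<close>

lemma sum_decomposition:
  assumes XY: "X \<in> Obj C" "Y \<in> Obj C" and g: "g \<in> Arr C" "Cod C g = sum_obj C X Y"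
  obtains j0 j1 f0 f1 where "j0 \<in> Arr C" "j1 \<in> Arr C" "f0 \<in> Arr C" "f1 \<in> Arr C" "Cod C j0 = Dom C g" "Cod C j1 = Dom C g"
    "Dom C f0 = Dom C j0" "Dom C f1 = Dom C j1" "Cod C f0 = X" "Cod C f1 = Y"
    "g \<cdot>\<^sub>C j0 = sum_inj C X Y 0 \<cdot>\<^sub>C f0" "g \<cdot>\<^sub>C j1 = sum_inj C X Y (Suc 0) \<cdot>\<^sub>C f1"
    "\<forall>u v. u \<in> Arr C \<and> v \<in> Arr C \<and> Dom C u = Dom C g \<and> Dom C v = Dom C g \<and> Cod C u = Cod C v \<and> u \<cdot>\<^sub>C j0 = v \<cdot>\<^sub>C j0 \<and> u \<cdot>\<^sub>C j1 = v \<cdot>\<^sub>C j1 \<longrightarrow> u = v"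
proof -
  have eq: "is_equivalence (slice_pair X Y) (slice_category C (sum_obj C X Y)) (slice_sum_functor C X Y)"
    using extensive XY unfolding extensive_category_def by blast
  obtain p i where p: "p \<in> Obj (slice_pair X Y)" and i: "in_hom (slice_category C (sum_obj C X Y)) i (FO (slice_sum_functor C X Y) p) g"
    and iso: "is_iso (slice_category C (sum_obj C X Y)) i"
    by (rule equivalence_ess_surj[OF eq, of g]) (use g in auto)
  obtain f0 f1 where f: "p = (f0, f1)" "f0 \<in> Arr C" "Cod C f0 = X" "f1 \<in> Arr C" "Cod C f1 = Y" using p by (cases p) auto
  obtain h where h: "i = (sum_map C f0 f1, h, g)" "h \<in> Arr C" "Dom C h = sum_obj C (Dom C f0) (Dom C f1)" "Cod C h = Dom C g" "g \<cdot>\<^sub>C h = sum_map C f0 f1"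
    using i f by (cases i) auto
  obtain i' where i': "i' \<in> Arr (slice_category C (sum_obj C X Y))"
    "Dom (slice_category C (sum_obj C X Y)) i' = Cod (slice_category C (sum_obj C X Y)) i"
    "Cod (slice_category C (sum_obj C X Y)) i' = Dom (slice_category C (sum_obj C X Y)) i"
    "Comp (slice_category C (sum_obj C X Y)) i i' = Ident (slice_category C (sum_obj C X Y)) (Cod (slice_category C (sum_obj C X Y)) i)"
    by (rule is_isoE[OF iso])
  obtain g0 k g1 where k0: "i' = (g0, k, g1)" by (cases i')
  have k: "k \<in> Arr C" "Dom C k = Dom C g" "Cod C k = Dom C h" "h \<cdot>\<^sub>C k = Ident C (Dom C g)"
    using i' h(1,3) f unfolding k0 h(1) by simp_all
  let ?s = "sum_inj C (Dom C f0) (Dom C f1)"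
  have A: "Dom C f0 \<in> Obj C" "Dom C f1 \<in> Obj C" using f by auto
  have e: "g \<cdot>\<^sub>C (h \<cdot>\<^sub>C ?s 0) = sum_inj C X Y 0 \<cdot>\<^sub>C f0" "g \<cdot>\<^sub>C (h \<cdot>\<^sub>C ?s (Suc 0)) = sum_inj C X Y (Suc 0) \<cdot>\<^sub>C f1"
    using reassoc[OF h(5), of "?s 0"] reassoc[OF h(5), of "?s (Suc 0)"] h g f A sum_map_inj[OF f(2,4) refl refl f(3,5)] by simp_all
  show ?thesis
  proof (rule that[of "h \<cdot>\<^sub>C ?s 0" "h \<cdot>\<^sub>C ?s (Suc 0)" f0 f1])
    have "u = v" if uv: "u \<in> Arr C" "v \<in> Arr C" "Dom C u = Dom C g" "Dom C v = Dom C g" "Cod C u = Cod C v"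
      "u \<cdot>\<^sub>C (h \<cdot>\<^sub>C ?s 0) = v \<cdot>\<^sub>C (h \<cdot>\<^sub>C ?s 0)" "u \<cdot>\<^sub>C (h \<cdot>\<^sub>C ?s (Suc 0)) = v \<cdot>\<^sub>C (h \<cdot>\<^sub>C ?s (Suc 0))" for u v
    proof -
      have "u \<cdot>\<^sub>C h = v \<cdot>\<^sub>C h" by (rule sum_unique[OF A]) (use uv h(2-4) A in simp_all)
      then have "u \<cdot>\<^sub>C (h \<cdot>\<^sub>C k) = v \<cdot>\<^sub>C (h \<cdot>\<^sub>C k)" by (rule square_comp) (use uv h k in simp_all)
      moreover have "u \<cdot>\<^sub>C (h \<cdot>\<^sub>C k) = u" "v \<cdot>\<^sub>C (h \<cdot>\<^sub>C k) = v" using uv k by simp_all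
      ultimately show "u = v" by (simp only:)
    qed
    then show "\<forall>u v. u \<in> Arr C \<and> v \<in> Arr C \<and> Dom C u = Dom C g \<and> Dom C v = Dom C g \<and> Cod C u = Cod C v \<and>
      u \<cdot>\<^sub>C (h \<cdot>\<^sub>C ?s 0) = v \<cdot>\<^sub>C (h \<cdot>\<^sub>C ?s 0) \<and> u \<cdot>\<^sub>C (h \<cdot>\<^sub>C ?s (Suc 0)) = v \<cdot>\<^sub>C (h \<cdot>\<^sub>C ?s (Suc 0)) \<longrightarrow> u = v" by blast
  qed (use e f h A in simp_all)
qed

text \<open>In \<open>C/0 \<times> C/0 \<simeq> C/(0 + 0)\<close> the swap \<open>Y + 0 \<rightarrow> 0 + Y\<close> comes from a map \<open>Y \<rightarrow> 0\<close> and a map \<open>0 \<rightarrow> Y\<close>.\<close>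

lemma strict_initial:
  assumes O: "is_initial C Z" and f: "f \<in> Arr C" "Cod C f = Z"
    and uv: "u \<in> Arr C" "v \<in> Arr C" "Dom C u = Dom C f" "Dom C v = Dom C f" "Cod C u = Cod C v"
  shows "u = v"
proof -
  define Y where "Y = Dom C f"
  have Z: "Z \<in> Obj C" using O by (simp add: is_initial_def)
  have Y: "Y \<in> Obj C" "Dom C f = Y" using f by (auto simp: Y_def)
  let ?i = "Ident C Z" and ?a = "sum_inj C Y Z" and ?b = "sum_inj C Z Y" and ?c = "sum_inj C Z Z"
  obtain k where k: "k \<in> Arr C" "Dom C k = sum_obj C Y Z" "Cod C k = sum_obj C Z Y" "k \<cdot>\<^sub>C ?a 0 = ?b (Suc 0)" "k \<cdot>\<^sub>C ?a (Suc 0) = ?b 0"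
    using sum_lift[of "?b (Suc 0)" "?b 0"] Y Z by auto
  \<comment> \<open>The two injections of an initial object agree, so the swap \<open>k\<close> is
    an arrow over the sum of \<open>Z\<close> with itself.\<close>
  have cc: "?c 0 = ?c (Suc 0)" by (rule initial_unique[OF O]) (use Z in auto)
  have "sum_map C ?i f \<cdot>\<^sub>C k = sum_map C f ?i"
  proof (rule sum_unique[OF Y(1) Z])
    show "(sum_map C ?i f \<cdot>\<^sub>C k) \<cdot>\<^sub>C ?a 0 = sum_map C f ?i \<cdot>\<^sub>C ?a 0"
      using k Y Z f cc sum_map_inj[of ?i f Z Y Z Z] sum_map_inj[of f ?i Y Z Z Z] by simp
    show "(sum_map C ?i f \<cdot>\<^sub>C k) \<cdot>\<^sub>C ?a (Suc 0) = sum_map C f ?i \<cdot>\<^sub>C ?a (Suc 0)"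
      by (rule initial_unique[OF O]) (use k Y Z f in simp_all)
  qed (use k Y Z f in simp_all)
  then have kS: "(sum_map C f ?i, k, sum_map C ?i f) \<in> Arr (slice_category C (sum_obj C Z Z))"
    using k Y Z f by simp
  have eq: "is_equivalence (slice_pair Z Z) (slice_category C (sum_obj C Z Z)) (slice_sum_functor C Z Z)"
    using extensive Z unfolding extensive_category_def by blast
  obtain x where x: "x \<in> Arr (slice_pair Z Z)" "Dom (slice_pair Z Z) x = (f, ?i)" "Cod (slice_pair Z Z) x = (?i, f)"
    "FM (slice_sum_functor C Z Z) x = (sum_map C f ?i, k, sum_map C ?i f)"
    by (rule equivalence_full[OF eq _ _ kS, of "(f, ?i)" "(?i, f)"]) (use f Z in simp_all)
  then obtain h h' where h: "x = ((f, h, ?i), (?i, h', f))" "(f, h, ?i) \<in> Arr (slice_category C Z)" "(?i, h', f) \<in> Arr (slice_category C Z)"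
    by (cases x) auto
  have "h = f" using h(2) by auto
  moreover have "sum_map C h h' = k" using x(4) slice_sum_FM[OF h(2,3)] h(1) by simp
  \<comment> \<open>Fullness writes the swap as a sum whose first component is forced to be
    \<open>f\<close>. On the first summand this says that the injection of \<open>Y\<close> factors
    through \<open>f\<close>; consequently every arrow out of \<open>Y\<close> is \<open>f\<close>
    followed by the unique arrow from \<open>Z\<close>.\<close>
  ultimately have "?b (Suc 0) = ?b 0 \<cdot>\<^sub>C f"
    using k(4) sum_map_inj[of h h' Y Z Z Y] h(2,3) Y Z by simp
  note b = this
  have "w = w' \<cdot>\<^sub>C f" if w: "w \<in> Arr C" "Dom C w = Y" "w' \<in> Arr C" "Dom C w' = Z" "Cod C w' = Cod C w" for w w'
  proof -
    obtain t where t: "t \<in> Arr C" "Dom C t = sum_obj C Z Y" "Cod C t = Cod C w'" "t \<cdot>\<^sub>C ?b 0 = w'" "t \<cdot>\<^sub>C ?b (Suc 0) = w"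
      using sum_lift[of w' w] w by auto
    then show ?thesis using reassoc[OF t(4), of f] b Y Z f by simp
  qed
  moreover obtain w' where "w' \<in> Arr C" "Dom C w' = Z" "Cod C w' = Cod C u" by (rule initial_ex[OF O, of "Cod C u"]) (use uv in auto)
  ultimately show ?thesis using uv Y by metis
qed

text \<open>Universality of finite coproducts, phrased by test arrows instead of pullbacks: arrows
  on the domain of \<open>g\<close> agree if they agree wherever \<open>g\<close> lands in a
  summand. The empty case is strictness of the initial object; the induction splits off one summand
  by \<open>sum_decomposition\<close>.\<close>

lemma coproduct_jointly_epic:
  assumes "finite (I :: nat set)" "is_coproduct C I A S \<iota>" "g \<in> Arr C" "Cod C g = S"
    "u \<in> Arr C" "v \<in> Arr C" "Dom C u = Dom C g" "Dom C v = Dom C g" "Cod C u = Cod C v"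
    "\<And>i a b. \<lbrakk>i \<in> I; a \<in> Arr C; b \<in> Arr C; Dom C b = Dom C a; Cod C a = Dom C g; Cod C b = A i; g \<cdot>\<^sub>C a = \<iota> i \<cdot>\<^sub>C b\<rbrakk> \<Longrightarrow> u \<cdot>\<^sub>C a = v \<cdot>\<^sub>C a"
  shows "u = v"
  using assms
proof (induction I arbitrary: S \<iota> g u v rule: finite_induct)
  case empty
  then show ?case using strict_initial[of S g u v] by (simp add: is_coproduct_empty)
next
  case (insert k I)
  note co = insert.prems(1) and g = insert.prems(2,3) and uv = insert.prems(4-8) and eq = insert.prems(9)
  note c = coproduct_cocone[OF co]
  have A: "A i \<in> Obj C" if "i \<in> insert k I" for i using c(2,3)[OF that] Dom_Obj by metis
  obtain S' \<kappa> where co': "is_coproduct C I A S' \<kappa>" by (rule coproduct_ex[of I A]) (use insert.hyps A in auto)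
  note c' = coproduct_cocone[OF co']
  have Ak: "A k \<in> Obj C" using A by simp
  let ?j = "sum_inj C S' (A k)"
  obtain \<phi> where \<phi>: "\<phi> \<in> Arr C" "Dom C \<phi> = S" "Cod C \<phi> = sum_obj C S' (A k)"
    "\<And>i. i \<in> insert k I \<Longrightarrow> \<phi> \<cdot>\<^sub>C \<iota> i = (if i = k then ?j (Suc 0) else ?j 0 \<cdot>\<^sub>C \<kappa> i)"
    by (rule coproduct_lift[OF co, of "sum_obj C S' (A k)" "\<lambda>i. if i = k then ?j (Suc 0) else ?j 0 \<cdot>\<^sub>C \<kappa> i"]) (use c' Ak in auto)
  obtain t where t: "t \<in> Arr C" "Dom C t = S'" "Cod C t = S" "\<And>i. i \<in> I \<Longrightarrow> t \<cdot>\<^sub>C \<kappa> i = \<iota> i"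
    by (rule coproduct_lift[OF co', of S \<iota>]) (use c in auto)
  obtain \<psi> where \<psi>: "\<psi> \<in> Arr C" "Dom C \<psi> = sum_obj C S' (A k)" "Cod C \<psi> = S" "\<psi> \<cdot>\<^sub>C ?j 0 = t" "\<psi> \<cdot>\<^sub>C ?j (Suc 0) = \<iota> k"
    using sum_lift[of t "\<iota> k"] t c by auto
  \<comment> \<open>A left inverse is all that is taken from the comparison with the binary sum: it
    allows \<open>\<phi>\<close> to be cancelled.\<close>
  have \<psi>\<phi>: "\<psi> \<cdot>\<^sub>C \<phi> = Ident C S"
  proof (rule coproduct_unique[OF co])
    fix i assume i: "i \<in> insert k I"
    show "(\<psi> \<cdot>\<^sub>C \<phi>) \<cdot>\<^sub>C \<iota> i = Ident C S \<cdot>\<^sub>C \<iota> i"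
    proof (cases "i = k")
      case True then show ?thesis using \<phi>(1-3) \<phi>(4)[OF i] \<psi> c i by simp
    next
      case False
      then have "i \<in> I" using i by simp
      then show ?thesis using \<phi>(1-3) \<phi>(4)[OF i] \<psi> c(1) c(2-4)[OF i] c'(1) c'(2-4) t False reassoc[OF \<psi>(4), of "\<kappa> i"] Ak by simp
    qed
  qed (use \<phi> \<psi> c in auto)
  have mono: "x = y" if "x \<in> Arr C" "y \<in> Arr C" "Cod C x = S" "Cod C y = S" "\<phi> \<cdot>\<^sub>C x = \<phi> \<cdot>\<^sub>C y" for x y
  proof -
    have "x = \<psi> \<cdot>\<^sub>C (\<phi> \<cdot>\<^sub>C x)" using reassoc[OF \<psi>\<phi>, of x] that(1,3) \<phi>(1-3) \<psi>(1-3) by simp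
    also have "\<dots> = \<psi> \<cdot>\<^sub>C (\<phi> \<cdot>\<^sub>C y)" using that(5) by simp
    also have "\<dots> = y" using reassoc[OF \<psi>\<phi>, of y] that(2,4) \<phi>(1-3) \<psi>(1-3) by simp
    finally show ?thesis .
  qed
  have pg: "\<phi> \<cdot>\<^sub>C g \<in> Arr C" "Cod C (\<phi> \<cdot>\<^sub>C g) = sum_obj C S' (A k)" using \<phi>(1-3) g by simp_all
  obtain j0 j1 f0 f1 where j: "j0 \<in> Arr C" "j1 \<in> Arr C" "f0 \<in> Arr C" "f1 \<in> Arr C" "Cod C j0 = Dom C (\<phi> \<cdot>\<^sub>C g)" "Cod C j1 = Dom C (\<phi> \<cdot>\<^sub>C g)"
    "Dom C f0 = Dom C j0" "Dom C f1 = Dom C j1" "Cod C f0 = S'" "Cod C f1 = A k"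
    "(\<phi> \<cdot>\<^sub>C g) \<cdot>\<^sub>C j0 = ?j 0 \<cdot>\<^sub>C f0" "(\<phi> \<cdot>\<^sub>C g) \<cdot>\<^sub>C j1 = ?j (Suc 0) \<cdot>\<^sub>C f1"
    "\<forall>u v. u \<in> Arr C \<and> v \<in> Arr C \<and> Dom C u = Dom C (\<phi> \<cdot>\<^sub>C g) \<and> Dom C v = Dom C (\<phi> \<cdot>\<^sub>C g) \<and> Cod C u = Cod C v \<and> u \<cdot>\<^sub>C j0 = v \<cdot>\<^sub>C j0 \<and> u \<cdot>\<^sub>C j1 = v \<cdot>\<^sub>C j1 \<longrightarrow> u = v"
    by (rule sum_decomposition[OF c'(1) Ak pg])
  have jg: "Cod C j0 = Dom C g" "Cod C j1 = Dom C g" "Dom C (\<phi> \<cdot>\<^sub>C g) = Dom C g" using j(5,6) \<phi> g by auto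
  have e: "\<phi> \<cdot>\<^sub>C (g \<cdot>\<^sub>C j0) = ?j 0 \<cdot>\<^sub>C f0" "\<phi> \<cdot>\<^sub>C (g \<cdot>\<^sub>C j1) = ?j (Suc 0) \<cdot>\<^sub>C f1" using j(1,2,11,12) jg \<phi> g by auto
  have "u \<cdot>\<^sub>C j1 = v \<cdot>\<^sub>C j1"
  proof (rule eq[of k j1 f1])
    show "g \<cdot>\<^sub>C j1 = \<iota> k \<cdot>\<^sub>C f1"
      by (rule mono) (use e(2) j(2,4,8,10) jg g c reassoc[OF \<phi>(4), of k f1] \<phi>(1-3) in simp_all)
  qed (use j(1-10) jg in simp_all)
  moreover have "u \<cdot>\<^sub>C j0 = v \<cdot>\<^sub>C j0"
  proof (rule insert.IH[OF co' j(3,9)])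
    fix i a b assume i: "i \<in> I" and ab: "a \<in> Arr C" "b \<in> Arr C" "Dom C b = Dom C a" "Cod C a = Dom C f0" "Cod C b = A i" "f0 \<cdot>\<^sub>C a = \<kappa> i \<cdot>\<^sub>C b"
    have ik: "i \<in> insert k I" "i \<noteq> k" using i insert.hyps by auto
    note ci = c(2-4)[OF ik(1)] and ci' = c'(2-4)[OF i]
    have "\<phi> \<cdot>\<^sub>C (g \<cdot>\<^sub>C (j0 \<cdot>\<^sub>C a)) = ?j 0 \<cdot>\<^sub>C (f0 \<cdot>\<^sub>C a)"
      using reassoc[OF e(1), of a] ab j(1,3,7,9) jg \<phi>(1-3) g c'(1) Ak by simp
    also have "\<dots> = \<phi> \<cdot>\<^sub>C (\<iota> i \<cdot>\<^sub>C b)"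
      using reassoc[OF \<phi>(4)[OF ik(1)], of b] ab ik ci ci' \<phi>(1-3) c'(1) Ak by simp
    finally have "g \<cdot>\<^sub>C (j0 \<cdot>\<^sub>C a) = \<iota> i \<cdot>\<^sub>C b"
      by - (rule mono, use ab j(1,3,7) jg g ci in simp_all)
    then have "u \<cdot>\<^sub>C (j0 \<cdot>\<^sub>C a) = v \<cdot>\<^sub>C (j0 \<cdot>\<^sub>C a)"
      by - (rule eq[of i "j0 \<cdot>\<^sub>C a" b], use ik ab j(1,3,7) jg in simp_all)
    then show "(u \<cdot>\<^sub>C j0) \<cdot>\<^sub>C a = (v \<cdot>\<^sub>C j0) \<cdot>\<^sub>C a" using uv ab j(1,7) jg by simp
  qed (use uv j(1-10) jg in simp_all)
  ultimately show ?case by - (rule j(13)[THEN spec, THEN spec, THEN mp], use uv jg(3) in simp)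
qed

end

locale pretop = regcat + extcat
begin

text \<open>A map out of the coproduct of a disjoint family of monomorphisms is a monomorphism, because
  the coproduct is universal.\<close>

lemma coproduct_of_disjoint_monos:
  assumes I: "finite (I :: nat set)" and Z: "Z \<in> Obj C"
    and m: "\<And>i. i \<in> I \<Longrightarrow> is_mono C (m i)" "\<And>i. i \<in> I \<Longrightarrow> Dom C (m i) = A i" "\<And>i. i \<in> I \<Longrightarrow> Cod C (m i) = Z"
    and disj: "\<And>i j a b u v. \<lbrakk>i \<in> I; j \<in> I; i \<noteq> j; a \<in> Arr C; b \<in> Arr C; Dom C b = Dom C a; Cod C a = A i; Cod C b = A j; m i \<cdot>\<^sub>C a = m j \<cdot>\<^sub>C b;
       u \<in> Arr C; v \<in> Arr C; Dom C u = Dom C a; Dom C v = Dom C a; Cod C u = Cod C v\<rbrakk> \<Longrightarrow> u = v"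
    and cover: "\<And>n. \<lbrakk>is_mono C n; Cod C n = Z; \<And>i. i \<in> I \<Longrightarrow> factors_through C (m i) n\<rbrakk> \<Longrightarrow> is_iso C n"
  shows "is_coproduct C I A Z m"
proof -
  have ma: "m i \<in> Arr C" "A i \<in> Obj C" if "i \<in> I" for i
    using m(1,2)[OF that] is_mono_Arr[of C "m i"] Dom_Obj[of "m i"] by auto
  obtain S \<iota> where co: "is_coproduct C I A S \<iota>" by (rule coproduct_ex[OF I]) (use ma in auto)
  note c = coproduct_cocone[OF co]
  obtain h where h: "h \<in> Arr C" "Dom C h = S" "Cod C h = Z" "\<And>i. i \<in> I \<Longrightarrow> h \<cdot>\<^sub>C \<iota> i = m i"
    by (rule coproduct_lift[OF co Z, of m]) (use ma m in auto)
  \<comment> \<open>The image of \<open>h\<close> contains every \<open>m i\<close>, so it is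
    everything.\<close>
  have "is_cover C h"
  proof -
    obtain n e where n: "is_mono C n" "is_cover C e" "Cod C n = Cod C h" "Dom C e = Dom C h" "Cod C e = Dom C n" "n \<cdot>\<^sub>C e = h"
      by (rule image_factorization[OF h(1)])
    have ar: "n \<in> Arr C" "e \<in> Arr C" using n(1) is_cover_Arr[OF n(2)] by auto
    have "factors_through C (m i) n" if i: "i \<in> I" for i
      unfolding factors_through_def using reassoc[OF n(6), of "\<iota> i"] c(2-4)[OF i] h(1-3) h(4)[OF i] ar n(3-5) m(2)[OF i]
      by (intro exI[of _ "e \<cdot>\<^sub>C \<iota> i"]) simp
    then have "is_iso C n" using cover n(1,3) h(3) by simp
    then show ?thesis using cover_comp[OF n(2) iso_cover[of n]] n(5,6) by simp
  qed
  moreover have "is_mono C h"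
  proof (rule is_monoI[OF h(1)])
    fix x y assume xy: "x \<in> Arr C" "y \<in> Arr C" "Dom C x = Dom C y" "Cod C x = Dom C h" "Cod C y = Dom C h" "h \<cdot>\<^sub>C x = h \<cdot>\<^sub>C y"
    \<comment> \<open>Tested twice: first where \<open>x\<close> lands in the summand
      \<open>i\<close>, then where \<open>y\<close> lands in the summand \<open>j\<close>. For
      \<open>i = j\<close> the monomorphism \<open>m i\<close> decides; otherwise the test object
      lies over two disjoint subobjects and all parallel arrows out of it coincide.\<close>
    show "x = y"
    proof (rule coproduct_jointly_epic[OF I co, of x x y])
      fix i a b assume i: "i \<in> I" and a: "a \<in> Arr C" "b \<in> Arr C" "Dom C b = Dom C a" "Cod C a = Dom C x" "Cod C b = A i" "x \<cdot>\<^sub>C a = \<iota> i \<cdot>\<^sub>C b"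
      note ci = c(2-4)[OF i]
      show "x \<cdot>\<^sub>C a = y \<cdot>\<^sub>C a"
      proof (rule coproduct_jointly_epic[OF I co, of "y \<cdot>\<^sub>C a"])
        fix j a' b' assume j: "j \<in> I" and a': "a' \<in> Arr C" "b' \<in> Arr C" "Dom C b' = Dom C a'" "Cod C a' = Dom C (y \<cdot>\<^sub>C a)" "Cod C b' = A j" "(y \<cdot>\<^sub>C a) \<cdot>\<^sub>C a' = \<iota> j \<cdot>\<^sub>C b'"
        note cj = c(2-4)[OF j]
        have a'c: "Cod C a' = Dom C a" using a' a xy by simp
        have xa: "x \<cdot>\<^sub>C (a \<cdot>\<^sub>C a') = \<iota> i \<cdot>\<^sub>C (b \<cdot>\<^sub>C a')" by (rule square_comp[OF a(6)]) (use a a' a'c xy ci in simp_all)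
        have ya: "y \<cdot>\<^sub>C (a \<cdot>\<^sub>C a') = \<iota> j \<cdot>\<^sub>C b'" using a a' a'c xy by simp
        have "m i \<cdot>\<^sub>C (b \<cdot>\<^sub>C a') = h \<cdot>\<^sub>C (\<iota> i \<cdot>\<^sub>C (b \<cdot>\<^sub>C a'))"
          by (rule reassoc[OF h(4)[OF i], symmetric]) (use a a' a'c ci h in simp_all)
        also have "\<dots> = h \<cdot>\<^sub>C (y \<cdot>\<^sub>C (a \<cdot>\<^sub>C a'))"
          unfolding xa[symmetric] by (rule square_comp[OF xy(6)]) (use a a' a'c xy h cj in simp_all)
        also have "\<dots> = m j \<cdot>\<^sub>C b'"
          unfolding ya by (rule reassoc[OF h(4)[OF j]]) (use a' cj h in simp_all)
        finally have mm: "m i \<cdot>\<^sub>C (b \<cdot>\<^sub>C a') = m j \<cdot>\<^sub>C b'" .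
        have "x \<cdot>\<^sub>C (a \<cdot>\<^sub>C a') = y \<cdot>\<^sub>C (a \<cdot>\<^sub>C a')"
        proof (cases "i = j")
          case True
          have "b \<cdot>\<^sub>C a' = b'"
            by (rule is_monoD[OF m(1)[OF j]]) (use mm True a a' a'c m(2)[OF j] in simp_all)
          then show ?thesis using xa ya True by simp
        next
          case False
          show ?thesis
            by (rule disj[OF i j False _ a'(2) _ _ _ mm]) (use a a' a'c xy ci cj h in simp_all)
        qed
        then show "(x \<cdot>\<^sub>C a) \<cdot>\<^sub>C a' = (y \<cdot>\<^sub>C a) \<cdot>\<^sub>C a'" using a(1,4) a'(1) a'c xy(1-3) by simp
      qed (use a xy h(1-3) ci in simp_all)
    qed (use xy h in simp_all)
  qed
  ultimately have "is_iso C h" by (rule cover_mono_iso)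
  from coproduct_transport[OF co this h(2)] h show ?thesis by simp
qed

end

section \<open>Completions\<close>

lemma exact_functor_comp:
  assumes F: "exact_functor C E F" and G: "exact_functor E D G"
    and "has_finite_limits C" "has_finite_limits E"
  shows "exact_functor C D (comp_functor C G F)"
proof -
  interpret F: lex C E F using F assms(3) by (intro lexI) (auto simp: exact_functor_def)
  interpret G: lex E D G using G assms(4) by (intro lexI) (auto simp: exact_functor_def)
  have fn: "is_functor C D (comp_functor C G F)" by (rule is_functor_comp[OF F.fctr G.fctr])
  interpret GF: lex C D "comp_functor C G F"
  proof (unfold_locales)
    show "is_functor C D (comp_functor C G F)" by (rule fn)
    show "preserves_terminal C D (comp_functor C G F)" unfolding preserves_terminal_def
      using F.terminalF G.terminalF by (auto simp: is_terminal_def)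
    show "preserves_pullbacks C D (comp_functor C G F)" unfolding preserves_pullbacks_def
    proof (intro allI impI)
      fix f g p q assume pb: "is_pullback C f g p q"
      from G.pullbackF[OF F.pullbackF[OF pb]] pullback_square(1-4)[OF pb]
      show "is_pullback D (FM (comp_functor C G F) f) (FM (comp_functor C G F) g) (FM (comp_functor C G F) p) (FM (comp_functor C G F) q)"
        by simp
    qed
  qed (use F.has_pb F.has_term in auto)
  have "is_regular_epi D (FM (comp_functor C G F) q)" if q: "is_regular_epi C q" for q
  proof -
    have "q \<in> Arr C" using q unfolding is_regular_epi_def is_coequalizer_def by blast
    then show ?thesis
      using q F G unfolding exact_functor_def preserves_regular_epis_def by simp
  qed
  then show ?thesis unfolding exact_functor_def preserves_regular_epis_def
    using fn GF.preserves_finite_limits by blast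
qed

lemma factors_through_map:
  assumes "is_functor C D F" "factors_through C f m" "m \<in> Arr C" "Cod C f = Cod C m"
  shows "factors_through D (FM F f) (FM F m)"
proof -
  interpret F: fctr C D F by unfold_locales fact
  obtain h where h: "in_hom C h (Dom C f) (Dom C m)" "m \<cdot>\<^sub>C h = f" using assms(2) unfolding factors_through_def by blast
  then have "f \<in> Arr C" using F.S.Comp_Arr[of h m] assms(3) by auto
  then show ?thesis unfolding factors_through_def
    using h assms(3) F.FM_eq[OF h(2)] by (intro exI[of _ "FM F h"]) simp
qed

text \<open>Equivalent monomorphisms have equivalent images, so the union in \<open>sub_map\<close>
  runs over copies of one class.\<close>

lemma (in lex) sub_map_eq:
  assumes S: "S \<in> Sub C X" and m: "m \<in> S"
  shows "sub_map D F S = subobject_of D (FM F m)"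
proof -
  note sm = S.mem_Sub[OF S m]
  have mm: "is_mono D (FM F m)" by (rule monoF[OF sm(1)])
  have "subobject_of D (FM F n) = subobject_of D (FM F m)" if n: "n \<in> S" for n
  proof -
    note sn = S.mem_Sub[OF S n]
    have "factors_through C m n" "factors_through C n m"
      using n sm(3) unfolding subobject_of_def by auto
    then have "factors_through D (FM F m) (FM F n)" "factors_through D (FM F n) (FM F m)"
      using factors_through_map[OF fctr] sm(1,2) sn(1,2) by auto
    then have "FM F n \<in> subobject_of D (FM F m)"
      using monoF[OF sn(1)] is_mono_Arr[OF sm(1)] is_mono_Arr[OF sn(1)] sm(2) sn(2) unfolding subobject_of_def monos_into_def by auto
    then show ?thesis
      using T.mem_Sub(3)[OF T.subobject_of_Sub[OF mm]] by simp
  qed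
  then have "sub_map D F S = (\<Union>n\<in>S. subobject_of D (FM F m))" unfolding sub_map_def by (intro SUP_cong refl)
  with m show ?thesis by blast
qed

text \<open>By exactness \<open>r\<close> and \<open>s\<close> are the kernel pair of some
  coequalizer; it factors through \<open>q\<close>, so they are the kernel pair of \<open>q\<close>
  as well. \<open>F\<close> preserves this pullback and takes \<open>q\<close> to a cover, and a
  cover is the coequalizer of its kernel pair.\<close>

lemma preserves_quotientsI:
  assumes E: "regcat E" "exact_category E" and D: "regcat D" and F: "exact_functor E D F"
  shows "preserves_quotients E D F"
  unfolding preserves_quotients_def
proof (intro allI impI, elim conjE)
  fix r s q assume er: "internal_equivalence_relation E r s" and co: "is_coequalizer E r s q"
  interpret E: regcat E by fact
  interpret D: regcat D by fact
  interpret F: lex E D F using F E.regular by (intro lexI) (auto simp: exact_functor_def regular_category_def)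
  obtain q' where q': "is_coequalizer E r s q'" "is_pullback E q' q' r s"
    using E(2) er unfolding exact_category_def effective_relation_def by blast
  note sq = coequalizer_square[OF co] and sq' = coequalizer_square[OF q'(1)] and sp = pullback_square[OF q'(2)]
  obtain u where u: "u \<in> Arr E" "Dom E u = Cod E q" "Cod E u = Cod E q'" "u \<cdot>\<^sub>E q = q'"
    by (rule coequalizer_lift[OF co sq'(3,6,7)])
  have "is_pullback E q q r s"
  proof (rule E.is_pullbackI)
    show "jointly_monic E r s" by (rule E.pullback_jointly_monic[OF q'(2)])
    fix a b assume ab: "a \<in> Arr E" "b \<in> Arr E" "Dom E a = Dom E b" "Cod E a = Dom E q" "Cod E b = Dom E q" "q \<cdot>\<^sub>E a = q \<cdot>\<^sub>E b"
    have "q' \<cdot>\<^sub>E a = u \<cdot>\<^sub>E (q \<cdot>\<^sub>E a)" using E.reassoc[OF u(4), of a] u sq(3,6) ab by simp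
    also have "\<dots> = q' \<cdot>\<^sub>E b" unfolding ab(6) using E.reassoc[OF u(4), of b] u sq(3,6) ab(1-5) by simp
    finally obtain w where "w \<in> Arr E" "Dom E w = Dom E a" "Cod E w = Dom E r" "r \<cdot>\<^sub>E w = a" "s \<cdot>\<^sub>E w = b"
      by - (rule pullback_lift[OF q'(2) ab(1-3)], use ab sq(6) sq'(6) in simp_all)
    then show "\<exists>w. in_hom E w (Dom E a) (Dom E r) \<and> r \<cdot>\<^sub>E w = a \<and> s \<cdot>\<^sub>E w = b" by (intro exI[of _ w]) simp
  qed (use sq sq' in auto)
  moreover have "is_cover D (FM F q)"
    using F co D.regular_epi_iff_cover unfolding exact_functor_def preserves_regular_epis_def is_regular_epi_def by blast
  ultimately show "is_coequalizer D (FM F r) (FM F s) (FM F q)"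
    using D.cover_coequalizer F.pullbackF by blast
qed

lemma (in cat) kernel_pair_internal_equivalence_relation:
  assumes pb: "is_pullback C c c r s"
  shows "internal_equivalence_relation C r s"
proof -
  note sq = pullback_square[OF pb]
  have S: "Dom C c \<in> Obj C" using sq by simp
  obtain d where d: "d \<in> Arr C" "Dom C d = Dom C c" "Cod C d = Dom C r" "r \<cdot>\<^sub>C d = Ident C (Dom C c)" "s \<cdot>\<^sub>C d = Ident C (Dom C c)"
    by (rule pullback_lift[OF pb, of "Ident C (Dom C c)" "Ident C (Dom C c)"]) (use sq S in auto)
  obtain t where t: "t \<in> Arr C" "Dom C t = Dom C r" "Cod C t = Dom C r" "r \<cdot>\<^sub>C t = s" "s \<cdot>\<^sub>C t = r"
    by (rule pullback_lift[OF pb, of s r]) (use sq in auto)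
  have trans: "\<exists>w. in_hom C w (Dom C p) (Dom C r) \<and> r \<cdot>\<^sub>C w = r \<cdot>\<^sub>C p \<and> s \<cdot>\<^sub>C w = s \<cdot>\<^sub>C q"
    if pq: "is_pullback C s r p q" for p q
  proof -
    note sq0 = pullback_square[OF pq]
    have "c \<cdot>\<^sub>C (r \<cdot>\<^sub>C p) = c \<cdot>\<^sub>C (s \<cdot>\<^sub>C p)" by (rule square_comp[OF sq(9)]) (use sq sq0 in auto)
    moreover have "c \<cdot>\<^sub>C (r \<cdot>\<^sub>C q) = c \<cdot>\<^sub>C (s \<cdot>\<^sub>C q)" by (rule square_comp[OF sq(9)]) (use sq sq0 in auto)
    ultimately have "c \<cdot>\<^sub>C (r \<cdot>\<^sub>C p) = c \<cdot>\<^sub>C (s \<cdot>\<^sub>C q)" using sq0(9) by simp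
    then obtain w0 where w0: "w0 \<in> Arr C" "Dom C w0 = Dom C p" "Cod C w0 = Dom C r" "r \<cdot>\<^sub>C w0 = r \<cdot>\<^sub>C p" "s \<cdot>\<^sub>C w0 = s \<cdot>\<^sub>C q"
      using pullback_lift[OF pb, of "r \<cdot>\<^sub>C p" "s \<cdot>\<^sub>C q"] sq sq0 by auto
    then show ?thesis by (intro exI[of _ w0]) simp
  qed
  have "jointly_monic C r s" by (rule pullback_jointly_monic[OF pb])
  then show ?thesis unfolding internal_equivalence_relation_def
    using sq d t trans by (auto simp: jointly_monic_def)
qed

text \<open>A regular epimorphism is the coequalizer of its kernel pair, which is an internal
  equivalence relation. This is why pretopos morphisms are exact functors.\<close>

lemma exact_functorI:
  assumes E: "regcat E" and P: "is_functor E D F" "preserves_finite_limits E D F" "preserves_quotients E D F"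
  shows "exact_functor E D F"
proof -
  interpret E: regcat E by fact
  have "is_regular_epi D (FM F q)" if q: "is_regular_epi E q" for q
  proof -
    have q1: "is_cover E q" using q E.regular_epi_iff_cover by blast
    obtain r s where rs: "is_pullback E q q r s" by (rule E.pullback_ex[of q q]) (use is_cover_Arr[OF q1] in auto)
    have "is_coequalizer D (FM F r) (FM F s) (FM F q)"
      using P(3) E.kernel_pair_internal_equivalence_relation[OF rs] E.cover_coequalizer[OF q1 rs]
      unfolding preserves_quotients_def by blast
    then show ?thesis unfolding is_regular_epi_def by blast
  qed
  then show ?thesis unfolding exact_functor_def preserves_regular_epis_def using P(1,2) by blast
qed

lemma regcatI: "exact_category D \<Longrightarrow> regcat D"
  unfolding exact_category_def regular_category_def by (unfold_locales) (auto simp: regular_category_def)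

lemma pretopI: "pretopos D \<Longrightarrow> pretop D"
  unfolding pretopos_def exact_category_def regular_category_def by (unfold_locales) (auto simp: regular_category_def)

lemma inclusion_fully_faithful:
  assumes "is_functor C E (inclusion_functor C)" "Dom C = Dom E" "Cod C = Cod E"
    "\<And>f. f \<in> Arr C \<longleftrightarrow> f \<in> Arr E \<and> Dom E f \<in> Obj C \<and> Cod E f \<in> Obj C"
  shows "fully_faithful C E (inclusion_functor C)"
  by (rule fully_faithfulI[OF assms(1)]) (use assms(2-) in auto)

lemma is_mono_jointly_monic: "is_mono C m \<longleftrightarrow> jointly_monic C m m"
  unfolding is_mono_def jointly_monic_def by blast

section \<open>The exact completion of a covering subcategory\<close>

context covering_subcategory
begin

text \<open>Test arrows from an object of \<open>E\<close> are first restricted along a cover from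
  \<open>C\<close>, which is epic.\<close>

lemma epi_jointly_monic:
  assumes jm: "jointly_monic C p q"
  shows "jointly_monic E p q"
  unfolding jointly_monic_def
proof (intro conjI ballI impI)
  have pq: "p \<in> Arr E" "q \<in> Arr E" "Dom E p = Dom E q" "Dom E p \<in> Obj C" "Cod E p \<in> Obj C" "Cod E q \<in> Obj C"
    using jm by (auto simp: jointly_monic_def)
  then show "p \<in> Arr E" "q \<in> Arr E" "Dom E p = Dom E q" by auto
  fix f g assume f: "f \<in> Arr E" and g: "g \<in> Arr E" and *: "Dom E f = Dom E g \<and> Cod E f = Dom E p \<and> Cod E g = Dom E p \<and> p \<cdot>\<^sub>E f = p \<cdot>\<^sub>E g \<and> q \<cdot>\<^sub>E f = q \<cdot>\<^sub>E g"
  have fg: "Dom E g = Dom E f" "Cod E f = Dom E p" "Cod E g = Dom E p" "p \<cdot>\<^sub>E f = p \<cdot>\<^sub>E g" "q \<cdot>\<^sub>E f = q \<cdot>\<^sub>E g" using * by auto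
  obtain c where c: "is_cover E c" "c \<in> Arr E" "Cod E c = Dom E f" "Dom E c \<in> Obj C" by (rule covering_obtain[of "Dom E f"]) (use f in auto)
  have "p \<cdot>\<^sub>E (f \<cdot>\<^sub>E c) = p \<cdot>\<^sub>E (g \<cdot>\<^sub>E c)" by (rule E.square_comp[OF fg(4)]) (use f g fg(1-3) c pq in auto)
  moreover have "q \<cdot>\<^sub>E (f \<cdot>\<^sub>E c) = q \<cdot>\<^sub>E (g \<cdot>\<^sub>E c)" by (rule E.square_comp[OF fg(5)]) (use f g fg(1-3) c pq in auto)
  ultimately have "f \<cdot>\<^sub>E c = g \<cdot>\<^sub>E c"
    by - (rule jointly_monicD[OF jm], use f g fg(1-3) c pq in auto)
  then show "f = g" by - (rule E.cover_epi[OF c(1)], use f g fg(1-3) c in auto)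
qed

lemma mono_sub:
  assumes "m \<in> Arr E" "Dom E m \<in> Obj C" "Cod E m \<in> Obj C"
  shows "is_mono C m \<longleftrightarrow> is_mono E m"
  unfolding is_mono_jointly_monic using epi_jointly_monic jointly_monic_sub assms by blast

text \<open>The pullback formed in \<open>E\<close> has its vertex in \<open>C\<close>, so it
  factors through the one given in \<open>C\<close>.\<close>

lemma pullback_super:
  assumes pb: "is_pullback C f g p q"
  shows "is_pullback E f g p q"
proof (rule E.is_pullbackI)
  note sq = pullback_square[OF pb]
  show "jointly_monic E p q" by (rule epi_jointly_monic[OF C.pullback_jointly_monic[OF pb]])
  fix a b assume ab: "a \<in> Arr E" "b \<in> Arr E" "Dom E a = Dom E b" "Cod E a = Dom E f" "Cod E b = Dom E g" "f \<cdot>\<^sub>E a = g \<cdot>\<^sub>E b"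
  obtain p' q' where pb': "is_pullback E f g p' q'" by (rule E.pullback_ex[of f g]) (use sq in auto)
  note sq' = pullback_square[OF pb']
  have P: "Dom E p' \<in> Obj C" by (rule pullback_closed[OF pb']) (use sq in auto)
  obtain u where u: "u \<in> Arr E" "Dom E u = Dom E a" "Cod E u = Dom E p'" "p' \<cdot>\<^sub>E u = a" "q' \<cdot>\<^sub>E u = b"
    by (rule pullback_lift[OF pb' ab])
  obtain w where w: "w \<in> Arr C" "Dom C w = Dom C p'" "Cod C w = Dom C p" "p \<cdot>\<^sub>C w = p'" "q \<cdot>\<^sub>C w = q'"
    by (rule pullback_lift[OF pb, of p' q']) (use sq sq' P in auto)
  have "p \<cdot>\<^sub>E (w \<cdot>\<^sub>E u) = a" "q \<cdot>\<^sub>E (w \<cdot>\<^sub>E u) = b"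
    using E.reassoc[of p w p' u] E.reassoc[of q w q' u] w u sq(3,4,6) by auto
  then show "\<exists>u. in_hom E u (Dom E a) (Dom E p) \<and> p \<cdot>\<^sub>E u = a \<and> q \<cdot>\<^sub>E u = b"
    using w u by (intro exI[of _ "w \<cdot>\<^sub>E u"]) auto
qed (use pullback_square[OF pb] in auto)

lemma terminal_super:
  assumes T: "is_terminal C T"
  shows "is_terminal E T"
proof -
  have T1: "T \<in> Obj C" using T by (simp add: is_terminal_def)
  obtain T0 where T0: "T0 \<in> Obj C" "is_terminal E T0" using terminal_closed by blast
  obtain t where t: "t \<in> Arr E" "Dom E t = T0" "Cod E t = T" using C.terminal_ex[OF T T0(1)] by auto
  have "\<exists>!u. in_hom E u Y T" if Y: "Y \<in> Obj E" for Y
  proof (rule ex_ex1I)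
    obtain y where "y \<in> Arr E" "Dom E y = Y" "Cod E y = T0" by (rule E.terminal_ex[OF T0(2) Y])
    then show "\<exists>u. in_hom E u Y T" using t by (intro exI[of _ "t \<cdot>\<^sub>E y"]) auto
    fix u v assume uv: "in_hom E u Y T" "in_hom E v Y T"
    obtain c where c: "is_cover E c" "c \<in> Arr E" "Cod E c = Y" "Dom E c \<in> Obj C" by (rule covering_obtain[OF Y])
    have "u \<cdot>\<^sub>E c = v \<cdot>\<^sub>E c" by (rule C.terminal_unique[OF T]) (use uv c T1 in auto)
    then show "u = v" by - (rule E.cover_epi[OF c(1)], use uv c in auto)
  qed
  then show ?thesis unfolding is_terminal_def using T1 by simp
qed

lemma inclusion_exact: "exact_functor C E (inclusion_functor C)"
proof -
  interpret J: lex C E "inclusion_functor C"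
  proof (unfold_locales)
    show "is_functor C E (inclusion_functor C)" by (rule inclusion_functor)
    show "preserves_terminal C E (inclusion_functor C)" unfolding preserves_terminal_def
      using terminal_super by (auto simp: is_terminal_def)
    show "preserves_pullbacks C E (inclusion_functor C)" unfolding preserves_pullbacks_def
    proof (intro allI impI)
      fix f g p q assume pb: "is_pullback C f g p q"
      from pullback_super[OF pb] pullback_square(1-4)[OF pb]
      show "is_pullback E (FM (inclusion_functor C) f) (FM (inclusion_functor C) g) (FM (inclusion_functor C) p) (FM (inclusion_functor C) q)"
        by simp
    qed
  qed (use C.has_pb C.has_term in auto)
  have "is_regular_epi E (FM (inclusion_functor C) q)" if q: "is_regular_epi C q" for q
  proof -
    have q1: "is_cover C q" using q C.regular_epi_iff_cover by blast
    then have "q \<in> Arr C" by (rule is_cover_Arr)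
    then show ?thesis using q1 cover_sub[of q] E.regular_epi_iff_cover by simp
  qed
  then show ?thesis unfolding exact_functor_def preserves_regular_epis_def
    using inclusion_functor J.preserves_finite_limits by blast
qed

lemma exact_restriction_ex:
  assumes D: "exact_category D" and F: "exact_functor C D F"
  shows "exact_restriction E C D F"
proof -
  interpret D: regcat D by (rule regcatI[OF D])
  interpret F: lex C D F using F C.regular by (intro lexI) (auto simp: exact_functor_def regular_category_def)
  show ?thesis
  proof (unfold_locales)
    show "exact_category D" by (rule D)
    show "is_cover D (FM F f)" if "is_cover C f" for f
      using F that C.regular_epi_iff_cover D.regular_epi_iff_cover unfolding exact_functor_def preserves_regular_epis_def by blast
  qed
qed

lemma exact_completion:
  assumes E: "exact_category E"
  shows "is_exact_completion C E (inclusion_functor C) TYPE('d \<times> 'e)"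
  unfolding is_exact_completion_def
proof (intro conjI allI impI)
  show "fully_faithful C E (inclusion_functor C)"
    by (rule inclusion_fully_faithful[OF inclusion_functor]) auto
  have lim: "has_finite_limits C" "has_finite_limits E"
    using C.regular E.regular by (auto simp: regular_category_def)
  fix D :: "('d, 'e) category" assume D: "exact_category D"
  have Dr: "regcat D" by (rule regcatI[OF D])
  then interpret D: regcat D .
  show "is_equivalence (functor_category E D (exact_functor E D)) (functor_category C D (exact_functor C D))
     (precomposition C E D (exact_functor E D) (inclusion_functor C))"
  proof (rule precomposition_equivalence[OF inclusion_functor D.cat])
    show "exact_functor C D (comp_functor C F (inclusion_functor C))" if "exact_functor E D F" for F
      by (rule exact_functor_comp[OF inclusion_exact that lim])
    show "\<alpha> = \<beta>" if "exact_functor E D F" "is_functor E D G" "is_nat_trans E D F G \<alpha>" "is_nat_trans E D F G \<beta>"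
      "\<And>X. X \<in> Obj C \<Longrightarrow> \<alpha> (FO (inclusion_functor C) X) = \<beta> (FO (inclusion_functor C) X)" for F G \<alpha> \<beta>
      by (rule restriction_unique[OF Dr that(1-4)]) (use that(5) in simp)
    show "\<exists>\<alpha>. is_nat_trans E D F G \<alpha> \<and> (\<forall>X\<in>Obj C. \<alpha> (FO (inclusion_functor C) X) = \<beta> X)"
      if FG: "exact_functor E D F" "is_functor E D G"
        "is_nat_trans C D (comp_functor C F (inclusion_functor C)) (comp_functor C G (inclusion_functor C)) \<beta>" for F G \<beta>
    proof -
      show ?thesis by (rule restriction_extend[OF Dr FG]) auto
    qed
    show "\<exists>G. is_functor E D G \<and> exact_functor E D G \<and> naturally_isomorphic C D (comp_functor C G (inclusion_functor C)) F"
      if F: "exact_functor C D F" for F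
    proof -
      interpret X: exact_restriction E C D F by (rule exact_restriction_ex[OF D F])
      show ?thesis using X.extension_functor X.extension_exact X.extension_restrict by blast
    qed
  qed
qed (use C.regular E inclusion_exact in auto)

end

text \<open>The coproducts are those of \<open>E\<close>; their disjointness and universality are
  expressed through subobjects, because joins of subobjects are what a coherent functor on
  \<open>C\<close> sees of them. \<open>coproduct_universal\<close> says that the pullbacks of the
  injections along \<open>c\<close> jointly cover the domain of \<open>c\<close>.\<close>

locale coherent_covering_subcategory = covering_subcategory E C + E: pretop E
  for E C :: "('o, 'm) category" +
  assumes E_exact: "exact_category E"
    and C_coherent: "coherent_category C"
    and mono_closed: "\<lbrakk>is_mono E m; Cod E m \<in> Obj C\<rbrakk> \<Longrightarrow> Dom E m \<in> Obj C"
    and initial_closed: "is_initial E X \<Longrightarrow> X \<in> Obj C"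
    and coproduct_mono: "\<lbrakk>finite (I :: nat set); is_coproduct E I A S \<iota>; i \<in> I\<rbrakk> \<Longrightarrow> is_mono E (\<iota> i)"
    and coproduct_disjoint: "\<lbrakk>finite (I :: nat set); is_coproduct E I A S \<iota>; i \<in> I; j \<in> I; i \<noteq> j; is_pullback E (\<iota> i) (\<iota> j) p q\<rbrakk>
      \<Longrightarrow> is_initial E (Dom E p)"
    and coproduct_universal: "\<lbrakk>finite (I :: nat set); is_coproduct E I A S \<iota>; c \<in> Arr E; Cod E c = S; is_mono E n; Cod E n = Dom E c;
      \<And>i. i \<in> I \<Longrightarrow> \<exists>p q. is_pullback E c (\<iota> i) p q \<and> factors_through E p n\<rbrakk> \<Longrightarrow> is_iso E n"
begin

lemma factors_through_sub:
  assumes "f \<in> Arr E" "Dom E f \<in> Obj C" "Dom E m \<in> Obj C"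
  shows "factors_through C f m \<longleftrightarrow> factors_through E f m"
  using assms unfolding factors_through_def by auto

text \<open>The join of subobjects \<open>A i \<rightarrow> X\<close> in \<open>C\<close> is the image in \<open>E\<close> of the induced map from the
  coproduct of the \<open>A i\<close>.\<close>

lemma restriction_preserves_joins:
  assumes D: "regcat D" and G: "exact_functor E D G" and cop: "preserves_finite_coproducts E D G"
  shows "preserves_finite_joins C D (comp_functor C G (inclusion_functor C))"
  unfolding preserves_finite_joins_def
proof (intro ballI allI impI, elim conjE)
  let ?H = "comp_functor C G (inclusion_functor C)"
  interpret D: regcat D by fact
  have lim: "has_finite_limits C" "has_finite_limits E"
    using C.regular E.regular by (auto simp: regular_category_def)
  have Hex: "exact_functor C D ?H" by (rule exact_functor_comp[OF inclusion_exact G lim])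
  interpret H: lex C D ?H using Hex lim by (intro lexI) (auto simp: exact_functor_def)
  interpret G: lex E D G using G lim by (intro lexI) (auto simp: exact_functor_def)
  have Gcov: "is_cover D (FM G e)" if "is_cover E e" for e
    using G that E.regular_epi_iff_cover D.regular_epi_iff_cover unfolding exact_functor_def preserves_regular_epis_def by blast
  fix X \<S> V assume X: "X \<in> Obj C" and fin: "finite \<S>" and join: "is_join C X \<S> V"
  have S: "S \<in> Sub C X" if "S \<in> \<S>" for S using join that unfolding is_join_def by blast
  have V: "V \<in> Sub C X" and ub: "\<And>S. S \<in> \<S> \<Longrightarrow> sub_le C S V"
    and least: "\<And>T. \<lbrakk>T \<in> Sub C X; \<And>S. S \<in> \<S> \<Longrightarrow> sub_le C S T\<rbrakk> \<Longrightarrow> sub_le C V T"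
    using join unfolding is_join_def by blast+
  obtain v where v: "v \<in> V" "is_mono C v" "Cod C v = X" "V = subobject_of C v" by (rule C.Sub_rep[OF V])
  have va: "v \<in> Arr E" "Dom E v \<in> Obj C" "Cod E v = X" using is_mono_Arr[OF v(2)] v(3) by auto
  have HV: "sub_map D ?H V = subobject_of D (FM G v)" using H.sub_map_eq[OF V v(1)] va X by simp
  have mv: "is_mono D (FM G v)" using H.monoF[OF v(2)] va X by simp
  \<comment> \<open>Coproducts are indexed by finite sets of natural numbers, so the subobjects are
    enumerated.\<close>
  obtain e where e: "bij_betw e {..<card \<S>} \<S>" using ex_bij_betw_nat_finite[OF fin] by (auto simp: atLeast0LessThan)
  define m where "m i = (SOME m. m \<in> e i)" for i
  let ?I = "{..<card \<S>}"
  have ei: "e i \<in> \<S>" if "i \<in> ?I" for i using e that unfolding bij_betw_def by blast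
  have mi: "m i \<in> e i" if i: "i \<in> ?I" for i
  proof -
    obtain m0 where "m0 \<in> e i" by (rule C.Sub_rep[OF S[OF ei[OF i]]])
    then show ?thesis unfolding m_def by (rule someI)
  qed
  have m: "is_mono C (m i)" "Cod C (m i) = X" "e i = subobject_of C (m i)" if i: "i \<in> ?I" for i
    using C.mem_Sub[OF S[OF ei[OF i]] mi[OF i]] by auto
  have ma: "m i \<in> Arr E" "Dom E (m i) \<in> Obj C" "Cod E (m i) = X" if i: "i \<in> ?I" for i
    using is_mono_Arr[OF m(1)[OF i]] m(2)[OF i] by auto
  have He: "sub_map D ?H (e i) = subobject_of D (FM G (m i))" if i: "i \<in> ?I" for i
    using H.sub_map_eq[OF S[OF ei[OF i]] mi[OF i]] ma[OF i] X by simp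
  have mm: "is_mono D (FM G (m i))" if i: "i \<in> ?I" for i using H.monoF[OF m(1)[OF i]] ma[OF i] X by simp
  have \<S>: "\<S> = e ` ?I" using e unfolding bij_betw_def by simp
  obtain Q \<iota> where co: "is_coproduct E ?I (\<lambda>i. Dom E (m i)) Q \<iota>"
    by (rule E.coproduct_ex[of ?I "\<lambda>i. Dom E (m i)"]) (use ma in auto)
  note c = coproduct_cocone[OF co]
  obtain h where h: "h \<in> Arr E" "Dom E h = Q" "Cod E h = X" "\<And>i. i \<in> ?I \<Longrightarrow> h \<cdot>\<^sub>E \<iota> i = m i"
    by (rule coproduct_lift[OF co, of X m]) (use ma X in auto)
  obtain w k where w: "is_mono E w" "is_cover E k" "Cod E w = Cod E h" "Dom E k = Dom E h" "Cod E k = Dom E w" "w \<cdot>\<^sub>E k = h"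
    by (rule E.image_factorization[OF h(1)])
  have wk: "w \<in> Arr E" "k \<in> Arr E" using w(1) is_cover_Arr[OF w(2)] by auto
  have W: "Dom E w \<in> Obj C" by (rule mono_closed[OF w(1)]) (use w h X in auto)
  have wC: "is_mono C w" using mono_sub[of w] wk W w h X by simp
  have miw: "factors_through E (m i) w" if i: "i \<in> ?I" for i
    unfolding factors_through_def using E.reassoc[OF w(6), of "\<iota> i"] c(2-4)[OF i] h(1-3) h(4)[OF i] wk w(3-5)
    by (intro exI[of _ "k \<cdot>\<^sub>E \<iota> i"]) simp
  \<comment> \<open>The image \<open>w\<close> of the coproduct is an upper bound in
    \<open>C\<close>, so the join lies below it.\<close>
  have "sub_le C V (subobject_of C w)"
  proof (rule least)
    show "subobject_of C w \<in> Sub C X" using C.subobject_of_Sub[OF wC] w h by simp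
    fix S assume "S \<in> \<S>"
    then obtain i where i: "i \<in> ?I" "S = e i" using \<S> by blast
    show "sub_le C S (subobject_of C w)"
      unfolding i(2) m(3)[OF i(1)] C.sub_le_iff[OF m(1)[OF i(1)] wC]
      using miw[OF i(1)] factors_through_sub[of "m i" w] ma[OF i(1)] W by simp
  qed
  then have "factors_through C v w" using C.sub_le_iff[OF v(2) wC] v(4) by simp
  then have vw: "factors_through D (FM G v) (FM G w)"
    using factors_through_map[OF G.fctr, of v w] factors_through_sub[of v w] va W wk w h by simp
  show "is_join D (FO ?H X) (sub_map D ?H ` \<S>) (sub_map D ?H V)"
    unfolding is_join_def
  proof (intro conjI ballI impI subsetI)
    have X': "FO ?H X = FO G X" using X by simp
    show "sub_map D ?H V \<in> Sub D (FO ?H X)" unfolding HV X'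
      using D.subobject_of_Sub[OF mv] va by simp
    fix S' assume "S' \<in> sub_map D ?H ` \<S>"
    then obtain S0 where S0: "S' = sub_map D ?H S0" "S0 \<in> \<S>" by (rule imageE)
    then have "S0 \<in> e ` ?I" using e by (simp add: bij_betw_def)
    then obtain i where "i \<in> ?I" "S' = sub_map D ?H (e i)" using S0(1) by blast
    then have i: "i \<in> ?I" "S' = subobject_of D (FM G (m i))" using He by auto
    show "S' \<in> Sub D (FO ?H X)" unfolding i(2) X'
      using D.subobject_of_Sub[OF mm[OF i(1)]] ma[OF i(1)] by simp
    have "factors_through C (m i) v"
      using ub[OF ei[OF i(1)]] C.sub_le_iff[OF m(1)[OF i(1)] v(2)] v(4) m(3)[OF i(1)] by simp
    then have "factors_through E (m i) v" using factors_through_sub[of "m i" v] ma[OF i(1)] va by simp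
    then have "factors_through D (FM G (m i)) (FM G v)"
      using factors_through_map[OF G.fctr, of "m i" v] va ma[OF i(1)] by simp
    then show "sub_le D S' (sub_map D ?H V)"
      unfolding HV i(2) using D.sub_le_iff[OF mm[OF i(1)] mv] by simp
  next
    fix T assume T: "T \<in> Sub D (FO ?H X)" and le: "\<forall>S'\<in>sub_map D ?H ` \<S>. sub_le D S' T"
    obtain n where n: "n \<in> T" "is_mono D n" "Cod D n = FO ?H X" "T = subobject_of D n" by (rule D.Sub_rep[OF T])
    have na: "n \<in> Arr D" "Cod D n = FO G X" using is_mono_Arr[OF n(2)] n(3) X by auto
    have "\<exists>t. in_hom D t (FO G (Dom E (m i))) (Dom D n) \<and> n \<cdot>\<^sub>D t = FM G (m i)" if i: "i \<in> ?I" for i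
    proof -
      have "sub_le D (subobject_of D (FM G (m i))) T" using le He[OF i] ei[OF i] by auto
      then have "factors_through D (FM G (m i)) n" using D.sub_le_iff[OF mm[OF i] n(2)] n(4) by simp
      then show ?thesis unfolding factors_through_def using ma[OF i] by simp
    qed
    then obtain t where t: "\<And>i. i \<in> ?I \<Longrightarrow> in_hom D (t i) (FO G (Dom E (m i))) (Dom D n) \<and> n \<cdot>\<^sub>D t i = FM G (m i)" by metis
    have co': "is_coproduct D ?I (\<lambda>i. FO G (Dom E (m i))) (FO G Q) (\<lambda>i. FM G (\<iota> i))"
      using cop co unfolding preserves_finite_coproducts_def by blast
    \<comment> \<open>\<open>G\<close> preserves the coproduct, so an upper bound \<open>n\<close>
      in \<open>D\<close> receives an arrow from \<open>FO G Q\<close>. It descends along the cover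
      \<open>FM G k\<close>, which puts the image of \<open>w\<close> below
      \<open>n\<close>.\<close>
    obtain s where s: "s \<in> Arr D" "Dom D s = FO G Q" "Cod D s = Dom D n" "\<And>i. i \<in> ?I \<Longrightarrow> s \<cdot>\<^sub>D FM G (\<iota> i) = t i"
      by (rule coproduct_lift[OF co', of "Dom D n" t]) (use t na in auto)
    have ns: "n \<cdot>\<^sub>D s = FM G h"
    proof (rule D.coproduct_unique[OF co'])
      show "(n \<cdot>\<^sub>D s) \<cdot>\<^sub>D FM G (\<iota> i) = FM G h \<cdot>\<^sub>D FM G (\<iota> i)" if i: "i \<in> ?I" for i
        using s(1-3) s(4)[OF i] t[OF i] na c(2-4)[OF i] h(1-3) G.FM_eq[OF h(4)[OF i]] by simp
    qed (use s na h in auto)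
    have nn: "jointly_monic D n n" by (rule D.jointly_monic_mono[OF n(2)]) (use na in auto)
    have wk': "n \<cdot>\<^sub>D s = FM G w \<cdot>\<^sub>D FM G k" using ns G.FM_eq[OF w(6)] wk w by simp
    obtain y where "y \<in> Arr D" "Dom D y = Cod D (FM G k)" "Cod D y = Dom D n" "n \<cdot>\<^sub>D y = FM G w"
      by (rule D.cover_jointly_monic_lift[OF Gcov[OF w(2)] nn s(1) _ _ _ _ _ _ _ _ wk' wk'])
        (use s wk w h na in auto)
    then have wn: "factors_through D (FM G w) n" unfolding factors_through_def using wk w by auto
    have "factors_through D (FM G v) n"
      by (rule D.factors_through_trans[OF vw wn]) (use wk na in auto)
    then show "sub_le D (sub_map D ?H V) T" unfolding HV n(4) using D.sub_le_iff[OF mv n(2)] by simp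
  qed
qed

text \<open>\<open>coproduct_of_disjoint_monos\<close> reduces the claim to disjointness and joint
  covering of the images of the injections. \<open>F\<close> preserves joins of subobjects of
  objects of \<open>C\<close>, so the covering condition is pulled back along a cover from
  \<open>C\<close>; disjointness rests on the empty join.\<close>

lemma extension_preserves_coproducts:
  assumes D: "pretopos D" and F: "coherent_functor C D F"
  shows "preserves_finite_coproducts E D (exact_restriction.extension E C D F)"
proof -
  have Dex: "exact_category D" using D by (simp add: pretopos_def)
  have Fex: "exact_functor C D F" using F by (simp add: coherent_functor_def exact_functor_def)
  have Fj: "preserves_finite_joins C D F" using F by (simp add: coherent_functor_def)
  interpret D: pretop D by (rule pretopI[OF D])
  interpret X: exact_restriction E C D F by (rule exact_restriction_ex[OF Dex Fex])
  \<comment> \<open>If the \<open>m i\<close> jointly cover \<open>T\<close>, then \<open>T\<close>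
    is their join in \<open>C\<close> and \<open>FO F T\<close> is the join of their images, so a
    subobject containing these images is everything.\<close>
  have top: "is_iso D n"
    if fin: "finite (I :: nat set)" and T: "T \<in> Obj C" and m: "\<And>i. i \<in> I \<Longrightarrow> is_mono C (m i)" "\<And>i. i \<in> I \<Longrightarrow> Cod E (m i) = T"
      and univ: "\<And>w. \<lbrakk>is_mono C w; Cod E w = T; \<And>i. i \<in> I \<Longrightarrow> factors_through C (m i) w\<rbrakk> \<Longrightarrow> is_iso E w"
      and n: "is_mono D n" "Cod D n = FO F T" and mn: "\<And>i. i \<in> I \<Longrightarrow> factors_through D (FM F (m i)) n"
    for I T m n
  proof -
    let ?id = "Ident E T" and ?S = "(\<lambda>i. subobject_of C (m i)) ` I"
    have T1: "T \<in> Obj E" "is_mono C ?id" using T C.is_iso_mono[OF C.is_iso_Ident[OF T]] by auto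
    have na: "n \<in> Arr D" using n by auto
    have "is_join C T ?S (subobject_of C ?id)" unfolding is_join_def
    proof (intro conjI ballI impI subsetI)
      show "subobject_of C ?id \<in> Sub C T" using C.subobject_of_Sub[OF T1(2)] T1(1) by simp
      fix S assume "S \<in> ?S"
      then obtain i where i: "i \<in> I" "S = subobject_of C (m i)" by blast
      show "S \<in> Sub C T" using C.subobject_of_Sub[OF m(1)[OF i(1)]] m(2)[OF i(1)] i(2) by simp
      have mi: "m i \<in> Arr E" "Dom E (m i) \<in> Obj C" using is_mono_Arr[OF m(1)[OF i(1)]] by auto
      have "factors_through C (m i) ?id" unfolding factors_through_def
        using mi m(2)[OF i(1)] T by (intro exI[of _ "m i"]) simp
      then show "sub_le C S (subobject_of C ?id)" unfolding i(2) using C.sub_le_iff[OF m(1)[OF i(1)] T1(2)] by simp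
    next
      fix T' assume T': "T' \<in> Sub C T" and le: "\<forall>S\<in>?S. sub_le C S T'"
      obtain w where w: "w \<in> T'" "is_mono C w" "Cod C w = T" "T' = subobject_of C w" by (rule C.Sub_rep[OF T'])
      have wa: "w \<in> Arr E" "Dom E w \<in> Obj C" "Cod E w = T" using is_mono_Arr[OF w(2)] w(3) by auto
      have "factors_through C (m i) w" if i: "i \<in> I" for i
        using le i C.sub_le_iff[OF m(1)[OF i] w(2)] w(4) by auto
      then have "is_iso E w" using univ w(2) wa by simp
      then obtain s where s: "s \<in> Arr E" "Dom E s = Cod E w" "Cod E s = Dom E w" "w \<cdot>\<^sub>E s = Ident E (Cod E w)"
        by (rule is_isoE)
      then have "factors_through C ?id w" unfolding factors_through_def using wa T by (intro exI[of _ s]) simp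
      then show "sub_le C (subobject_of C ?id) T'" unfolding w(4) using C.sub_le_iff[OF T1(2) w(2)] by simp
    qed
    then have jn: "is_join D (FO F T) (sub_map D F ` ?S) (sub_map D F (subobject_of C ?id))"
      using Fj T fin unfolding preserves_finite_joins_def by blast
    have "sub_le D (sub_map D F (subobject_of C ?id)) (subobject_of D n)"
    proof -
      have "sub_le D S' (subobject_of D n)" if S': "S' \<in> sub_map D F ` ?S" for S'
      proof -
        obtain S0 where S0: "S' = sub_map D F S0" "S0 \<in> ?S" using S' by (rule imageE)
        obtain i where "S0 = subobject_of C (m i)" "i \<in> I" using S0(2) by (rule imageE)
        then have i: "i \<in> I" "S' = sub_map D F (subobject_of C (m i))" using S0(1) by simp_all
        have "S' = subobject_of D (FM F (m i))" unfolding i(2)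
          by (rule X.F.sub_map_eq[OF C.subobject_of_Sub[OF m(1)[OF i(1)]] C.subobject_self[OF m(1)[OF i(1)]]])
        then show ?thesis using mn[OF i(1)] D.sub_le_iff[OF X.F.monoF[OF m(1)[OF i(1)]] n(1)] by simp
      qed
      moreover have "subobject_of D n \<in> Sub D (FO F T)" using D.subobject_of_Sub[OF n(1)] n(2) by simp
      moreover note jn[unfolded is_join_def, THEN conjunct2, THEN conjunct2, THEN conjunct2, THEN bspec, THEN mp]
      ultimately show ?thesis by simp
    qed
    moreover have "sub_map D F (subobject_of C ?id) = subobject_of D (FM F ?id)"
      by (rule X.F.sub_map_eq[OF C.subobject_of_Sub[OF T1(2)] C.subobject_self[OF T1(2)]])
    ultimately have "factors_through D (FM F ?id) n"
      using D.sub_le_iff[OF X.F.monoF[OF T1(2)] n(1)] by simp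
    then obtain s where "s \<in> Arr D" "Dom D s = FO F T" "Cod D s = Dom D n" "n \<cdot>\<^sub>D s = Ident D (FO F T)"
      unfolding factors_through_def using T by auto
    then show "is_iso D n" by - (rule D.split_mono_iso[OF n(1)], use n(2) in auto)
  qed
  \<comment> \<open>For the empty family, \<open>top\<close> makes the value of \<open>F\<close> at
    an initial object isomorphic to an initial object of \<open>D\<close>; strictness then
    identifies parallel arrows out of any object that maps to it.\<close>
  have degenerate: "u = v"
    if Z: "is_initial E Z" and a: "a \<in> Arr D" "Cod D a = X.val Z"
      and uv: "u \<in> Arr D" "v \<in> Arr D" "Dom D u = Dom D a" "Dom D v = Dom D a" "Cod D u = Cod D v" for Z a u v
  proof -
    have ZC: "Z \<in> Obj C" "Z \<in> Obj E" using initial_closed[OF Z] by auto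
    obtain N \<iota> where "is_coproduct D {} (\<lambda>_::nat. undefined) N \<iota>" by (rule D.coproduct_ex[of "{}"]) auto
    then have N: "is_initial D N" by (simp add: is_coproduct_empty)
    obtain z where z: "z \<in> Arr D" "Dom D z = N" "Cod D z = FO F Z" by (rule D.initial_ex[OF N, of "FO F Z"]) (use ZC in auto)
    have mz: "is_mono D z"
    proof (rule is_monoI[OF z(1)])
      fix f g assume "f \<in> Arr D" "g \<in> Arr D" "Dom D f = Dom D g" "Cod D f = Dom D z" "Cod D g = Dom D z"
      then show "f = g" by - (rule D.strict_initial[OF N, of f], use z in simp_all)
    qed
    have "is_iso D z"
    proof (rule top[of "{}" Z "\<lambda>_. undefined" z])
      fix w assume w: "is_mono C w" "Cod E w = Z"
      have wa: "w \<in> Arr E" "Dom E w \<in> Obj C" using is_mono_Arr[OF w(1)] by auto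
      obtain s where s: "s \<in> Arr E" "Dom E s = Z" "Cod E s = Dom E w" by (rule E.initial_ex[OF Z, of "Dom E w"]) (use wa in auto)
      have "w \<cdot>\<^sub>E s = Ident E Z" by (rule E.initial_unique[OF Z]) (use s wa w ZC in auto)
      then show "is_iso E w" by (intro E.split_mono_iso[where s=s]) (use mono_sub[of w] s wa w ZC in auto)
    qed (use ZC z mz in auto)
    then obtain z' where z': "z' \<in> Arr D" "Dom D z' = Cod D z" "Cod D z' = Dom D z" by (rule is_isoE)
    obtain l where l: "l \<in> Arr D" "Dom D l = Cod D (X.leg (Ident E Z))" "Cod D l = Dom D (X.leg (Ident E Z))"
      by (rule is_isoE[OF X.leg_Ident_iso[OF ZC(1)]])
    show ?thesis
      by (rule D.strict_initial[OF N, of "z' \<cdot>\<^sub>D (l \<cdot>\<^sub>D a)"]) (use z z' l a uv ZC in auto)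
  qed
  show ?thesis unfolding preserves_finite_coproducts_def
  proof (intro allI impI, elim conjE)
    fix I :: "nat set" and A S \<iota> assume fin: "finite I" and co: "is_coproduct E I A S \<iota>"
    note c = coproduct_cocone[OF co]
    have fm: "FM X.extension (\<iota> i) = X.ext_map (\<iota> i)" if "i \<in> I" for i using c(2)[OF that] by simp
    have A: "A i \<in> Obj E" if "i \<in> I" for i using c(2,3)[OF that] E.Dom_Obj by metis
    show "is_coproduct D I (\<lambda>i. FO X.extension (A i)) (FO X.extension S) (\<lambda>i. FM X.extension (\<iota> i))"
    proof (rule D.coproduct_of_disjoint_monos[OF fin])
      show "FO X.extension S \<in> Obj D" using c(1) by simp
      show "is_mono D (FM X.extension (\<iota> i))" if "i \<in> I" for i
        by (rule X.X.monoF[OF coproduct_mono[OF fin co that]])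
      show "Dom D (FM X.extension (\<iota> i)) = FO X.extension (A i)" "Cod D (FM X.extension (\<iota> i)) = FO X.extension S" if "i \<in> I" for i
        using c(2-4)[OF that] A[OF that] c(1) by simp_all
    next
      fix i j a b u v assume i: "i \<in> I" and j: "j \<in> I" and ij: "i \<noteq> j"
        and ab: "a \<in> Arr D" "b \<in> Arr D" "Dom D b = Dom D a" "Cod D a = FO X.extension (A i)" "Cod D b = FO X.extension (A j)"
          "FM X.extension (\<iota> i) \<cdot>\<^sub>D a = FM X.extension (\<iota> j) \<cdot>\<^sub>D b"
        and uv: "u \<in> Arr D" "v \<in> Arr D" "Dom D u = Dom D a" "Dom D v = Dom D a" "Cod D u = Cod D v"
      obtain p q where pb: "is_pullback E (\<iota> i) (\<iota> j) p q" by (rule E.pullback_ex[of "\<iota> i" "\<iota> j"]) (use c i j in auto)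
      note sq = pullback_square[OF pb]
      have init: "is_initial E (Dom E p)" by (rule coproduct_disjoint[OF fin co i j ij pb])
      obtain w where w: "w \<in> Arr D" "Dom D w = Dom D a" "Cod D w = Dom D (FM X.extension p)"
        by (rule pullback_lift[OF X.X.pullbackF[OF pb] ab(1,2) _ _ _ ab(6)])
          (use ab(3-5) c(2-4)[OF i] c(2-4)[OF j] A[OF i] A[OF j] in simp_all)
      show "u = v"
        by (rule degenerate[OF init w(1)]) (use w sq uv in simp_all)
    next
      fix n assume n: "is_mono D n" "Cod D n = FO X.extension S"
        and le: "\<And>i. i \<in> I \<Longrightarrow> factors_through D (FM X.extension (\<iota> i)) n"
      have na: "n \<in> Arr D" "Cod D n = X.val S" using n c(1) by auto
      \<comment> \<open>Over a covering object the pulled back injections are subobjects in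
        \<open>C\<close>, and universality makes them jointly covering. So \<open>top\<close>
        applies to the pullback \<open>n'\<close> of \<open>n\<close>, and the leg of
        \<open>t\<close>, a cover, factors through \<open>n\<close>.\<close>
      obtain t where t: "is_cover E t" "t \<in> Arr E" "Cod E t = S" "Dom E t \<in> Obj C" by (rule covering_obtain[OF c(1)])
      have lt: "X.leg t \<in> Arr D" "Dom D (X.leg t) = FO F (Dom E t)" "Cod D (X.leg t) = X.val S" using t by auto
      have "\<forall>i\<in>I. \<exists>p q. is_pullback E t (\<iota> i) p q"
        using E.pullback_ex[OF t(2)] c t(3) by metis
      then obtain p q where pq: "\<And>i. i \<in> I \<Longrightarrow> is_pullback E t (\<iota> i) (p i) (q i)" by metis
      obtain n' k where nk: "is_pullback D (X.leg t) n n' k" by (rule D.pullback_ex[OF lt(1) na(1)]) (use lt na in simp)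
      note sn = pullback_square[OF nk]
      have n': "is_mono D n'" by (rule D.pullback_mono[OF nk n(1)])
      have p: "is_mono E (p i)" "p i \<in> Arr E" "Cod E (p i) = Dom E t" "Dom E (p i) \<in> Obj C" "q i \<in> Arr E" "Dom E (q i) = Dom E (p i)"
        "Cod E (q i) = A i" "t \<cdot>\<^sub>E p i = \<iota> i \<cdot>\<^sub>E q i" if i: "i \<in> I" for i
      proof -
        note sq = pullback_square[OF pq[OF i]]
        show pm: "is_mono E (p i)" by (rule E.pullback_mono[OF pq[OF i] coproduct_mono[OF fin co i]])
        show "Dom E (p i) \<in> Obj C" by (rule mono_closed[OF pm]) (use sq t in auto)
        show "p i \<in> Arr E" "Cod E (p i) = Dom E t" "q i \<in> Arr E" "Dom E (q i) = Dom E (p i)"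
          "Cod E (q i) = A i" "t \<cdot>\<^sub>E p i = \<iota> i \<cdot>\<^sub>E q i" using sq c(3)[OF i] by auto
      qed
      have "is_iso D n'"
      proof (rule top[OF fin t(4), of p])
        show "is_mono C (p i)" "Cod E (p i) = Dom E t" if "i \<in> I" for i
          using p[OF that] mono_sub[of "p i"] t(4) by simp_all
        show "is_iso E w" if w: "is_mono C w" "Cod E w = Dom E t" and f: "\<And>i. i \<in> I \<Longrightarrow> factors_through C (p i) w" for w
        proof (rule coproduct_universal[OF fin co t(2,3) _ w(2)])
          have wa: "w \<in> Arr E" "Dom E w \<in> Obj C" "Cod E w \<in> Obj C" using is_mono_Arr[OF w(1)] by auto
          show "is_mono E w" using w mono_sub[OF wa] by simp
          show "\<exists>p q. is_pullback E t (\<iota> i) p q \<and> factors_through E p w" if i: "i \<in> I" for i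
            using pq[OF i] f[OF i] factors_through_sub[of "p i" w] p[OF i] wa by auto
        qed
        show "is_mono D n'" by (rule n')
        show "Cod D n' = FO F (Dom E t)" using sn(7) lt(2) by simp
        show "factors_through D (FM F (p i)) n'" if i: "i \<in> I" for i
        proof -
          note pi = p[OF i] and ci = c(2-4)[OF i]
          obtain h where h0: "in_hom D h (Dom D (FM X.extension (\<iota> i))) (Dom D n)" "n \<cdot>\<^sub>D h = FM X.extension (\<iota> i)"
            using le[OF i] unfolding factors_through_def by blast
          have h: "h \<in> Arr D" "Dom D h = X.val (A i)" "Cod D h = Dom D n" "n \<cdot>\<^sub>D h = X.ext_map (\<iota> i)"
            using h0 ci by simp_all
          have lq: "X.leg (q i) \<in> Arr D" "Dom D (X.leg (q i)) = FO F (Dom E (p i))" "Cod D (X.leg (q i)) = X.val (A i)"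
            using pi by simp_all
          have "X.leg t \<cdot>\<^sub>D FM F (p i) = X.leg (t \<cdot>\<^sub>E p i)"
            by (rule X.leg_comp[symmetric]) (use t pi in simp_all)
          also have "\<dots> = X.ext_map (\<iota> i) \<cdot>\<^sub>D X.leg (q i)"
            unfolding pi(8) by (rule X.ext_map_leg[symmetric]) (use pi ci in simp_all)
          also have "\<dots> = n \<cdot>\<^sub>D (h \<cdot>\<^sub>D X.leg (q i))"
            by (rule D.reassoc[OF h(4), symmetric]) (use h lq na in simp_all)
          finally obtain y where "y \<in> Arr D" "Dom D y = Dom D (FM F (p i))" "Cod D y = Dom D n'" "n' \<cdot>\<^sub>D y = FM F (p i)"
            by - (rule pullback_lift[OF nk, of "FM F (p i)" "h \<cdot>\<^sub>D X.leg (q i)"], use h lq lt pi t na in simp_all)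
          then show ?thesis unfolding factors_through_def by auto
        qed
      qed
      then obtain s where s: "s \<in> Arr D" "Dom D s = Cod D n'" "Cod D s = Dom D n'" "n' \<cdot>\<^sub>D s = Ident D (Cod D n')"
        by (rule is_isoE)
      have "n \<cdot>\<^sub>D (k \<cdot>\<^sub>D s) = X.leg t \<cdot>\<^sub>D (n' \<cdot>\<^sub>D s)"
        by (rule D.square_comp[OF sn(9)[symmetric]]) (use sn s na lt in simp_all)
      also have "\<dots> = X.leg t" using s(4) sn(7) lt by simp
      finally have "is_cover D (n \<cdot>\<^sub>D (k \<cdot>\<^sub>D s))" using X.leg_cover[OF t(1,4)] by simp
      then have "is_cover D n" by (rule D.cover_cancel) (use sn s na in simp_all)
      then show "is_iso D n" by (rule D.cover_mono_iso[OF _ n(1)])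
    qed
  qed
qed

lemma id_preserves_coproducts: "preserves_finite_coproducts E E (id_functor E)"
  unfolding preserves_finite_coproducts_def
proof (intro allI impI, elim conjE)
  fix I :: "nat set" and A S \<iota> assume co: "is_coproduct E I A S \<iota>"
  note c = coproduct_cocone[OF co]
  have "A i \<in> Obj E" if "i \<in> I" for i using c(2,3)[OF that] E.Dom_Obj by metis
  then show "is_coproduct E I (\<lambda>i. FO (id_functor E) (A i)) (FO (id_functor E) S) (\<lambda>i. FM (id_functor E) (\<iota> i))"
    using co c unfolding is_coproduct_def by simp
qed

text \<open>The inclusion is the restriction of the identity functor, to which
  \<open>restriction_preserves_joins\<close> applies.\<close>

lemma inclusion_coherent: "coherent_functor C E (inclusion_functor C)"
proof -
  have "exact_functor E E (id_functor E)"
    unfolding exact_functor_def preserves_regular_epis_def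
  proof (intro conjI allI impI)
    show "is_regular_epi E (FM (id_functor E) q)" if "is_regular_epi E q" for q
      using that E.regular_epi_iff_cover is_cover_Arr[of E q] by simp
  qed (use E.Id.fctr E.Id.preserves_finite_limits in auto)
  then have "preserves_finite_joins C E (comp_functor C (id_functor E) (inclusion_functor C))"
    by (rule restriction_preserves_joins[OF E.regcat_axioms _ id_preserves_coproducts])
  moreover have "comp_functor C (id_functor E) (inclusion_functor C) = inclusion_functor C"
    unfolding comp_functor_def inclusion_functor_def compose_def by (auto intro!: restrict_ext)
  ultimately show ?thesis using inclusion_exact unfolding coherent_functor_def exact_functor_def by simp
qed

text \<open>Pretopos morphisms are exact, so uniqueness and extension of transformations are those
  of the exact case. What is new is the passage between preservation of joins on \<open>C\<close>
  and of coproducts on \<open>E\<close>.\<close>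

lemma pretopos_completion: "is_pretopos_completion C E (inclusion_functor C) TYPE('d \<times> 'e)"
  unfolding is_pretopos_completion_def
proof (intro conjI allI impI)
  show "pretopos E" using E_exact E.extensive by (simp add: pretopos_def)
  have lim: "has_finite_limits C" "has_finite_limits E"
    using C.regular E.regular by (auto simp: regular_category_def)
  fix D :: "('d, 'e) category" assume D: "pretopos D"
  then have Dex: "exact_category D" by (simp add: pretopos_def)
  have Dr: "regcat D" by (rule regcatI[OF Dex])
  then interpret D: regcat D .
  have ex: "exact_functor E D F" if "pretopos_morphism E D F" for F
    by (rule exact_functorI[OF E.regcat_axioms]) (use that in \<open>auto simp: pretopos_morphism_def\<close>)
  show "is_equivalence (functor_category E D (pretopos_morphism E D)) (functor_category C D (coherent_functor C D))
     (precomposition C E D (pretopos_morphism E D) (inclusion_functor C))"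
  proof (rule precomposition_equivalence[OF inclusion_functor D.cat])
    show "coherent_functor C D (comp_functor C F (inclusion_functor C))" if F: "pretopos_morphism E D F" for F
      using exact_functor_comp[OF inclusion_exact ex[OF F] lim] restriction_preserves_joins[OF Dr ex[OF F]] F
      unfolding coherent_functor_def exact_functor_def pretopos_morphism_def by simp
    show "\<alpha> = \<beta>" if "pretopos_morphism E D F" "is_functor E D G" "is_nat_trans E D F G \<alpha>" "is_nat_trans E D F G \<beta>"
      "\<And>X. X \<in> Obj C \<Longrightarrow> \<alpha> (FO (inclusion_functor C) X) = \<beta> (FO (inclusion_functor C) X)" for F G \<alpha> \<beta>
      by (rule restriction_unique[OF Dr ex[OF that(1)] that(2-4)]) (use that(5) in simp)
    show "\<exists>\<alpha>. is_nat_trans E D F G \<alpha> \<and> (\<forall>X\<in>Obj C. \<alpha> (FO (inclusion_functor C) X) = \<beta> X)"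
      if FG: "pretopos_morphism E D F" "is_functor E D G"
        "is_nat_trans C D (comp_functor C F (inclusion_functor C)) (comp_functor C G (inclusion_functor C)) \<beta>" for F G \<beta>
    proof -
      show ?thesis by (rule restriction_extend[OF Dr ex[OF FG(1)] FG(2,3)]) auto
    qed
    show "\<exists>G. is_functor E D G \<and> pretopos_morphism E D G \<and> naturally_isomorphic C D (comp_functor C G (inclusion_functor C)) F"
      if F: "coherent_functor C D F" for F
    proof -
      have Fex: "exact_functor C D F" using F by (simp add: coherent_functor_def exact_functor_def)
      interpret X: exact_restriction E C D F by (rule exact_restriction_ex[OF Dex Fex])
      have "pretopos_morphism E D X.extension"
        unfolding pretopos_morphism_def
        using X.extension_exact extension_preserves_coproducts[OF D F] preserves_quotientsI[OF E.regcat_axioms E_exact Dr X.extension_exact]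
        by (simp add: exact_functor_def)
      then show ?thesis using X.extension_functor X.extension_restrict by blast
    qed
  qed
qed (use C_coherent inclusion_coherent in auto)

end

section \<open>Categories of compact Hausdorff spaces\<close>

definition fn :: "'a map_arrow \<Rightarrow> 'a \<Rightarrow> 'a" where
  "fn m = fst (snd m)"

definition top_arrow :: "'a topology \<Rightarrow> ('a \<Rightarrow> 'a) \<Rightarrow> 'a topology \<Rightarrow> 'a map_arrow" where
  "top_arrow X f Y = (X, restrict f (topspace X), Y)"

text \<open>Through this set the subobjects of a space correspond to its closed subsets.\<close>

definition img :: "'a map_arrow \<Rightarrow> 'a set" where
  "img m = fn m ` topspace (fst m)"

lemma top_category_simps [simp]:
  "Obj (top_category \<X>) = \<X>"
  "Dom (top_category \<X>) m = fst m" "Cod (top_category \<X>) m = snd (snd m)"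
  "Ident (top_category \<X>) X = top_arrow X (\<lambda>x. x) X"
  by (auto simp: top_category_def top_arrow_def split: prod.splits)

lemma top_category_Comp:
  "Comp (top_category \<X>) g f = (fst f, compose (topspace (fst f)) (fn g) (fn f), snd (snd g))"
  by (auto simp: top_category_def fn_def split: prod.splits)

lemma top_category_Comp_simps [simp]:
  "fst (Comp (top_category \<X>) g f) = fst f" "snd (snd (Comp (top_category \<X>) g f)) = snd (snd g)"
  "x \<in> topspace (fst f) \<Longrightarrow> fn (Comp (top_category \<X>) g f) x = fn g (fn f x)"
  by (simp_all add: top_category_Comp fn_def compose_eq)

lemma top_category_Arr:
  "m \<in> Arr (top_category \<X>) \<longleftrightarrow> fst m \<in> \<X> \<and> snd (snd m) \<in> \<X> \<and> continuous_map (fst m) (snd (snd m)) (fn m) \<and>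
     fn m \<in> extensional (topspace (fst m))"
  by (cases m) (auto simp: top_category_def fn_def)

lemma top_arrow_simps [simp]:
  "fst (top_arrow X f Y) = X" "snd (snd (top_arrow X f Y)) = Y"
  "x \<in> topspace X \<Longrightarrow> fn (top_arrow X f Y) x = f x"
  by (auto simp: top_arrow_def fn_def)

lemma top_arrow_Arr [simp]:
  "top_arrow X f Y \<in> Arr (top_category \<X>) \<longleftrightarrow> X \<in> \<X> \<and> Y \<in> \<X> \<and> continuous_map X Y f"
  unfolding top_category_Arr top_arrow_def fn_def by (auto intro: continuous_map_eq)

lemma fn_in:
  "\<lbrakk>m \<in> Arr (top_category \<X>); x \<in> topspace (fst m)\<rbrakk> \<Longrightarrow> fn m x \<in> topspace (snd (snd m))"
  unfolding top_category_Arr using continuous_map_image_subset_topspace by blast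

lemma arr_eqI:
  assumes "m \<in> Arr (top_category \<X>)" "n \<in> Arr (top_category \<X>)" "fst m = fst n" "snd (snd m) = snd (snd n)"
    "\<And>x. x \<in> topspace (fst m) \<Longrightarrow> fn m x = fn n x"
  shows "m = n"
proof -
  have "fn m = fn n" by (rule extensionalityI[of _ "topspace (fst m)"]) (use assms in \<open>auto simp: top_category_Arr\<close>)
  then show ?thesis using assms(3,4) by (auto simp: fn_def prod_eq_iff)
qed

lemma is_category_top: "is_category (top_category \<X>)"
  unfolding is_category_def
proof (intro conjI ballI impI)
  let ?C = "top_category \<X>"
  have comp: "Comp ?C g f \<in> Arr ?C" if "f \<in> Arr ?C" "g \<in> Arr ?C" "Cod ?C f = Dom ?C g" for f g
  proof -
    have "continuous_map (fst f) (snd (snd g)) (fn g \<circ> fn f)"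
      using that continuous_map_compose[of "fst f" "fst g" "fn f"] by (auto simp: top_category_Arr)
    then have "continuous_map (fst f) (snd (snd g)) (compose (topspace (fst f)) (fn g) (fn f))"
      by (rule continuous_map_eq) (simp add: compose_eq)
    then show ?thesis using that by (auto simp: top_category_Arr top_category_Comp fn_def)
  qed
  show "in_hom ?C (Ident ?C X) X X" if "X \<in> Obj ?C" for X using that by simp
  fix f assume f: "f \<in> Arr ?C"
  then have f': "fst f \<in> \<X>" "snd (snd f) \<in> \<X>" by (auto simp: top_category_Arr)
  then show "Dom ?C f \<in> Obj ?C" "Cod ?C f \<in> Obj ?C" by auto
  have "Ident ?C (Dom ?C f) \<in> Arr ?C" "Ident ?C (Cod ?C f) \<in> Arr ?C" using f' by simp_all
  note c = comp[OF this(1) f] comp[OF f this(2)]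
  show "Comp ?C f (Ident ?C (Dom ?C f)) = f" by (rule arr_eqI[OF c(1) f]) simp_all
  show "Comp ?C (Ident ?C (Cod ?C f)) f = f" by (rule arr_eqI[OF c(2) f]) (use fn_in[OF f] in simp_all)
  fix g assume g: "g \<in> Arr ?C"
  show "in_hom ?C (Comp ?C g f) (Dom ?C f) (Cod ?C g)" if "Cod ?C f = Dom ?C g"
    using comp[OF f g that] by simp
  fix h assume h: "h \<in> Arr ?C"
  show "Comp ?C h (Comp ?C g f) = Comp ?C (Comp ?C h g) f" if "Cod ?C f = Dom ?C g \<and> Cod ?C g = Dom ?C h"
  proof -
    have fg: "Cod ?C f = Dom ?C g" "Cod ?C g = Dom ?C h" using that by auto
    note c = comp[OF f g fg(1)] comp[OF g h fg(2)]
    have "Comp ?C h (Comp ?C g f) \<in> Arr ?C" "Comp ?C (Comp ?C h g) f \<in> Arr ?C"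
      using comp[OF c(1) h] comp[OF f c(2)] fg by simp_all
    then show ?thesis by (rule arr_eqI) (use fg fn_in[OF f] in simp_all)
  qed
qed

text \<open>A continuous injection of a compact space into a Hausdorff space is an embedding, so a
  factorization of functions through it is continuous. This makes the universal properties below
  checkable on points.\<close>

lemma continuous_factor:
  assumes j: "continuous_map N Q j" "inj_on j (topspace N)" and N: "compact_space N" "Hausdorff_space Q"
    and h: "continuous_map T Q h" "h ` topspace T \<subseteq> j ` topspace N"
  obtains k where "continuous_map T N k" "\<And>t. t \<in> topspace T \<Longrightarrow> j (k t) = h t"
proof -
  have "embedding_map N Q j" by (rule continuous_imp_embedding_map[OF j(1) N j(2)])
  then obtain g where g: "homeomorphic_maps N (subtopology Q (j ` topspace N)) j g"
    unfolding embedding_map_def homeomorphic_map_maps by blast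
  have "continuous_map T (subtopology Q (j ` topspace N)) h"
    using h by (intro continuous_map_into_subtopology) auto
  then have "continuous_map T N (g \<circ> h)"
    using g unfolding homeomorphic_maps_def by (meson continuous_map_compose)
  moreover have "j ((g \<circ> h) t) = h t" if "t \<in> topspace T" for t
  proof -
    have "h t \<in> topspace (subtopology Q (j ` topspace N))"
      using h that continuous_map_image_subset_topspace[OF h(1)] by auto
    then show ?thesis using g unfolding homeomorphic_maps_def by simp
  qed
  ultimately show ?thesis by (rule that)
qed

text \<open>The closure properties shared by the two classes of spaces, so that regularity and
  coherence are proved once. Subspaces of products are asked for up to homeomorphism because their
  points are pairs rather than elements of the fixed type of points.\<close>

locale ch_spaces =
  fixes \<X> :: "'a topology set"
  assumes compact: "X \<in> \<X> \<Longrightarrow> compact_space X"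
    and Hausdorff: "X \<in> \<X> \<Longrightarrow> Hausdorff_space X"
    and closed_subspace: "\<lbrakk>X \<in> \<X>; closedin X A\<rbrakk> \<Longrightarrow> subtopology X A \<in> \<X>"
    and product_subspace: "\<lbrakk>X \<in> \<X>; Y \<in> \<X>; closedin (prod_topology X Y) B\<rbrakk>
      \<Longrightarrow> \<exists>Z\<in>\<X>. subtopology (prod_topology X Y) B homeomorphic_space Z"
    and point: "\<exists>X\<in>\<X>. \<exists>x. topspace X = {x}"
begin

abbreviation "C \<equiv> top_category \<X>"

sublocale cat C by unfold_locales (rule is_category_top)

lemmas arr_eq = arr_eqI[of _ \<X>]

lemma ArrD:
  assumes "m \<in> Arr C"
  shows "fst m \<in> \<X>" "snd (snd m) \<in> \<X>" "compact_space (fst m)" "Hausdorff_space (snd (snd m))"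
    "Hausdorff_space (fst m)" "continuous_map (fst m) (snd (snd m)) (fn m)"
  using assms compact Hausdorff by (auto simp: top_category_Arr)

lemma closedin_img: "m \<in> Arr C \<Longrightarrow> closedin (snd (snd m)) (img m)"
  using ArrD[of m] compactin_imp_closedin image_compactin unfolding img_def compact_space_def by blast

lemma img_subset: "m \<in> Arr C \<Longrightarrow> img m \<subseteq> topspace (snd (snd m))"
  using fn_in[of m \<X>] by (auto simp: img_def)

section \<open>The one-point space and pointwise tests\<close>

definition pt :: "'a topology" where
  "pt = (SOME X. X \<in> \<X> \<and> (\<exists>x. topspace X = {x}))"

lemma pt: "pt \<in> \<X>" "\<exists>x. topspace pt = {x}"
proof -
  have "\<exists>X. X \<in> \<X> \<and> (\<exists>x. topspace X = {x})" using point by (simp add: Bex_def)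
  then have "pt \<in> \<X> \<and> (\<exists>x. topspace pt = {x})" unfolding pt_def by (rule someI_ex)
  then show "pt \<in> \<X>" "\<exists>x. topspace pt = {x}" by auto
qed

lemma point_terminal:
  assumes P: "P \<in> \<X>" and x: "topspace P = {x}"
  shows "is_terminal C P"
  unfolding is_terminal_def
proof (intro conjI ballI)
  show "P \<in> Obj C" using P by simp
  fix X assume X: "X \<in> Obj C"
  show "\<exists>!u. in_hom C u X P"
  proof (rule ex_ex1I)
    show "\<exists>u. in_hom C u X P" using X P x by (intro exI[of _ "top_arrow X (\<lambda>_. x) P"]) simp
    fix u v assume uv: "in_hom C u X P" "in_hom C v X P"
    then have "fn u y = x" "fn v y = x" if "y \<in> topspace X" for y
      using that x fn_in[of u \<X> y] fn_in[of v \<X> y] by auto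
    then show "u = v" by - (rule arr_eq, use uv in auto)
  qed
qed

lemma pt_terminal: "is_terminal C pt"
  using pt point_terminal by blast

text \<open>Points as arrows from the one-point space: testing a universal property against them
  gives its pointwise content.\<close>

definition const :: "'a \<Rightarrow> 'a topology \<Rightarrow> 'a map_arrow" where
  "const x X = top_arrow pt (\<lambda>_. x) X"

lemma const_simps [simp]:
  "fst (const x X) = pt" "snd (snd (const x X)) = X" "\<lbrakk>X \<in> \<X>; x \<in> topspace X\<rbrakk> \<Longrightarrow> const x X \<in> Arr C"
  "p \<in> topspace pt \<Longrightarrow> fn (const x X) p = x"
  unfolding const_def using pt(1) by simp_all

lemma comp_const:
  assumes "m \<in> Arr C" "x \<in> topspace (fst m)"
  shows "m \<cdot>\<^sub>C const x (fst m) = const (fn m x) (snd (snd m))"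
proof (rule arr_eq)
  show "m \<cdot>\<^sub>C const x (fst m) \<in> Arr C" by (rule Comp_Arr) (use assms ArrD(1)[OF assms(1)] in simp_all)
  show "const (fn m x) (snd (snd m)) \<in> Arr C" using fn_in[OF assms] ArrD(2)[OF assms(1)] by simp
qed (use assms in auto)

lemma const_inj: "const x X = const y X \<Longrightarrow> x = y"
  using pt by (auto simp: const_def top_arrow_def restrict_def fun_eq_iff split: if_splits)

lemma mono_iff: "m \<in> Arr C \<Longrightarrow> is_mono C m \<longleftrightarrow> inj_on (fn m) (topspace (fst m))"
proof
  assume m: "m \<in> Arr C" and mono: "is_mono C m"
  show "inj_on (fn m) (topspace (fst m))"
  proof (rule inj_onI)
    fix x y assume xy: "x \<in> topspace (fst m)" "y \<in> topspace (fst m)" "fn m x = fn m y"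
    have "const x (fst m) = const y (fst m)"
      by (rule is_monoD[OF mono]) (use xy m ArrD[OF m] comp_const[OF m] in auto)
    then show "x = y" by (rule const_inj)
  qed
next
  assume m: "m \<in> Arr C" and inj: "inj_on (fn m) (topspace (fst m))"
  show "is_mono C m"
  proof (rule is_monoI[OF m])
    fix f g assume fg: "f \<in> Arr C" "g \<in> Arr C" "Dom C f = Dom C g" "Cod C f = Dom C m" "Cod C g = Dom C m" "m \<cdot>\<^sub>C f = m \<cdot>\<^sub>C g"
    show "f = g"
    proof (rule arr_eq[OF fg(1,2)])
      fix x assume x: "x \<in> topspace (fst f)"
      have "fn (m \<cdot>\<^sub>C f) x = fn (m \<cdot>\<^sub>C g) x" using fg(6) by simp
      then have "fn m (fn f x) = fn m (fn g x)" using x fg(3) by simp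
      then show "fn f x = fn g x" using inj fn_in[OF fg(1)] fn_in[OF fg(2)] x fg by (auto dest: inj_onD)
    qed (use fg in auto)
  qed
qed

text \<open>Inclusion of images gives a factorization of the underlying functions, which
  \<open>continuous_factor\<close> shows to be continuous.\<close>

lemma factors_through_iff:
  assumes f: "f \<in> Arr C" and n: "is_mono C n" "Cod C f = Cod C n"
  shows "factors_through C f n \<longleftrightarrow> img f \<subseteq> img n"
proof
  have nA: "n \<in> Arr C" using n by auto
  assume "factors_through C f n"
  then obtain h where h: "in_hom C h (Dom C f) (Dom C n)" "n \<cdot>\<^sub>C h = f" unfolding factors_through_def by blast
  have "fn f x \<in> img n" if x: "x \<in> topspace (fst f)" for x
  proof -
    have "fn (n \<cdot>\<^sub>C h) x = fn n (fn h x)" using x h(1) by simp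
    then have "fn f x = fn n (fn h x)" using h(2) by simp
    then show ?thesis using fn_in[of h \<X> x] h(1) x unfolding img_def by simp
  qed
  then show "img f \<subseteq> img n" unfolding img_def[of f] by blast
next
  have nA: "n \<in> Arr C" using n by auto
  assume "img f \<subseteq> img n"
  then obtain k where k: "continuous_map (fst f) (fst n) k" "\<And>t. t \<in> topspace (fst f) \<Longrightarrow> fn n (k t) = fn f t"
    by - (rule continuous_factor[OF ArrD(6)[OF nA] _ ArrD(3,4)[OF nA], of "fst f" "fn f"],
        use n mono_iff[OF nA] ArrD[OF f] in \<open>auto simp: img_def\<close>)
  have kA: "top_arrow (fst f) k (fst n) \<in> Arr C" using k ArrD[OF f] ArrD[OF nA] by simp
  have "n \<cdot>\<^sub>C top_arrow (fst f) k (fst n) = f"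
  proof (rule arr_eq[OF _ f])
    show "n \<cdot>\<^sub>C top_arrow (fst f) k (fst n) \<in> Arr C" by (rule Comp_Arr[OF kA nA]) simp
    fix x assume "x \<in> topspace (fst (n \<cdot>\<^sub>C top_arrow (fst f) k (fst n)))"
    then have x: "x \<in> topspace (fst f)" by simp
    have "fn (n \<cdot>\<^sub>C top_arrow (fst f) k (fst n)) x = fn n (fn (top_arrow (fst f) k (fst n)) x)"
      using top_category_Comp_simps(3)[of x "top_arrow (fst f) k (fst n)"] x by simp
    then show "fn (n \<cdot>\<^sub>C top_arrow (fst f) k (fst n)) x = fn f x" using x k(2) by simp
  qed (use n in auto)
  then show "factors_through C f n" unfolding factors_through_def using kA
    by (intro exI[of _ "top_arrow (fst f) k (fst n)"]) auto
qed

lemma iso_iff: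
  assumes m: "m \<in> Arr C" shows "is_iso C m \<longleftrightarrow> inj_on (fn m) (topspace (fst m)) \<and> img m = topspace (snd (snd m))"
proof
  have id: "Ident C (Cod C m) \<in> Arr C" using m ArrD by simp
  have img_id: "img (Ident C (Cod C m)) = topspace (snd (snd m))" by (auto simp: img_def image_iff)
  {
    assume iso: "is_iso C m"
    then have mono: "is_mono C m" by (rule is_iso_mono)
    obtain s where "s \<in> Arr C" "Dom C s = Cod C m" "Cod C s = Dom C m" "m \<cdot>\<^sub>C s = Ident C (Cod C m)"
      by (rule is_isoE[OF iso])
    then have "factors_through C (Ident C (Cod C m)) m" unfolding factors_through_def using m by (intro exI[of _ s]) simp
    then have "topspace (snd (snd m)) \<subseteq> img m" using factors_through_iff[OF id mono] m img_id by simp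
    then show "inj_on (fn m) (topspace (fst m)) \<and> img m = topspace (snd (snd m))"
      using mono mono_iff[OF m] img_subset[OF m] by auto
  }
  assume *: "inj_on (fn m) (topspace (fst m)) \<and> img m = topspace (snd (snd m))"
  then have mono: "is_mono C m" using mono_iff[OF m] by simp
  have "factors_through C (Ident C (Cod C m)) m" using factors_through_iff[OF id mono] * img_id by simp
  then obtain s where "s \<in> Arr C" "Dom C s = Cod C m" "Cod C s = Dom C m" "m \<cdot>\<^sub>C s = Ident C (Cod C m)"
    unfolding factors_through_def by auto
  then show "is_iso C m" using split_mono_iso[OF mono] by blast
qed

definition incl :: "'a topology \<Rightarrow> 'a set \<Rightarrow> 'a map_arrow" where
  "incl X A = top_arrow (subtopology X A) (\<lambda>x. x) X"

lemma incl:
  assumes X: "X \<in> \<X>" and A: "closedin X A"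
  shows "incl X A \<in> Arr C" "is_mono C (incl X A)" "snd (snd (incl X A)) = X" "img (incl X A) = A" "fst (incl X A) = subtopology X A"
proof -
  have sub: "A \<subseteq> topspace X" using A closedin_subset by blast
  show 1: "incl X A \<in> Arr C" unfolding incl_def using closed_subspace[OF X A] X by simp
  show "snd (snd (incl X A)) = X" "fst (incl X A) = subtopology X A" by (auto simp: incl_def)
  show "img (incl X A) = A" using sub by (auto simp: img_def incl_def image_iff)
  show "is_mono C (incl X A)" using mono_iff[OF 1] by (auto simp: incl_def intro: inj_onI)
qed

text \<open>The image of \<open>f\<close> is closed, so its inclusion is a monomorphism of the
  category through which \<open>f\<close> factors; a cover makes it an isomorphism.\<close>

lemma cover_iff:
  assumes f: "f \<in> Arr C" shows "is_cover C f \<longleftrightarrow> img f = topspace (snd (snd f))"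
proof
  assume c: "is_cover C f"
  note i = incl[OF ArrD(2)[OF f] closedin_img[OF f]]
  have "factors_through C f (incl (snd (snd f)) (img f))" using factors_through_iff[OF f i(2)] i by simp
  then obtain h where "in_hom C h (Dom C f) (Dom C (incl (snd (snd f)) (img f)))" "incl (snd (snd f)) (img f) \<cdot>\<^sub>C h = f"
    unfolding factors_through_def by blast
  then have "is_iso C (incl (snd (snd f)) (img f))"
    using is_coverD[OF c i(2), of h] i by simp
  then show "img f = topspace (snd (snd f))" using iso_iff[OF i(1)] i by simp
next
  assume s: "img f = topspace (snd (snd f))"
  show "is_cover C f"
  proof (rule is_coverI[OF f])
    fix m h assume m: "is_mono C m" "Cod C m = Cod C f" "h \<in> Arr C" "Dom C h = Dom C f" "Cod C h = Dom C m" "m \<cdot>\<^sub>C h = f"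
    have mA: "m \<in> Arr C" using m by auto
    have "factors_through C f m" unfolding factors_through_def using m by (intro exI[of _ h]) simp
    then have "img f \<subseteq> img m" using factors_through_iff[OF f m(1)] m by simp
    then show "is_iso C m" using iso_iff[OF mA] mono_iff[OF mA] m s img_subset[OF mA] by auto
  qed
qed

lemma pullback_points:
  assumes pb: "is_pullback C f g p q" and x: "x \<in> topspace (fst f)" "y \<in> topspace (fst g)" "fn f x = fn g y"
  shows "\<exists>z\<in>topspace (fst p). fn p z = x \<and> fn q z = y"
proof -
  note sq = pullback_square[OF pb]
  note Af = ArrD[OF sq(1)] and Ag = ArrD[OF sq(2)]
  have "f \<cdot>\<^sub>C const x (fst f) = g \<cdot>\<^sub>C const y (fst g)" using comp_const sq x by simp
  then obtain u where u: "u \<in> Arr C" "Dom C u = pt" "Cod C u = Dom C p" "p \<cdot>\<^sub>C u = const x (fst f)" "q \<cdot>\<^sub>C u = const y (fst g)"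
    by - (rule pullback_lift[OF pb, of "const x (fst f)" "const y (fst g)"], use x Af Ag in auto)
  obtain a where a: "a \<in> topspace pt" using pt by blast
  have "fn (p \<cdot>\<^sub>C u) a = x" "fn (q \<cdot>\<^sub>C u) a = y" using u(4,5) a by simp_all
  moreover have "fn (p \<cdot>\<^sub>C u) a = fn p (fn u a)" "fn (q \<cdot>\<^sub>C u) a = fn q (fn u a)" using a u(2) by simp_all
  moreover have "fn u a \<in> topspace (fst p)" using fn_in[OF u(1)] a u by simp
  ultimately show ?thesis by auto
qed

lemma pullback_inj:
  assumes pb: "is_pullback C f g p q" and z: "z \<in> topspace (fst p)" "w \<in> topspace (fst p)" "fn p z = fn p w" "fn q z = fn q w"
  shows "z = w"
proof -
  note sq = pullback_square[OF pb]
  have "const z (fst p) = const w (fst p)"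
    by (rule jointly_monicD[OF pullback_jointly_monic[OF pb]])
      (use z sq ArrD[OF sq(3)] comp_const[OF sq(3)] comp_const[OF sq(4)] in auto)
  then show ?thesis by (rule const_inj)
qed

lemma square_fn: "\<lbrakk>g \<cdot>\<^sub>C f = k \<cdot>\<^sub>C h; x \<in> topspace (fst f); fst h = fst f\<rbrakk> \<Longrightarrow> fn g (fn f x) = fn k (fn h x)"
  by (metis top_category_Comp_simps(3))

text \<open>The mediating map exists as a function by \<open>ex\<close>, and it is continuous
  because the vertex embeds into the product of the two sources.\<close>

lemma pullbackI:
  assumes ar: "f \<in> Arr C" "g \<in> Arr C" "p \<in> Arr C" "q \<in> Arr C" "snd (snd f) = snd (snd g)" "fst p = fst q"
      "snd (snd p) = fst f" "snd (snd q) = fst g"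
    and com: "\<And>z. z \<in> topspace (fst p) \<Longrightarrow> fn f (fn p z) = fn g (fn q z)"
    and inj: "\<And>z w. \<lbrakk>z \<in> topspace (fst p); w \<in> topspace (fst p); fn p z = fn p w; fn q z = fn q w\<rbrakk> \<Longrightarrow> z = w"
    and ex: "\<And>x y. \<lbrakk>x \<in> topspace (fst f); y \<in> topspace (fst g); fn f x = fn g y\<rbrakk> \<Longrightarrow> \<exists>z\<in>topspace (fst p). fn p z = x \<and> fn q z = y"
  shows "is_pullback C f g p q"
proof (rule is_pullbackI)
  note Ap = ArrD[OF ar(3)] and Aq = ArrD[OF ar(4)]
  show "f \<cdot>\<^sub>C p = g \<cdot>\<^sub>C q"
  proof (rule arr_eq)
    show "f \<cdot>\<^sub>C p \<in> Arr C" by (rule Comp_Arr) (use ar in simp_all)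
    show "g \<cdot>\<^sub>C q \<in> Arr C" by (rule Comp_Arr) (use ar in simp_all)
    show "fn (f \<cdot>\<^sub>C p) x = fn (g \<cdot>\<^sub>C q) x" if "x \<in> topspace (fst (f \<cdot>\<^sub>C p))" for x
      using that com[of x] ar(6) by simp
  qed (use ar in auto)
  show "jointly_monic C p q" unfolding jointly_monic_def
  proof (intro conjI ballI impI)
    fix h k assume h: "h \<in> Arr C" and k: "k \<in> Arr C" and *: "Dom C h = Dom C k \<and> Cod C h = Dom C p \<and> Cod C k = Dom C p \<and> p \<cdot>\<^sub>C h = p \<cdot>\<^sub>C k \<and> q \<cdot>\<^sub>C h = q \<cdot>\<^sub>C k"
    show "h = k"
    proof (rule arr_eq[OF h k])
      fix x assume x: "x \<in> topspace (fst h)"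
      have hk: "fst k = fst h" "snd (snd h) = fst p" "snd (snd k) = fst p" "p \<cdot>\<^sub>C h = p \<cdot>\<^sub>C k" "q \<cdot>\<^sub>C h = q \<cdot>\<^sub>C k" using * by simp_all
      show "fn h x = fn k x"
        by (rule inj) (use x hk(1-3) fn_in[OF h, of x] fn_in[OF k, of x] square_fn[OF hk(4) x] square_fn[OF hk(5) x] in simp_all)
    qed (use * in simp_all)
  qed (use ar in auto)
  fix a b assume ab: "a \<in> Arr C" "b \<in> Arr C" "Dom C a = Dom C b" "Cod C a = Dom C f" "Cod C b = Dom C g" "f \<cdot>\<^sub>C a = g \<cdot>\<^sub>C b"
  let ?Q = "prod_topology (fst f) (fst g)"
  have ab': "fst b = fst a" "snd (snd a) = fst f" "snd (snd b) = fst g" using ab by auto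
  have Hf: "Hausdorff_space (fst f)" "Hausdorff_space (fst g)" using ArrD(5)[OF ar(1)] ArrD(5)[OF ar(2)] .
  obtain k where k: "continuous_map (fst a) (fst p) k" "\<And>t. t \<in> topspace (fst a) \<Longrightarrow> (fn p (k t), fn q (k t)) = (fn a t, fn b t)"
  proof (rule continuous_factor[of "fst p" ?Q "\<lambda>z. (fn p z, fn q z)" "fst a" "\<lambda>t. (fn a t, fn b t)"])
    show "continuous_map (fst p) ?Q (\<lambda>z. (fn p z, fn q z))"
      using Ap(6) Aq(6) ar(6-8) by (simp add: continuous_map_paired)
    show "inj_on (\<lambda>z. (fn p z, fn q z)) (topspace (fst p))" by (rule inj_onI) (use inj in auto)
    show "compact_space (fst p)" by (rule Ap)
    show "Hausdorff_space ?Q" using Hf by (simp add: Hausdorff_space_prod_topology)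
    show "continuous_map (fst a) ?Q (\<lambda>t. (fn a t, fn b t))"
      using ArrD(6)[OF ab(1)] ArrD(6)[OF ab(2)] ab' by (simp add: continuous_map_paired)
    show "(\<lambda>t. (fn a t, fn b t)) ` topspace (fst a) \<subseteq> (\<lambda>z. (fn p z, fn q z)) ` topspace (fst p)"
    proof clarify
      fix t assume t: "t \<in> topspace (fst a)"
      have "\<exists>z\<in>topspace (fst p). fn p z = fn a t \<and> fn q z = fn b t"
        by (rule ex) (use fn_in[OF ab(1)] fn_in[OF ab(2)] ab' t square_fn[OF ab(6) t] in auto)
      then show "(fn a t, fn b t) \<in> (\<lambda>z. (fn p z, fn q z)) ` topspace (fst p)" by force
    qed
  qed auto
  let ?u = "top_arrow (fst a) k (fst p)"
  have u: "?u \<in> Arr C" using k ArrD(1)[OF ab(1)] Ap(1) by simp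
  have "p \<cdot>\<^sub>C ?u = a"
  proof (rule arr_eq[OF _ ab(1)])
    show "p \<cdot>\<^sub>C ?u \<in> Arr C" by (rule Comp_Arr[OF u ar(3)]) simp
    show "fn (p \<cdot>\<^sub>C ?u) x = fn a x" if "x \<in> topspace (fst (p \<cdot>\<^sub>C ?u))" for x
      using that k(2)[of x] by simp
  qed (use ab' ar in auto)
  moreover have "q \<cdot>\<^sub>C ?u = b"
  proof (rule arr_eq[OF _ ab(2)])
    show "q \<cdot>\<^sub>C ?u \<in> Arr C" by (rule Comp_Arr[OF u ar(4)]) (use ar in simp)
    show "fn (q \<cdot>\<^sub>C ?u) x = fn b x" if "x \<in> topspace (fst (q \<cdot>\<^sub>C ?u))" for x
      using that k(2)[of x] by simp
  qed (use ab' ar in auto)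
  ultimately show "\<exists>u. in_hom C u (Dom C a) (Dom C p) \<and> p \<cdot>\<^sub>C u = a \<and> q \<cdot>\<^sub>C u = b"
    using u by (intro exI[of _ ?u]) simp
qed (use ar in auto)

lemma pullbacks: "has_pullbacks C"
  unfolding has_pullbacks_def
proof (intro ballI impI)
  fix f g assume f: "f \<in> Arr C" and g: "g \<in> Arr C" and fg: "Cod C f = Cod C g"
  note Af = ArrD[OF f] and Ag = ArrD[OF g]
  let ?Q = "prod_topology (fst f) (fst g)"
  define A where "A = {z \<in> topspace ?Q. fn f (fst z) = fn g (snd z)}"
  have A: "closedin ?Q A" unfolding A_def
  proof (rule closedin_continuous_maps_eq[OF Af(4)])
    show "continuous_map ?Q (snd (snd f)) (\<lambda>z. fn f (fst z))"
      using continuous_map_compose[OF continuous_map_fst Af(6)] by (simp add: o_def)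
    show "continuous_map ?Q (snd (snd f)) (\<lambda>z. fn g (snd z))"
      using continuous_map_compose[OF continuous_map_snd Ag(6)] fg by (simp add: o_def)
  qed
  \<comment> \<open>The fibre product consists of pairs; a homeomorphic copy in the class takes its
    place.\<close>
  obtain Z where Z: "Z \<in> \<X>" "subtopology ?Q A homeomorphic_space Z"
    using product_subspace[OF Af(1) Ag(1) A] by blast
  then obtain j k where jk: "homeomorphic_maps (subtopology ?Q A) Z j k" unfolding homeomorphic_space_def by blast
  have kc: "continuous_map Z (subtopology ?Q A) k" using jk by (simp add: homeomorphic_maps_def)
  have kA: "k z \<in> A" if "z \<in> topspace Z" for z using continuous_map_image_subset_topspace[OF kc] that by auto
  have kQ: "continuous_map Z ?Q k" using kc by (simp add: continuous_map_in_subtopology)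
  let ?p = "top_arrow Z (\<lambda>z. fst (k z)) (fst f)" and ?q = "top_arrow Z (\<lambda>z. snd (k z)) (fst g)"
  have "is_pullback C f g ?p ?q"
  proof (rule pullbackI[OF f g])
    show "?p \<in> Arr C" "?q \<in> Arr C"
      using continuous_map_compose[OF kQ continuous_map_fst] continuous_map_compose[OF kQ continuous_map_snd] Z(1) Af(1) Ag(1)
      by (simp_all add: o_def)
    show "fn f (fn ?p z) = fn g (fn ?q z)" if "z \<in> topspace (fst ?p)" for z
      using that kA[of z] unfolding A_def by simp
    show "z = w" if "z \<in> topspace (fst ?p)" "w \<in> topspace (fst ?p)" "fn ?p z = fn ?p w" "fn ?q z = fn ?q w" for z w
    proof -
      have "k z = k w" using that by (simp add: prod_eq_iff)
      then show ?thesis using jk that unfolding homeomorphic_maps_def by (metis top_arrow_simps(1))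
    qed
    show "\<exists>z\<in>topspace (fst ?p). fn ?p z = x \<and> fn ?q z = y" if xy: "x \<in> topspace (fst f)" "y \<in> topspace (fst g)" "fn f x = fn g y" for x y
    proof -
      have "(x, y) \<in> topspace (subtopology ?Q A)" using xy by (simp add: A_def)
      then have "j (x, y) \<in> topspace Z" "k (j (x, y)) = (x, y)"
        using jk continuous_map_image_subset_topspace unfolding homeomorphic_maps_def by blast+
      then show ?thesis by (intro bexI[of _ "j (x, y)"]) auto
    qed
  qed (use fg in auto)
  then show "\<exists>p q. is_pullback C f g p q" by blast
qed

sublocale flim C
  by unfold_locales (use pt_terminal pullbacks in auto)

lemma pullback_img:
  assumes pb: "is_pullback C f g p q"
  shows "img p = {x \<in> topspace (fst f). fn f x \<in> img g}"
proof -
  note sq = pullback_square[OF pb]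
  have "fn f (fn p z) = fn g (fn q z)" if "z \<in> topspace (fst p)" for z
    by (rule square_fn[OF sq(9)]) (use that sq in auto)
  note fg = this
  show ?thesis
  proof (intro set_eqI iffI)
    fix x assume "x \<in> img p"
    then obtain z where z: "z \<in> topspace (fst p)" "x = fn p z" unfolding img_def by blast
    have "fn q z \<in> topspace (fst g)" using fn_in[OF sq(4), of z] z(1) sq(6,8) by simp
    then have "fn f x \<in> img g" using fg[OF z(1)] z(2) unfolding img_def by simp
    moreover have "x \<in> topspace (fst f)" using fn_in[OF sq(3) z(1)] sq(7) z(2) by simp
    ultimately show "x \<in> {x \<in> topspace (fst f). fn f x \<in> img g}" by blast
  next
    fix x assume "x \<in> {x \<in> topspace (fst f). fn f x \<in> img g}"
    then obtain y where "x \<in> topspace (fst f)" "y \<in> topspace (fst g)" "fn f x = fn g y" unfolding img_def by blast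
    from pullback_points[OF pb this] show "x \<in> img p" unfolding img_def by blast
  qed
qed

text \<open>A subobject is determined by its image, and pullback takes images to preimages.
  Conversely, a monomorphism with the right image is itself a pullback, its second projection being
  obtained through \<open>q'\<close>.\<close>

lemma sub_pullback_eq:
  assumes m: "is_mono C m" and pb: "is_pullback C g m m' q'"
  shows "sub_pullback C g (subobject_of C m) = subobject_of C m'"
proof
  note sq = pullback_square[OF pb]
  have m': "is_mono C m'" by (rule pullback_mono[OF pb m])
  have same: "n \<in> subobject_of C m \<longleftrightarrow> is_mono C n \<and> Cod C n = Cod C m \<and> img n = img m" if "is_mono C m" for n m
    using factors_through_iff[of n m] factors_through_iff[of m n] that is_mono_Arr[of C n] is_mono_Arr[of C m]
    unfolding subobject_of_def monos_into_def by auto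
  show "sub_pullback C g (subobject_of C m) \<subseteq> subobject_of C m'"
  proof
    fix p assume "p \<in> sub_pullback C g (subobject_of C m)"
    then obtain n q where n: "n \<in> subobject_of C m" "is_pullback C g n p q" unfolding sub_pullback_def by blast
    have "is_mono C n" "img n = img m" using n(1) same[OF m] by auto
    then show "p \<in> subobject_of C m'"
      unfolding same[OF m'] using pullback_mono[OF n(2)] pullback_img[OF n(2)] pullback_img[OF pb] pullback_square[OF n(2)] sq by simp
  qed
  show "subobject_of C m' \<subseteq> sub_pullback C g (subobject_of C m)"
  proof
    fix p assume "p \<in> subobject_of C m'"
    then have p: "is_mono C p" "Cod C p = Cod C m'" "img p = img m'" using same[OF m'] by auto
    have pA: "p \<in> Arr C" using p by auto
    obtain h where h: "in_hom C h (Dom C p) (Dom C m')" "m' \<cdot>\<^sub>C h = p"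
      using factors_through_iff[OF pA m' p(2)] p(3) unfolding factors_through_def by auto
    have mh: "fn m' (fn h z) = fn p z" if "z \<in> topspace (fst p)" for z
      using h that top_category_Comp_simps(3)[of z h \<X> m'] by auto
    have hq: "q' \<cdot>\<^sub>C h \<in> Arr C" by (rule Comp_Arr) (use h sq in auto)
    have qh: "fn (q' \<cdot>\<^sub>C h) z = fn q' (fn h z)" if "z \<in> topspace (fst p)" for z
      using that h by simp
    have "is_pullback C g m p (q' \<cdot>\<^sub>C h)"
    proof (rule pullbackI[OF sq(1,2) pA hq])
      show "fn g (fn p z) = fn m (fn (q' \<cdot>\<^sub>C h) z)" if z: "z \<in> topspace (fst p)" for z
        using mh[OF z] qh[OF z] square_fn[OF sq(9), of "fn h z"] fn_in[of h \<X> z] h(1) z sq by simp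
      show "z = w" if "z \<in> topspace (fst p)" "w \<in> topspace (fst p)" "fn p z = fn p w" for z w
        using p(1) mono_iff[OF pA] that by (auto dest: inj_onD)
      show "\<exists>z\<in>topspace (fst p). fn p z = x \<and> fn (q' \<cdot>\<^sub>C h) z = y"
        if xy: "x \<in> topspace (fst g)" "y \<in> topspace (fst m)" "fn g x = fn m y" for x y
      proof -
        have "x \<in> img m'" unfolding pullback_img[OF pb] using xy by (auto simp: img_def)
        then obtain z where z: "z \<in> topspace (fst p)" "fn p z = x" unfolding p(3)[symmetric] by (auto simp: img_def)
        have "fn m (fn q' (fn h z)) = fn m y"
          using mh[OF z(1)] z xy square_fn[OF sq(9), of "fn h z"] fn_in[of h \<X> z] h(1) sq by simp
        moreover have "fn q' (fn h z) \<in> topspace (fst m)"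
          using fn_in[OF sq(4), of "fn h z"] fn_in[of h \<X> z] h(1) z(1) sq by simp
        ultimately have "fn q' (fn h z) = y" using m mono_iff[OF sq(2)] xy(2) by (auto dest: inj_onD)
        then show ?thesis using z qh by auto
      qed
    qed (use sq p h in auto)
    then show "p \<in> sub_pullback C g (subobject_of C m)" unfolding sub_pullback_def using subobject_self[OF m] by blast
  qed
qed

lemma is_image_iff_img:
  assumes m: "is_mono C m" "Cod C m = Cod C f" "f \<in> Arr C"
  shows "is_image C f (subobject_of C m) \<longleftrightarrow> img m = img f"
proof -
  have mA: "m \<in> Arr C" using m by auto
  note i = incl[OF ArrD(2)[OF m(3)] closedin_img[OF m(3)]]
  have "img f \<subseteq> img m \<and> (\<forall>n. is_mono C n \<and> Cod C n = Cod C f \<and> img f \<subseteq> img n \<longrightarrow> img m \<subseteq> img n) \<longleftrightarrow> img m = img f"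
  proof
    assume "img f \<subseteq> img m \<and> (\<forall>n. is_mono C n \<and> Cod C n = Cod C f \<and> img f \<subseteq> img n \<longrightarrow> img m \<subseteq> img n)"
    then show "img m = img f" using i by (metis order_refl subset_antisym top_category_simps(3))
  qed auto
  moreover have "factors_through C f n \<longleftrightarrow> img f \<subseteq> img n" "factors_through C m n \<longleftrightarrow> img m \<subseteq> img n"
    if "is_mono C n" "Cod C n = Cod C f" for n
    using factors_through_iff[OF m(3) that(1)] factors_through_iff[OF mA that(1)] that m by simp_all
  ultimately show ?thesis unfolding is_image_iff[OF m] using m(1,2) by metis
qed

lemma regular: "regular_category C"
  unfolding regular_category_def
proof (intro conjI ballI allI impI)
  show "is_category C" by (rule is_category_top)
  show "has_finite_limits C" by (rule has_finite_limitsI[OF is_category_top pt_terminal pullbacks])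
  fix f assume f: "f \<in> Arr C"
  note i = incl[OF ArrD(2)[OF f] closedin_img[OF f]]
  show "\<exists>S. is_image C f S" using is_image_iff_img[OF i(2) _ f] i by auto
next
  fix f g p q S assume "is_pullback C g f p q \<and> is_image C f S"
  then have pb: "is_pullback C g f p q" and im: "is_image C f S" by auto
  note sq = pullback_square[OF pb]
  obtain m where m: "is_mono C m" "Cod C m = Cod C f" "S = subobject_of C m"
    using im unfolding is_image_def Sub_def monos_into_def by auto
  have mA: "m \<in> Arr C" using m by auto
  have mf: "img m = img f" using im is_image_iff_img[OF m(1,2) sq(2)] m(3) by simp
  obtain m' q' where pb': "is_pullback C g m m' q'" by (rule pullback_ex[OF sq(1) mA]) (use sq m in auto)
  have "img m' = img p" using pullback_img[OF pb] pullback_img[OF pb'] mf by simp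
  then have "is_image C p (subobject_of C m')"
    using is_image_iff_img[OF pullback_mono[OF pb' m(1)] _ sq(3)] pullback_square[OF pb'] sq by simp
  then show "is_image C p (sub_pullback C g S)" unfolding m(3) sub_pullback_eq[OF m(1) pb'] .
qed

sublocale regcat C by unfold_locales (rule regular)

section \<open>Subobjects as closed subsets, joins as unions\<close>

definition sub_img :: "'a map_arrow set \<Rightarrow> 'a set" where
  "sub_img S = (\<Union>m\<in>S. img m)"

lemma sub_img_subobject:
  assumes "is_mono C m" shows "sub_img (subobject_of C m) = img m"
proof -
  have "img n = img m" if "n \<in> subobject_of C m" for n
    using that factors_through_iff[of n m] factors_through_iff[of m n] assms is_mono_Arr[of C n] is_mono_Arr[of C m]
    unfolding subobject_of_def monos_into_def by auto
  then show ?thesis unfolding sub_img_def using subobject_self[OF assms] by blast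
qed

lemma sub_le_img:
  assumes "S \<in> Sub C X" "T \<in> Sub C X" shows "sub_le C S T \<longleftrightarrow> sub_img S \<subseteq> sub_img T"
proof -
  obtain m where m: "m \<in> S" "is_mono C m" "Cod C m = X" "S = subobject_of C m" by (rule Sub_rep[OF assms(1)])
  obtain n where n: "n \<in> T" "is_mono C n" "Cod C n = X" "T = subobject_of C n" by (rule Sub_rep[OF assms(2)])
  show ?thesis unfolding m(4) n(4) sub_le_iff[OF m(2) n(2)] sub_img_subobject[OF m(2)] sub_img_subobject[OF n(2)]
    by (rule factors_through_iff[OF is_mono_Arr[OF m(2)] n(2)]) (simp only: m(3) n(3))
qed

lemma sub_img_closed:
  assumes "S \<in> Sub C X" shows "closedin X (sub_img S)"
proof -
  obtain m where m: "m \<in> S" "is_mono C m" "Cod C m = X" "S = subobject_of C m" by (rule Sub_rep[OF assms])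
  show ?thesis using closedin_img[OF is_mono_Arr[OF m(2)]] m(3,4) sub_img_subobject[OF m(2)] by simp
qed

text \<open>A finite union of closed subsets is closed, so its inclusion is a subobject, and it is
  the least upper bound.\<close>

lemma is_join_iff:
  assumes X: "X \<in> \<X>" and fin: "finite \<S>" and S: "\<S> \<subseteq> Sub C X" and V: "V \<in> Sub C X"
  shows "is_join C X \<S> V \<longleftrightarrow> sub_img V = (\<Union>S\<in>\<S>. sub_img S)"
proof
  let ?U = "\<Union>S\<in>\<S>. sub_img S"
  have cl: "closedin X ?U" using fin S sub_img_closed by (intro closedin_Union) auto
  note i = incl[OF X cl]
  have W: "subobject_of C (incl X ?U) \<in> Sub C X" "sub_img (subobject_of C (incl X ?U)) = ?U"
    using subobject_of_Sub[OF i(2)] sub_img_subobject[OF i(2)] i by simp_all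
  have le: "sub_le C S T \<longleftrightarrow> sub_img S \<subseteq> sub_img T" if "S \<in> \<S>" "T \<in> Sub C X" for S T
    using sub_le_img[of S X T] that S by blast
  assume j: "is_join C X \<S> V"
  have "sub_img S \<subseteq> sub_img V" if "S \<in> \<S>" for S
    using j le[OF that V] that unfolding is_join_def by blast
  moreover have "sub_le C V (subobject_of C (incl X ?U))"
  proof -
    have "\<forall>S\<in>\<S>. sub_le C S (subobject_of C (incl X ?U))" using le[OF _ W(1)] W(2) by auto
    then show ?thesis using j[unfolded is_join_def, THEN conjunct2, THEN conjunct2, THEN conjunct2, THEN bspec[OF _ W(1)]] by simp
  qed
  ultimately show "sub_img V = ?U" using sub_le_img[OF V W(1)] W(2) by auto
next
  assume "sub_img V = (\<Union>S\<in>\<S>. sub_img S)"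
  moreover have le: "sub_le C S T \<longleftrightarrow> sub_img S \<subseteq> sub_img T" if "S \<in> \<S>" "T \<in> Sub C X" for S T
    using sub_le_img[of S X T] that S by blast
  ultimately show "is_join C X \<S> V"
    unfolding is_join_def using S V le sub_le_img[OF V] by auto
qed

lemma sub_pullback_img:
  assumes f: "f \<in> Arr C" and S: "S \<in> Sub C (Cod C f)"
  shows "sub_pullback C f S \<in> Sub C (Dom C f)" "sub_img (sub_pullback C f S) = {x \<in> topspace (fst f). fn f x \<in> sub_img S}"
proof -
  obtain m where m: "is_mono C m" "Cod C m = Cod C f" "S = subobject_of C m"
    using S unfolding Sub_def monos_into_def by auto
  have mA: "m \<in> Arr C" using m by auto
  obtain m' q' where pb: "is_pullback C f m m' q'" by (rule pullback_ex[OF f mA]) (use m in auto)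
  have m': "is_mono C m'" by (rule pullback_mono[OF pb m(1)])
  note eq = sub_pullback_eq[OF m(1) pb]
  show "sub_pullback C f S \<in> Sub C (Dom C f)"
    unfolding m(3) eq using subobject_of_Sub[OF m'] pullback_square[OF pb] by simp
  show "sub_img (sub_pullback C f S) = {x \<in> topspace (fst f). fn f x \<in> sub_img S}"
    unfolding m(3) eq sub_img_subobject[OF m'] sub_img_subobject[OF m(1)] by (rule pullback_img[OF pb])
qed

text \<open>Pullback stability of joins holds because preimages commute with unions.\<close>

lemma coherent: "coherent_category C"
  unfolding coherent_category_def
proof (intro conjI ballI allI impI)
  show "regular_category C" by (rule regular)
  show "\<exists>V. is_join C X \<S> V" if X: "X \<in> Obj C" and S: "finite \<S> \<and> \<S> \<subseteq> Sub C X" for X \<S>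
  proof -
    let ?U = "\<Union>S\<in>\<S>. sub_img S"
    have cl: "closedin X ?U" using S sub_img_closed by (intro closedin_Union) auto
    have X': "X \<in> \<X>" using X by simp
    note i = incl[OF X' cl]
    have "subobject_of C (incl X ?U) \<in> Sub C X" "sub_img (subobject_of C (incl X ?U)) = ?U"
      using subobject_of_Sub[OF i(2)] sub_img_subobject[OF i(2)] i by simp_all
    then show ?thesis using is_join_iff[OF X'] S by blast
  qed
  fix f \<S> V assume f: "f \<in> Arr C" and *: "finite \<S> \<and> is_join C (Cod C f) \<S> V"
  have S: "finite \<S>" "\<S> \<subseteq> Sub C (Cod C f)" "V \<in> Sub C (Cod C f)" and j: "is_join C (Cod C f) \<S> V"
    using * unfolding is_join_def by auto
  have X: "Dom C f \<in> \<X>" "Cod C f \<in> \<X>" using ArrD[OF f] by auto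
  have "sub_img V = (\<Union>S\<in>\<S>. sub_img S)" using is_join_iff[OF X(2) S] j by simp
  then have "sub_img (sub_pullback C f V) = (\<Union>S\<in>\<S>. {x \<in> topspace (fst f). fn f x \<in> sub_img S})"
    unfolding sub_pullback_img(2)[OF f S(3)] by auto
  also have "\<dots> = (\<Union>S\<in>\<S>. sub_img (sub_pullback C f S))"
    using S(2) by (intro SUP_cong refl sub_pullback_img(2)[OF f, symmetric]) blast
  finally have "sub_img (sub_pullback C f V) = (\<Union>S\<in>sub_pullback C f ` \<S>. sub_img S)" by simp
  then show "is_join C (Dom C f) (sub_pullback C f ` \<S>) (sub_pullback C f V)"
    using is_join_iff[OF X(1), of "sub_pullback C f ` \<S>" "sub_pullback C f V"] S sub_pullback_img[OF f] by auto
qed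

end

text \<open>Further closure properties, to be instantiated with all small compact Hausdorff spaces;
  quotients by closed equivalence relations lead out of the Stone spaces.\<close>

locale ch_pretopos = ch_spaces +
  assumes sums: "\<lbrakk>finite (I :: nat set); \<And>i. i \<in> I \<Longrightarrow> X i \<in> \<X>\<rbrakk> \<Longrightarrow> \<exists>Z\<in>\<X>. sum_topology X I homeomorphic_space Z"
    and quotients: "\<lbrakk>Y \<in> \<X>; closedin (prod_topology Y Y) R; equiv (topspace Y) R\<rbrakk>
      \<Longrightarrow> \<exists>Z\<in>\<X>. \<exists>q. continuous_map Y Z q \<and> q ` topspace Y = topspace Z \<and>
            (\<forall>x\<in>topspace Y. \<forall>y\<in>topspace Y. q x = q y \<longleftrightarrow> (x, y) \<in> R)"
begin

text \<open>The images are closed, finitely many, and partition \<open>S\<close>. The glued map is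
  continuous because the preimage of a closed set is a finite union of images under the closed maps
  \<open>\<iota> i\<close>.\<close>

lemma coproductI:
  assumes I: "finite (I :: nat set)" and S: "S \<in> \<X>"
    and \<iota>: "\<And>i. i \<in> I \<Longrightarrow> \<iota> i \<in> Arr C" "\<And>i. i \<in> I \<Longrightarrow> fst (\<iota> i) = A i" "\<And>i. i \<in> I \<Longrightarrow> snd (snd (\<iota> i)) = S"
    and inj: "\<And>i. i \<in> I \<Longrightarrow> inj_on (fn (\<iota> i)) (topspace (A i))"
    and disj: "\<And>i j. \<lbrakk>i \<in> I; j \<in> I; i \<noteq> j\<rbrakk> \<Longrightarrow> img (\<iota> i) \<inter> img (\<iota> j) = {}"
    and cover: "topspace S \<subseteq> (\<Union>i\<in>I. img (\<iota> i))"
  shows "is_coproduct C I A S \<iota>"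
  unfolding is_coproduct_def
proof (intro conjI ballI allI impI)
  show "S \<in> Obj C" using S by simp
  show "in_hom C (\<iota> i) (A i) S" if "i \<in> I" for i using \<iota>[OF that] by simp
  fix Y q assume Y: "Y \<in> Obj C" and q0: "\<forall>i\<in>I. in_hom C (q i) (A i) Y"
  have q: "q i \<in> Arr C" "fst (q i) = A i" "snd (snd (q i)) = Y" if "i \<in> I" for i using q0 that by auto
  have fib: "\<exists>i\<in>I. \<exists>x\<in>topspace (A i). fn (\<iota> i) x = s" if "s \<in> topspace S" for s
    using cover that \<iota>(2) unfolding img_def by fastforce
  have uniq: "i = j \<and> x = y" if "i \<in> I" "j \<in> I" "x \<in> topspace (A i)" "y \<in> topspace (A j)" "fn (\<iota> i) x = fn (\<iota> j) y" for i j x y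
  proof -
    have "fn (\<iota> j) y \<in> img (\<iota> j)" using that(2,4) \<iota>(2) unfolding img_def by simp
    moreover have "fn (\<iota> i) x \<in> img (\<iota> i)" using that(1,3) \<iota>(2)[OF that(1)] unfolding img_def by simp
    then have "fn (\<iota> j) y \<in> img (\<iota> i)" using that(5) by (rule back_subst[of "\<lambda>z. z \<in> img (\<iota> i)"])
    ultimately have "i = j" using disj[OF that(1,2)] by blast
    then show ?thesis using inj[OF that(1)] that by (auto dest: inj_onD)
  qed
  have img_in: "fn (\<iota> i) x \<in> topspace S" if "i \<in> I" "x \<in> topspace (A i)" for i x
    using fn_in[OF \<iota>(1)[OF that(1)], of x] \<iota>(2,3)[OF that(1)] that by simp
  show "\<exists>!u. in_hom C u S Y \<and> (\<forall>i\<in>I. u \<cdot>\<^sub>C \<iota> i = q i)"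
  proof (rule ex_ex1I)
    define h where "h s = (SOME y. \<exists>i\<in>I. \<exists>x\<in>topspace (A i). fn (\<iota> i) x = s \<and> y = fn (q i) x)" for s
    have h: "h (fn (\<iota> i) x) = fn (q i) x" if i: "i \<in> I" "x \<in> topspace (A i)" for i x
      unfolding h_def
    proof (rule some_equality)
      show "\<exists>j\<in>I. \<exists>y\<in>topspace (A j). fn (\<iota> j) y = fn (\<iota> i) x \<and> fn (q i) x = fn (q j) y" using i by blast
      fix z assume "\<exists>j\<in>I. \<exists>y\<in>topspace (A j). fn (\<iota> j) y = fn (\<iota> i) x \<and> z = fn (q j) y"
      then obtain j y where "j \<in> I" "y \<in> topspace (A j)" "fn (\<iota> j) y = fn (\<iota> i) x" "z = fn (q j) y" by blast
      then show "z = fn (q i) x" using uniq[of j i y x] i by simp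
    qed
    have hc: "continuous_map S Y h"
      unfolding continuous_map_closedin
    proof (intro conjI allI impI)
      show "h \<in> topspace S \<rightarrow> topspace Y"
      proof
        fix s assume "s \<in> topspace S"
        then obtain i x where "i \<in> I" "x \<in> topspace (A i)" "fn (\<iota> i) x = s" using fib by blast
        then show "h s \<in> topspace Y" using h[of i x] fn_in[OF q(1), of i x] q(2,3) by simp
      qed
      fix K assume K: "closedin Y K"
      have "{s \<in> topspace S. h s \<in> K} = (\<Union>i\<in>I. fn (\<iota> i) ` {x \<in> topspace (A i). fn (q i) x \<in> K})"
      proof (intro set_eqI iffI)
        fix s assume s: "s \<in> {s \<in> topspace S. h s \<in> K}"
        then obtain i x where "i \<in> I" "x \<in> topspace (A i)" "fn (\<iota> i) x = s" using fib by blast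
        then show "s \<in> (\<Union>i\<in>I. fn (\<iota> i) ` {x \<in> topspace (A i). fn (q i) x \<in> K})" using s h[of i x] by auto
      next
        fix s assume "s \<in> (\<Union>i\<in>I. fn (\<iota> i) ` {x \<in> topspace (A i). fn (q i) x \<in> K})"
        then obtain i x where "i \<in> I" "x \<in> topspace (A i)" "fn (\<iota> i) x = s" "fn (q i) x \<in> K" by blast
        then show "s \<in> {s \<in> topspace S. h s \<in> K}" using h[of i x] img_in[of i x] by simp
      qed
      moreover have "closedin S (fn (\<iota> i) ` {x \<in> topspace (A i). fn (q i) x \<in> K})" if i: "i \<in> I" for i
      proof -
        have "closedin (A i) {x \<in> topspace (A i). fn (q i) x \<in> K}"
          using ArrD(6)[OF q(1)[OF i]] q(2,3)[OF i] K unfolding continuous_map_closedin by simp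
        moreover have "closed_map (A i) S (fn (\<iota> i))"
          using continuous_imp_closed_map[OF ArrD(6)[OF \<iota>(1)[OF i]] ArrD(3,4)[OF \<iota>(1)[OF i]]] \<iota>(2,3)[OF i] by simp
        ultimately show ?thesis unfolding closed_map_def by blast
      qed
      ultimately show "closedin S {s \<in> topspace S. h s \<in> K}" using I by (auto intro!: closedin_Union)
    qed
    let ?u = "top_arrow S h Y"
    have u: "?u \<in> Arr C" using S Y hc by simp
    have "?u \<cdot>\<^sub>C \<iota> i = q i" if i: "i \<in> I" for i
    proof (rule arr_eq[OF _ q(1)[OF i]])
      show "?u \<cdot>\<^sub>C \<iota> i \<in> Arr C" by (rule Comp_Arr[OF \<iota>(1)[OF i] u]) (use \<iota>(3)[OF i] in simp)
    qed (use \<iota>(2,3)[OF i] q(2,3)[OF i] h[OF i] img_in[OF i] in simp_all)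
    then show "\<exists>u. in_hom C u S Y \<and> (\<forall>i\<in>I. u \<cdot>\<^sub>C \<iota> i = q i)" using u by (intro exI[of _ ?u]) simp
    fix u v assume u: "in_hom C u S Y \<and> (\<forall>i\<in>I. u \<cdot>\<^sub>C \<iota> i = q i)" and v: "in_hom C v S Y \<and> (\<forall>i\<in>I. v \<cdot>\<^sub>C \<iota> i = q i)"
    have "fn u s = fn v s" if s: "s \<in> topspace S" for s
    proof -
      obtain i x where ix: "i \<in> I" "x \<in> topspace (A i)" "fn (\<iota> i) x = s" using fib[OF s] by blast
      have "fn (u \<cdot>\<^sub>C \<iota> i) x = fn (v \<cdot>\<^sub>C \<iota> i) x" using u v ix(1) by simp
      then show ?thesis using ix \<iota>(2)[OF ix(1)] by simp
    qed
    then show "u = v" by - (rule arr_eq, use u v in auto)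
  qed
qed

lemma concrete_coproduct:
  assumes I: "finite (I :: nat set)" and A: "\<And>i. i \<in> I \<Longrightarrow> A i \<in> \<X>"
  obtains S \<iota> where "is_coproduct C I A S \<iota>"
    "\<forall>i\<in>I. inj_on (fn (\<iota> i)) (topspace (A i))"
    "\<forall>i\<in>I. \<forall>j\<in>I. i \<noteq> j \<longrightarrow> img (\<iota> i) \<inter> img (\<iota> j) = {}"
    "topspace S \<subseteq> (\<Union>i\<in>I. img (\<iota> i))"
proof -
  obtain Z where Z: "Z \<in> \<X>" "sum_topology A I homeomorphic_space Z" using sums[where I=I and X=A, OF I A] by blast
  then obtain j k where jk: "homeomorphic_maps (sum_topology A I) Z j k" unfolding homeomorphic_space_def by blast
  have jc: "continuous_map (sum_topology A I) Z j" and kc: "continuous_map Z (sum_topology A I) k"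
    and kj: "\<And>x. x \<in> topspace (sum_topology A I) \<Longrightarrow> k (j x) = x" and jk': "\<And>z. z \<in> topspace Z \<Longrightarrow> j (k z) = z"
    using jk unfolding homeomorphic_maps_def by auto
  define \<iota> where "\<iota> i = top_arrow (A i) (\<lambda>x. j (i, x)) Z" for i
  have \<iota>: "\<iota> i \<in> Arr C" if "i \<in> I" for i
  proof -
    have "continuous_map (A i) Z (j \<circ> (\<lambda>x. (i, x)))"
      by (rule continuous_map_compose[OF continuous_map_component_injection[OF that] jc])
    then show ?thesis unfolding \<iota>_def using A[OF that] Z(1) by (simp add: o_def)
  qed
  have val: "fn (\<iota> i) x = j (i, x)" if "x \<in> topspace (A i)" for i x using that by (simp add: \<iota>_def)
  have jinj: "i = i' \<and> x = x'" if "i \<in> I" "x \<in> topspace (A i)" "i' \<in> I" "x' \<in> topspace (A i')" "j (i, x) = j (i', x')" for i x i' x'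
  proof -
    have "k (j (i, x)) = (i, x)" "k (j (i', x')) = (i', x')" using kj that(1-4) by simp_all
    then show ?thesis using that(5) by (metis Pair_inject)
  qed
  have img\<iota>: "img (\<iota> i) = (\<lambda>x. j (i, x)) ` topspace (A i)" for i
    unfolding img_def \<iota>_def by (rule image_cong) simp_all
  have inj: "inj_on (fn (\<iota> i)) (topspace (A i))" if "i \<in> I" for i
    using jinj[of i _ i] that val by (auto intro!: inj_onI)
  have disj: "img (\<iota> i) \<inter> img (\<iota> j') = {}" if "i \<in> I" "j' \<in> I" "i \<noteq> j'" for i j'
    using jinj[of i _ j'] that unfolding img\<iota> by blast
  have cover: "topspace Z \<subseteq> (\<Union>i\<in>I. img (\<iota> i))"
  proof
    fix z assume z: "z \<in> topspace Z"
    have "k z \<in> topspace (sum_topology A I)" using kc z continuous_map_image_subset_topspace by blast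
    then obtain i x where "k z = (i, x)" "i \<in> I" "x \<in> topspace (A i)" by auto
    then show "z \<in> (\<Union>i\<in>I. img (\<iota> i))" using jk'[OF z] unfolding img\<iota> by (auto simp: image_iff intro!: bexI[of _ i])
  qed
  have "is_coproduct C I A Z \<iota>"
    by (rule coproductI[OF I Z(1)]) (use \<iota> inj disj cover in \<open>simp_all add: \<iota>_def\<close>)
  then show ?thesis using inj disj cover by (intro that) auto
qed

text \<open>The arrows to and from the concrete coproduct commute with the injections, so
  injectivity, disjointness and covering carry over to an arbitrary one.\<close>

lemma coproduct_points:
  assumes I: "finite (I :: nat set)" and co: "is_coproduct C I A S \<iota>"
  shows "\<And>i. i \<in> I \<Longrightarrow> inj_on (fn (\<iota> i)) (topspace (A i))"
    "\<And>i j. \<lbrakk>i \<in> I; j \<in> I; i \<noteq> j\<rbrakk> \<Longrightarrow> img (\<iota> i) \<inter> img (\<iota> j) = {}"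
    "topspace S = (\<Union>i\<in>I. img (\<iota> i))"
proof -
  note c = coproduct_cocone[OF co]
  have A: "A i \<in> \<X>" if "i \<in> I" for i using ArrD(1)[OF c(2)[OF that]] c(3)[OF that] by simp
  obtain Z \<kappa> where z: "is_coproduct C I A Z \<kappa>"
    "\<forall>i\<in>I. inj_on (fn (\<kappa> i)) (topspace (A i))"
    "\<forall>i\<in>I. \<forall>j\<in>I. i \<noteq> j \<longrightarrow> img (\<kappa> i) \<inter> img (\<kappa> j) = {}"
    "topspace Z \<subseteq> (\<Union>i\<in>I. img (\<kappa> i))" by (rule concrete_coproduct[OF I A])
  note d = coproduct_cocone[OF z(1)]
  obtain u where u: "u \<in> Arr C" "Dom C u = S" "Cod C u = Z" "\<And>i. i \<in> I \<Longrightarrow> u \<cdot>\<^sub>C \<iota> i = \<kappa> i"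
    by (rule coproduct_lift[OF co d(1), of \<kappa>]) (use d in auto)
  obtain v where v: "v \<in> Arr C" "Dom C v = Z" "Cod C v = S" "\<And>i. i \<in> I \<Longrightarrow> v \<cdot>\<^sub>C \<kappa> i = \<iota> i"
    by (rule coproduct_lift[OF z(1) c(1), of \<iota>]) (use c in auto)
  have vu: "v \<cdot>\<^sub>C u = Ident C S"
  proof (rule coproduct_unique[OF co])
    show "(v \<cdot>\<^sub>C u) \<cdot>\<^sub>C \<iota> i = Ident C S \<cdot>\<^sub>C \<iota> i" if i: "i \<in> I" for i
      using reassoc[of v u "v \<cdot>\<^sub>C u" "\<iota> i"] u(1-3) u(4)[OF i] v(1-3) v(4)[OF i] c(1) c(2-4)[OF i] Comp_assoc[of "\<iota> i" u v]
        Comp_Ident_left[of "\<iota> i" S] by metis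
  qed (use u v c in auto)
  have u\<iota>: "fn u (fn (\<iota> i) x) = fn (\<kappa> i) x" if "i \<in> I" "x \<in> topspace (A i)" for i x
    using u(4)[OF that(1)] that(2) c(3)[OF that(1)] top_category_Comp_simps(3)[of x "\<iota> i" \<X> u] by simp
  have v\<kappa>: "fn v (fn (\<kappa> i) x) = fn (\<iota> i) x" if "i \<in> I" "x \<in> topspace (A i)" for i x
    using v(4)[OF that(1)] that(2) d(3)[OF that(1)] top_category_Comp_simps(3)[of x "\<kappa> i" \<X> v] by simp
  have vus: "fn v (fn u s) = s" if "s \<in> topspace S" for s
  proof -
    have "fn (v \<cdot>\<^sub>C u) s = fn v (fn u s)" using that u(2) by simp
    then show ?thesis using vu that by simp
  qed
  have img\<iota>: "img (\<iota> i) = fn (\<iota> i) ` topspace (A i)" "img (\<kappa> i) = fn (\<kappa> i) ` topspace (A i)" if "i \<in> I" for i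
    using c(3)[OF that] d(3)[OF that] unfolding img_def by simp_all
  show "inj_on (fn (\<iota> i)) (topspace (A i))" if i: "i \<in> I" for i
  proof (rule inj_onI)
    fix x y assume xy: "x \<in> topspace (A i)" "y \<in> topspace (A i)" "fn (\<iota> i) x = fn (\<iota> i) y"
    then have "fn (\<kappa> i) x = fn (\<kappa> i) y" using u\<iota>[OF i] by metis
    then show "x = y" using z(2) i xy by (auto dest: inj_onD)
  qed
  show "img (\<iota> i) \<inter> img (\<iota> j) = {}" if ij: "i \<in> I" "j \<in> I" "i \<noteq> j" for i j
  proof -
    have False if "x \<in> topspace (A i)" "y \<in> topspace (A j)" "fn (\<iota> i) x = fn (\<iota> j) y" for x y
    proof -
      have "fn (\<kappa> i) x = fn (\<kappa> j) y" using u\<iota>[OF ij(1) that(1)] u\<iota>[OF ij(2) that(2)] that(3) by simp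
      then show False using z(3) ij that(1,2) img\<iota>(2)[OF ij(1)] img\<iota>(2)[OF ij(2)] by blast
    qed
    then show ?thesis unfolding img\<iota>(1)[OF ij(1)] img\<iota>(1)[OF ij(2)] by blast
  qed
  show "topspace S = (\<Union>i\<in>I. img (\<iota> i))"
  proof
    show "topspace S \<subseteq> (\<Union>i\<in>I. img (\<iota> i))"
    proof
      fix s assume s: "s \<in> topspace S"
      have "fn u s \<in> topspace Z" using fn_in[OF u(1), of s] u(2,3) s by simp
      then obtain i x where ix: "i \<in> I" "x \<in> topspace (A i)" "fn u s = fn (\<kappa> i) x" using z(4) img\<iota>(2) by blast
      then have "s = fn (\<iota> i) x" using vus[OF s] v\<kappa>[OF ix(1,2)] by simp
      then show "s \<in> (\<Union>i\<in>I. img (\<iota> i))" using ix img\<iota>(1)[OF ix(1)] by blast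
    qed
    show "(\<Union>i\<in>I. img (\<iota> i)) \<subseteq> topspace S" using img_subset c(2,4) by fastforce
  qed
qed

sublocale sumcat C
proof unfold_locales
  show "has_finite_coproducts C" unfolding has_finite_coproducts_def
  proof (intro allI impI)
    fix I :: "nat set" and A assume "finite I \<and> (\<forall>i\<in>I. A i \<in> Obj C)"
    then have I: "finite I" and A: "\<And>i. i \<in> I \<Longrightarrow> A i \<in> \<X>" by auto
    obtain S \<iota> where "is_coproduct C I A S \<iota>" by (rule concrete_coproduct[OF I A])
    then show "\<exists>S \<iota>. is_coproduct C I A S \<iota>" by blast
  qed
qed

lemma sum_points:
  assumes "X \<in> \<X>" "Y \<in> \<X>"
  shows "inj_on (fn (sum_inj C X Y 0)) (topspace X)" "inj_on (fn (sum_inj C X Y (Suc 0))) (topspace Y)"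
    "img (sum_inj C X Y 0) \<inter> img (sum_inj C X Y (Suc 0)) = {}"
    "topspace (sum_obj C X Y) = img (sum_inj C X Y 0) \<union> img (sum_inj C X Y (Suc 0))"
proof -
  have co: "is_coproduct C {0, 1} (\<lambda>i. if i = 0 then X else Y) (sum_obj C X Y) (sum_inj C X Y)"
    by (rule sum_coproduct) (use assms in auto)
  have fin: "finite {0, 1::nat}" by simp
  note p = coproduct_points[OF fin co]
  show "inj_on (fn (sum_inj C X Y 0)) (topspace X)" "inj_on (fn (sum_inj C X Y (Suc 0))) (topspace Y)"
    using p(1)[of 0] p(1)[of 1] by simp_all
  show "img (sum_inj C X Y 0) \<inter> img (sum_inj C X Y (Suc 0)) = {}" using p(2)[of 0 1] by simp
  show "topspace (sum_obj C X Y) = img (sum_inj C X Y 0) \<union> img (sum_inj C X Y (Suc 0))" using p(3) by simp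
qed

text \<open>All conditions of \<open>extensiveI\<close> are checked on points: each point of a sum
  lies in exactly one summand.\<close>

lemma extensive: "extensive_category C"
proof (rule extensiveI[OF pullbacks])
  fix A B assume "A \<in> Obj C" "B \<in> Obj C"
  then have AB: "A \<in> \<X>" "B \<in> \<X>" "A \<in> Obj C" "B \<in> Obj C" by auto
  show "is_mono C (sum_inj C A B 0)" "is_mono C (sum_inj C A B (Suc 0))"
    using mono_iff[OF sum_inj_simps(1)[OF AB(3,4)]] mono_iff[OF sum_inj_simps(2)[OF AB(3,4)]]
      sum_points(1,2)[OF AB(1,2)] sum_inj_simps(3,4)[OF AB(3,4)] by simp_all
next
  fix f g assume f: "f \<in> Arr C" and g: "g \<in> Arr C"
  define A B X Y where "A = fst f" and "B = fst g" and "X = snd (snd f)" and "Y = snd (snd g)"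
  have ob: "A \<in> \<X>" "B \<in> \<X>" "X \<in> \<X>" "Y \<in> \<X>" using ArrD[OF f] ArrD[OF g] by (auto simp: A_def B_def X_def Y_def)
  then have ob': "A \<in> Obj C" "B \<in> Obj C" "X \<in> Obj C" "Y \<in> Obj C" by auto
  have eq: "Dom C f = A" "Cod C f = X" "Dom C g = B" "Cod C g = Y" by (auto simp: A_def B_def X_def Y_def)
  let ?a = "sum_inj C A B" and ?x = "sum_inj C X Y" and ?m = "sum_map C f g"
  note sa = sum_inj_simps[OF ob'(1,2)] and sx = sum_inj_simps[OF ob'(3,4)] and sm = sum_map_simps[OF f g]
  note pa = sum_points[OF ob(1,2)] and px = sum_points[OF ob(3,4)]
  have com: "?m \<cdot>\<^sub>C ?a 0 = ?x 0 \<cdot>\<^sub>C f" "?m \<cdot>\<^sub>C ?a (Suc 0) = ?x (Suc 0) \<cdot>\<^sub>C g"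
    by (rule sum_map_inj[OF f g]; use eq in simp)+
  have m0: "fn ?m (fn (?a 0) x) = fn (?x 0) (fn f x)" if "x \<in> topspace A" for x
    by (rule square_fn[OF com(1)]) (use that sa eq in auto)
  have m1: "fn ?m (fn (?a (Suc 0)) x) = fn (?x (Suc 0)) (fn g x)" if "x \<in> topspace B" for x
    by (rule square_fn[OF com(2)]) (use that sa eq in auto)
  have fx: "fn f x \<in> topspace X" if "x \<in> topspace A" for x using fn_in[OF f, of x] that eq by simp
  have gx: "fn g x \<in> topspace Y" if "x \<in> topspace B" for x using fn_in[OF g, of x] that eq by simp
  have im: "img (?a 0) = fn (?a 0) ` topspace A" "img (?a (Suc 0)) = fn (?a (Suc 0)) ` topspace B"
    "img (?x 0) = fn (?x 0) ` topspace X" "img (?x (Suc 0)) = fn (?x (Suc 0)) ` topspace Y"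
    using sa(3,4) sx(3,4) unfolding img_def by simp_all
  have "is_pullback C ?m (?x 0) (?a 0) f"
  proof (rule pullbackI)
    show "\<exists>z\<in>topspace (fst (?a 0)). fn (?a 0) z = x \<and> fn f z = y"
      if x: "x \<in> topspace (fst ?m)" "y \<in> topspace (fst (?x 0))" "fn ?m x = fn (?x 0) y" for x y
    proof -
      have x': "x \<in> img (?a 0) \<union> img (?a (Suc 0))" using x(1) sm(2) pa(4) eq by simp
      have y: "y \<in> topspace X" using x(2) sx(3) by simp
      have "x \<notin> img (?a (Suc 0))"
      proof
        assume "x \<in> img (?a (Suc 0))"
        then obtain b where b: "b \<in> topspace B" "x = fn (?a (Suc 0)) b" unfolding im by blast
        then have "fn (?x 0) y = fn (?x (Suc 0)) (fn g b)" using m1 x(3) by simp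
        then show False using px(3) y gx[OF b(1)] unfolding im by blast
      qed
      then obtain a where a: "a \<in> topspace A" "x = fn (?a 0) a" using x' unfolding im by blast
      then have "fn (?x 0) (fn f a) = fn (?x 0) y" using m0 x(3) by simp
      then have "fn f a = y" using px(1) fx[OF a(1)] y by (auto dest: inj_onD)
      then show ?thesis using a sa(3) by auto
    qed
    show "z = w" if "z \<in> topspace (fst (?a 0))" "w \<in> topspace (fst (?a 0))" "fn (?a 0) z = fn (?a 0) w" for z w
      using pa(1) that sa(3) by (auto dest: inj_onD)
    show "fn ?m (fn (?a 0) z) = fn (?x 0) (fn f z)" if "z \<in> topspace (fst (?a 0))" for z
      using m0[of z] that sa(3) by simp
  qed (use sa sx sm f eq in auto)
  moreover have "is_pullback C ?m (?x (Suc 0)) (?a (Suc 0)) g"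
  proof (rule pullbackI)
    show "\<exists>z\<in>topspace (fst (?a (Suc 0))). fn (?a (Suc 0)) z = x \<and> fn g z = y"
      if x: "x \<in> topspace (fst ?m)" "y \<in> topspace (fst (?x (Suc 0)))" "fn ?m x = fn (?x (Suc 0)) y" for x y
    proof -
      have x': "x \<in> img (?a 0) \<union> img (?a (Suc 0))" using x(1) sm(2) pa(4) eq by simp
      have y: "y \<in> topspace Y" using x(2) sx(4) by simp
      have "x \<notin> img (?a 0)"
      proof
        assume "x \<in> img (?a 0)"
        then obtain b where b: "b \<in> topspace A" "x = fn (?a 0) b" unfolding im by blast
        then have "fn (?x 0) (fn f b) = fn (?x (Suc 0)) y" using m0 x(3) by simp
        then show False using px(3) y fx[OF b(1)] unfolding im by blast
      qed
      then obtain a where a: "a \<in> topspace B" "x = fn (?a (Suc 0)) a" using x' unfolding im by blast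
      then have "fn (?x (Suc 0)) (fn g a) = fn (?x (Suc 0)) y" using m1 x(3) by simp
      then have "fn g a = y" using px(2) gx[OF a(1)] y by (auto dest: inj_onD)
      then show ?thesis using a sa(4) by auto
    qed
    show "z = w" if "z \<in> topspace (fst (?a (Suc 0)))" "w \<in> topspace (fst (?a (Suc 0)))" "fn (?a (Suc 0)) z = fn (?a (Suc 0)) w" for z w
      using pa(2) that sa(4) by (auto dest: inj_onD)
    show "fn ?m (fn (?a (Suc 0)) z) = fn (?x (Suc 0)) (fn g z)" if "z \<in> topspace (fst (?a (Suc 0)))" for z
      using m1[of z] that sa(4) by simp
  qed (use sa sx sm g eq in auto)
  ultimately show "is_pullback C ?m (sum_inj C (Cod C f) (Cod C g) 0) (sum_inj C (Dom C f) (Dom C g) 0) f \<and>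
    is_pullback C ?m (sum_inj C (Cod C f) (Cod C g) (Suc 0)) (sum_inj C (Dom C f) (Dom C g) (Suc 0)) g"
    using eq by simp
next
  fix X Y h a p b q assume XY: "X \<in> Obj C" "Y \<in> Obj C"
    and pa: "is_pullback C h (sum_inj C X Y 0) a p" and pb: "is_pullback C h (sum_inj C X Y (Suc 0)) b q"
  have XY': "X \<in> \<X>" "Y \<in> \<X>" using XY by auto
  note sa = pullback_square[OF pa] and sb = pullback_square[OF pb] and s = sum_points[OF XY'] and si = sum_inj_simps[OF XY]
  note ia = pullback_img[OF pa] and ib = pullback_img[OF pb]
  have "is_mono C a" "is_mono C b"
    using pullback_mono[OF pa] pullback_mono[OF pb] mono_iff[OF si(1)] mono_iff[OF si(2)] s(1,2) si(3,4) by simp_all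
  then have inj: "inj_on (fn a) (topspace (fst a))" "inj_on (fn b) (topspace (fst b))"
    using mono_iff[OF sa(3)] mono_iff[OF sb(3)] by auto
  have disj: "img a \<inter> img b = {}" unfolding ia ib using s(3) by auto
  have "fn h x \<in> topspace (sum_obj C X Y)" if "x \<in> topspace (fst h)" for x
    using fn_in[OF sa(1) that] sa(5) si(5) by simp
  then have cover: "topspace (fst h) \<subseteq> img a \<union> img b" unfolding ia ib using s(4) by auto
  show "is_coproduct C {0, 1} (\<lambda>i. if i = 0 then Dom C a else Dom C b) (Dom C h) (\<lambda>i::nat. if i = 0 then a else b)"
    by (rule coproductI) (use ArrD(1)[OF sa(1)] sa sb inj disj cover in auto)
qed

text \<open>On points the relation is an equivalence relation \<open>R\<close>, closed because its
  source is compact. The pair \<open>r\<close>, \<open>s\<close> is injective with image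
  \<open>R\<close>, so it is the kernel pair of the quotient map, and this cover is the coequalizer
  of its kernel pair.\<close>

lemma exact: "exact_category C"
  unfolding exact_category_def
proof (intro conjI allI impI)
  show "regular_category C" by (rule regular)
  fix r s assume er: "internal_equivalence_relation C r s"
  have rs: "r \<in> Arr C" "s \<in> Arr C" "Dom C r = Dom C s" "Cod C r = Cod C s"
    and jm: "jointly_monic C r s"
    and refl: "\<exists>d. in_hom C d (Cod C r) (Dom C r) \<and> r \<cdot>\<^sub>C d = Ident C (Cod C r) \<and> s \<cdot>\<^sub>C d = Ident C (Cod C r)"
    and sym: "\<exists>t. in_hom C t (Dom C r) (Dom C r) \<and> r \<cdot>\<^sub>C t = s \<and> s \<cdot>\<^sub>C t = r"
    and trans: "\<And>p q. is_pullback C s r p q \<Longrightarrow> \<exists>t. in_hom C t (Dom C p) (Dom C r) \<and> r \<cdot>\<^sub>C t = r \<cdot>\<^sub>C p \<and> s \<cdot>\<^sub>C t = s \<cdot>\<^sub>C q"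
    using er unfolding internal_equivalence_relation_def jointly_monic_def by blast+
  define X Z where "X = snd (snd r)" and "Z = fst r"
  have XZ: "X \<in> \<X>" "Z \<in> \<X>" "fst s = Z" "snd (snd s) = X" "fst r = Z" "snd (snd r) = X"
    using ArrD[OF rs(1)] rs by (auto simp: X_def Z_def)
  define R where "R = (\<lambda>z. (fn r z, fn s z)) ` topspace Z"
  have cont: "continuous_map Z (prod_topology X X) (\<lambda>z. (fn r z, fn s z))"
    using ArrD(6)[OF rs(1)] ArrD(6)[OF rs(2)] XZ by (simp add: continuous_map_paired)
  have "compactin (prod_topology X X) R" unfolding R_def
    by (rule image_compactin[OF _ cont]) (use compact[OF XZ(2)] in \<open>simp add: compact_space_def\<close>)
  then have closed: "closedin (prod_topology X X) R"
    by (rule compactin_imp_closedin[rotated]) (use Hausdorff[OF XZ(1)] in \<open>simp add: Hausdorff_space_prod_topology\<close>)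
  have rs_in: "fn r z \<in> topspace X" "fn s z \<in> topspace X" if "z \<in> topspace Z" for z
    using fn_in[OF rs(1), of z] fn_in[OF rs(2), of z] that XZ by simp_all
  have "equiv (topspace X) R"
  proof (rule equivI)
    show "R \<subseteq> topspace X \<times> topspace X" using rs_in by (auto simp: R_def)
    show "refl_on (topspace X) R"
    proof (rule refl_onI)
      fix x assume x: "x \<in> topspace X"
      obtain d where d: "in_hom C d (Cod C r) (Dom C r)" "r \<cdot>\<^sub>C d = Ident C (Cod C r)" "s \<cdot>\<^sub>C d = Ident C (Cod C r)" using refl by blast
      have dx: "fn d x \<in> topspace Z" using fn_in[of d \<X> x] d(1) x XZ by simp
      have "fn r (fn d x) = fn (r \<cdot>\<^sub>C d) x" "fn s (fn d x) = fn (s \<cdot>\<^sub>C d) x" using d(1) x XZ by simp_all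
      then have "fn r (fn d x) = x" "fn s (fn d x) = x" using d(2,3) x XZ by simp_all
      then show "(x, x) \<in> R" unfolding R_def using dx by (intro image_eqI[of _ _ "fn d x"]) simp_all
    qed
    show "sym R"
    proof (rule symI)
      fix x y assume "(x, y) \<in> R"
      then obtain z where z: "z \<in> topspace Z" "x = fn r z" "y = fn s z" by (auto simp: R_def)
      obtain t where t: "in_hom C t (Dom C r) (Dom C r)" "r \<cdot>\<^sub>C t = s" "s \<cdot>\<^sub>C t = r" using sym by blast
      have tz: "fn t z \<in> topspace Z" using fn_in[of t \<X> z] t(1) z XZ by simp
      have "fn r (fn t z) = fn (r \<cdot>\<^sub>C t) z" "fn s (fn t z) = fn (s \<cdot>\<^sub>C t) z" using t(1) z XZ by simp_all
      then have "fn r (fn t z) = y" "fn s (fn t z) = x" using t(2,3) z by simp_all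
      then show "(y, x) \<in> R" unfolding R_def using tz by (intro image_eqI[of _ _ "fn t z"]) simp_all
    qed
    show "trans R"
    proof (rule transI)
      fix x y w assume "(x, y) \<in> R" "(y, w) \<in> R"
      then obtain z z' where z: "z \<in> topspace Z" "x = fn r z" "y = fn s z" "z' \<in> topspace Z" "y = fn r z'" "w = fn s z'"
        by (auto simp: R_def)
      obtain p q where pb: "is_pullback C s r p q" by (rule pullback_ex[OF rs(2,1)]) (use rs in simp)
      note sq = pullback_square[OF pb]
      obtain v where v: "v \<in> topspace (fst p)" "fn p v = z" "fn q v = z'"
        using pullback_points[OF pb, of z z'] z XZ by auto
      obtain t where t: "in_hom C t (Dom C p) (Dom C r)" "r \<cdot>\<^sub>C t = r \<cdot>\<^sub>C p" "s \<cdot>\<^sub>C t = s \<cdot>\<^sub>C q" using trans[OF pb] by blast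
      have tv: "fn t v \<in> topspace Z" using fn_in[of t \<X> v] t(1) v(1) XZ(5) by simp
      have "fn r (fn t v) = x" using square_fn[OF t(2)[symmetric], of v] t(1) v(1,2) z(2) by simp
      moreover have "fn s (fn t v) = w" using square_fn[OF t(3)[symmetric], of v] t(1) v(1,3) z(6) sq(6) by simp
      ultimately show "(x, w) \<in> R" unfolding R_def using tv by (intro image_eqI[of _ _ "fn t v"]) simp_all
    qed
  qed
  then obtain Y q where Y: "Y \<in> \<X>" and q: "continuous_map X Y q" "q ` topspace X = topspace Y"
    "\<forall>x\<in>topspace X. \<forall>y\<in>topspace X. q x = q y \<longleftrightarrow> (x, y) \<in> R" using quotients[OF XZ(1) closed] by blast
  let ?q = "top_arrow X q Y"
  have qA: "?q \<in> Arr C" using XZ Y q by simp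
  have "is_pullback C ?q ?q r s"
  proof (rule pullbackI[OF qA qA rs(1,2)])
    show "fn ?q (fn r z) = fn ?q (fn s z)" if "z \<in> topspace (fst r)" for z
    proof -
      have "(fn r z, fn s z) \<in> R" using that XZ by (auto simp: R_def)
      then show ?thesis using q(3) rs_in[of z] that XZ by simp
    qed
    show "z = w" if z: "z \<in> topspace (fst r)" "w \<in> topspace (fst r)" "fn r z = fn r w" "fn s z = fn s w" for z w
    proof -
      have "const z (fst r) = const w (fst r)"
        by (rule jointly_monicD[OF jm]) (use z XZ comp_const[OF rs(1)] comp_const[OF rs(2)] in simp_all)
      then show ?thesis by (rule const_inj)
    qed
    show "\<exists>z\<in>topspace (fst r). fn r z = x \<and> fn s z = y" if "x \<in> topspace (fst ?q)" "y \<in> topspace (fst ?q)" "fn ?q x = fn ?q y" for x y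
    proof -
      have "(x, y) \<in> R" using that q(3) by simp
      then show ?thesis using XZ by (auto simp: R_def)
    qed
  qed (use XZ in auto)
  moreover have "is_cover C ?q" using cover_iff[OF qA] q(2) by (simp add: img_def)
  ultimately show "effective_relation C r s"
    unfolding effective_relation_def using cover_coequalizer by blast
qed

sublocale pretop C by unfold_locales (rule extensive)

lemma initial_iff: "X \<in> \<X> \<Longrightarrow> is_initial C X \<longleftrightarrow> topspace X = {}"
proof
  assume X: "X \<in> \<X>"
  {
    assume "is_initial C X"
    then have co: "is_coproduct C {} (\<lambda>_::nat. undefined) X (\<lambda>_. undefined)" by (simp add: is_coproduct_empty)
    then show "topspace X = {}" using coproduct_points(3)[OF _ co] by simp
  }
  assume "topspace X = {}"
  then have "is_coproduct C {} (\<lambda>_::nat. undefined) X (\<lambda>_. undefined)" by (intro coproductI) (use X in auto)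
  then show "is_initial C X" by (simp add: is_coproduct_empty)
qed

end

section \<open>Small compact Hausdorff spaces\<close>

text \<open>In a compact space the finite intersections of such a family form a base
  (\<open>separating_base\<close>), so a bound on its cardinality bounds the weight.\<close>

definition separating :: "'b set set \<Rightarrow> 'b topology \<Rightarrow> bool" where
  "separating \<S> X \<longleftrightarrow> (\<forall>V\<in>\<S>. openin X V) \<and>
     (\<forall>x\<in>topspace X. \<forall>y\<in>topspace X. x \<noteq> y \<longrightarrow> (\<exists>V\<in>\<S>. \<exists>W\<in>\<S>. x \<in> V \<and> y \<in> W \<and> disjnt V W))"

text \<open>For compact Hausdorff spaces this is zero-dimensionality
  (\<open>zero_dimensional_iff\<close>), in a form that is inherited along jointly injective
  maps.\<close>

definition clopen_separated :: "'b topology \<Rightarrow> bool" where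
  "clopen_separated X \<longleftrightarrow> (\<forall>x\<in>topspace X. \<forall>y\<in>topspace X. x \<noteq> y \<longrightarrow>
     (\<exists>V. openin X V \<and> closedin X V \<and> x \<in> V \<and> y \<notin> V))"

lemma separating_Hausdorff: "separating \<S> X \<Longrightarrow> Hausdorff_space X"
  unfolding separating_def Hausdorff_space_def by meson

text \<open>The complement of \<open>W\<close> is compact and covered by members that are disjoint
  from some member around \<open>x\<close>. Finitely many of them suffice, and their partners around
  \<open>x\<close> intersect inside \<open>W\<close>.\<close>

lemma separating_base:
  assumes X: "compact_space X" and \<S>: "separating \<S> X" and W: "openin X W" "x \<in> W"
  shows "\<exists>\<F>. finite \<F> \<and> \<F> \<subseteq> \<S> \<and> x \<in> \<Inter>\<F> \<and> topspace X \<inter> \<Inter>\<F> \<subseteq> W"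
proof -
  have x: "x \<in> topspace X" using W openin_subset by blast
  define \<N> where "\<N> = {N\<in>\<S>. \<exists>V\<in>\<S>. x \<in> V \<and> disjnt V N}"
  have op: "openin X N" if "N \<in> \<N>" for N using that \<S> by (auto simp: \<N>_def separating_def)
  have "compactin X (topspace X - W)" using X W by (intro closedin_compact_space) auto
  moreover have "topspace X - W \<subseteq> \<Union>\<N>"
  proof
    fix y assume y: "y \<in> topspace X - W"
    then have "x \<noteq> y" using W by auto
    then obtain V N where "V \<in> \<S>" "N \<in> \<S>" "x \<in> V" "y \<in> N" "disjnt V N"
      using \<S> x y unfolding separating_def by blast
    then show "y \<in> \<Union>\<N>" unfolding \<N>_def by blast
  qed
  ultimately obtain \<F> where \<F>: "finite \<F>" "\<F> \<subseteq> \<N>" "topspace X - W \<subseteq> \<Union>\<F>"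
    using compactinD[of X "topspace X - W" \<N>] op by blast
  have "\<forall>N\<in>\<F>. \<exists>V. V \<in> \<S> \<and> x \<in> V \<and> disjnt V N" using \<F>(2) unfolding \<N>_def by blast
  then obtain v where v: "\<forall>N\<in>\<F>. v N \<in> \<S> \<and> x \<in> v N \<and> disjnt (v N) N" by (rule bchoice[THEN exE])
  have "z \<in> W" if z: "z \<in> topspace X" "\<And>N. N \<in> \<F> \<Longrightarrow> z \<in> v N" for z
  proof (rule ccontr)
    assume "z \<notin> W"
    then obtain N where N: "N \<in> \<F>" "z \<in> N" using z(1) \<F>(3) by blast
    then show False using v z(2)[OF N(1)] by (auto simp: disjnt_iff)
  qed
  then have "topspace X \<inter> \<Inter>(v ` \<F>) \<subseteq> W" by auto
  then show ?thesis using \<F>(1) v by (intro exI[of _ "v ` \<F>"]) auto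
qed

text \<open>Two jointly injective maps serve both a subspace, where they coincide, and a subspace of
  a product, where they are the projections.\<close>

lemma separating_preimage:
  assumes f: "continuous_map X Y f" and g: "continuous_map X Z g"
    and inj: "\<And>x y. \<lbrakk>x \<in> topspace X; y \<in> topspace X; f x = f y; g x = g y\<rbrakk> \<Longrightarrow> x = y"
    and \<S>: "separating \<S> Y" and \<T>: "separating \<T> Z"
  shows "separating ((\<lambda>V. {x \<in> topspace X. f x \<in> V}) ` \<S> \<union> (\<lambda>V. {x \<in> topspace X. g x \<in> V}) ` \<T>) X"
proof -
  let ?p = "\<lambda>V. {x \<in> topspace X. f x \<in> V}" and ?q = "\<lambda>V. {x \<in> topspace X. g x \<in> V}"
  have op: "openin X W" if "W \<in> ?p ` \<S> \<union> ?q ` \<T>" for W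
  proof -
    have "openin X (?p V)" if "V \<in> \<S>" for V
      using that \<S> openin_continuous_map_preimage[OF f, of V] unfolding separating_def by simp
    moreover have "openin X (?q V)" if "V \<in> \<T>" for V
      using that \<T> openin_continuous_map_preimage[OF g, of V] unfolding separating_def by simp
    ultimately show ?thesis using that by (elim UnE imageE) simp_all
  qed
  have sep: "\<exists>V\<in>?p ` \<S> \<union> ?q ` \<T>. \<exists>W\<in>?p ` \<S> \<union> ?q ` \<T>. x \<in> V \<and> y \<in> W \<and> disjnt V W"
    if x: "x \<in> topspace X" and y: "y \<in> topspace X" and "x \<noteq> y" for x y
  proof -
    have "f x \<in> topspace Y" "f y \<in> topspace Y" "g x \<in> topspace Z" "g y \<in> topspace Z"
      using f g x y continuous_map_image_subset_topspace by blast+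
    then consider V W where "V \<in> \<S>" "W \<in> \<S>" "f x \<in> V" "f y \<in> W" "disjnt V W"
      | V W where "V \<in> \<T>" "W \<in> \<T>" "g x \<in> V" "g y \<in> W" "disjnt V W"
      using inj[OF x y] \<open>x \<noteq> y\<close> \<S> \<T> unfolding separating_def by metis
    then show ?thesis
    proof cases
      case 1
      then have "x \<in> ?p V" "y \<in> ?p W" "disjnt (?p V) (?p W)" using x y by (auto simp: disjnt_iff)
      then show ?thesis using 1(1,2) by (intro bexI[of _ "?p V"] bexI[of _ "?p W"]) auto
    next
      case 2
      then have "x \<in> ?q V" "y \<in> ?q W" "disjnt (?q V) (?q W)" using x y by (auto simp: disjnt_iff)
      then show ?thesis using 2(1,2) by (intro bexI[of _ "?q V"] bexI[of _ "?q W"]) auto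
    qed
  qed
  show ?thesis unfolding separating_def by (intro conjI ballI impI op sep)
qed

lemma clopen_separated_preimage:
  assumes f: "continuous_map X Y f" and g: "continuous_map X Z g"
    and inj: "\<And>x y. \<lbrakk>x \<in> topspace X; y \<in> topspace X; f x = f y; g x = g y\<rbrakk> \<Longrightarrow> x = y"
    and YZ: "clopen_separated Y" "clopen_separated Z"
  shows "clopen_separated X"
  unfolding clopen_separated_def
proof (intro ballI impI)
  fix x y assume x: "x \<in> topspace X" and y: "y \<in> topspace X" and "x \<noteq> y"
  have "f x \<in> topspace Y" "f y \<in> topspace Y" "g x \<in> topspace Z" "g y \<in> topspace Z"
    using f g x y continuous_map_image_subset_topspace by blast+
  then consider V where "openin Y V" "closedin Y V" "f x \<in> V" "f y \<notin> V"
    | V where "openin Z V" "closedin Z V" "g x \<in> V" "g y \<notin> V"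
    using inj[OF x y] \<open>x \<noteq> y\<close> YZ unfolding clopen_separated_def by metis
  then show "\<exists>V. openin X V \<and> closedin X V \<and> x \<in> V \<and> y \<notin> V"
  proof cases
    case 1
    then show ?thesis using openin_continuous_map_preimage[OF f 1(1)] closedin_continuous_map_preimage[OF f 1(2)] x
      by (intro exI[of _ "{x \<in> topspace X. f x \<in> V}"]) auto
  next
    case 2
    then show ?thesis using openin_continuous_map_preimage[OF g 2(1)] closedin_continuous_map_preimage[OF g 2(2)] x
      by (intro exI[of _ "{x \<in> topspace X. g x \<in> V}"]) auto
  qed
qed

text \<open>Clopen sets and their complements form a separating family, whose finite intersections
  are again clopen; compactness makes these a base.\<close>

lemma zero_dimensional_iff:
  assumes X: "compact_space X" "Hausdorff_space X"
  shows "zero_dimensional_space X \<longleftrightarrow> clopen_separated X"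
proof
  assume zd: "zero_dimensional_space X"
  show "clopen_separated X" unfolding clopen_separated_def
  proof (intro ballI impI)
    fix x y assume x: "x \<in> topspace X" and y: "y \<in> topspace X" and "x \<noteq> y"
    have "closedin X {y}" using closedin_Hausdorff_sing_eq[OF X(2)] y by simp
    then have "openin X (topspace X - {y})" by blast
    moreover have "x \<in> topspace X - {y}" using x \<open>x \<noteq> y\<close> by simp
    ultimately obtain G V where "openin X V \<and> closedin X V" "x \<in> G" "G \<subseteq> V" "V \<subseteq> topspace X - {y}"
      using zd unfolding zero_dimensional_space_def neighbourhood_base_of by meson
    then show "\<exists>V. openin X V \<and> closedin X V \<and> x \<in> V \<and> y \<notin> V" by blast
  qed
next
  assume cs: "clopen_separated X"
  define \<S> where "\<S> = {V. openin X V \<and> closedin X V}"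
  have sep: "separating \<S> X" unfolding separating_def
  proof (intro conjI ballI impI)
    fix x y assume xy: "x \<in> topspace X" "y \<in> topspace X" "x \<noteq> y"
    obtain V where V: "openin X V" "closedin X V" "x \<in> V" "y \<notin> V" using cs xy unfolding clopen_separated_def by blast
    have "topspace X - V \<in> \<S>" "V \<in> \<S>" using V unfolding \<S>_def by auto
    moreover have "disjnt V (topspace X - V)" by (auto simp: disjnt_iff)
    ultimately show "\<exists>V\<in>\<S>. \<exists>W\<in>\<S>. x \<in> V \<and> y \<in> W \<and> disjnt V W" using V xy by blast
  qed (simp add: \<S>_def)
  show "zero_dimensional_space X" unfolding zero_dimensional_space_def neighbourhood_base_of
  proof (intro allI impI, elim conjE)
    fix W x assume W: "openin X W" "x \<in> W"
    obtain \<F> where \<F>: "finite \<F>" "\<F> \<subseteq> \<S>" "x \<in> \<Inter>\<F>" "topspace X \<inter> \<Inter>\<F> \<subseteq> W"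
      using separating_base[OF X(1) sep W] by blast
    \<comment> \<open>\<open>topspace X\<close> is included so that the empty family yields the
      whole space.\<close>
    let ?V = "\<Inter>(insert (topspace X) \<F>)"
    have "openin X ?V" by (rule openin_Inter) (use \<F> in \<open>auto simp: \<S>_def\<close>)
    moreover have "closedin X ?V" by (rule closedin_Inter) (use \<F> in \<open>auto simp: \<S>_def\<close>)
    moreover have "x \<in> ?V" "?V \<subseteq> W" using \<F> W openin_subset[OF W(1)] by auto
    ultimately show "\<exists>G V. openin X G \<and> (openin X V \<and> closedin X V) \<and> x \<in> G \<and> G \<subseteq> V \<and> V \<subseteq> W" by blast
  qed
qed

section \<open>Cardinality of the set of finite subsets\<close>

lemma lepoll_iff_card_of: "A \<lesssim> B \<longleftrightarrow> (card_of A, card_of B) \<in> ordLeq"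
  unfolding lepoll_def card_of_ordLeq ..

text \<open>By induction the subsets of size \<open>n\<close> are bounded by \<open>B\<close>, since
  \<open>B \<times> B\<close> is. The union over \<open>n\<close> is a countable union of sets
  bounded by the infinite \<open>B\<close>.\<close>

lemma Fpow_lepoll:
  assumes B: "infinite B" and A: "A \<lesssim> B"
  shows "Fpow A \<lesssim> B"
proof -
  let ?F = "\<lambda>n. {X. X \<subseteq> A \<and> finite X \<and> card X = n}"
  have BB: "B \<times> B \<lesssim> B"
    using card_of_Times_same_infinite[OF B] eqpoll_iff_card_of_ordIso eqpoll_imp_lepoll by blast
  have F: "?F n \<lesssim> B" for n
  proof (induction n)
    case 0
    have "?F 0 = {{}}" by auto
    then show ?case using finite_lepoll_infinite[OF B, of "{{}}"] by simp
  next
    case (Suc n)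
    have "?F (Suc n) \<subseteq> (\<lambda>(a, X). insert a X) ` (A \<times> ?F n)"
    proof
      fix X assume X: "X \<in> ?F (Suc n)"
      then obtain a Y where "X = insert a Y" "a \<notin> Y" "card Y = n" by (auto simp: card_Suc_eq)
      then show "X \<in> (\<lambda>(a, X). insert a X) ` (A \<times> ?F n)" using X by (intro image_eqI[of _ _ "(a, Y)"]) auto
    qed
    then have "?F (Suc n) \<lesssim> A \<times> ?F n" by (rule subset_image_lepoll)
    also have "\<dots> \<lesssim> B \<times> B" by (rule times_lepoll_mono[OF A Suc])
    finally show ?case using BB by (rule lepoll_trans)
  qed
  have "(UNIV :: nat set) \<lesssim> B" using B infinite_le_lepoll by blast
  then have "(\<Union>n\<in>UNIV. ?F n) \<lesssim> B"
    using card_of_UNION_ordLeq_infinite[OF B, of UNIV ?F] F unfolding lepoll_iff_card_of by simp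
  moreover have "Fpow A = (\<Union>n\<in>UNIV. ?F n)" by (auto simp: Fpow_def)
  ultimately show ?thesis by simp
qed

section \<open>Small families and spaces of small weight\<close>

locale universe =
  fixes U :: "'a set set"
  assumes U: "size_universe U"
begin

definition small :: "'b set \<Rightarrow> bool" where
  "small \<S> \<longleftrightarrow> (\<exists>A\<in>U. \<S> \<lesssim> A)"

lemma small_lepoll: "\<lbrakk>small \<S>; \<T> \<lesssim> \<S>\<rbrakk> \<Longrightarrow> small \<T>"
  unfolding small_def using lepoll_trans by blast

lemma small_image: "small \<S> \<Longrightarrow> small (f ` \<S>)"
  using small_lepoll image_lepoll by blast

text \<open>Some member of \<open>U\<close> is infinite; infinite bounds are wanted because the
  absorption laws of cardinal arithmetic apply to them.\<close>

lemma small_infinite_bound: "small \<S> \<Longrightarrow> \<exists>A\<in>U. infinite A \<and> \<S> \<lesssim> A"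
proof -
  assume "small \<S>"
  then obtain A where A: "A \<in> U" "\<S> \<lesssim> A" unfolding small_def by blast
  obtain B where B: "B \<in> U" "infinite B" using U unfolding size_universe_def by blast
  show ?thesis
  proof (cases "finite A")
    case True
    then have "A \<lesssim> B" using finite_lepoll_infinite[OF B(2)] by blast
    then show ?thesis using A(2) B lepoll_trans by blast
  qed (use A in blast)
qed

lemma small_finite: "finite \<S> \<Longrightarrow> small \<S>"
  using U finite_lepoll_infinite unfolding small_def size_universe_def by blast

lemma small_Fpow: "small \<S> \<Longrightarrow> small (Fpow \<S>)"
  using small_infinite_bound[of \<S>] Fpow_lepoll[of _ \<S>] unfolding small_def by blast

text \<open>Two bounds are comparable as cardinals, so the larger one serves for both
  families.\<close>

lemma small_Un: assumes "small \<S>" "small \<T>" shows "small (\<S> \<union> \<T>)"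
proof -
  obtain A where A: "A \<in> U" "infinite A" "\<S> \<lesssim> A" using small_infinite_bound[OF assms(1)] by blast
  obtain B where B: "B \<in> U" "infinite B" "\<T> \<lesssim> B" using small_infinite_bound[OF assms(2)] by blast
  have "A \<lesssim> B \<or> B \<lesssim> A" unfolding lepoll_iff_card_of using ordLeq_total card_of_Well_order by blast
  then obtain D where D: "D \<in> U" "infinite D" "\<S> \<lesssim> D" "\<T> \<lesssim> D" using A B lepoll_trans by metis
  have "\<S> \<union> \<T> \<lesssim> D"
    using card_of_Un_ordLeq_infinite_Field[of "card_of D" \<S> \<T>] D
    unfolding lepoll_iff_card_of by (simp add: Field_card_of card_of_card_order_on)
  then show ?thesis using D(1) unfolding small_def by blast
qed

lemma small_UN: "\<lbrakk>finite I; \<And>i. i \<in> I \<Longrightarrow> small (\<S> i)\<rbrakk> \<Longrightarrow> small (\<Union>i\<in>I. \<S> i)"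
  by (induction I rule: finite_induct) (auto intro: small_finite small_Un)

text \<open>The finite intersections of a separating family form a base, and there are no more of
  them than finite subsets of the family.\<close>

lemma small_spaceI:
  assumes X: "compact_space X" and \<S>: "separating \<S> X" and sm: "small \<S>"
  shows "small_space U X"
proof -
  let ?\<B> = "(\<lambda>\<F>. \<Inter>(insert (topspace X) \<F>)) ` Fpow \<S>"
  have op: "openin X V" if V: "V \<in> ?\<B>" for V
  proof -
    obtain \<F> where \<F>: "\<F> \<in> Fpow \<S>" "V = \<Inter>(insert (topspace X) \<F>)" using V by blast
    show ?thesis unfolding \<F>(2) by (rule openin_Inter) (use \<F>(1) \<S> in \<open>auto simp: Fpow_def separating_def\<close>)
  qed
  have "neighbourhood_base_of (\<lambda>V. V \<in> ?\<B>) X" unfolding neighbourhood_base_of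
  proof (intro allI impI, elim conjE)
    fix W x assume W: "openin X W" "x \<in> W"
    obtain \<F> where \<F>: "finite \<F>" "\<F> \<subseteq> \<S>" "x \<in> \<Inter>\<F>" "topspace X \<inter> \<Inter>\<F> \<subseteq> W"
      using separating_base[OF X \<S> W] by blast
    let ?V = "\<Inter>(insert (topspace X) \<F>)"
    have V: "?V \<in> ?\<B>" using \<F> unfolding Fpow_def by blast
    moreover have "x \<in> ?V" "?V \<subseteq> W" using \<F> W openin_subset[OF W(1)] by auto
    ultimately show "\<exists>G V. openin X G \<and> V \<in> ?\<B> \<and> x \<in> G \<and> G \<subseteq> V \<and> V \<subseteq> W" using op[OF V] by blast
  qed
  moreover have "small ?\<B>" by (rule small_image[OF small_Fpow[OF sm]])
  ultimately show ?thesis using op unfolding small_space_def small_def by blast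
qed

lemma small_spaceE:
  assumes "small_space U X"
  obtains \<B> where "small \<B>" "\<And>V. V \<in> \<B> \<Longrightarrow> openin X V" "\<And>W x. \<lbrakk>openin X W; x \<in> W\<rbrakk> \<Longrightarrow> \<exists>V\<in>\<B>. x \<in> V \<and> V \<subseteq> W"
proof -
  obtain \<B> where \<B>: "small \<B>" "\<forall>V\<in>\<B>. openin X V" "neighbourhood_base_of (\<lambda>V. V \<in> \<B>) X"
    using assms unfolding small_space_def small_def by blast
  have "\<exists>V\<in>\<B>. x \<in> V \<and> V \<subseteq> W" if "openin X W" "x \<in> W" for W x
    using \<B>(3) that unfolding neighbourhood_base_of by (meson subsetD)
  then show ?thesis by (intro that[of \<B>]) (use \<B> in auto)
qed

lemma small_separating:
  assumes "small_space U X" "Hausdorff_space X"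
  shows "\<exists>\<S>. separating \<S> X \<and> small \<S>"
proof -
  obtain \<B> where \<B>: "small \<B>" "\<And>V. V \<in> \<B> \<Longrightarrow> openin X V" "\<And>W x. \<lbrakk>openin X W; x \<in> W\<rbrakk> \<Longrightarrow> \<exists>V\<in>\<B>. x \<in> V \<and> V \<subseteq> W"
    using small_spaceE[OF assms(1)] by metis
  have sep: "\<exists>V\<in>\<B>. \<exists>W\<in>\<B>. x \<in> V \<and> y \<in> W \<and> disjnt V W" if xy: "x \<in> topspace X" "y \<in> topspace X" "x \<noteq> y" for x y
  proof -
    obtain V W where VW: "openin X V" "openin X W" "x \<in> V" "y \<in> W" "disjnt V W"
      using assms(2) xy unfolding Hausdorff_space_def by meson
    obtain V' where "V' \<in> \<B>" "x \<in> V'" "V' \<subseteq> V" using \<B>(3)[OF VW(1,3)] by blast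
    moreover obtain W' where "W' \<in> \<B>" "y \<in> W'" "W' \<subseteq> W" using \<B>(3)[OF VW(2,4)] by blast
    ultimately show ?thesis using VW(5) unfolding disjnt_def by blast
  qed
  have "separating \<B> X" using \<B>(2) sep by (simp add: separating_def)
  then show ?thesis using \<B>(1) by blast
qed

lemma small_space_preimage:
  assumes X: "compact_space X" and f: "continuous_map X Y f" and g: "continuous_map X Z g"
    and inj: "\<And>x y. \<lbrakk>x \<in> topspace X; y \<in> topspace X; f x = f y; g x = g y\<rbrakk> \<Longrightarrow> x = y"
    and YZ: "Hausdorff_space Y" "small_space U Y" "Hausdorff_space Z" "small_space U Z"
  shows "Hausdorff_space X" "small_space U X"
proof -
  obtain \<S> where \<S>: "separating \<S> Y" "small \<S>" using small_separating[OF YZ(2,1)] by blast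
  obtain \<T> where \<T>: "separating \<T> Z" "small \<T>" using small_separating[OF YZ(4,3)] by blast
  note sep = separating_preimage[OF f g inj \<S>(1) \<T>(1)]
  show "Hausdorff_space X" using sep by (rule separating_Hausdorff)
  show "small_space U X" by (rule small_spaceI[OF X sep small_Un[OF small_image[OF \<S>(2)] small_image[OF \<T>(2)]]])
qed

text \<open>\<open>T \<F>\<close> consists of the points whose whole fibre is covered by
  \<open>\<F>\<close>, and it is open because \<open>q\<close> is closed. Fibres are compact, so the
  finite \<open>\<F>\<close> already give a base.\<close>

lemma small_space_image:
  assumes X: "compact_space X" "small_space U X" and Y: "Hausdorff_space Y"
    and q: "continuous_map X Y q" "q ` topspace X = topspace Y"
  shows "small_space U Y"
proof -
  obtain \<B> where \<B>: "small \<B>" "\<And>V. V \<in> \<B> \<Longrightarrow> openin X V" "\<And>W x. \<lbrakk>openin X W; x \<in> W\<rbrakk> \<Longrightarrow> \<exists>V\<in>\<B>. x \<in> V \<and> V \<subseteq> W"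
    using small_spaceE[OF X(2)] by metis
  define T where "T \<F> = topspace Y - q ` (topspace X - \<Union>\<F>)" for \<F>
  have cl: "closed_map X Y q" by (rule continuous_imp_closed_map[OF q(1) X(1) Y])
  have op: "openin Y (T \<F>)" if "\<F> \<in> Fpow \<B>" for \<F>
  proof -
    have "openin X (\<Union>\<F>)" using that \<B>(2) by (auto simp: Fpow_def)
    then have "closedin Y (q ` (topspace X - \<Union>\<F>))" using cl unfolding closed_map_def by blast
    then show ?thesis unfolding T_def by blast
  qed
  have base: "\<exists>\<F>\<in>Fpow \<B>. y \<in> T \<F> \<and> T \<F> \<subseteq> W" if W: "openin Y W" "y \<in> W" for W y
  proof -
    let ?G = "{x \<in> topspace X. q x \<in> W}" and ?K = "{x \<in> topspace X. q x \<in> {y}}"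
    have y: "y \<in> topspace Y" using W openin_subset by blast
    have G: "openin X ?G" by (rule openin_continuous_map_preimage[OF q(1) W(1)])
    have "closedin Y {y}" using closedin_Hausdorff_sing_eq[OF Y] y by simp
    then have K: "compactin X ?K" using closedin_continuous_map_preimage[OF q(1)] X(1) closedin_compact_space by blast
    have sub: "?K \<subseteq> \<Union>{V\<in>\<B>. V \<subseteq> ?G}" using \<B>(3)[OF G] W(2) by fastforce
    have "\<exists>\<F>. finite \<F> \<and> \<F> \<subseteq> {V\<in>\<B>. V \<subseteq> ?G} \<and> ?K \<subseteq> \<Union>\<F>"
      by (rule compactinD[OF K _ sub]) (use \<B>(2) in simp)
    then obtain \<F> where \<F>: "finite \<F>" "\<F> \<subseteq> {V\<in>\<B>. V \<subseteq> ?G}" "?K \<subseteq> \<Union>\<F>" by (elim exE conjE)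
    have "T \<F> \<subseteq> W"
    proof
      fix z assume z: "z \<in> T \<F>"
      then obtain x where x: "x \<in> topspace X" "z = q x" using q(2) unfolding T_def by blast
      then have "x \<in> \<Union>\<F>" using z unfolding T_def by blast
      then show "z \<in> W" using \<F>(2) x by blast
    qed
    moreover have "y \<in> T \<F>" using y \<F>(3) unfolding T_def by blast
    ultimately show ?thesis using \<F> by (intro bexI[of _ \<F>]) (auto simp: Fpow_def)
  qed
  have "neighbourhood_base_of (\<lambda>V. V \<in> T ` Fpow \<B>) Y"
    unfolding neighbourhood_base_of
  proof (intro allI impI, elim conjE)
    fix W y assume "openin Y W" "y \<in> W"
    then obtain \<F> where \<F>: "\<F> \<in> Fpow \<B>" "y \<in> T \<F>" "T \<F> \<subseteq> W" using base by meson
    then show "\<exists>G V. openin Y G \<and> V \<in> T ` Fpow \<B> \<and> y \<in> G \<and> G \<subseteq> V \<and> V \<subseteq> W"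
      by (intro exI[of _ "T \<F>"] conjI op imageI subset_refl)
  qed
  moreover have "small (T ` Fpow \<B>)" by (rule small_image[OF small_Fpow[OF \<B>(1)]])
  ultimately show ?thesis using op unfolding small_space_def small_def by blast
qed

section \<open>Closure properties of the two classes of spaces\<close>

definition kh_spaces :: "'a topology set" where
  "kh_spaces = {X. compact_space X \<and> Hausdorff_space X \<and> small_space U X}"

definition stone_spaces :: "'a topology set" where
  "stone_spaces = {X. zero_dimensional_space X \<and> compact_space X \<and> Hausdorff_space X \<and> small_space U X}"

lemma stone_spaces_iff: "X \<in> stone_spaces \<longleftrightarrow> X \<in> kh_spaces \<and> clopen_separated X"
  unfolding stone_spaces_def kh_spaces_def using zero_dimensional_iff by blast

lemma kh_copy:
  assumes "compact_space X" "Hausdorff_space X" "small_space U X"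
  shows "\<exists>Y\<in>kh_spaces. X homeomorphic_space Y"
  using small_space_copy[OF U assms(2,3)] assms homeomorphic_compact_space homeomorphic_Hausdorff_space
  unfolding kh_spaces_def by blast

lemma clopen_separated_homeomorphic:
  assumes "X homeomorphic_space Y" "clopen_separated X" shows "clopen_separated Y"
proof -
  obtain f g where fg: "homeomorphic_maps X Y f g" using assms(1) unfolding homeomorphic_space_def by blast
  then have g: "continuous_map Y X g" "\<And>y. y \<in> topspace Y \<Longrightarrow> f (g y) = y" unfolding homeomorphic_maps_def by auto
  show ?thesis by (rule clopen_separated_preimage[OF g(1) g(1) _ assms(2,2)]) (use g(2) in metis)
qed

lemma kh_closed_subspace:
  assumes X: "X \<in> kh_spaces" and A: "closedin X A"
  shows "subtopology X A \<in> kh_spaces"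
proof -
  have c: "compact_space (subtopology X A)"
    using X A closedin_compact_space compact_space_subtopology unfolding kh_spaces_def by blast
  have i: "continuous_map (subtopology X A) X (\<lambda>x. x)" by (simp add: continuous_map_from_subtopology)
  have "Hausdorff_space X" "small_space U X" using X unfolding kh_spaces_def by auto
  note small_space_preimage[OF c i i _ this this]
  then show ?thesis using c unfolding kh_spaces_def by auto
qed

lemma kh_product_subspace:
  assumes X: "X \<in> kh_spaces" and Y: "Y \<in> kh_spaces" and B: "closedin (prod_topology X Y) B"
  shows "\<exists>Z\<in>kh_spaces. subtopology (prod_topology X Y) B homeomorphic_space Z"
proof (rule kh_copy)
  have XY: "compact_space X" "Hausdorff_space X" "small_space U X" "compact_space Y" "Hausdorff_space Y" "small_space U Y"
    using X Y unfolding kh_spaces_def by auto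
  have "compact_space (prod_topology X Y)" using XY compact_space_prod_topology by blast
  then show c: "compact_space (subtopology (prod_topology X Y) B)"
    using B closedin_compact_space compact_space_subtopology by blast
  have f: "continuous_map (subtopology (prod_topology X Y) B) X fst" "continuous_map (subtopology (prod_topology X Y) B) Y snd"
    by (simp_all add: continuous_map_from_subtopology continuous_map_fst continuous_map_snd)
  note sp = small_space_preimage[OF c f prod_eqI XY(2,3,5,6)]
  show "Hausdorff_space (subtopology (prod_topology X Y) B)" by (rule sp)
  show "small_space U (subtopology (prod_topology X Y) B)" by (rule sp)
qed

lemma stone_product_subspace:
  assumes X: "X \<in> stone_spaces" and Y: "Y \<in> stone_spaces" and B: "closedin (prod_topology X Y) B"
  shows "\<exists>Z\<in>stone_spaces. subtopology (prod_topology X Y) B homeomorphic_space Z"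
proof -
  obtain Z where Z: "Z \<in> kh_spaces" "subtopology (prod_topology X Y) B homeomorphic_space Z"
    using kh_product_subspace[OF _ _ B] X Y unfolding stone_spaces_iff by blast
  have f: "continuous_map (subtopology (prod_topology X Y) B) X fst" "continuous_map (subtopology (prod_topology X Y) B) Y snd"
    by (simp_all add: continuous_map_from_subtopology continuous_map_fst continuous_map_snd)
  have "clopen_separated (subtopology (prod_topology X Y) B)"
    by (rule clopen_separated_preimage[OF f prod_eqI]) (use X Y in \<open>simp_all add: stone_spaces_iff\<close>)
  then show ?thesis using Z clopen_separated_homeomorphic[OF Z(2)] by (auto simp: stone_spaces_iff)
qed

lemma stone_closed_subspace:
  assumes X: "X \<in> stone_spaces" and A: "closedin X A"
  shows "subtopology X A \<in> stone_spaces"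
proof -
  have i: "continuous_map (subtopology X A) X (\<lambda>x. x)" by (simp add: continuous_map_from_subtopology)
  have "clopen_separated (subtopology X A)"
    by (rule clopen_separated_preimage[OF i i]) (use X in \<open>simp_all add: stone_spaces_iff\<close>)
  then show ?thesis using X kh_closed_subspace[OF _ A] unfolding stone_spaces_iff by blast
qed

lemma stone_finite_discrete: "finite A \<Longrightarrow> discrete_topology A \<in> stone_spaces"
proof -
  assume A: "finite A"
  have c: "compact_space (discrete_topology A)" using A by (simp add: compact_space_discrete_topology)
  have "separating (Pow A) (discrete_topology A)" unfolding separating_def
  proof (intro conjI ballI impI)
    fix x y assume "x \<in> topspace (discrete_topology A)" "y \<in> topspace (discrete_topology A)" "x \<noteq> y"
    then show "\<exists>V\<in>Pow A. \<exists>W\<in>Pow A. x \<in> V \<and> y \<in> W \<and> disjnt V W" by (intro bexI[of _ "{x}"] bexI[of _ "{y}"]) auto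
  qed simp
  then have "small_space U (discrete_topology A)" by (rule small_spaceI[OF c]) (use A in \<open>simp add: small_finite\<close>)
  moreover have "clopen_separated (discrete_topology A)" unfolding clopen_separated_def
  proof (intro ballI impI)
    fix x y assume "x \<in> topspace (discrete_topology A)" "y \<in> topspace (discrete_topology A)" "x \<noteq> y"
    then show "\<exists>V. openin (discrete_topology A) V \<and> closedin (discrete_topology A) V \<and> x \<in> V \<and> y \<notin> V"
      by (intro exI[of _ "{x}"]) auto
  qed
  ultimately show ?thesis using c unfolding stone_spaces_iff kh_spaces_def by simp
qed

lemma kh_sums:
  assumes I: "finite (I :: nat set)" and X: "\<And>i. i \<in> I \<Longrightarrow> X i \<in> kh_spaces"
  shows "\<exists>Z\<in>kh_spaces. sum_topology X I homeomorphic_space Z"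
proof (rule kh_copy)
  let ?S = "sum_topology X I"
  have Xi: "compact_space (X i)" "Hausdorff_space (X i)" "small_space U (X i)" if "i \<in> I" for i
    using X[OF that] unfolding kh_spaces_def by auto
  have "compactin ?S ((\<lambda>x. (i, x)) ` topspace (X i))" if i: "i \<in> I" for i
    by (rule image_compactin[OF _ continuous_map_component_injection[OF i]]) (use Xi(1)[OF i] in \<open>simp add: compact_space_def\<close>)
  then have "compactin ?S (\<Union>i\<in>I. (\<lambda>x. (i, x)) ` topspace (X i))" using I by (intro compactin_Union) auto
  moreover have "(\<Union>i\<in>I. (\<lambda>x. (i, x)) ` topspace (X i)) = topspace ?S" by auto
  ultimately show c: "compact_space ?S" by (simp add: compact_space_def)
  have "\<forall>i\<in>I. \<exists>\<S>. separating \<S> (X i) \<and> small \<S>" using small_separating Xi(2,3) by blast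
  then obtain \<S> where \<S>: "\<forall>i\<in>I. separating (\<S> i) (X i) \<and> small (\<S> i)" by (rule bchoice[THEN exE])
  \<comment> \<open>The whole summand is added to each family in order to separate points of
    different summands.\<close>
  define \<T> where "\<T> = (\<Union>i\<in>I. (\<lambda>V. {i} \<times> V) ` (insert (topspace (X i)) (\<S> i)))"
  have T: "{i} \<times> V \<in> \<T>" if "i \<in> I" "V = topspace (X i) \<or> V \<in> \<S> i" for i V
    unfolding \<T>_def using that by blast
  have sep: "separating \<T> ?S" unfolding separating_def
  proof (intro conjI ballI impI)
    fix W assume "W \<in> \<T>"
    then obtain i V where i: "i \<in> I" "W = {i} \<times> V" "openin (X i) V"
      using \<S> unfolding \<T>_def separating_def by blast
    have "{x. (j, x) \<in> W} = (if j = i then V else {})" for j using i(2) by auto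
    then show "openin ?S W" using i openin_subset[OF i(3)] by (auto simp: openin_sum_topology)
  next
    fix a b assume ab: "a \<in> topspace ?S" "b \<in> topspace ?S" "a \<noteq> b"
    obtain i x where a: "a = (i, x)" "i \<in> I" "x \<in> topspace (X i)" using ab(1) by auto
    obtain j y where b: "b = (j, y)" "j \<in> I" "y \<in> topspace (X j)" using ab(2) by auto
    show "\<exists>V\<in>\<T>. \<exists>W\<in>\<T>. a \<in> V \<and> b \<in> W \<and> disjnt V W"
    proof (cases "i = j")
      case True
      then have xy: "x \<noteq> y" "y \<in> topspace (X i)" using ab(3) a b by auto
      obtain V W where VW: "V \<in> \<S> i" "W \<in> \<S> i" "x \<in> V" "y \<in> W" "disjnt V W"
        using \<S> a(2,3) xy unfolding separating_def by blast
      then have "disjnt ({i} \<times> V) ({i} \<times> W)" by (auto simp: disjnt_iff)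
      moreover have "{i} \<times> V \<in> \<T>" "{i} \<times> W \<in> \<T>" "a \<in> {i} \<times> V" "b \<in> {i} \<times> W"
        using VW T[OF a(2)] a(1) b(1) True by simp_all
      ultimately show ?thesis by (intro bexI[of _ "{i} \<times> V"] bexI[of _ "{i} \<times> W"] conjI)
    next
      case False
      then have "disjnt ({i} \<times> topspace (X i)) ({j} \<times> topspace (X j))" by (auto simp: disjnt_iff)
      moreover have "{i} \<times> topspace (X i) \<in> \<T>" "{j} \<times> topspace (X j) \<in> \<T>" using T[OF a(2)] T[OF b(2)] by simp_all
      moreover have "a \<in> {i} \<times> topspace (X i)" "b \<in> {j} \<times> topspace (X j)" using a b by simp_all
      ultimately show ?thesis
        by (intro bexI[of _ "{i} \<times> topspace (X i)"] bexI[of _ "{j} \<times> topspace (X j)"] conjI)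
    qed
  qed
  show "Hausdorff_space ?S" using sep by (rule separating_Hausdorff)
  have "small \<T>" unfolding \<T>_def
  proof (rule small_UN[OF I small_image])
    fix i assume "i \<in> I"
    then have "small ({topspace (X i)} \<union> \<S> i)" using \<S> by (intro small_Un[OF small_finite]) auto
    then show "small (insert (topspace (X i)) (\<S> i))" by simp
  qed
  then show "small_space U ?S" by (rule small_spaceI[OF c sep])
qed

text \<open>The quotient map is closed because \<open>R\<close> is closed and projection along a
  compact factor is a closed map. The quotient is then Hausdorff as a closed continuous T1 image of
  a normal space, and \<open>small_space_image\<close> bounds its weight.\<close>

lemma kh_quotients:
  assumes Y: "Y \<in> kh_spaces" and R: "closedin (prod_topology Y Y) R" "equiv (topspace Y) R"
  shows "\<exists>Z\<in>kh_spaces. \<exists>q. continuous_map Y Z q \<and> q ` topspace Y = topspace Z \<and>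
            (\<forall>x\<in>topspace Y. \<forall>y\<in>topspace Y. q x = q y \<longleftrightarrow> (x, y) \<in> R)"
proof -
  have cY: "compact_space Y" and hY: "Hausdorff_space Y" and sY: "small_space U Y" using Y unfolding kh_spaces_def by auto
  define q where "q x = R `` {x}" for x
  have q: "q x = q y \<longleftrightarrow> (x, y) \<in> R" if "x \<in> topspace Y" "y \<in> topspace Y" for x y
    unfolding q_def using eq_equiv_class_iff[OF R(2) that] .
  let ?o = "\<lambda>V. V \<subseteq> q ` topspace Y \<and> openin Y {x \<in> topspace Y. q x \<in> V}"
  define Q where "Q = topology ?o"
  have "istopology ?o" unfolding istopology_def
  proof (intro conjI allI impI)
    fix V W assume V: "?o V" and W: "?o W"
    have "{x \<in> topspace Y. q x \<in> V \<inter> W} = {x \<in> topspace Y. q x \<in> V} \<inter> {x \<in> topspace Y. q x \<in> W}" by auto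
    then show "openin Y {x \<in> topspace Y. q x \<in> V \<inter> W}" using V W by auto
    show "V \<inter> W \<subseteq> q ` topspace Y" using V by auto
  next
    fix \<K> assume K: "\<forall>V\<in>\<K>. ?o V"
    have "{x \<in> topspace Y. q x \<in> \<Union>\<K>} = (\<Union>V\<in>\<K>. {x \<in> topspace Y. q x \<in> V})" by auto
    then show "openin Y {x \<in> topspace Y. q x \<in> \<Union>\<K>}" using K by auto
    show "\<Union>\<K> \<subseteq> q ` topspace Y" using K by auto
  qed
  then have oQ: "openin Q V \<longleftrightarrow> ?o V" for V unfolding Q_def by (simp add: topology_inverse')
  have tQ: "topspace Q = q ` topspace Y"
  proof
    show "topspace Q \<subseteq> q ` topspace Y" using openin_topspace[of Q] unfolding oQ by blast
    have "{x \<in> topspace Y. q x \<in> q ` topspace Y} = topspace Y" by auto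
    then have "openin Q (q ` topspace Y)" unfolding oQ by simp
    then show "q ` topspace Y \<subseteq> topspace Q" by (rule openin_subset)
  qed
  have cont: "continuous_map Y Q q" unfolding continuous_map using tQ oQ by auto
  have closed: "closed_map Y Q q" unfolding closed_map_def
  proof (intro allI impI)
    fix K assume K: "closedin Y K"
    \<comment> \<open>The saturation of \<open>K\<close> is the projection of the part of
      \<open>R\<close> that starts in \<open>K\<close>.\<close>
    have "closedin (prod_topology Y Y) (R \<inter> K \<times> topspace Y)"
      using R(1) K by (intro closedin_Int) (simp_all add: closedin_prod_Times_iff)
    then have "closedin Y (snd ` (R \<inter> K \<times> topspace Y))"
      using closed_map_snd[OF cY] unfolding closed_map_def by blast
    then have "openin Y (topspace Y - snd ` (R \<inter> K \<times> topspace Y))" by blast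
    moreover have "{x \<in> topspace Y. q x \<in> q ` topspace Y - q ` K} = topspace Y - snd ` (R \<inter> K \<times> topspace Y)"
    proof -
      have "q x \<in> q ` K \<longleftrightarrow> x \<in> snd ` (R \<inter> K \<times> topspace Y)" if x: "x \<in> topspace Y" for x
      proof
        assume "q x \<in> q ` K"
        then obtain k where "k \<in> K" "q k = q x" by (metis imageE)
        then show "x \<in> snd ` (R \<inter> K \<times> topspace Y)" using q[of k x] x closedin_subset[OF K]
          by (intro image_eqI[of _ _ "(k, x)"]) auto
      next
        assume "x \<in> snd ` (R \<inter> K \<times> topspace Y)"
        then obtain k where "k \<in> K" "(k, x) \<in> R" by auto
        then show "q x \<in> q ` K" using q[of k x] x closedin_subset[OF K] by (intro image_eqI[of _ _ k]) auto
      qed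
      then show ?thesis by auto
    qed
    ultimately have "openin Q (q ` topspace Y - q ` K)" unfolding oQ by auto
    then show "closedin Q (q ` K)" unfolding closedin_def tQ using closedin_subset[OF K] by auto
  qed
  have t1: "t1_space Q" using t1_space_closed_map_image[OF closed tQ[symmetric]] Hausdorff_imp_t1_space[OF hY] by blast
  have hQ: "Hausdorff_space Q"
    by (rule Hausdorff_normal_space_closed_continuous_map_image[OF _ closed cont tQ[symmetric] t1])
      (use cY hY compact_Hausdorff_or_regular_imp_normal_space in blast)
  have cQ: "compact_space Q" using image_compactin[OF _ cont, of "topspace Y"] cY tQ by (simp add: compact_space_def)
  have sQ: "small_space U Q" by (rule small_space_image[OF cY sY hQ cont tQ[symmetric]])
  obtain Z where Z: "Z \<in> kh_spaces" "Q homeomorphic_space Z" using kh_copy[OF cQ hQ sQ] by blast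
  obtain f g where fg: "homeomorphic_maps Q Z f g" using Z(2) unfolding homeomorphic_space_def by blast
  then have f: "continuous_map Q Z f" "\<And>x. x \<in> topspace Q \<Longrightarrow> g (f x) = x" "f ` topspace Q = topspace Z"
    using homeomorphic_imp_surjective_map[of Q Z f] by (auto simp: homeomorphic_maps_def homeomorphic_map_maps)
  have "(f \<circ> q) ` topspace Y = topspace Z" using tQ f(3) by (metis image_comp)
  moreover have "continuous_map Y Z (f \<circ> q)" by (rule continuous_map_compose[OF cont f(1)])
  moreover have "(f \<circ> q) x = (f \<circ> q) y \<longleftrightarrow> (x, y) \<in> R" if xy: "x \<in> topspace Y" "y \<in> topspace Y" for x y
  proof -
    have "q x \<in> topspace Q" "q y \<in> topspace Q" using tQ xy by auto
    then have "f (q x) = f (q y) \<longleftrightarrow> q x = q y" using f(2) by metis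
    then show ?thesis using q[OF xy] by simp
  qed
  ultimately show ?thesis using Z(1) by blast
qed

text \<open>A Stone space covering \<open>X\<close>: a point \<open>x\<close> together with a choice, for every set \<open>B\<close> of a
  base, of one of the closed sets \<open>closure B\<close> and \<open>X - B\<close> containing \<open>x\<close>. The choices alone determine \<open>x\<close>.\<close>

lemma stone_cover:
  assumes X: "X \<in> kh_spaces"
  shows "\<exists>Z\<in>stone_spaces. \<exists>f. continuous_map Z X f \<and> f ` topspace Z = topspace X"
proof -
  have cX: "compact_space X" and hX: "Hausdorff_space X" and sX: "small_space U X" using X unfolding kh_spaces_def by auto
  obtain \<B> where \<B>: "small \<B>" "\<And>V. V \<in> \<B> \<Longrightarrow> openin X V" "\<And>W x. \<lbrakk>openin X W; x \<in> W\<rbrakk> \<Longrightarrow> \<exists>V\<in>\<B>. x \<in> V \<and> V \<subseteq> W"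
    using small_spaceE[OF sX] by metis
  define Q where "Q = prod_topology X (product_topology (\<lambda>_. discrete_topology (UNIV :: bool set)) \<B>)"
  have tQ: "topspace Q = topspace X \<times> (\<B> \<rightarrow>\<^sub>E UNIV)" unfolding Q_def by simp
  have cQ: "compact_space Q"
    unfolding Q_def using cX by (simp add: compact_space_prod_topology compact_space_product_topology compact_space_discrete_topology)
  \<comment> \<open>The choice at \<open>B\<close> places the point: in the closure of
    \<open>B\<close> for \<open>True\<close>, outside \<open>B\<close> for \<open>False\<close>.
    Both sets are closed, so the consistent pairs form a closed subspace.\<close>
  define D where "D B = {z \<in> topspace Q. snd z B \<in> {True}} \<inter> {z \<in> topspace Q. fst z \<in> X closure_of B} \<union>
      {z \<in> topspace Q. snd z B \<in> {False}} \<inter> {z \<in> topspace Q. fst z \<in> topspace X - B}" for B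
  define S where "S = \<Inter>(insert (topspace Q) (D ` \<B>))"
  have fstQ: "continuous_map Q X fst" unfolding Q_def by (rule continuous_map_fst)
  have comp: "continuous_map Q (discrete_topology UNIV) (\<lambda>z. snd z B)" if "B \<in> \<B>" for B
  proof -
    have "continuous_map Q (discrete_topology UNIV) ((\<lambda>\<phi>. \<phi> B) \<circ> snd)"
      unfolding Q_def by (rule continuous_map_compose[OF continuous_map_snd continuous_map_product_projection[OF that]])
    then show ?thesis by (simp add: o_def)
  qed
  have "closedin Q (D B)" if B: "B \<in> \<B>" for B
    unfolding D_def
    by (intro closedin_Un closedin_Int closedin_continuous_map_preimage[OF comp[OF B]] closedin_continuous_map_preimage[OF fstQ])
      (use \<B>(2)[OF B] in auto)
  then have clS: "closedin Q S" unfolding S_def by (intro closedin_Inter) auto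
  have S: "z \<in> S \<longleftrightarrow> z \<in> topspace Q \<and> (\<forall>B\<in>\<B>. if snd z B then fst z \<in> X closure_of B else fst z \<notin> B)" for z
    unfolding S_def D_def tQ by auto
  define Z where "Z = subtopology Q S"
  have tZ: "topspace Z = S" unfolding Z_def using clS closedin_subset by auto
  have cZ: "compact_space Z" unfolding Z_def using cQ clS closedin_compact_space compact_space_subtopology by blast
  define h where "h b B = {z \<in> S. snd z B \<in> {b}}" for b :: bool and B
  have "continuous_map Z (discrete_topology UNIV) (\<lambda>z. snd z B)" if "B \<in> \<B>" for B
    unfolding Z_def by (rule continuous_map_from_subtopology[OF comp[OF that]])
  note pre = openin_continuous_map_preimage[OF this] closedin_continuous_map_preimage[OF this]
  have h: "openin Z (h b B)" "closedin Z (h b B)" if "B \<in> \<B>" for b B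
    using pre[OF that, of "{b}"] unfolding h_def tZ by simp_all
  \<comment> \<open>For different first components, a base set around one point inside one of two
    disjoint neighbourhoods forces the choice \<open>True\<close> there. The other point cannot
    share it, as it is not in the closure of that base set.\<close>
  have sep0: "\<exists>B\<in>\<B>. snd z B \<noteq> snd w B" if z: "z \<in> S" and w: "w \<in> S" and "z \<noteq> w" for z w
  proof (rule ccontr)
    assume "\<not> (\<exists>B\<in>\<B>. snd z B \<noteq> snd w B)"
    then have eq: "snd z B = snd w B" if "B \<in> \<B>" for B using that by blast
    have zw: "snd z \<in> \<B> \<rightarrow>\<^sub>E UNIV" "snd w \<in> \<B> \<rightarrow>\<^sub>E UNIV" "fst z \<in> topspace X" "fst w \<in> topspace X"
      using z w unfolding S tQ by auto
    have "snd z = snd w" by (rule PiE_ext[OF zw(1,2)]) (rule eq)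
    then have "fst z \<noteq> fst w" using \<open>z \<noteq> w\<close> by (simp add: prod_eq_iff)
    then obtain V W where VW: "openin X V" "openin X W" "fst z \<in> V" "fst w \<in> W" "disjnt V W"
      using hX zw(3,4) unfolding Hausdorff_space_def by meson
    obtain B where B: "B \<in> \<B>" "fst z \<in> B" "B \<subseteq> V" using \<B>(3)[OF VW(1,3)] by blast
    have "snd z B" using z B(1,2) unfolding S by (auto split: if_splits)
    then have "fst w \<in> X closure_of B" using w B(1) eq[OF B(1)] unfolding S by auto
    then have "\<exists>y\<in>B. y \<in> W" using VW(2,4) unfolding in_closure_of by blast
    then show False using VW(5) B(3) by (auto simp: disjnt_iff)
  qed
  \<comment> \<open>Two clopen sets for each base set of \<open>X\<close>: this keeps the weight of
    the cover small.\<close>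
  define \<S> where "\<S> = h True ` \<B> \<union> h False ` \<B>"
  have sep: "separating \<S> Z" unfolding separating_def
  proof (intro conjI ballI impI)
    show "openin Z V" if "V \<in> \<S>" for V using that h(1) unfolding \<S>_def by blast
    fix z w assume zw: "z \<in> topspace Z" "w \<in> topspace Z" "z \<noteq> w"
    obtain B where B: "B \<in> \<B>" "snd z B \<noteq> snd w B" using sep0 zw unfolding tZ by blast
    have hS: "h b B \<in> \<S>" for b using B(1) unfolding \<S>_def by (cases b) auto
    have "z \<in> h (snd z B) B" "w \<in> h (snd w B) B" "disjnt (h (snd z B) B) (h (snd w B) B)"
      using B(2) zw unfolding h_def tZ by (auto simp: disjnt_iff)
    then show "\<exists>V\<in>\<S>. \<exists>W\<in>\<S>. z \<in> V \<and> w \<in> W \<and> disjnt V W" using hS by blast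
  qed
  have cs: "clopen_separated Z" unfolding clopen_separated_def
  proof (intro ballI impI)
    fix z w assume zw: "z \<in> topspace Z" "w \<in> topspace Z" "z \<noteq> w"
    obtain B where B: "B \<in> \<B>" "snd z B \<noteq> snd w B" using sep0 zw unfolding tZ by blast
    then have "z \<in> h (snd z B) B" "w \<notin> h (snd z B) B" using zw unfolding h_def tZ by auto
    then show "\<exists>V. openin Z V \<and> closedin Z V \<and> z \<in> V \<and> w \<notin> V" using h[OF B(1)] by blast
  qed
  have hZ: "Hausdorff_space Z" using sep by (rule separating_Hausdorff)
  have "small \<S>" unfolding \<S>_def by (intro small_Un small_image \<B>(1))
  then have sZ: "small_space U Z" by (rule small_spaceI[OF cZ sep])
  obtain Z' where Z': "Z' \<in> kh_spaces" "Z homeomorphic_space Z'" using kh_copy[OF cZ hZ sZ] by blast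
  obtain f g where fg: "homeomorphic_maps Z Z' f g" using Z'(2) unfolding homeomorphic_space_def by blast
  then have "homeomorphic_map Z' Z g" using homeomorphic_maps_map by blast
  then have g: "continuous_map Z' Z g" "g ` topspace Z' = topspace Z"
    by (auto simp: homeomorphic_imp_continuous_map homeomorphic_imp_surjective_map)
  have "continuous_map Z X fst" unfolding Z_def by (rule continuous_map_from_subtopology[OF fstQ])
  then have "continuous_map Z' X (fst \<circ> g)" by (rule continuous_map_compose[OF g(1)])
  moreover have "fst ` S = topspace X"
  proof
    show "fst ` S \<subseteq> topspace X" by (auto simp: S tQ)
    show "topspace X \<subseteq> fst ` S"
    proof
      fix x assume x: "x \<in> topspace X"
      \<comment> \<open>Choosing according to membership of \<open>x\<close> is consistent, so the
        projection is surjective.\<close>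
      have "(x, \<lambda>B\<in>\<B>. x \<in> B) \<in> S" unfolding S tQ
        using x closure_of_subset[OF openin_subset[OF \<B>(2)]] by auto
      then show "x \<in> fst ` S" by (intro image_eqI[of _ _ "(x, \<lambda>B\<in>\<B>. x \<in> B)"]) simp_all
    qed
  qed
  then have "(fst \<circ> g) ` topspace Z' = topspace X" using g(2) tZ by (metis image_comp)
  moreover have "Z' \<in> stone_spaces" using Z' clopen_separated_homeomorphic[OF Z'(2) cs] unfolding stone_spaces_iff by blast
  ultimately show ?thesis by blast
qed

end

section \<open>Stone spaces as a covering subcategory of compact Hausdorff spaces\<close>

context universe
begin

sublocale K: ch_pretopos kh_spaces
proof
  show "compact_space X" "Hausdorff_space X" if "X \<in> kh_spaces" for X
    using that unfolding kh_spaces_def by auto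
  show "\<exists>X\<in>kh_spaces. \<exists>x. topspace X = {x}"
    using stone_finite_discrete[of "{undefined}"] by (intro bexI[of _ "discrete_topology {undefined}"]) (auto simp: stone_spaces_iff)
qed (fact kh_closed_subspace kh_product_subspace kh_sums kh_quotients)+

sublocale S: ch_spaces stone_spaces
proof
  show "compact_space X" "Hausdorff_space X" if "X \<in> stone_spaces" for X
    using that unfolding stone_spaces_def by auto
  show "\<exists>X\<in>stone_spaces. \<exists>x. topspace X = {x}"
    using stone_finite_discrete[of "{undefined}"] by (intro bexI[of _ "discrete_topology {undefined}"]) auto
qed (fact stone_closed_subspace stone_product_subspace)+

lemma stone_arr_iff:
  "f \<in> Arr S.C \<longleftrightarrow> f \<in> Arr K.C \<and> fst f \<in> stone_spaces \<and> snd (snd f) \<in> stone_spaces"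
  unfolding top_category_Arr by (auto simp: stone_spaces_iff)

lemma stone_domain:
  assumes X: "X \<in> kh_spaces" and f: "continuous_map X Y f" and g: "continuous_map X Z g"
    and inj: "\<And>x y. \<lbrakk>x \<in> topspace X; y \<in> topspace X; f x = f y; g x = g y\<rbrakk> \<Longrightarrow> x = y"
    and YZ: "Y \<in> stone_spaces" "Z \<in> stone_spaces"
  shows "X \<in> stone_spaces"
proof -
  have "clopen_separated Y" "clopen_separated Z" using YZ unfolding stone_spaces_iff by auto
  then have "clopen_separated X" using clopen_separated_preimage[OF f g inj] by blast
  then show ?thesis using X unfolding stone_spaces_iff by blast
qed

sublocale coherent_covering_subcategory K.C S.C
proof unfold_locales
  show "Obj S.C \<subseteq> Obj K.C" by (auto simp: stone_spaces_iff)
  show "f \<in> Arr S.C \<longleftrightarrow> f \<in> Arr K.C \<and> Dom K.C f \<in> Obj S.C \<and> Cod K.C f \<in> Obj S.C" for f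
    unfolding stone_arr_iff by simp
  show "Dom S.C = Dom K.C" "Cod S.C = Cod K.C" "Ident S.C = Ident K.C" "Comp S.C = Comp K.C"
    by (simp_all add: top_category_def)
  show "Dom K.C p \<in> Obj S.C" if pb: "is_pullback K.C a b p q" and ab: "Dom K.C a \<in> Obj S.C" "Dom K.C b \<in> Obj S.C" for a b p q
  proof -
    note sq = pullback_square[OF pb]
    \<comment> \<open>The two projections are jointly injective into Stone spaces, whatever the
      common codomain of \<open>a\<close> and \<open>b\<close> is.\<close>
    have "fst p \<in> stone_spaces"
    proof (rule stone_domain[OF K.ArrD(1)[OF sq(3)] K.ArrD(6)[OF sq(3)]])
      show "continuous_map (fst p) (snd (snd q)) (fn q)" using K.ArrD(6)[OF sq(4)] sq(6) by simp
      show "snd (snd p) \<in> stone_spaces" "snd (snd q) \<in> stone_spaces" using ab sq(7,8) by simp_all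
    qed (rule K.pullback_inj[OF pb])
    then show ?thesis by simp
  qed
  show "\<exists>T\<in>Obj S.C. is_terminal K.C T"
  proof -
    have T: "discrete_topology {undefined} \<in> stone_spaces" by (rule stone_finite_discrete) simp
    then have "is_terminal K.C (discrete_topology {undefined})"
      by (intro K.point_terminal[of _ undefined]) (simp_all add: stone_spaces_iff)
    then show ?thesis using T by auto
  qed
  show "\<exists>c. is_cover K.C c \<and> Cod K.C c = X \<and> Dom K.C c \<in> Obj S.C" if X: "X \<in> Obj K.C" for X
  proof -
    obtain Z f where Z: "Z \<in> stone_spaces" "continuous_map Z X f" "f ` topspace Z = topspace X"
      using stone_cover[of X] X by auto
    have A: "top_arrow Z f X \<in> Arr K.C" using Z X by (simp add: stone_spaces_iff)
    have "is_cover K.C (top_arrow Z f X)" using K.cover_iff[OF A] Z(3) by (simp add: img_def)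
    then show ?thesis using Z(1) by (intro exI[of _ "top_arrow Z f X"]) simp
  qed
  show "is_cover S.C f \<longleftrightarrow> is_cover K.C f" if "f \<in> Arr K.C" "Dom K.C f \<in> Obj S.C" "Cod K.C f \<in> Obj S.C" for f
  proof -
    have "f \<in> Arr S.C" using that unfolding stone_arr_iff by simp
    then show ?thesis using S.cover_iff[of f] K.cover_iff[OF that(1)] by simp
  qed
  show "exact_category K.C" by (rule K.exact)
  show "coherent_category S.C" by (rule S.coherent)
  show "Dom K.C m \<in> Obj S.C" if m: "is_mono K.C m" "Cod K.C m \<in> Obj S.C" for m
  proof -
    have mA: "m \<in> Arr K.C" using m by auto
    have inj: "inj_on (fn m) (topspace (fst m))" using K.mono_iff[OF mA] m(1) by simp
    have "fst m \<in> stone_spaces"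
      by (rule stone_domain[OF K.ArrD(1)[OF mA] K.ArrD(6)[OF mA] K.ArrD(6)[OF mA]]) (use m(2) inj in \<open>auto dest: inj_onD\<close>)
    then show ?thesis by simp
  qed
  show "X \<in> Obj S.C" if X: "is_initial K.C X" for X
  proof -
    have XK: "X \<in> kh_spaces" using X unfolding is_initial_def by simp
    then have "topspace X = {}" using K.initial_iff[OF XK] X by simp
    then have "clopen_separated X" by (simp add: clopen_separated_def)
    then show ?thesis using XK by (simp add: stone_spaces_iff)
  qed
  fix I :: "nat set" and A T \<iota> assume I: "finite I" and co: "is_coproduct K.C I A T \<iota>"
  note c = coproduct_cocone[OF co] and p = K.coproduct_points[OF I co]
  show "is_mono K.C (\<iota> i)" if i: "i \<in> I" for i
    using K.mono_iff[OF c(2)[OF i]] p(1)[OF i] c(3)[OF i] by simp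
  show "is_initial K.C (Dom K.C r)" if ij: "i \<in> I" "j \<in> I" "i \<noteq> j" and pb: "is_pullback K.C (\<iota> i) (\<iota> j) r s" for i j r s
  proof -
    note sq = pullback_square[OF pb]
    have False if z: "z \<in> topspace (fst r)" for z
    proof -
      have "fn (\<iota> i) (fn r z) = fn (\<iota> j) (fn s z)"
        using K.square_fn[OF sq(9) z] sq(6) by simp
      moreover have "fn (\<iota> i) (fn r z) \<in> img (\<iota> i)" using fn_in[OF sq(3) z] sq(7) by (simp add: img_def)
      moreover have "fn (\<iota> j) (fn s z) \<in> img (\<iota> j)" using fn_in[OF sq(4), of z] z sq(6,8) by (simp add: img_def)
      ultimately show False using p(2)[OF ij] by auto
    qed
    then have "topspace (fst r) = {}" by blast
    then show ?thesis using K.initial_iff[OF K.ArrD(1)[OF sq(3)]] by simp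
  qed
  show "is_iso K.C n" if h: "h \<in> Arr K.C" "Cod K.C h = T" and n: "is_mono K.C n" "Cod K.C n = Dom K.C h"
    and fac: "\<And>i. i \<in> I \<Longrightarrow> \<exists>r s. is_pullback K.C h (\<iota> i) r s \<and> factors_through K.C r n" for h n
  proof -
    have nA: "n \<in> Arr K.C" using n by auto
    \<comment> \<open>A point of the domain of \<open>h\<close> goes to some summand, so it lies in
      the image of the pullback of that injection, which is contained in the image of
      \<open>n\<close>.\<close>
    have "topspace (fst h) \<subseteq> img n"
    proof
      fix x assume x: "x \<in> topspace (fst h)"
      then have "fn h x \<in> topspace T" using fn_in[OF h(1) x] h(2) by simp
      then obtain i where i: "i \<in> I" "fn h x \<in> img (\<iota> i)" using p(3) by blast
      obtain r s where rs: "is_pullback K.C h (\<iota> i) r s" "factors_through K.C r n" using fac[OF i(1)] by blast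
      note sq = pullback_square[OF rs(1)]
      have "x \<in> img r" using K.pullback_img[OF rs(1)] x i(2) by simp
      then show "x \<in> img n" using K.factors_through_iff[OF sq(3) n(1)] rs(2) sq(7) n(2) by auto
    qed
    then have "img n = topspace (snd (snd n))" using K.img_subset[OF nA] n(2) by auto
    then show ?thesis using K.iso_iff[OF nA] K.mono_iff[OF nA] n(1) by simp
  qed
qed

end

theorem theorem8p1:
  fixes U :: "'a set set"
  assumes "size_universe U"
  shows "is_exact_completion (Stone U) (KH U) (inclusion_functor (Stone U)) TYPE('d \<times> 'e) \<and>
         is_pretopos_completion (Stone U) (KH U) (inclusion_functor (Stone U)) TYPE('d \<times> 'e)"
proof -
  interpret universe U by unfold_locales (rule assms)
  have "KH U = K.C" "Stone U = S.C" by (simp_all add: KH_def Stone_def kh_spaces_def stone_spaces_def)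
  then show ?thesis using exact_completion[OF K.exact] pretopos_completion by metis
qed

end
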